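(* Let $N\in\mathbb{N}$, $p,q>1$, $a,b>0$, and let $G\in C^1(\mathbb{R}^2)$ satisfy $G(0,0)=0$ and $G(s,\sigma)\ge a|s|^q+b|\sigma|^p$ for all $(s,\sigma)\in\mathbb{R}^2$. Let $f,g\in C_c^\infty(\mathbb{R}^N)$ with $\int_{\mathbb{R}^N}g(x)\,dx>0$, and put $r_0=\sup\{|x|\;;\;x\in\operatorname{supp}(f,g)\}$. Assume $$\max\{\Gamma_S(N,q),\Gamma_G(N,p)\}\ge0\quad\text{or}\quad\Gamma_{\rm comb}(N,p,q)>0.$$ Then there exist constants $\varepsilon_0>0$ and $C>0$, independent of $\varepsilon$, such that the following holds for every $\varepsilon\in(0,\varepsilon_0]$: if $u$ is a weak solution in $(0,T)$ of $$\partial_t^2u-\Delta u=G(u,\partial_tu)\ \text{ in }\mathbb{R}^N\times(0,T),\qquad u(0)=\varepsilon f,\quad\partial_tu(0)=\varepsilon g,$$ satisfying $\operatorname{supp}u\subset\{(x,t)\in\mathbb{R}^N\times[0,T)\;;\;|x|\le r_0+t\}$, then $$T\le\begin{cases}\exp(C\varepsilon^{-(p-1)})&\text{if }p=\frac{N+1}{N-1},\ q>1+\frac{4}{N-1},\\ C\varepsilon^{-\Gamma_G(N,p)^{-1}}&\text{if }p<\frac{N+1}{N-1},\ q>2p-1,\\ C\varepsilon^{-\Gamma_{\rm comb}(N,p,q)^{-1}}&\text{if }p\le q\le2p-1,\ \Gamma_{\rm comb}(N,p,q)>0,\\ C\varepsilon^{-\Gamma_S(N,q)^{-1}}&\text{if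 }p>q,\ q<p_S(N),\\ \exp(C\varepsilon^{-q(q-1)})&\text{if }p\ge q=p_S(N).\end{cases}$$
   Context: Notation: $\Gamma_S(N,q)=\big(1+\frac1q\big)(q-1)^{-1}-\frac{N-1}{2}$; $\Gamma_G(N,p)=\frac{1}{p-1}-\frac{N-1}{2}$; $\Gamma_{\rm comb}(N,p,q)=\frac{q+1}{p(q-1)}-\frac{N-1}{2}$; $p_S(N)=\sup\{r>1\;;\;2+(N+1)r-(N-1)r^2>0\}$ (so $p_S(1)=\infty$). For $N=1$ the quantity $\frac{N+1}{N-1}$ is understood as $\infty$. Weak solution in $(0,T)$: a function $u\in C([0,T);H^1(\mathbb{R}^N))\cap C^1([0,T);L^2(\mathbb{R}^N))$ with $G(u,\partial_tu)\in L^1(0,T;L^1(\mathbb{R}^N))$, $u(0)=\varepsilon f$, $\partial_tu(0)=\varepsilon g$, such that for every $\Psi\in C_c^\infty(\mathbb{R}^N\times[0,T))$, $$\varepsilon\int_{\mathbb{R}^N}g(x)\Psi(x,0)\,dx+\int_0^T\!\!\int_{\mathbb{R}^N}G(u,\partial_tu)\Psi\,dx\,dt=\int_0^T\!\!\int_{\mathbb{R}^N}\big(-\partial_tu\,\partial_t\Psi+\nabla u\cdot\nabla\Psi\big)\,dx\,dt.$$ *)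

theory Defs
  imports "HOL-Analysis.Analysis"
begin

section \<open>Smooth and compactly supported functions\<close>

text \<open>\<open>C_k k f\<close>: all partial derivatives of order at most \<open>k\<close> exist and are continuous on the
  whole space.\<close>

primrec C_k :: "nat \<Rightarrow> ('a::euclidean_space \<Rightarrow> real) \<Rightarrow> bool" where
  "C_k 0 f \<longleftrightarrow> continuous_on UNIV f"
| "C_k (Suc k) f \<longleftrightarrow>
     (\<forall>x. f differentiable (at x)) \<and> (\<forall>i\<in>Basis. C_k k (\<lambda>x. frechet_derivative f (at x) i))"

definition C_infinity :: "('a::euclidean_space \<Rightarrow> real) \<Rightarrow> bool" where
  "C_infinity f \<longleftrightarrow> (\<forall>k. C_k k f)"

definition supp :: "('a::topological_space \<Rightarrow> 'b::zero) \<Rightarrow> 'a set" where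
  "supp f = closure {x. f x \<noteq> 0}"

definition C_c_infinity :: "('a::euclidean_space \<Rightarrow> real) \<Rightarrow> bool" where
  "C_c_infinity f \<longleftrightarrow> C_infinity f \<and> compact (supp f)"

definition grad :: "('a::euclidean_space \<Rightarrow> real) \<Rightarrow> 'a \<Rightarrow> 'a" where
  "grad f x = (\<Sum>i\<in>Basis. frechet_derivative f (at x) i *\<^sub>R i)"

text \<open>Elements of \<open>C\<^sub>c\<^sup>\<infinity>(\<real>\<^sup>N \<times> [0,T))\<close> are represented by smooth functions on the whole of
  \<open>\<real>\<^sup>N \<times> \<real>\<close> with compact support in \<open>\<real>\<^sup>N \<times> (-\<infinity>,T)\<close>; only their restrictions to
  \<open>\<real>\<^sup>N \<times> [0,T)\<close> are ever used, and they need not vanish at \<open>t = 0\<close>.\<close>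

definition test_function :: "ereal \<Rightarrow> ('a::euclidean_space \<times> real \<Rightarrow> real) \<Rightarrow> bool" where
  "test_function T \<Psi> \<longleftrightarrow> C_c_infinity \<Psi> \<and> supp \<Psi> \<subseteq> {(x, t). ereal t < T}"


section \<open>Lebesgue and Sobolev spaces\<close>

text \<open>Elements of these spaces are represented by functions; the notions below depend only on
  their classes modulo null sets.\<close>

definition in_L2 :: "('a::euclidean_space \<Rightarrow> 'b::euclidean_space) \<Rightarrow> bool" where
  "in_L2 f \<longleftrightarrow> f \<in> borel_measurable lebesgue \<and> integrable lebesgue (\<lambda>x. (norm (f x))\<^sup>2)"

definition L2_norm :: "('a::euclidean_space \<Rightarrow> 'b::euclidean_space) \<Rightarrow> real" where
  "L2_norm f = sqrt (LINT x|lebesgue. (norm (f x))\<^sup>2)"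

definition has_L2_weak_grad :: "('a::euclidean_space \<Rightarrow> real) \<Rightarrow> ('a \<Rightarrow> 'a) \<Rightarrow> bool" where
  "has_L2_weak_grad f w \<longleftrightarrow> in_L2 w \<and>
     (\<forall>\<phi>. C_c_infinity \<phi> \<longrightarrow>
       (LINT x|lebesgue. f x *\<^sub>R grad \<phi> x) = - (LINT x|lebesgue. \<phi> x *\<^sub>R w x))"

definition in_H1 :: "('a::euclidean_space \<Rightarrow> real) \<Rightarrow> bool" where
  "in_H1 f \<longleftrightarrow> in_L2 f \<and> (\<exists>w. has_L2_weak_grad f w)"

text \<open>The weak gradient is unique up to a null set.\<close>

definition weak_grad :: "('a::euclidean_space \<Rightarrow> real) \<Rightarrow> 'a \<Rightarrow> 'a" where
  "weak_grad f = (SOME w. has_L2_weak_grad f w)"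

definition H1_norm :: "('a::euclidean_space \<Rightarrow> real) \<Rightarrow> real" where
  "H1_norm f = sqrt ((L2_norm f)\<^sup>2 + (L2_norm (weak_grad f))\<^sup>2)"


section \<open>Functions of time with values in function spaces\<close>

text \<open>Such functions are curried, with the time variable first.\<close>

definition cont_H1 :: "real set \<Rightarrow> (real \<Rightarrow> 'a::euclidean_space \<Rightarrow> real) \<Rightarrow> bool" where
  "cont_H1 I u \<longleftrightarrow> (\<forall>t\<in>I. in_H1 (u t)) \<and>
     (\<forall>t\<in>I. ((\<lambda>s. H1_norm (\<lambda>x. u s x - u t x)) \<longlongrightarrow> 0) (at t within I))"

definition cont_L2 :: "real set \<Rightarrow> (real \<Rightarrow> 'a::euclidean_space \<Rightarrow> real) \<Rightarrow> bool" where
  "cont_L2 I u \<longleftrightarrow> (\<forall>t\<in>I. in_L2 (u t)) \<and>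
     (\<forall>t\<in>I. ((\<lambda>s. L2_norm (\<lambda>x. u s x - u t x)) \<longlongrightarrow> 0) (at t within I))"

text \<open>\<open>C1_L2 I u v\<close>: \<open>u \<in> C\<^sup>1(I;L\<^sup>2)\<close>, with derivative \<open>v\<close> (unique up to null sets).\<close>

definition C1_L2 ::
  "real set \<Rightarrow> (real \<Rightarrow> 'a::euclidean_space \<Rightarrow> real) \<Rightarrow> (real \<Rightarrow> 'a \<Rightarrow> real) \<Rightarrow> bool" where
  "C1_L2 I u v \<longleftrightarrow> (\<forall>t\<in>I. in_L2 (u t)) \<and> cont_L2 I v \<and>
     (\<forall>t\<in>I. ((\<lambda>s. L2_norm (\<lambda>x. (u s x - u t x) / (s - t) - v t x)) \<longlongrightarrow> 0) (at t within I))"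

text \<open>The Bochner space \<open>L\<^sup>1(I;L\<^sup>1)\<close>: strong measurability (almost everywhere limit in \<open>L\<^sup>1\<close> of
  simple functions) and integrability of the norm.\<close>

definition L1_simple :: "(real \<Rightarrow> 'a::euclidean_space \<Rightarrow> real) \<Rightarrow> bool" where
  "L1_simple s \<longleftrightarrow> finite (range s) \<and>
     (\<forall>h\<in>range s. integrable lebesgue h \<and> {t. s t = h} \<in> sets lebesgue)"

definition L1_strongly_measurable ::
  "real set \<Rightarrow> (real \<Rightarrow> 'a::euclidean_space \<Rightarrow> real) \<Rightarrow> bool" where
  "L1_strongly_measurable I F \<longleftrightarrow>
     (\<exists>s :: nat \<Rightarrow> real \<Rightarrow> 'a \<Rightarrow> real. (\<forall>n. L1_simple (s n)) \<and>
       (AE t in lebesgue. t \<in> I \<longrightarrow>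
          (\<lambda>n. LINT x|lebesgue. \<bar>s n t x - F t x\<bar>) \<longlonglongrightarrow> 0))"

definition L1_L1 :: "real set \<Rightarrow> (real \<Rightarrow> 'a::euclidean_space \<Rightarrow> real) \<Rightarrow> bool" where
  "L1_L1 I F \<longleftrightarrow>
     (AE t in lebesgue. t \<in> I \<longrightarrow> integrable lebesgue (F t)) \<and>
     L1_strongly_measurable I F \<and>
     set_integrable lebesgue I (\<lambda>t. LINT x|lebesgue. \<bar>F t x\<bar>)"

text \<open>Support, in \<open>\<real>\<^sup>N \<times> I\<close>, of the class of \<open>u\<close>: the complement of the largest
  relatively open set on which \<open>u\<close> vanishes almost everywhere. The nested almost-everywhere
  quantifiers avoid any choice of a jointly measurable representative.\<close>

definition ess_supp :: "real set \<Rightarrow> (real \<Rightarrow> 'a::euclidean_space \<Rightarrow> real) \<Rightarrow> ('a \<times> real) set" where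
  "ess_supp I u = {(x, t). t \<in> I \<and>
     (\<forall>U. open U \<and> (x, t) \<in> U \<longrightarrow>
       \<not> (AE s in lebesgue. s \<in> I \<longrightarrow> (AE y in lebesgue. (y, s) \<in> U \<longrightarrow> u s y = 0)))}"


section \<open>Weak solutions\<close>

text \<open>Lifespans may be infinite. The function \<open>v\<close> is the time derivative of \<open>u\<close>.\<close>

definition weak_solution ::
  "(real \<Rightarrow> real \<Rightarrow> real) \<Rightarrow> real \<Rightarrow> ('a::euclidean_space \<Rightarrow> real) \<Rightarrow> ('a \<Rightarrow> real) \<Rightarrow>
   ereal \<Rightarrow> (real \<Rightarrow> 'a \<Rightarrow> real) \<Rightarrow> bool" where
  "weak_solution G \<epsilon> f g T u \<longleftrightarrow>
     (let I = {t. 0 \<le> t \<and> ereal t < T}; J = {t. 0 < t \<and> ereal t < T} in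
      0 < T \<and> cont_H1 I u \<and>
      (\<exists>v. C1_L2 I u v \<and>
        L1_L1 J (\<lambda>t x. G (u t x) (v t x)) \<and>
        (AE x in lebesgue. u 0 x = \<epsilon> * f x) \<and>
        (AE x in lebesgue. v 0 x = \<epsilon> * g x) \<and>
        (\<forall>\<Psi>. test_function T \<Psi> \<longrightarrow>
          \<epsilon> * (LINT x|lebesgue. g x * \<Psi> (x, 0)) +
          (LINT t:J|lebesgue. LINT x|lebesgue. G (u t x) (v t x) * \<Psi> (x, t)) =
          (LINT t:J|lebesgue. LINT x|lebesgue.
             - v t x * deriv (\<lambda>s. \<Psi> (x, s)) t +
             weak_grad (u t) x \<bullet> grad (\<lambda>y. \<Psi> (y, t)) x))))"


section \<open>Critical exponents\<close>

definition \<Gamma>_S :: "nat \<Rightarrow> real \<Rightarrow> real" where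
  "\<Gamma>_S N q = (1 + 1 / q) * inverse (q - 1) - (real N - 1) / 2"

definition \<Gamma>_G :: "nat \<Rightarrow> real \<Rightarrow> real" where
  "\<Gamma>_G N p = 1 / (p - 1) - (real N - 1) / 2"

definition \<Gamma>_comb :: "nat \<Rightarrow> real \<Rightarrow> real \<Rightarrow> real" where
  "\<Gamma>_comb N p q = (q + 1) / (p * (q - 1)) - (real N - 1) / 2"

definition p_S :: "nat \<Rightarrow> ereal" where
  "p_S N = (SUP r \<in> {r::real. r > 1 \<and> 2 + (real N + 1) * r - (real N - 1) * r\<^sup>2 > 0}. ereal r)"

text \<open>The exponent \<open>(N+1)/(N-1)\<close>, understood as \<open>\<infinity>\<close> for \<open>N = 1\<close>.\<close>

definition p_G :: "nat \<Rightarrow> ereal" where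
  "p_G N = (if N = 1 then \<infinity> else ereal ((real N + 1) / (real N - 1)))"

end

theory Submission
  imports Defs
begin

text \<open>The solution is tested against products \<open>\<theta>(t) \<Phi>(x)\<close>, where \<open>\<Phi>\<close> is constant or an average of
  the plane waves \<open>exp (\<lambda> x \<bullet> \<omega>)\<close> over finitely many equidistributed unit directions \<open>\<omega>\<close>. Such averages are
  eigenfunctions of the Laplacian with eigenvalue \<open>\<lambda>\<^sup>2\<close> and obey the pointwise bounds of the spherical
  average on any prescribed ball once the directions are dense enough, so no surface measure is
  needed; on the light cone they decay like \<open>(1 + |x|) powr (- (N - 1) / 2)\<close> up to the factor \<open>exp (\<lambda> |x|)\<close>.

  Each test reduces the equation to a scalar identity. The waves turn the data into a linear lower
  bound in \<open>\<epsilon>\<close> for the pairings with \<open>u\<close> and \<open>\<partial>\<^sub>t u\<close>, and Hoelder's inequality on the light cone converts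
  it into a lower bound for the source. If \<open>p\<close> is at most the Glassey exponent, the pairing with
  \<open>\<partial>\<^sub>t u\<close> satisfies a differential inequality of Bernoulli type. In the other subcritical cases the lower
  bound is played against the upper bound obtained from a compactly supported \<open>\<theta>\<close> and Young's inequality.
  For the critical Strauss exponent, dyadic superpositions of the waves (a substitute for self-similar
  solutions of the wave equation) give a discrete inequality which blows up after a number of dyadic
  time scales of order \<open>\<epsilon> powr (- q (q - 1))\<close>.\<close>

section \<open>Smooth functions\<close>

text \<open>The number of directions has to grow with the time horizon, which depends on the
  solution. Hence the constants below are uniform in \<open>n\<close>, and \<open>n\<close> is fixed
  only once a time below the lifespan is given. The source is merely integrable in time, so the
  pairing with the time derivative is only known to be continuous. Its evolution law is recovered in
  integrated form, and estimates of the source hold off a negligible set of times. With dec = (N -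
  1)/2 and q' = q/(q - 1), the exponents come from one balance. At time R the data force a source of
  size \<epsilon>^r R^(dec (2 - r)), r being q or p; integrated over an interval of length R/4 it
  meets the upper bound R^(2 dec + 2 - 2 q'). The quotient has exponent (q + 1)/(q - 1) - dec r,
  which is q \<Gamma>_S for r = q and p \<Gamma>_comb for r = p. For r = q it vanishes at the
  Strauss exponent; then every dyadic time scale contributes the same multiple of \<epsilon>^q, and
  it is the number of scales, the logarithm of time, that has to be bounded.\<close>

abbreviation pderiv_dir :: "'a::euclidean_space \<Rightarrow> ('a \<Rightarrow> real) \<Rightarrow> 'a \<Rightarrow> real" where
  "pderiv_dir i f \<equiv> (\<lambda>x. frechet_derivative f (at x) i)"

lemma frechet_derivative_eqI:
  "(f has_derivative f') (at x) \<Longrightarrow> frechet_derivative f (at x) = f'"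
  by (metis frechet_derivative_at)

lemma C_k_SucI:
  assumes "\<And>x. (f has_derivative f' x) (at x)" "\<And>i. i \<in> Basis \<Longrightarrow> C_k k (\<lambda>x. f' x i)"
  shows "C_k (Suc k) f"
  using assms by (auto simp: frechet_derivative_eqI[OF assms(1)] differentiable_def)

lemma C_k_Suc_derivative:
  "C_k (Suc k) f \<Longrightarrow> (f has_derivative frechet_derivative f (at x)) (at x)"
  by (simp add: frechet_derivative_works[symmetric])

lemma C_k_SucD: "C_k (Suc k) f \<Longrightarrow> C_k k f"
proof (induction k arbitrary: f)
  case 0
  then show ?case
    by (auto simp: continuous_on_eq_continuous_at intro: differentiable_imp_continuous_within)
next
  case (Suc k)
  then show ?case
    by (metis C_k.simps(2))
qed

lemma C_k_const [intro]: "C_k k (\<lambda>x::'a::euclidean_space. c)"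
proof (induction k arbitrary: c)
  case (Suc k)
  show ?case
    by (rule C_k_SucI[where f' = "\<lambda>x h. 0"]) (auto simp: Suc)
qed auto

lemma C_k_linear:
  fixes f :: "'a::euclidean_space \<Rightarrow> real"
  assumes "bounded_linear f"
  shows "C_k k f"
proof (cases k)
  case 0
  then show ?thesis using assms by (simp add: linear_continuous_on)
next
  case (Suc m)
  show ?thesis unfolding Suc
    by (rule C_k_SucI[where f' = "\<lambda>x. f"]) (auto simp: assms bounded_linear_imp_has_derivative)
qed

lemma C_k_add:
  assumes "C_k k f" "C_k k g"
  shows "C_k k (\<lambda>x. f x + g x)"
  using assms
proof (induction k arbitrary: f g)
  case 0
  then show ?case by (auto intro!: continuous_intros)
next
  case (Suc k)
  show ?case
  proof (rule C_k_SucI)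
    show "((\<lambda>x. f x + g x) has_derivative
        (\<lambda>h. frechet_derivative f (at x) h + frechet_derivative g (at x) h)) (at x)" for x
      by (intro has_derivative_add C_k_Suc_derivative[OF Suc.prems(1)] C_k_Suc_derivative[OF Suc.prems(2)])
  qed (use Suc in auto)
qed

lemma C_k_mult:
  assumes "C_k k f" "C_k k g"
  shows "C_k k (\<lambda>x. f x * g x)"
  using assms
proof (induction k arbitrary: f g)
  case 0
  then show ?case by (auto intro!: continuous_intros)
next
  case (Suc k)
  show ?case
  proof (rule C_k_SucI)
    show "((\<lambda>x. f x * g x) has_derivative
        (\<lambda>h. f x * frechet_derivative g (at x) h + frechet_derivative f (at x) h * g x)) (at x)" for x
      by (intro has_derivative_mult C_k_Suc_derivative[OF Suc.prems(1)] C_k_Suc_derivative[OF Suc.prems(2)])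
    show "C_k k (\<lambda>x. f x * frechet_derivative g (at x) i + frechet_derivative f (at x) i * g x)"
      if "i \<in> Basis" for i
      using Suc.prems C_k_SucD[OF Suc.prems(1)] C_k_SucD[OF Suc.prems(2)] that
      by (intro C_k_add Suc.IH) auto
  qed
qed

lemma C_k_sum:
  assumes "\<And>i. i \<in> A \<Longrightarrow> C_k k (f i)"
  shows "C_k k (\<lambda>x. \<Sum>i\<in>A. f i x)"
  using assms by (induction A rule: infinite_finite_induct) (auto intro: C_k_add)

lemma C_k_power: "C_k k f \<Longrightarrow> C_k k (\<lambda>x. f x ^ n)"
  by (induction n) (auto intro: C_k_mult)

lemma C_k_compose:
  fixes f :: "'a::euclidean_space \<Rightarrow> real" and h :: "real \<Rightarrow> real"
  assumes "C_k k h" "C_k k f"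
  shows "C_k k (\<lambda>x. h (f x))"
  using assms
proof (induction k arbitrary: h f)
  case 0
  then show ?case
    by (auto intro: continuous_on_compose2)
next
  case (Suc k)
  show ?case
  proof (rule C_k_SucI)
    show "((\<lambda>x. h (f x)) has_derivative
        (\<lambda>v. frechet_derivative h (at (f x)) (frechet_derivative f (at x) v))) (at x)" for x
      using diff_chain_at[OF C_k_Suc_derivative[OF Suc.prems(2)] C_k_Suc_derivative[OF Suc.prems(1)], of x]
      by (simp add: o_def)
    fix i :: 'a assume i: "i \<in> Basis"
    \<comment> \<open>On the line a derivative is multiplication by its value at 1. This separates a
      partial derivative of \<open>f\<close> from a composition with \<open>f\<close>, to which the
      induction hypothesis applies.\<close>
    have lin: "frechet_derivative h (at y) v = v * frechet_derivative h (at y) 1" for y v :: real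
      using linear_scale[of "frechet_derivative h (at y)" v 1]
        has_derivative_linear[OF C_k_Suc_derivative[OF Suc.prems(1)]] by simp
    have "C_k k (\<lambda>x. frechet_derivative f (at x) i * frechet_derivative h (at (f x)) 1)"
      using Suc.prems C_k_SucD[OF Suc.prems(2)] i
      by (intro C_k_mult Suc.IH[of "\<lambda>y. frechet_derivative h (at y) 1"]) auto
    then show "C_k k (\<lambda>x. frechet_derivative h (at (f x)) (frechet_derivative f (at x) i))"
      by (subst lin)
  qed
qed

lemma C_k_compose_linear:
  fixes f :: "'a::euclidean_space \<Rightarrow> real" and L :: "'b::euclidean_space \<Rightarrow> 'a"
  assumes "C_k k f" "bounded_linear L"
  shows "C_k k (\<lambda>x. f (L x))"
  using assms(1)
proof (induction k arbitrary: f)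
  case 0
  then show ?case
    using linear_continuous_on[OF assms(2)] by (auto intro: continuous_on_compose2)
next
  case (Suc k)
  show ?case
  proof (rule C_k_SucI)
    show "((\<lambda>x. f (L x)) has_derivative (\<lambda>v. frechet_derivative f (at (L x)) (L v))) (at x)" for x
      using diff_chain_at[OF bounded_linear_imp_has_derivative[OF assms(2)] C_k_Suc_derivative[OF Suc.prems], of x]
      by (simp add: o_def)
    fix i :: 'b assume i: "i \<in> Basis"
    \<comment> \<open>The direction \<open>L i\<close> need not be a basis vector, whereas
      \<open>C_k\<close> controls partial derivatives, so the derivative is expanded in the
      basis.\<close>
    have lin: "frechet_derivative f (at y) v = (\<Sum>j\<in>Basis. (v \<bullet> j) * frechet_derivative f (at y) j)" for y v
    proof -
      have l: "linear (frechet_derivative f (at y))"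
        by (rule has_derivative_linear[OF C_k_Suc_derivative[OF Suc.prems]])
      have "frechet_derivative f (at y) v = frechet_derivative f (at y) (\<Sum>j\<in>Basis. (v \<bullet> j) *\<^sub>R j)"
        by (simp add: euclidean_representation)
      also have "\<dots> = (\<Sum>j\<in>Basis. (v \<bullet> j) * frechet_derivative f (at y) j)"
        using l by (simp add: linear_sum linear_scale)
      finally show ?thesis .
    qed
    have "C_k k (\<lambda>x. \<Sum>j\<in>Basis. (L i \<bullet> j) * frechet_derivative f (at (L x)) j)"
      using Suc by (intro C_k_sum C_k_mult Suc.IH[where f="\<lambda>y. frechet_derivative f (at y) _"]) auto
    then show "C_k k (\<lambda>x. frechet_derivative f (at (L x)) (L i))"
      by (subst lin)
  qed
qed

lemma C_k_inverse:
  assumes "C_k k f" "\<And>x. f x > 0"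
  shows "C_k k (\<lambda>x. inverse (f x))"
  using assms(1)
proof (induction k)
  case 0
  then show ?case using assms(2) by (auto intro!: continuous_intros simp: less_imp_neq[symmetric])
next
  case (Suc k)
  show ?case
  proof (rule C_k_SucI)
    show "((\<lambda>x. inverse (f x)) has_derivative
       (\<lambda>v. - (inverse (f x) * frechet_derivative f (at x) v * inverse (f x)))) (at x)" for x
      using Deriv.has_derivative_inverse[OF _ C_k_Suc_derivative[OF Suc.prems]] assms(2)[of x] by simp
    fix i :: 'a assume i: "i \<in> Basis"
    have "C_k k (\<lambda>x. (-1) * (inverse (f x) * frechet_derivative f (at x) i * inverse (f x)))"
      using Suc.IH C_k_SucD[OF Suc.prems] Suc.prems i by (intro C_k_mult) auto
    then show "C_k k (\<lambda>x. - (inverse (f x) * frechet_derivative f (at x) i * inverse (f x)))"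
      by simp
  qed
qed

lemma C_infinity_const [intro]: "C_infinity (\<lambda>x. c)"
  by (auto simp: C_infinity_def)

lemma C_infinity_linear: "bounded_linear f \<Longrightarrow> C_infinity f"
  by (auto simp: C_infinity_def intro: C_k_linear)

lemma C_infinity_add: "C_infinity f \<Longrightarrow> C_infinity g \<Longrightarrow> C_infinity (\<lambda>x. f x + g x)"
  by (auto simp: C_infinity_def intro: C_k_add)

lemma C_infinity_mult: "C_infinity f \<Longrightarrow> C_infinity g \<Longrightarrow> C_infinity (\<lambda>x. f x * g x)"
  by (auto simp: C_infinity_def intro: C_k_mult)

lemma C_infinity_sum: "(\<And>i. i \<in> A \<Longrightarrow> C_infinity (f i)) \<Longrightarrow> C_infinity (\<lambda>x. \<Sum>i\<in>A. f i x)"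
  by (auto simp: C_infinity_def intro: C_k_sum)

lemma C_infinity_power: "C_infinity f \<Longrightarrow> C_infinity (\<lambda>x. f x ^ n)"
  by (auto simp: C_infinity_def intro: C_k_power)

lemma C_infinity_compose:
  "C_infinity (h :: real \<Rightarrow> real) \<Longrightarrow> C_infinity f \<Longrightarrow> C_infinity (\<lambda>x. h (f x))"
  by (auto simp: C_infinity_def intro: C_k_compose)

lemma C_infinity_compose_linear:
  "C_infinity f \<Longrightarrow> bounded_linear L \<Longrightarrow> C_infinity (\<lambda>x. f (L x))"
  by (auto simp: C_infinity_def intro: C_k_compose_linear)

lemma C_infinity_inverse:
  "C_infinity f \<Longrightarrow> (\<And>x. f x > 0) \<Longrightarrow> C_infinity (\<lambda>x. inverse (f x))"
  by (auto simp: C_infinity_def intro: C_k_inverse)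

lemma C_infinity_has_derivative:
  "C_infinity f \<Longrightarrow> (f has_derivative frechet_derivative f (at x)) (at x)"
  unfolding C_infinity_def using C_k_Suc_derivative[of 0 f x] by blast

lemma C_infinity_continuous: "C_infinity f \<Longrightarrow> continuous_on A f"
  unfolding C_infinity_def using C_k.simps(1) continuous_on_subset by blast

lemma C_infinity_pderiv: "C_infinity f \<Longrightarrow> i \<in> Basis \<Longrightarrow> C_infinity (pderiv_dir i f)"
  unfolding C_infinity_def by (metis C_k.simps(2))

lemma C_infinity_real_deriv:
  fixes h :: "real \<Rightarrow> real"
  assumes "C_infinity h"
  shows "(h has_real_derivative deriv h x) (at x)" "C_infinity (deriv h)"
proof -
  have d: "(h has_real_derivative frechet_derivative h (at x) 1) (at x)" for x
  proof -
    have "linear (frechet_derivative h (at x))"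
      by (rule has_derivative_linear[OF C_infinity_has_derivative[OF assms]])
    then have "frechet_derivative h (at x) v = frechet_derivative h (at x) 1 * v" for v
      using linear_scale[of "frechet_derivative h (at x)" v 1] by (simp add: mult.commute)
    then have "frechet_derivative h (at x) = (*) (frechet_derivative h (at x) 1)"
      by (rule ext)
    then show ?thesis
      using C_infinity_has_derivative[OF assms, of x] by (simp add: has_field_derivative_def)
  qed
  have e: "deriv h = pderiv_dir 1 h"
    using d by (auto simp: fun_eq_iff intro!: DERIV_imp_deriv)
  show "(h has_real_derivative deriv h x) (at x)"
    using d by (simp add: e)
  show "C_infinity (deriv h)"
    unfolding e by (rule C_infinity_pderiv[OF assms]) auto
qed

text \<open>Differentiation never leaves the sequence, so the induction on the order closes.
  Exponentials and the functions \<open>flat_exp P\<close> come with such explicit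
  sequences.\<close>

lemma C_infinity_real_derivative_chain:
  fixes d :: "nat \<Rightarrow> real \<Rightarrow> real"
  assumes "\<And>n x. (d n has_real_derivative d (Suc n) x) (at x)"
  shows "C_infinity (d n)"
proof -
  have "C_k k (d n)" for k
  proof (induction k arbitrary: n)
    case 0
    then show ?case
      by (auto simp: continuous_on_eq_continuous_at intro: DERIV_isCont[OF assms])
  next
    case (Suc k)
    show ?case
      by (rule C_k_SucI[where f' = "\<lambda>x. (*) (d (Suc n) x)"])
        (use assms Suc in \<open>auto simp: has_field_derivative_def\<close>)
  qed
  then show ?thesis by (simp add: C_infinity_def)
qed

lemma C_infinity_exp: "C_infinity (\<lambda>x::real. exp (c * x))"
proof -
  have "C_infinity ((\<lambda>n (x::real). c ^ n * exp (c * x)) 0)"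
    by (rule C_infinity_real_derivative_chain) (auto intro!: derivative_eq_intros)
  then show ?thesis by simp
qed

subsection \<open>A smooth step\<close>

text \<open>Polynomials in 1/x appear as factors because differentiating exp (-1/x) produces them;
  with them the family is closed under derivatives.\<close>

definition flat_exp :: "real poly \<Rightarrow> real \<Rightarrow> real" where
  "flat_exp P x = (if x \<le> 0 then 0 else poly P (1 / x) * exp (- (1 / x)))"

lemma poly_times_exp_minus_tendsto_0:
  "((\<lambda>y::real. poly P y * exp (- y)) \<longlongrightarrow> 0) at_top"
proof -
  have "((\<lambda>y::real. \<Sum>i\<le>degree P. coeff P i * (y ^ i / exp y)) \<longlongrightarrow> (\<Sum>i\<le>degree P. coeff P i * 0)) at_top"
    by (intro tendsto_sum tendsto_mult tendsto_const tendsto_power_div_exp_0)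
  moreover have "(\<lambda>y::real. \<Sum>i\<le>degree P. coeff P i * (y ^ i / exp y)) = (\<lambda>y. poly P y * exp (- y))"
    by (auto simp: poly_altdef sum_distrib_right exp_minus divide_inverse mult.assoc)
  ultimately show ?thesis by simp
qed

text \<open>In the variable y = 1/x the derivative is y^2 (P - P')(y) exp (-y), which explains the
  polynomial. At 0 the right difference quotient tends to 0 because exp (-y) beats every power of y;
  the left one is 0.\<close>

lemma flat_exp_deriv:
  "(flat_exp P has_real_derivative flat_exp ([:0, 0, 1:] * (P - pderiv P)) x) (at x)"
proof -
  consider "x < 0" | "x > 0" | "x = 0" by linarith
  then show ?thesis
  proof cases
    case 1
    have "((\<lambda>x. 0) has_real_derivative 0) (at x)" by simp
    then have "(flat_exp P has_real_derivative 0) (at x)"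
      by (rule has_field_derivative_transform_within_open[of _ _ _ "{..<0}"])
        (use 1 in \<open>auto simp: flat_exp_def\<close>)
    then show ?thesis using 1 by (simp add: flat_exp_def)
  next
    case 2
    have "((\<lambda>x. poly P (1 / x) * exp (- (1 / x))) has_real_derivative
        poly ([:0, 0, 1:] * (P - pderiv P)) (1 / x) * exp (- (1 / x))) (at x)"
      using 2 by (auto intro!: derivative_eq_intros DERIV_chain2[OF poly_DERIV] simp: field_simps power2_eq_square)
    then have "(flat_exp P has_real_derivative
        poly ([:0, 0, 1:] * (P - pderiv P)) (1 / x) * exp (- (1 / x))) (at x)"
      by (rule has_field_derivative_transform_within_open[of _ _ _ "{0<..}"])
        (use 2 in \<open>auto simp: flat_exp_def\<close>)
    then show ?thesis using 2 by (simp add: flat_exp_def)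
  next
    case 3
    have "((\<lambda>y. flat_exp P y / y) \<longlongrightarrow> 0) (at_right 0)"
    proof -
      \<comment> \<open>Dividing by x multiplies the polynomial by its own variable.\<close>
      have "((\<lambda>x::real. poly (pCons 0 P) (inverse x) * exp (- inverse x)) \<longlongrightarrow> 0) (at_right 0)"
        by (rule filterlim_compose[OF poly_times_exp_minus_tendsto_0 filterlim_inverse_at_top_right])
      moreover have "\<forall>\<^sub>F x in at_right 0. poly (pCons 0 P) (inverse x) * exp (- inverse x) = flat_exp P x / x"
        using eventually_at_right_less[of "0::real"]
        by eventually_elim (auto simp: flat_exp_def field_simps)
      ultimately show ?thesis
        by (rule Lim_transform_eventually)
    qed
    moreover have "((\<lambda>y. flat_exp P y / y) \<longlongrightarrow> 0) (at_left 0)"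
    proof (rule Lim_transform_eventually[OF tendsto_const])
      show "\<forall>\<^sub>F y in at_left 0. 0 = flat_exp P y / y"
        by (auto simp: flat_exp_def eventually_at_filter)
    qed
    ultimately have "((\<lambda>y. flat_exp P y / y) \<longlongrightarrow> 0) (at 0)"
      by (simp add: filterlim_split_at)
    then show ?thesis using 3
      by (simp add: has_field_derivative_iff flat_exp_def)
  qed
qed

lemma C_infinity_flat_exp: "C_infinity (flat_exp P)"
proof -
  define Q where "Q = (\<lambda>P::real poly. [:0, 0, 1:] * (P - pderiv P))"
  have "C_infinity ((\<lambda>n. flat_exp ((Q ^^ n) P)) 0)"
    by (rule C_infinity_real_derivative_chain) (auto simp: Q_def flat_exp_deriv simp del: mult_pCons_left)
  then show ?thesis by simp
qed

text \<open>A descending step: 1 for y \<le> 0 and 0 for y \<ge> 1. The two flat functions have no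
  common zero, so the quotient is smooth.\<close>

definition smooth_step :: "real \<Rightarrow> real" where
  "smooth_step y = flat_exp 1 (1 - y) * inverse (flat_exp 1 (1 - y) + flat_exp 1 y)"

lemma flat_exp_1: "flat_exp 1 x \<ge> 0" "x \<le> 0 \<Longrightarrow> flat_exp 1 x = 0" "x > 0 \<Longrightarrow> flat_exp 1 x > 0"
  by (auto simp: flat_exp_def)

lemma smooth_step_denominator_pos: "flat_exp 1 (1 - y) + flat_exp 1 y > 0"
proof (cases "y > 0")
  case True
  then show ?thesis using flat_exp_1(1)[of "1 - y"] flat_exp_1(3)[of y] by linarith
next
  case False
  then show ?thesis using flat_exp_1(1)[of y] flat_exp_1(3)[of "1 - y"] by linarith
qed

lemma C_infinity_flat_exp_reflect: "C_infinity (\<lambda>y. flat_exp P (1 - y))"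
proof (rule C_infinity_compose[OF C_infinity_flat_exp])
  show "C_infinity (\<lambda>y::real. 1 - y)"
    using C_infinity_add[OF C_infinity_const[of 1] C_infinity_linear[of "\<lambda>x::real. - x"]]
    by (simp add: bounded_linear_minus bounded_linear_ident)
qed

lemma smooth_step_C_infinity: "C_infinity smooth_step"
proof -
  have "C_infinity (\<lambda>y. flat_exp 1 (1 - y) * inverse (flat_exp 1 (1 - y) + flat_exp 1 y))"
    by (intro C_infinity_mult C_infinity_inverse C_infinity_add C_infinity_flat_exp_reflect
        C_infinity_flat_exp smooth_step_denominator_pos)
  then show ?thesis unfolding smooth_step_def[abs_def] .
qed

lemma smooth_step_eq_1: "y \<le> 0 \<Longrightarrow> smooth_step y = 1"
  using smooth_step_denominator_pos[of y] by (simp add: smooth_step_def flat_exp_1(2))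

lemma smooth_step_eq_0: "y \<ge> 1 \<Longrightarrow> smooth_step y = 0"
  by (simp add: smooth_step_def flat_exp_1)

lemma smooth_step_bounds: "0 \<le> smooth_step y" "smooth_step y \<le> 1"
proof -
  have "inverse (flat_exp 1 (1 - y) + flat_exp 1 y) > 0"
    using smooth_step_denominator_pos[of y] by simp
  then show "0 \<le> smooth_step y"
    unfolding smooth_step_def using flat_exp_1(1)[of "1 - y"] by simp
  show "smooth_step y \<le> 1"
    unfolding smooth_step_def
    using smooth_step_denominator_pos[of y] flat_exp_1(1)[of y] flat_exp_1(1)[of "1-y"]
    by (simp add: divide_simps flip: divide_inverse)
qed

text \<open>Both flat functions are nondecreasing, which fixes the sign in the quotient rule. Minus
  the derivative is thereby a nonnegative kernel of mass 1, with which the weak formulation is later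
  localised at a single time.\<close>

lemma smooth_step_deriv_nonpos: "deriv smooth_step y \<le> 0"
proof -
  define a b where "a = flat_exp 1 (1 - y)" and "b = flat_exp 1 y"
  define a' b' where "a' = flat_exp [:0, 0, 1:] (1 - y)" and "b' = flat_exp [:0, 0, 1:] y"
  have nn: "a \<ge> 0" "b \<ge> 0" "a' \<ge> 0" "b' \<ge> 0" "a + b > 0"
    unfolding a_def b_def a'_def b'_def
    using flat_exp_1(1) smooth_step_denominator_pos[of y] by (auto simp: flat_exp_def)
  have d: "(flat_exp 1 has_real_derivative flat_exp [:0, 0, 1:] x) (at x)" for x
    using flat_exp_deriv[of 1 x] by (simp add: pderiv_1)
  have d1: "((\<lambda>y. flat_exp 1 (1 - y)) has_real_derivative - a') (at y)"
  proof -
    have "((\<lambda>y::real. 1 - y) has_real_derivative - 1) (at y)"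
      by (auto intro!: derivative_eq_intros)
    then show ?thesis
      using DERIV_chain2[OF d, of "\<lambda>y. 1 - y" "-1" y UNIV] unfolding a'_def by simp
  qed
  have d2: "((\<lambda>y. flat_exp 1 (1 - y) + flat_exp 1 y) has_real_derivative - a' + b') (at y)"
    unfolding b'_def by (rule DERIV_add[OF d1 d])
  have "(smooth_step has_real_derivative
      (- a') * inverse (a + b) + (- ((inverse (a + b) * (- a' + b')) * inverse (a + b))) * a) (at y)"
    unfolding smooth_step_def[abs_def] a_def b_def
    by (rule DERIV_mult[OF d1 DERIV_inverse'[OF d2]]) (use smooth_step_denominator_pos[of y] in simp)
  then have "deriv smooth_step y = (- a') * inverse (a + b) + (- ((inverse (a + b) * (- a' + b')) * inverse (a + b))) * a"
    by (rule DERIV_imp_deriv)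
  also have "\<dots> = - (a' * b + a * b') * (inverse (a + b))\<^sup>2"
  proof -
    define i where "i = inverse (a + b)"
    have "(a + b) * i = 1" using nn(5) by (simp add: i_def)
    then show ?thesis unfolding i_def[symmetric] by algebra
  qed
  also have "\<dots> \<le> 0"
  proof (rule mult_nonpos_nonneg)
    have "a' * b + a * b' \<ge> 0" using nn by simp
    then show "- (a' * b + a * b') \<le> 0" by linarith
  qed simp
  finally show ?thesis .
qed

section \<open>Finitely many equidistributed directions\<close>

definition grid_vec :: "('a::euclidean_space \<Rightarrow> int) \<Rightarrow> 'a" where
  "grid_vec k = (\<Sum>b\<in>Basis. of_int (k b) *\<^sub>R b)"

text \<open>Lattice points are extensional coordinate functions, so that they can be counted as
  products of intervals. Averages will run over lattice points and not over distinct directions: a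
  direction carries the weight of all grid points on its ray.\<close>

definition grid :: "nat \<Rightarrow> ('a::euclidean_space \<Rightarrow> int) set" where
  "grid n = {k \<in> Basis \<rightarrow>\<^sub>E {- int n..int n}. grid_vec k \<noteq> 0}"

definition direction :: "('a::euclidean_space \<Rightarrow> int) \<Rightarrow> 'a" where
  "direction k = sgn (grid_vec k)"

lemma grid_vec_inner: "b \<in> Basis \<Longrightarrow> grid_vec k \<bullet> b = of_int (k b)"
  by (simp add: grid_vec_def)

lemma finite_grid: "finite (grid n)"
  unfolding grid_def by (rule finite_subset[OF _ finite_PiE[of Basis "\<lambda>_. {- int n..int n}"]]) auto

lemma norm_direction: "k \<in> grid n \<Longrightarrow> norm (direction k) = 1"
  by (auto simp: grid_def direction_def norm_sgn)

text \<open>The points with all coordinates in \<open>{1..n}\<close> already give the order n^d. The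
  bound serves as the denominator of the averages.\<close>

lemma card_grid_ge: "real n ^ DIM('a) \<le> real (card (grid n :: ('a::euclidean_space \<Rightarrow> int) set))"
proof -
  have "(Basis :: 'a set) \<rightarrow>\<^sub>E {1..int n} \<subseteq> grid n"
  proof
    fix k assume k: "k \<in> (Basis :: 'a set) \<rightarrow>\<^sub>E {1..int n}"
    obtain b :: 'a where b: "b \<in> Basis" using nonempty_Basis by blast
    have "k b \<ge> 1" using k b by (auto simp: PiE_iff)
    then have "grid_vec k \<bullet> b \<noteq> 0" using b by (simp add: grid_vec_inner)
    then have "grid_vec k \<noteq> 0" by auto
    moreover have "k \<in> Basis \<rightarrow>\<^sub>E {- int n..int n}"
      using k by (rule subsetD[OF PiE_mono, rotated]) auto
    ultimately show "k \<in> grid n" by (simp add: grid_def)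
  qed
  then have "card ((Basis :: 'a set) \<rightarrow>\<^sub>E {1..int n}) \<le> card (grid n :: ('a \<Rightarrow> int) set)"
    by (rule card_mono[OF finite_grid])
  then have "n ^ DIM('a) \<le> card (grid n :: ('a \<Rightarrow> int) set)"
    by (simp add: card_PiE)
  then show ?thesis
    by (metis of_nat_le_iff of_nat_power)
qed

lemma card_grid_pos: "n \<ge> 1 \<Longrightarrow> card (grid n :: ('a::euclidean_space \<Rightarrow> int) set) > 0"
  using card_grid_ge[where 'a='a, of n]
  by (metis less_le_trans of_nat_0_less_iff zero_less_power less_numeral_extra(1) of_nat_0 of_nat_less_iff One_nat_def Suc_le_eq)

lemma card_int_interval_le:
  fixes c W :: real
  assumes "W \<ge> 1"
  shows "real (card {\<lceil>c - W\<rceil>..\<lfloor>c + W\<rfloor>}) \<le> 3 * W"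
proof -
  have "real (card {\<lceil>c - W\<rceil>..\<lfloor>c + W\<rfloor>}) = real (nat (\<lfloor>c + W\<rfloor> - \<lceil>c - W\<rceil> + 1))"
    by simp
  also have "\<dots> \<le> max 0 (real_of_int (\<lfloor>c + W\<rfloor> - \<lceil>c - W\<rceil> + 1))"
    by linarith
  also have "\<dots> \<le> 3 * W"
    using assms by linarith
  finally show ?thesis .
qed

lemma unit_vector_large_coordinate:
  fixes e :: "'a::euclidean_space"
  assumes "norm e = 1"
  shows "\<exists>i\<in>Basis. \<bar>e \<bullet> i\<bar> \<ge> 1 / real DIM('a)"
proof (rule ccontr)
  assume "\<not> ?thesis"
  then have "\<And>i. i \<in> Basis \<Longrightarrow> \<bar>e \<bullet> i\<bar> < 1 / real DIM('a)" by force
  then have "(\<Sum>i\<in>Basis. \<bar>e \<bullet> i\<bar>) < (\<Sum>i\<in>(Basis::'a set). 1 / real DIM('a))"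
    by (intro sum_strict_mono) auto
  then have "(\<Sum>i\<in>Basis. \<bar>e \<bullet> i\<bar>) < 1" by simp
  then show False using norm_le_l1[of e] assms by simp
qed

text \<open>A lattice point whose direction is \<open>\<delta>\<close>-close to \<open>e\<close> is determined, up to
  \<open>O(n\<delta>)\<close> choices for each other coordinate, by its coordinate along a basis vector on which
  \<open>e\<close> has a large component.\<close>

lemma card_directions_near:
  fixes e :: "'a::euclidean_space"
  assumes e: "norm e = 1" and \<delta>: "real n * \<delta> \<ge> 1"
  defines "D \<equiv> real DIM('a)"
  shows "real (card {k \<in> grid n. norm (direction k - e) \<le> \<delta>})
    \<le> 3 * (3 * ((1 + D) * D)) ^ (DIM('a) - 1) * real n ^ DIM('a) * \<delta> ^ (DIM('a) - 1)"
proof -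
  have D1: "D \<ge> 1" unfolding D_def by (simp add: Suc_le_eq)
  have n0: "n \<ge> 1" using \<delta> by (cases n) auto
  have \<delta>0: "\<delta> > 0"
  proof (rule ccontr)
    assume "\<not> \<delta> > 0"
    then have "real n * \<delta> \<le> 0" by (simp add: mult_nonneg_nonpos)
    then show False using \<delta> by simp
  qed
  obtain i where i: "i \<in> Basis" and ei: "\<bar>e \<bullet> i\<bar> \<ge> 1 / D"
    using unit_vector_large_coordinate[OF e] unfolding D_def by blast
  have ei0: "e \<bullet> i \<noteq> 0" using ei D1 by auto
  define c where "c j = (e \<bullet> j) / (e \<bullet> i)" for j
  have c: "\<bar>c j\<bar> \<le> D" if "j \<in> Basis" for j
  proof -
    have "\<bar>e \<bullet> j\<bar> \<le> 1" using Basis_le_norm[OF that, of e] e by simp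
    also have "1 \<le> D * \<bar>e \<bullet> i\<bar>" using ei D1 by (simp add: field_simps)
    finally show ?thesis using ei0 by (simp add: c_def abs_divide field_simps)
  qed
  \<comment> \<open>A grid vector has norm at most D n, so if its direction is \<delta>-close to
    \<open>e\<close>, it differs from a multiple of \<open>e\<close> by at most D n \<delta>. The
    factor 1 + D pays for predicting coordinate \<open>j\<close> from coordinate \<open>i\<close>
    through the slope \<open>c j\<close>, which is at most D.\<close>
  define W where "W = (1 + D) * (D * (real n * \<delta>))"
  have W1: "W \<ge> 1"
  proof -
    have "1 \<le> D * (real n * \<delta>)" using D1 \<delta> by (metis mult_mono' mult_1 order_trans zero_le_one)
    then have "1 * 1 \<le> (1 + D) * (D * (real n * \<delta>))" using D1 by (intro mult_mono) auto
    then show ?thesis by (simp add: W_def)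
  qed
  define F where "F m = PiE (Basis :: 'a set)
    (\<lambda>j. if j = i then {m} else {\<lceil>c j * of_int m - W\<rceil>..\<lfloor>c j * of_int m + W\<rfloor>})" for m :: int
  have sub: "{k \<in> grid n. norm (direction k - e) \<le> \<delta>} \<subseteq> (\<Union>m\<in>{- int n..int n}. F m)"
  proof
    fix k assume "k \<in> {k \<in> grid n. norm (direction k - e) \<le> \<delta>}"
    then have k: "k \<in> Basis \<rightarrow>\<^sub>E {- int n..int n}" and kn: "norm (direction k - e) \<le> \<delta>"
      by (auto simp: grid_def)
    let ?g = "grid_vec k"
    define w where "w = ?g - norm ?g *\<^sub>R e"
    have "w = norm ?g *\<^sub>R (direction k - e)"
      by (cases "?g = 0") (auto simp: w_def direction_def sgn_div_norm scaleR_right_diff_distrib)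
    then have "norm w = norm ?g * norm (direction k - e)" by simp
    also have "norm ?g \<le> D * real n"
    proof -
      have "norm ?g \<le> (\<Sum>b\<in>Basis. \<bar>?g \<bullet> b\<bar>)" by (rule norm_le_l1)
      also have "\<dots> \<le> (\<Sum>b\<in>(Basis::'a set). real n)"
      proof (rule sum_mono)
        fix b :: 'a assume b: "b \<in> Basis"
        have "k b \<in> {- int n..int n}" using k b by (auto simp: PiE_iff)
        then show "\<bar>?g \<bullet> b\<bar> \<le> real n" using b by (auto simp: grid_vec_inner)
      qed
      finally show ?thesis by (simp add: D_def)
    qed
    then have "norm ?g * norm (direction k - e) \<le> (D * real n) * \<delta>"
      using kn by (intro mult_mono) (auto simp: D_def)
    finally have w: "norm w \<le> D * (real n * \<delta>)" by (simp add: mult.assoc)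
    have "k \<in> F (k i)"
      unfolding F_def
    proof (rule PiE_I)
      fix j :: 'a assume j: "j \<in> Basis"
      have "of_int (k j) - c j * of_int (k i) = ?g \<bullet> j - c j * (?g \<bullet> i)"
        using i j by (simp add: grid_vec_inner)
      also have "\<dots> = w \<bullet> j - c j * (w \<bullet> i)"
        using ei0 by (simp add: w_def c_def inner_diff_left field_simps)
      finally have "\<bar>of_int (k j) - c j * of_int (k i)\<bar> = \<bar>w \<bullet> j - c j * (w \<bullet> i)\<bar>" by simp
      also have "\<dots> \<le> \<bar>w \<bullet> j\<bar> + \<bar>c j\<bar> * \<bar>w \<bullet> i\<bar>"
        by (metis abs_mult abs_triangle_ineq4)
      also have "\<dots> \<le> norm w + D * norm w"
        using Basis_le_norm[OF i, of w] Basis_le_norm[OF j, of w] c[OF j] by (intro add_mono mult_mono) (auto simp: D_def)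
      also have "\<dots> = (1 + D) * norm w" by (simp add: algebra_simps)
      also have "\<dots> \<le> W" unfolding W_def using w D1 by (intro mult_left_mono) auto
      finally have "\<bar>of_int (k j) - c j * of_int (k i)\<bar> \<le> W" .
      then show "k j \<in> (if j = i then {k i} else {\<lceil>c j * of_int (k i) - W\<rceil>..\<lfloor>c j * of_int (k i) + W\<rfloor>})"
        by (auto simp: abs_le_iff) linarith+
    next
      fix j :: 'a assume "j \<notin> Basis"
      then show "k j = undefined" using k by (auto simp: PiE_iff extensional_def)
    qed
    moreover have "k i \<in> {- int n..int n}" using k i by (auto simp: PiE_iff)
    ultimately show "k \<in> (\<Union>m\<in>{- int n..int n}. F m)" by blast
  qed
  have fin: "finite (F m)" for m unfolding F_def by (intro finite_PiE) auto
  have cardF: "real (card (F m)) \<le> (3 * W) ^ (DIM('a) - 1)" for m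
  proof -
    have "real (card (F m)) = (\<Prod>j\<in>(Basis::'a set). real (card
        (if j = i then {m} else {\<lceil>c j * of_int m - W\<rceil>..\<lfloor>c j * of_int m + W\<rfloor>})))"
      unfolding F_def by (subst card_PiE) (auto simp: of_nat_prod)
    also have "\<dots> = (\<Prod>j\<in>(Basis::'a set) - {i}. real (card {\<lceil>c j * of_int m - W\<rceil>..\<lfloor>c j * of_int m + W\<rfloor>}))"
      by (subst prod.remove[OF _ i]) (auto intro!: prod.cong)
    also have "\<dots> \<le> (\<Prod>j\<in>(Basis::'a set) - {i}. 3 * W)"
      using card_int_interval_le[OF W1] by (intro prod_mono) auto
    also have "\<dots> = (3 * W) ^ (DIM('a) - 1)"
      using i by (simp add: card_Diff_singleton)
    finally show ?thesis .
  qed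
  have "real (card {k \<in> grid n. norm (direction k - e) \<le> \<delta>}) \<le> real (card (\<Union>m\<in>{- int n..int n}. F m))"
    using fin by (intro of_nat_mono card_mono[OF _ sub]) auto
  also have "\<dots> \<le> real (\<Sum>m\<in>{- int n..int n}. card (F m))"
    by (intro of_nat_mono card_UN_le) auto
  also have "\<dots> \<le> (\<Sum>m\<in>{- int n..int n}. (3 * W) ^ (DIM('a) - 1))"
    unfolding of_nat_sum by (intro sum_mono cardF)
  also have "\<dots> = (2 * real n + 1) * (3 * W) ^ (DIM('a) - 1)" by simp
  also have "\<dots> \<le> (3 * real n) * (3 * W) ^ (DIM('a) - 1)"
    using n0 W1 by (intro mult_right_mono) auto
  also have "\<dots> = 3 * (3 * ((1 + D) * D)) ^ (DIM('a) - 1) * (real n * real n ^ (DIM('a) - 1)) * \<delta> ^ (DIM('a) - 1)"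
    unfolding W_def by (simp add: power_mult_distrib mult_ac)
  also have "real n * real n ^ (DIM('a) - 1) = real n ^ DIM('a)"
    by (metis DIM_positive Suc_pred' power_Suc)
  finally show ?thesis .
qed

section \<open>Averages of plane waves\<close>

text \<open>The layers z ~ 2^l sqrt (d/r) are those on which d + r z^2/2 is comparable to d 4^l.
  Written with indicator functions, the bound can be averaged by counting points in balls, which
  takes the place of polar coordinates around a pole of the sphere.\<close>

lemma dyadic_layer_bound:
  fixes d r z \<gamma> :: real
  assumes d: "d > 0" and r: "r > 0" and \<gamma>: "\<gamma> > 0" and z: "z \<ge> 0" "z \<le> 2 ^ L * sqrt (d / r)"
  shows "(d + r * z\<^sup>2 / 2) powr - \<gamma>
    \<le> (\<Sum>l\<le>L. 8 powr \<gamma> * (d * 4 ^ l) powr - \<gamma> * (if z \<le> 2 ^ l * sqrt (d / r) then 1 else 0))"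
proof -
  define l where "l = (LEAST l. z \<le> 2 ^ l * sqrt (d / r))"
  have l: "z \<le> 2 ^ l * sqrt (d / r)" unfolding l_def by (rule LeastI[of _ L]) (rule z(2))
  have lL: "l \<le> L" unfolding l_def by (rule Least_le) (rule z(2))
  \<comment> \<open>By minimality of \<open>l\<close>, z exceeds half of its bound, so r z^2/2 is at
    least d 4^l / 8; for l = 0 the summand d suffices.\<close>
  have "(d * 4 ^ l) / 8 \<le> d + r * z\<^sup>2 / 2"
  proof (cases l)
    case 0
    then show ?thesis using d r by simp
  next
    case (Suc m)
    have "\<not> z \<le> 2 ^ m * sqrt (d / r)"
      using not_less_Least[of m "\<lambda>l. z \<le> 2 ^ l * sqrt (d / r)"] Suc unfolding l_def by simp
    then have "(2 ^ m * sqrt (d / r))\<^sup>2 \<le> z\<^sup>2"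
      using d r by (intro power_mono) auto
    moreover have "(2 ^ m)\<^sup>2 = (4::real) ^ m"
      using power_mult_distrib[of "2::real" 2 m] by (simp add: power2_eq_square)
    moreover have "(2 ^ m * sqrt (d / r))\<^sup>2 = (2 ^ m)\<^sup>2 * (d / r)"
      using d r by (simp only: power_mult_distrib real_sqrt_pow2 divide_nonneg_nonneg less_imp_le)
    ultimately have "4 ^ m * (d / r) \<le> z\<^sup>2" by simp
    then have "d * 4 ^ m \<le> r * z\<^sup>2" using r by (simp add: field_simps)
    then show ?thesis using Suc d by simp
  qed
  then have "(d + r * z\<^sup>2 / 2) powr - \<gamma> \<le> ((d * 4 ^ l) / 8) powr - \<gamma>"
    using d \<gamma> by (intro powr_mono2') auto
  also have "\<dots> = 8 powr \<gamma> * (d * 4 ^ l) powr - \<gamma> * (if z \<le> 2 ^ l * sqrt (d / r) then 1 else 0)"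
    using l d by (simp add: powr_divide powr_minus field_simps)
  also have "\<dots> \<le> (\<Sum>l\<le>L. 8 powr \<gamma> * (d * 4 ^ l) powr - \<gamma> * (if z \<le> 2 ^ l * sqrt (d / r) then 1 else 0))"
    using lL by (intro member_le_sum) auto
  finally show ?thesis .
qed

definition dir_avg :: "nat \<Rightarrow> ('a::euclidean_space \<Rightarrow> real) \<Rightarrow> real" where
  "dir_avg n h = (\<Sum>k\<in>grid n. h (direction k)) / real (card (grid n :: ('a \<Rightarrow> int) set))"

lemma dir_avg_mono:
  "(\<And>w. norm w = 1 \<Longrightarrow> h w \<le> h' w) \<Longrightarrow> dir_avg n h \<le> dir_avg n h'"
  unfolding dir_avg_def by (intro divide_right_mono sum_mono) (auto dest: norm_direction)

lemma dir_avg_cmult: "dir_avg n (\<lambda>w. c * h w) = c * dir_avg n h"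
  by (simp add: dir_avg_def sum_distrib_left)

lemma dir_avg_const: "n \<ge> 1 \<Longrightarrow> dir_avg n (\<lambda>w::'a::euclidean_space. c) = c"
  using card_grid_pos[where 'a='a, of n] by (simp add: dir_avg_def)

lemma dir_avg_sum: "dir_avg n (\<lambda>w. \<Sum>i\<in>A. h i w) = (\<Sum>i\<in>A. dir_avg n (h i))"
  unfolding dir_avg_def sum_divide_distrib by (rule sum.swap)

text \<open>For unit \<open>w\<close> and x = r e one has s - x \<bullet> w = d + r |w - e|^2 / 2
  with d = s - r, so the average is governed by the directions within about sqrt (d/r) of
  \<open>e\<close>. A ball of radius \<delta> around \<open>e\<close> contains at most a fraction of
  order \<delta>^(N-1) = \<delta>^(2a) of the grid, which yields (d/r)^a d^(-\<gamma>); \<gamma> > a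
  makes the sum over dyadic layers geometric.\<close>

lemma dir_avg_powr_le:
  fixes \<gamma> :: real
  defines "a \<equiv> (real DIM('a::euclidean_space) - 1) / 2"
  assumes \<gamma>: "\<gamma> > a"
  shows "\<exists>C>0. \<forall>n s. \<forall>x::'a. norm x \<le> s - 1 \<longrightarrow> s \<le> real n \<longrightarrow>
    dir_avg n (\<lambda>w. (s - x \<bullet> w) powr - \<gamma>) \<le> C * (s powr - a * (s - norm x) powr (a - \<gamma>))"
proof -
  define N where "N = DIM('a)"
  define D where "D = real N"
  have N1: "N \<ge> 1" by (simp add: N_def Suc_le_eq)
  have a0: "a \<ge> 0" using N1 unfolding a_def N_def by simp
  have a2: "2 * a = real (N - 1)" using N1 unfolding a_def N_def by (simp add: of_nat_diff)
  define B where "B = 3 * (3 * ((1 + D) * D)) ^ (N - 1)"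
  have B0: "B > 0" using N1 by (auto simp: B_def D_def intro!: mult_pos_pos zero_less_power)
  \<comment> \<open>The ratio of consecutive layers: the share of directions grows by 4^a, the
    weight falls by 4^(-\<gamma>).\<close>
  define \<theta> where "\<theta> = 2 powr (2 * (a - \<gamma>))"
  have \<theta>: "0 < \<theta>" "\<theta> < 1" using \<gamma> powr_less_mono[of "2 * (a - \<gamma>)" 0 2] by (auto simp: \<theta>_def)
  define C where "C = 2 powr a + 8 powr \<gamma> * B * 2 powr a / (1 - \<theta>)"
  have C1: "8 powr \<gamma> * B * 2 powr a / (1 - \<theta>) \<ge> 0" using B0 \<theta> by simp
  have C0: "C > 0" unfolding C_def using C1 by (intro add_pos_nonneg) auto
  have "dir_avg n (\<lambda>w. (s - x \<bullet> w) powr - \<gamma>) \<le> C * (s powr - a * (s - norm x) powr (a - \<gamma>))"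
    if xs: "norm x \<le> s - 1" and sn: "s \<le> real n" for n s and x :: 'a
  proof -
    define r d where "r = norm x" and "d = s - norm x"
    have d1: "d \<ge> 1" and r0: "r \<ge> 0" and srd: "s = r + d" using xs by (auto simp: d_def r_def)
    have s1: "s \<ge> 1" using d1 r0 srd by simp
    have n1: "n \<ge> 1" using s1 sn by simp
    show ?thesis
    \<comment> \<open>Well inside the cone d exceeds s/2, and the crude bound s - x \<bullet> w
      \<ge> d already has the right order; the geometry of directions matters for r \<ge> s/2
      only.\<close>
    proof (cases "r < s / 2")
      case True
      have "dir_avg n (\<lambda>w. (s - x \<bullet> w) powr - \<gamma>) \<le> dir_avg n (\<lambda>w::'a. d powr - \<gamma>)"
      proof (rule dir_avg_mono)
        fix w :: 'a assume w: "norm w = 1"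
        have "x \<bullet> w \<le> norm x" using norm_cauchy_schwarz[of x w] w by simp
        then show "(s - x \<bullet> w) powr - \<gamma> \<le> d powr - \<gamma>"
          using d1 a0 \<gamma> by (intro powr_mono2') (auto simp: d_def)
      qed
      also have "\<dots> = d powr - \<gamma>" by (rule dir_avg_const[OF n1])
      also have "\<dots> = d powr - a * d powr (a - \<gamma>)" by (simp flip: powr_add)
      also have "\<dots> \<le> (s / 2) powr - a * d powr (a - \<gamma>)"
        using True srd s1 a0 by (intro mult_right_mono powr_mono2') auto
      also have "\<dots> = 2 powr a * (s powr - a * d powr (a - \<gamma>))"
        using s1 by (simp add: powr_divide powr_minus field_simps)
      also have "\<dots> \<le> C * (s powr - a * d powr (a - \<gamma>))"
        using C1 unfolding C_def by (intro mult_right_mono) auto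
      finally show ?thesis by (simp add: d_def)
    next
      case False
      then have rs: "r \<ge> s / 2" and r0: "r > 0" using s1 by auto
      define e where "e = x /\<^sub>R r"
      have e: "norm e = 1" using r0 by (simp add: e_def r_def)
      have xe: "x = r *\<^sub>R e" using r0 by (simp add: e_def)
      define \<rho> where "\<rho> = sqrt (d / r)"
      have \<rho>0: "\<rho> > 0" using d1 r0 by (simp add: \<rho>_def)
      \<comment> \<open>The smallest layer must not be finer than the grid spacing 1/n, or the count
        of directions fails. This is the purpose of the condition s \<le> n.\<close>
      have n\<rho>: "real n * \<rho> \<ge> 1"
      proof -
        have "r \<le> s" using srd d1 by simp
        have "1 * 1 \<le> real n * d" using n1 d1 by (intro mult_mono) auto
        then have "real n * 1 \<le> real n * (real n * d)" by (intro mult_left_mono) auto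
        with \<open>r \<le> s\<close> have "r \<le> real n * (real n * d)" using sn by simp
        then have "1 \<le> (real n)\<^sup>2 * (d / r)" using r0 by (simp add: field_simps power2_eq_square)
        then have "1 \<le> sqrt ((real n)\<^sup>2 * (d / r))" by (rule real_sqrt_ge_one)
        also have "sqrt ((real n)\<^sup>2 * (d / r)) = real n * \<rho>"
          by (simp only: real_sqrt_mult real_sqrt_abs abs_of_nat \<rho>_def)
        finally show ?thesis .
      qed
      obtain L where L: "2 / \<rho> < 2 ^ L" using real_arch_pow[of 2 "2 / \<rho>"] by auto
      then have L: "2 \<le> 2 ^ L * \<rho>" using \<rho>0 by (simp add: field_simps)
      have pt: "(s - x \<bullet> w) powr - \<gamma> \<le> (\<Sum>l\<le>L. 8 powr \<gamma> * (d * 4 ^ l) powr - \<gamma> *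
          (if norm (w - e) \<le> 2 ^ l * \<rho> then 1 else 0))" if w: "norm w = 1" for w
      proof -
        have "(norm (w - e))\<^sup>2 = 2 - 2 * (e \<bullet> w)"
          using w e by (simp add: power2_norm_eq_inner inner_diff_left inner_diff_right inner_commute norm_eq_1)
        moreover have "s - x \<bullet> w = d + r * (2 - 2 * (e \<bullet> w)) / 2"
          by (simp add: srd xe) (simp add: field_simps)
        ultimately have "s - x \<bullet> w = d + r * (norm (w - e))\<^sup>2 / 2" by simp
        moreover have "norm (w - e) \<le> 2 ^ L * \<rho>"
          using norm_triangle_ineq4[of w e] w e L by simp
        ultimately show ?thesis
          using dyadic_layer_bound[of d r \<gamma> "norm (w - e)" L] d1 r0 a0 \<gamma> by (simp add: \<rho>_def)
      qed
      have layer: "dir_avg n (\<lambda>w. if norm (w - e) \<le> 2 ^ l * \<rho> then 1 else 0)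
          \<le> B * ((d / r) powr a * (2 powr (2 * a)) ^ l)" for l
      proof -
        have nl: "real n * (2 ^ l * \<rho>) \<ge> 1"
        proof -
          have "1 * 1 \<le> 2 ^ l * (real n * \<rho>)" using n\<rho> by (intro mult_mono) auto
          then show ?thesis by (simp add: mult_ac)
        qed
        have "(\<Sum>k\<in>grid n. if norm (direction k - e) \<le> 2 ^ l * \<rho> then 1 else 0)
           = real (card {k \<in> grid n. norm (direction k - e) \<le> 2 ^ l * \<rho>})"
          by (simp flip: sum.inter_filter[OF finite_grid])
        also have "\<dots> \<le> B * real n ^ N * (2 ^ l * \<rho>) ^ (N - 1)"
          using card_directions_near[OF e nl] unfolding B_def D_def N_def by simp
        finally have le: "(\<Sum>k\<in>grid n. if norm (direction k - e) \<le> 2 ^ l * \<rho> then 1 else 0)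
          \<le> B * real n ^ N * (2 ^ l * \<rho>) ^ (N - 1)" .
        have "dir_avg n (\<lambda>w. if norm (w - e) \<le> 2 ^ l * \<rho> then 1 else 0)
           \<le> (B * real n ^ N * (2 ^ l * \<rho>) ^ (N - 1)) / real n ^ N"
          unfolding dir_avg_def using card_grid_ge[where 'a='a, of n] le n1 B0 \<rho>0
          by (intro frac_le) (auto simp: N_def)
        also have "\<dots> = B * (2 ^ l * \<rho>) ^ (N - 1)" using n1 by simp
        also have "(2 ^ l * \<rho>) ^ (N - 1) = (2 ^ l * \<rho>) powr (2 * a)"
          using \<rho>0 by (simp add: a2 powr_realpow)
        also have "\<dots> = (2 powr l) powr (2 * a) * \<rho> powr (2 * a)"
          using \<rho>0 by (simp add: powr_mult powr_realpow)
        also have "\<rho> powr (2 * a) = (d / r) powr a"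
          using d1 r0 by (simp add: \<rho>_def powr_half_sqrt[symmetric] powr_powr)
        also have "(2 powr l) powr (2 * a) = (2 powr (2 * a)) ^ l"
          by (simp add: powr_powr mult.commute flip: powr_realpow)
        finally show ?thesis by (simp add: mult_ac)
      qed
      have "dir_avg n (\<lambda>w. (s - x \<bullet> w) powr - \<gamma>)
          \<le> dir_avg n (\<lambda>w. \<Sum>l\<le>L. 8 powr \<gamma> * (d * 4 ^ l) powr - \<gamma> *
          (if norm (w - e) \<le> 2 ^ l * \<rho> then 1 else 0))"
        by (rule dir_avg_mono[OF pt])
      also have "\<dots> = (\<Sum>l\<le>L. 8 powr \<gamma> * (d * 4 ^ l) powr - \<gamma> *
          dir_avg n (\<lambda>w. if norm (w - e) \<le> 2 ^ l * \<rho> then 1 else 0))"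
        by (simp only: dir_avg_sum dir_avg_cmult)
      also have "\<dots> \<le> (\<Sum>l\<le>L. 8 powr \<gamma> * (d * 4 ^ l) powr - \<gamma> * (B * ((d / r) powr a * (2 powr (2 * a)) ^ l)))"
        by (intro sum_mono mult_left_mono layer) auto
      also have "\<dots> = (\<Sum>l\<le>L. (8 powr \<gamma> * B * d powr (a - \<gamma>) * r powr - a) * \<theta> ^ l)"
      proof (rule sum.cong[OF refl])
        fix l
        have "(d * 4 ^ l) powr - \<gamma> = d powr - \<gamma> * (4 powr l) powr - \<gamma>"
          using d1 by (simp add: powr_mult powr_realpow)
        also have "(4 powr l) powr - \<gamma> = (4 powr - \<gamma>) ^ l"
          by (simp add: powr_powr mult.commute flip: powr_realpow)
        also have "4 powr - \<gamma> = 2 powr (2 * - \<gamma>)"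
          using powr_powr[of 2 2 "- \<gamma>"] by simp
        finally have 1: "(d * 4 ^ l) powr - \<gamma> = d powr - \<gamma> * (2 powr (2 * - \<gamma>)) ^ l" .
        have 2: "\<theta> ^ l = (2 powr (2 * - \<gamma>)) ^ l * (2 powr (2 * a)) ^ l"
          by (simp add: \<theta>_def algebra_simps flip: power_mult_distrib powr_add)
        have 3: "d powr (a - \<gamma>) * r powr - a = d powr - \<gamma> * (d / r) powr a"
          using d1 r0 by (simp add: powr_divide powr_diff powr_minus field_simps)
        show "8 powr \<gamma> * (d * 4 ^ l) powr - \<gamma> * (B * ((d / r) powr a * (2 powr (2 * a)) ^ l))
            = (8 powr \<gamma> * B * d powr (a - \<gamma>) * r powr - a) * \<theta> ^ l"
          unfolding 1 2 using 3 by (simp add: mult_ac)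
      qed
      also have "\<dots> = (8 powr \<gamma> * B * d powr (a - \<gamma>) * r powr - a) * (\<Sum>l\<le>L. \<theta> ^ l)"
        by (simp add: sum_distrib_left)
      also have "\<dots> \<le> (8 powr \<gamma> * B * d powr (a - \<gamma>) * (2 powr a * s powr - a)) * (1 / (1 - \<theta>))"
      proof (intro mult_mono mult_left_mono)
        have "(1 - \<theta>) * (\<Sum>l\<le>L. \<theta> ^ l) = 1 - \<theta> ^ Suc L" by (rule sum_gp_basic)
        also have "\<dots> \<le> 1" using \<theta> by simp
        finally show "(\<Sum>l\<le>L. \<theta> ^ l) \<le> 1 / (1 - \<theta>)"
          using \<theta> by (subst pos_le_divide_eq) (auto simp: mult.commute)
        have "r powr - a \<le> (s / 2) powr - a"
          using rs s1 a0 by (intro powr_mono2') auto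
        also have "(s / 2) powr - a = 2 powr a * s powr - a"
          using s1 by (simp add: powr_divide powr_minus field_simps)
        finally show "r powr - a \<le> 2 powr a * s powr - a" .
      qed (use B0 \<theta> in \<open>auto intro!: sum_nonneg\<close>)
      also have "\<dots> = (8 powr \<gamma> * B * 2 powr a / (1 - \<theta>)) * (s powr - a * d powr (a - \<gamma>))"
        by simp
      also have "\<dots> \<le> C * (s powr - a * d powr (a - \<gamma>))"
        unfolding C_def by (intro mult_right_mono) auto
      finally show ?thesis by (simp add: d_def)
    qed
  qed
  then show ?thesis using C0 by blast
qed

definition avg_exp :: "nat \<Rightarrow> real \<Rightarrow> 'a::euclidean_space \<Rightarrow> real" where
  "avg_exp n l x = dir_avg n (\<lambda>w. exp (l * (x \<bullet> w)))"

lemma avg_exp_pos: "n \<ge> 1 \<Longrightarrow> avg_exp n l (x::'a::euclidean_space) > 0"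
  using card_grid_pos[where 'a='a, of n] finite_grid[of n]
  unfolding avg_exp_def dir_avg_def by (intro divide_pos_pos sum_pos) auto

lemma continuous_on_avg_exp [continuous_intros]: "continuous_on S (avg_exp n l)"
  unfolding avg_exp_def[abs_def] dir_avg_def divide_inverse by (intro continuous_intros)

lemma avg_exp_bounds:
  assumes "n \<ge> 1" "l \<ge> 0" "norm (x::'a::euclidean_space) \<le> r"
  shows "exp (- (l * r)) \<le> avg_exp n l x" "avg_exp n l x \<le> exp (l * r)"
proof -
  have *: "\<bar>x \<bullet> w\<bar> \<le> r" if "norm w = 1" for w :: 'a
    using Cauchy_Schwarz_ineq2[of x w] that assms(3) by simp
  have "dir_avg n (\<lambda>w::'a. exp (- (l * r))) \<le> avg_exp n l x"
    unfolding avg_exp_def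
  proof (rule dir_avg_mono)
    fix w :: 'a assume "norm w = 1"
    then have "l * (- r) \<le> l * (x \<bullet> w)"
      using *[of w] assms(2) by (intro mult_left_mono) (auto simp: abs_le_iff)
    then show "exp (- (l * r)) \<le> exp (l * (x \<bullet> w))" by simp
  qed
  then show "exp (- (l * r)) \<le> avg_exp n l x" by (simp add: dir_avg_const[OF assms(1)])
  have "avg_exp n l x \<le> dir_avg n (\<lambda>w::'a. exp (l * r))"
    unfolding avg_exp_def
  proof (rule dir_avg_mono)
    fix w :: 'a assume "norm w = 1"
    then have "l * (x \<bullet> w) \<le> l * r"
      using *[of w] assms(2) by (intro mult_left_mono) (auto simp: abs_le_iff)
    then show "exp (l * (x \<bullet> w)) \<le> exp (l * r)" by simp
  qed
  then show "avg_exp n l x \<le> exp (l * r)" by (simp add: dir_avg_const[OF assms(1)])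
qed

text \<open>The function y^\<gamma> exp (-l y) is largest at y = \<gamma>/l. The constant is its
  value there without the factor exp (-\<gamma>), which is given away.\<close>

lemma powr_le_exp:
  fixes \<gamma> l y :: real
  assumes "\<gamma> > 0" "l > 0" "y > 0"
  shows "y powr \<gamma> \<le> (\<gamma> / l) powr \<gamma> * exp (l * y)"
proof -
  have "ln (l * y / \<gamma>) \<le> l * y / \<gamma>"
    using assms ln_le_minus_one[of "l * y / \<gamma>"] by simp
  then have "\<gamma> * ln (l * y / \<gamma>) \<le> l * y"
    using assms by (simp add: field_simps)
  then have "(l * y / \<gamma>) powr \<gamma> \<le> exp (l * y)"
    using assms by (simp add: powr_def)
  then have "(\<gamma> / l) powr \<gamma> * (l * y / \<gamma>) powr \<gamma> \<le> (\<gamma> / l) powr \<gamma> * exp (l * y)"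
    by (intro mult_left_mono) auto
  then show ?thesis
    using assms by (simp flip: powr_mult)
qed

text \<open>Under the average exp (-l y) is replaced by a multiple of y^(-\<gamma>), y = s - x
  \<bullet> w, which reduces the claim to powers. The shift of t by \<open>r\<^sub>0 + 1\<close>
  keeps y at least 1 on the cone, and \<gamma> = a + 2 leaves the power -2 of the distance to the
  boundary, summable over unit shells.\<close>

lemma avg_exp_decay:
  fixes r\<^sub>0 l :: real
  defines "a \<equiv> (real DIM('a::euclidean_space) - 1) / 2"
  assumes l: "l > 0" and r0: "r\<^sub>0 \<ge> 0"
  shows "\<exists>C>0. \<forall>n t. \<forall>x::'a. 0 \<le> t \<longrightarrow> norm x \<le> r\<^sub>0 + t \<longrightarrow> r\<^sub>0 + 1 + t \<le> real n \<longrightarrow>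
    exp (- (l * t)) * avg_exp n l x \<le> C * ((r\<^sub>0 + 1 + t) powr - a * (r\<^sub>0 + 1 + t - norm x) powr - 2)"
proof -
  have a0: "a \<ge> 0" unfolding a_def by (simp add: Suc_le_eq)
  define \<gamma> where "\<gamma> = a + 2"
  obtain C where C: "C > 0" "\<And>n s x. norm x \<le> s - 1 \<Longrightarrow> s \<le> real n \<Longrightarrow>
      dir_avg n (\<lambda>w. (s - x \<bullet> w) powr - \<gamma>) \<le> C * (s powr - a * (s - norm (x::'a)) powr (a - \<gamma>))"
    using dir_avg_powr_le[where 'a='a, of \<gamma>] unfolding \<gamma>_def a_def by auto
  define K where "K = exp (l * (r\<^sub>0 + 1)) * (\<gamma> / l) powr \<gamma>"
  have K0: "K > 0" using a0 l by (auto simp: K_def \<gamma>_def)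
  have "exp (- (l * t)) * avg_exp n l x \<le> K * C * ((r\<^sub>0 + 1 + t) powr - a * (r\<^sub>0 + 1 + t - norm x) powr - 2)"
    if t: "0 \<le> t" "norm x \<le> r\<^sub>0 + t" "r\<^sub>0 + 1 + t \<le> real n" for n t and x :: 'a
  proof -
    define s where "s = r\<^sub>0 + 1 + t"
    have "exp (- (l * t)) * avg_exp n l x = dir_avg n (\<lambda>w. exp (- (l * t)) * exp (l * (x \<bullet> w)))"
      by (simp add: avg_exp_def dir_avg_cmult)
    also have "\<dots> \<le> dir_avg n (\<lambda>w. K * (s - x \<bullet> w) powr - \<gamma>)"
    proof (rule dir_avg_mono)
      fix w :: 'a assume w: "norm w = 1"
      have "x \<bullet> w \<le> norm x" using norm_cauchy_schwarz[of x w] w by simp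
      then have y: "s - x \<bullet> w > 0" using t by (simp add: s_def)
      have "(s - x \<bullet> w) powr \<gamma> \<le> (\<gamma> / l) powr \<gamma> * exp (l * (s - x \<bullet> w))"
        using powr_le_exp[of \<gamma> l "s - x \<bullet> w"] y l a0 by (simp add: \<gamma>_def)
      then have "exp (- (l * (s - x \<bullet> w))) * (s - x \<bullet> w) powr \<gamma>
          \<le> exp (- (l * (s - x \<bullet> w))) * ((\<gamma> / l) powr \<gamma> * exp (l * (s - x \<bullet> w)))"
        by (intro mult_left_mono) auto
      also have "\<dots> = (\<gamma> / l) powr \<gamma>" by (simp add: exp_minus)
      finally have "exp (- (l * (s - x \<bullet> w))) \<le> (\<gamma> / l) powr \<gamma> / (s - x \<bullet> w) powr \<gamma>"
        using y by (subst pos_le_divide_eq) auto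
      then have "exp (- (l * (s - x \<bullet> w))) \<le> (\<gamma> / l) powr \<gamma> * (s - x \<bullet> w) powr - \<gamma>"
        by (simp add: powr_minus divide_inverse)
      then have "exp (l * (r\<^sub>0 + 1)) * exp (- (l * (s - x \<bullet> w))) \<le> K * (s - x \<bullet> w) powr - \<gamma>"
        unfolding K_def by simp
      then show "exp (- (l * t)) * exp (l * (x \<bullet> w)) \<le> K * (s - x \<bullet> w) powr - \<gamma>"
        by (simp add: s_def algebra_simps flip: exp_add)
    qed
    also have "\<dots> = K * dir_avg n (\<lambda>w. (s - x \<bullet> w) powr - \<gamma>)" by (rule dir_avg_cmult)
    also have "\<dots> \<le> K * (C * (s powr - a * (s - norm x) powr (a - \<gamma>)))"
      using K0 t by (intro mult_left_mono C) (auto simp: s_def)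
    finally show ?thesis by (simp add: \<gamma>_def s_def mult.assoc)
  qed
  then show ?thesis using K0 C(1) by (intro exI[of _ "K * C"]) auto
qed

section \<open>Integrals over the light cone\<close>

lemma measure_cball_0:
  "r \<ge> 0 \<Longrightarrow> measure lebesgue (cball (0::'a::euclidean_space) r) = r ^ DIM('a) * measure lebesgue (ball (0::'a) 1)"
  using content_ball_conv_unit_ball[of r "0::'a"] by (simp add: content_cball_conv_ball)

lemma integrable_on_cball:
  assumes "continuous_on (cball (0::'a::euclidean_space) r) h"
  shows "set_integrable lebesgue (cball 0 r) (h :: 'a \<Rightarrow> real)"
proof -
  have i: "integrable lborel (\<lambda>x. indicat_real (cball 0 r) x *\<^sub>R h x)"
    by (rule borel_integrable_compact[OF _ assms]) auto
  then show ?thesis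
    unfolding set_integrable_def by (subst integrable_completion) (auto intro: borel_measurable_integrable)
qed

text \<open>Bernoulli's inequality gives \<rho>^N - (\<rho> - 1)^N \<le> N \<rho>^(N-1). For \<rho>
  < 1 the inner ball has negative radius and is empty, so the whole ball has to be bounded
  instead.\<close>

lemma measure_annulus_le:
  fixes s :: real
  assumes s: "s \<ge> 1" and k: "0 \<le> k" "k \<le> s"
  shows "measure lebesgue (cball (0::'a::euclidean_space) (s - k) - cball 0 (s - k - 1))
    \<le> real DIM('a) * measure lebesgue (ball (0::'a) 1) * s ^ (DIM('a) - 1)"
proof -
  define V where "V = measure lebesgue (ball (0::'a) 1)"
  define N where "N = DIM('a)"
  have N1: "N \<ge> 1" by (simp add: N_def Suc_le_eq)
  have V0: "V \<ge> 0" by (simp add: V_def)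
  define \<rho> where "\<rho> = s - k"
  have \<rho>: "0 \<le> \<rho>" "\<rho> \<le> s" using k by (auto simp: \<rho>_def)
  show ?thesis
  proof (cases "\<rho> < 1")
    case True
    then have "cball (0::'a) (\<rho> - 1) = {}" by simp
    then have "measure lebesgue (cball (0::'a) \<rho> - cball 0 (\<rho> - 1)) = \<rho> ^ N * V"
      using measure_cball_0[OF \<rho>(1), where 'a='a] by (simp add: V_def N_def)
    also have "\<dots> \<le> 1 * V" using \<rho> True V0 by (intro mult_right_mono power_le_one) auto
    also have "\<dots> \<le> (real N * s ^ (N - 1)) * V"
    proof (rule mult_right_mono[OF _ V0])
      have "1 * 1 \<le> real N * s ^ (N - 1)" using N1 s by (intro mult_mono) auto
      then show "1 \<le> real N * s ^ (N - 1)" by simp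
    qed
    finally show ?thesis by (simp add: \<rho>_def V_def N_def mult_ac)
  next
    case False
    then have \<rho>1: "\<rho> \<ge> 1" by simp
    have "measure lebesgue (cball (0::'a) \<rho> - cball 0 (\<rho> - 1))
        = measure lebesgue (cball (0::'a) \<rho>) - measure lebesgue (cball (0::'a) (\<rho> - 1))"
      by (rule measurable_measure_Diff) auto
    also have "\<dots> = (\<rho> ^ N - (\<rho> - 1) ^ N) * V"
      using measure_cball_0[of \<rho>, where 'a='a] measure_cball_0[of "\<rho> - 1", where 'a='a] \<rho>1
      by (simp add: V_def N_def algebra_simps)
    also have "\<dots> \<le> (real N * s ^ (N - 1)) * V"
    proof (rule mult_right_mono[OF _ V0])
      have "1 + real N * (- (1 / \<rho>)) \<le> (1 + (- (1 / \<rho>))) ^ N"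
        using \<rho>1 by (intro Bernoulli_inequality) (simp add: field_simps)
      then have "\<rho> ^ N * (1 - real N * (1 / \<rho>)) \<le> \<rho> ^ N * (1 - 1 / \<rho>) ^ N"
        using \<rho>1 by (intro mult_left_mono) auto
      also have "\<rho> ^ N * (1 - 1 / \<rho>) ^ N = (\<rho> - 1) ^ N"
        using \<rho>1 by (simp add: field_simps flip: power_mult_distrib)
      also have "\<rho> ^ N * (1 - real N * (1 / \<rho>)) = \<rho> ^ N - real N * \<rho> ^ (N - 1)"
        using \<rho>1 N1 by (cases N) (auto simp: field_simps)
      finally have "\<rho> ^ N - (\<rho> - 1) ^ N \<le> real N * \<rho> ^ (N - 1)" by simp
      also have "\<dots> \<le> real N * s ^ (N - 1)"
        using \<rho> by (intro mult_left_mono power_mono) auto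
      finally show "\<rho> ^ N - (\<rho> - 1) ^ N \<le> real N * s ^ (N - 1)" .
    qed
    finally show ?thesis by (simp add: \<rho>_def V_def N_def mult_ac)
  qed
qed

text \<open>Radial integration is replaced by unit shells: on \<open>A k\<close> the distance s -
  |x| lies between k and k + 1, and each shell has volume of order s^(d-1).\<close>

lemma cone_integral_le:
  fixes \<kappa> s :: real
  assumes s: "s \<ge> 1" and \<kappa>: "\<kappa> \<ge> 0"
  shows "(LINT x:cball (0::'a::euclidean_space) (s - 1)|lebesgue. (s - norm x) powr - \<kappa>)
    \<le> real DIM('a) * measure lebesgue (ball (0::'a) 1) * s ^ (DIM('a) - 1)
        * (\<Sum>k=1..nat \<lfloor>s\<rfloor>. real k powr - \<kappa>)"
proof -
  define M where "M = real DIM('a) * measure lebesgue (ball (0::'a) 1) * s ^ (DIM('a) - 1)"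
  define A where "A k = cball (0::'a) (s - real k) - cball 0 (s - real k - 1)" for k :: nat
  have A: "A k \<in> lmeasurable" for k
    unfolding A_def by (intro fmeasurable.Diff) auto
  have int: "integrable lebesgue (\<lambda>x. real k powr - \<kappa> * indicat_real (A k) x)" for k
    using A[of k] by (intro integrable_mult_right) (auto simp: fmeasurable_def)
  have cont: "set_integrable lebesgue (cball (0::'a) (s - 1)) (\<lambda>x. (s - norm x) powr - \<kappa>)"
    by (intro integrable_on_cball continuous_intros) auto
  have "(LINT x:cball (0::'a) (s - 1)|lebesgue. (s - norm x) powr - \<kappa>)
     \<le> (LINT x|lebesgue. (\<Sum>k=1..nat \<lfloor>s\<rfloor>. real k powr - \<kappa> * indicat_real (A k) x))"
    unfolding set_lebesgue_integral_def
  proof (rule integral_mono)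
    show "integrable lebesgue (\<lambda>x. indicat_real (cball (0::'a) (s - 1)) x *\<^sub>R (s - norm x) powr - \<kappa>)"
      using cont by (simp add: set_integrable_def)
    show "integrable lebesgue (\<lambda>x. \<Sum>k=1..nat \<lfloor>s\<rfloor>. real k powr - \<kappa> * indicat_real (A k) x)"
      by (intro Bochner_Integration.integrable_sum int)
    fix x :: 'a
    show "indicat_real (cball 0 (s - 1)) x *\<^sub>R (s - norm x) powr - \<kappa>
      \<le> (\<Sum>k=1..nat \<lfloor>s\<rfloor>. real k powr - \<kappa> * indicat_real (A k) x)"
    proof (cases "x \<in> cball 0 (s - 1)")
      case True
      define k where "k = nat \<lfloor>s - norm x\<rfloor>"
      have y: "s - norm x \<ge> 1" using True by simp
      have k: "real k \<le> s - norm x" "s - norm x < real k + 1" "k \<ge> 1" "k \<le> nat \<lfloor>s\<rfloor>"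
        using y unfolding k_def by (auto simp: le_nat_iff intro!: nat_mono floor_mono)
      have "(s - norm x) powr - \<kappa> \<le> real k powr - \<kappa> * indicat_real (A k) x"
        using k \<kappa> by (auto simp: A_def indicator_def intro!: powr_mono2')
      also have "\<dots> \<le> (\<Sum>k=1..nat \<lfloor>s\<rfloor>. real k powr - \<kappa> * indicat_real (A k) x)"
        using k by (intro member_le_sum) auto
      finally show ?thesis using True by simp
    qed (auto intro!: sum_nonneg)
  qed
  also have "\<dots> = (\<Sum>k=1..nat \<lfloor>s\<rfloor>. real k powr - \<kappa> * measure lebesgue (A k))"
    using int A by (subst Bochner_Integration.integral_sum[OF int]) (auto simp: fmeasurableD)
  also have "\<dots> \<le> (\<Sum>k=1..nat \<lfloor>s\<rfloor>. real k powr - \<kappa> * M)"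
  proof (intro sum_mono mult_left_mono)
    fix k assume "k \<in> {1..nat \<lfloor>s\<rfloor>}"
    then have "real k \<le> s" by (auto simp: le_nat_floor nat_le_iff le_floor_iff) linarith
    then show "measure lebesgue (A k) \<le> M"
      unfolding A_def M_def by (intro measure_annulus_le s) auto
  qed auto
  also have "\<dots> = M * (\<Sum>k=1..nat \<lfloor>s\<rfloor>. real k powr - \<kappa>)"
    by (simp add: sum_distrib_left mult.commute)
  finally show ?thesis by (simp add: M_def)
qed

lemma sum_inverse_squares_le: "(\<Sum>k=1..n. real k powr - 2) \<le> 2"
proof (cases "n = 0")
  case False
  have "(\<Sum>k=1..n. real k powr - 2) \<le> 2 - 1 / real n" if "n \<ge> 1" for n
    using that
  proof (induction n rule: dec_induct)
    case (step n)
    have "real (Suc n) powr - 2 = 1 / (real (Suc n))\<^sup>2"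
      by (simp add: powr_minus divide_inverse)
    also have "\<dots> \<le> 1 / (real n * real (Suc n))"
      using step(1) by (intro frac_le) (auto simp: power2_eq_square)
    also have "\<dots> = 1 / real n - 1 / real (Suc n)"
      using step(1) by (simp add: field_simps)
    finally show ?case using step by simp
  qed simp
  from this[of n] False have "(\<Sum>k=1..n. real k powr - 2) \<le> 2 - 1 / real n" by simp
  also have "\<dots> \<le> 2" by simp
  finally show ?thesis .
qed simp

lemma sum_inverse_le: "n \<ge> 1 \<Longrightarrow> (\<Sum>k=1..n. real k powr - 1) \<le> 1 + ln (real n)"
proof (induction n rule: dec_induct)
  case (step n)
  have "ln (real n / real (Suc n)) \<le> real n / real (Suc n) - 1"
    using step(1) by (intro ln_le_minus_one) auto
  then have "ln (real n) - ln (real (Suc n)) \<le> - (1 / real (Suc n))"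
    using step(1) by (simp add: ln_div field_simps)
  then show ?case using step by (simp add: powr_minus divide_inverse)
qed simp

text \<open>The distance to the boundary is at least 1, so raising its power -2 to the exponent
  \<rho> \<ge> 1 only helps, and the sum of inverse squares serves all \<rho>. The exponent collects
  s^(2a) from the shells and s^(-a \<rho>) from the decay.\<close>

lemma avg_exp_cone_integral:
  fixes r\<^sub>0 l \<rho> :: real
  defines "a \<equiv> (real DIM('a::euclidean_space) - 1) / 2"
  assumes l: "l > 0" and r0: "r\<^sub>0 \<ge> 0" and \<rho>: "\<rho> \<ge> 1"
  shows "\<exists>C>0. \<forall>n t. 0 \<le> t \<longrightarrow> r\<^sub>0 + 1 + t \<le> real n \<longrightarrow>
    (LINT x:cball (0::'a) (r\<^sub>0 + t)|lebesgue. (exp (- (l * t)) * avg_exp n l x) powr \<rho>)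
      \<le> C * (r\<^sub>0 + 1 + t) powr (2 * a - a * \<rho>)"
proof -
  obtain C where C: "C > 0" "\<And>n t x. 0 \<le> t \<Longrightarrow> norm x \<le> r\<^sub>0 + t \<Longrightarrow> r\<^sub>0 + 1 + t \<le> real n \<Longrightarrow>
    exp (- (l * t)) * avg_exp n l (x::'a) \<le> C * ((r\<^sub>0 + 1 + t) powr - a * (r\<^sub>0 + 1 + t - norm x) powr - 2)"
    using avg_exp_decay[OF l r0, where 'a='a] unfolding a_def by blast
  define M where "M = real DIM('a) * measure lebesgue (ball (0::'a) 1)"
  have M0: "M \<ge> 0" by (simp add: M_def)
  have a2: "2 * a = real (DIM('a) - 1)" unfolding a_def by (simp add: of_nat_diff Suc_le_eq)
  define K where "K = C powr \<rho> * (M * 2) + 1"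
  have K0: "K > 0" unfolding K_def using M0 by (intro add_nonneg_pos) auto
  have "(LINT x:cball (0::'a) (r\<^sub>0 + t)|lebesgue. (exp (- (l * t)) * avg_exp n l x) powr \<rho>)
      \<le> K * (r\<^sub>0 + 1 + t) powr (2 * a - a * \<rho>)"
    if t: "0 \<le> t" "r\<^sub>0 + 1 + t \<le> real n" for n t
  proof -
    define s where "s = r\<^sub>0 + 1 + t"
    have s1: "s \<ge> 1" using t r0 by (simp add: s_def)
    have n1: "n \<ge> 1" using s1 t by (simp add: s_def)
    have B: "r\<^sub>0 + t = s - 1" by (simp add: s_def)
    have "(LINT x:cball (0::'a) (s - 1)|lebesgue. (exp (- (l * t)) * avg_exp n l x) powr \<rho>)
      \<le> (LINT x:cball (0::'a) (s - 1)|lebesgue. (C powr \<rho> * s powr (- (a * \<rho>))) * (s - norm x) powr - 2)"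
    proof (rule set_integral_mono)
      have pos: "exp (- (l * t)) * avg_exp n l (x::'a) \<noteq> 0" for x using avg_exp_pos[OF n1, of l x] by simp
      show "set_integrable lebesgue (cball (0::'a) (s - 1)) (\<lambda>x. (exp (- (l * t)) * avg_exp n l x) powr \<rho>)"
        using pos by (intro integrable_on_cball continuous_intros) blast
      show "set_integrable lebesgue (cball (0::'a) (s - 1)) (\<lambda>x. (C powr \<rho> * s powr (- (a * \<rho>))) * (s - norm x) powr - 2)"
        by (intro integrable_on_cball continuous_intros) auto
      fix x :: 'a assume x: "x \<in> cball 0 (s - 1)"
      have d1: "s - norm x \<ge> 1" using x by simp
      have "(exp (- (l * t)) * avg_exp n l x) powr \<rho> \<le> (C * (s powr - a * (s - norm x) powr - 2)) powr \<rho>"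
        using C(2)[of t x n] t x \<rho> less_imp_le[OF avg_exp_pos[OF n1, of l x]]
        by (intro powr_mono2) (simp_all add: s_def)
      also have "\<dots> = C powr \<rho> * s powr (- (a * \<rho>)) * (s - norm x) powr (- 2 * \<rho>)"
        using C(1) s1 d1 by (simp add: powr_mult powr_powr mult.assoc)
      also have "\<dots> \<le> C powr \<rho> * s powr (- (a * \<rho>)) * (s - norm x) powr - 2"
        using d1 \<rho> by (intro mult_left_mono powr_mono) simp_all
      finally show "(exp (- (l * t)) * avg_exp n l x) powr \<rho>
          \<le> (C powr \<rho> * s powr (- (a * \<rho>))) * (s - norm x) powr - 2" .
    qed
    also have "\<dots> = (C powr \<rho> * s powr (- (a * \<rho>))) * (LINT x:cball (0::'a) (s - 1)|lebesgue. (s - norm x) powr - 2)"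
      by simp
    also have "\<dots> \<le> (C powr \<rho> * s powr (- (a * \<rho>))) * (M * s ^ (DIM('a) - 1) * 2)"
    proof (intro mult_left_mono)
      have "(LINT x:cball (0::'a) (s - 1)|lebesgue. (s - norm x) powr - 2)
          \<le> M * s ^ (DIM('a) - 1) * (\<Sum>k=1..nat \<lfloor>s\<rfloor>. real k powr - 2)"
        unfolding M_def by (rule cone_integral_le[OF s1]) simp
      also have "\<dots> \<le> M * s ^ (DIM('a) - 1) * 2"
        using M0 s1 by (intro mult_left_mono sum_inverse_squares_le) auto
      finally show "(LINT x:cball (0::'a) (s - 1)|lebesgue. (s - norm x) powr - 2) \<le> M * s ^ (DIM('a) - 1) * 2" .
    qed auto
    also have "s ^ (DIM('a) - 1) = s powr (2 * a)" using s1 unfolding a2 by (subst powr_realpow) auto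
    also have "(C powr \<rho> * s powr (- (a * \<rho>))) * (M * s powr (2 * a) * 2) = (C powr \<rho> * (M * 2)) * s powr (2 * a - a * \<rho>)"
      by (simp add: powr_diff powr_minus divide_inverse mult_ac)
    also have "\<dots> \<le> K * s powr (2 * a - a * \<rho>)"
      unfolding K_def by (intro mult_right_mono) auto
    finally show ?thesis unfolding B s_def .
  qed
  then show ?thesis using K0 by blast
qed

section \<open>Dyadic superpositions of averaged exponential waves\<close>

text \<open>A finite substitute for the solution of the wave equation obtained by averaging
  \<open>(t + c - x \<bullet> \<omega>) powr - \<beta>\<close> over the sphere:
  \<open>y powr - \<beta>\<close> is comparable to the sum of \<open>\<lambda> powr \<beta> * exp (- \<lambda> y)\<close> over
  dyadic \<open>\<lambda>\<close>.\<close>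

definition wave_packet :: "nat \<Rightarrow> real \<Rightarrow> nat \<Rightarrow> real \<Rightarrow> real \<Rightarrow> 'a::euclidean_space \<Rightarrow> real" where
  "wave_packet n l I \<beta> t x =
    (\<Sum>i\<le>I. (l / 2 ^ i) powr \<beta> * (exp (- (l / 2 ^ i * t)) * avg_exp n (l / 2 ^ i) x))"

text \<open>The summands are dominated by the increments of \<open>z powr \<beta> / (1 + z powr \<beta>)\<close> along
  \<open>z = l y / 2 ^ i\<close>, which telescope.\<close>

lemma dyadic_exp_sum_le:
  fixes \<beta> l :: real
  assumes \<beta>: "\<beta> > 0" and l: "l > 0"
  shows "\<exists>C>0. \<forall>I. \<forall>y>0. (\<Sum>i\<le>I. (l / 2 ^ i) powr \<beta> * exp (- (l / 2 ^ i * y))) \<le> C * y powr - \<beta>"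
proof -
  define \<theta> :: real where "\<theta> = (1/2) powr \<beta>"
  have \<theta>: "0 < \<theta>" "\<theta> < 1"
    using \<beta> powr_less_mono2[of \<beta> "1/2" 1] by (auto simp: \<theta>_def)
  define K1 where "K1 = (2 * \<beta>) powr (2 * \<beta>)"
  define K where "K = (2 + 2 * K1) / (1 - \<theta>)"
  have K0: "K > 0" unfolding K_def K1_def using \<theta> by (intro divide_pos_pos add_pos_nonneg) auto
  define F :: "real \<Rightarrow> real" where "F z = z powr \<beta> / (1 + z powr \<beta>)" for z
  have F: "0 \<le> F z" "F z \<le> 1" for z
    unfolding F_def by (auto simp: divide_le_eq_1 add_pos_nonneg)
  \<comment> \<open>With P = z^\<beta> the increment of F from z/2 to z is (1 - \<theta>) P / ((1 +
    P)(1 + \<theta> P)), hence at least (1 - \<theta>) P / (1 + P)^2, and (1 + P)^2 is dominated by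
    exp z.\<close>
  have key: "z powr \<beta> * exp (- z) \<le> K * (F z - F (z / 2))" if z: "z > 0" for z
  proof -
    define P where "P = z powr \<beta>"
    have P0: "P > 0" using z by (simp add: P_def)
    have w: "(z / 2) powr \<beta> = \<theta> * P"
      using z by (simp add: P_def \<theta>_def powr_divide powr_one_eq_one)
    have "P\<^sup>2 = z powr (2 * \<beta>)"
      unfolding P_def power2_eq_square by (simp flip: powr_add)
    also have "\<dots> \<le> K1 * exp z"
      using powr_le_exp[of "2 * \<beta>" 1 z] \<beta> z by (simp add: K1_def)
    finally have P2: "P\<^sup>2 \<le> K1 * exp z" .
    have "(1 + P)\<^sup>2 \<le> 2 * 1 + 2 * P\<^sup>2"
      using sum_squares_bound[of 1 P] by (simp add: power2_sum)
    also have "\<dots> \<le> 2 * exp z + 2 * (K1 * exp z)"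
      using z by (intro add_mono mult_left_mono P2) auto
    finally have "(1 + P)\<^sup>2 \<le> (2 + 2 * K1) * exp z" by (simp add: algebra_simps)
    then have "exp (- z) \<le> (2 + 2 * K1) / (1 + P)\<^sup>2"
      using P0 by (simp add: exp_minus field_simps)
    then have "P * exp (- z) \<le> P * ((2 + 2 * K1) / (1 + P)\<^sup>2)"
      using P0 by (intro mult_left_mono) auto
    also have "\<dots> = K * ((1 - \<theta>) * P / (1 + P)\<^sup>2)"
      using \<theta> by (simp add: K_def)
    also have "(1 - \<theta>) * P / (1 + P)\<^sup>2 \<le> (1 - \<theta>) * P / ((1 + P) * (1 + \<theta> * P))"
    proof (intro divide_left_mono mult_pos_pos)
      have "\<theta> * P \<le> P" using \<theta> P0 by simp
      then show "(1 + P) * (1 + \<theta> * P) \<le> (1 + P)\<^sup>2"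
        using P0 unfolding power2_eq_square by (intro mult_left_mono) auto
    qed (use P0 \<theta> in \<open>auto intro!: add_pos_pos\<close>)
    then have "K * ((1 - \<theta>) * P / (1 + P)\<^sup>2) \<le> K * ((1 - \<theta>) * P / ((1 + P) * (1 + \<theta> * P)))"
      using K0 by (intro mult_left_mono) auto
    also have "(1 - \<theta>) * P / ((1 + P) * (1 + \<theta> * P)) = F z - F (z / 2)"
    proof -
      have "1 + P > 0" "1 + \<theta> * P > 0" using P0 \<theta> by (auto intro!: add_pos_pos)
      then show ?thesis unfolding F_def w P_def[symmetric] by (simp add: field_simps)
    qed
    finally show ?thesis by (simp add: P_def)
  qed
  have "(\<Sum>i\<le>I. (l / 2 ^ i) powr \<beta> * exp (- (l / 2 ^ i * y))) \<le> K * y powr - \<beta>"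
    if y: "y > 0" for I and y :: real
  proof -
    define z where "z i = l * y / 2 ^ i" for i :: nat
    have z: "z i > 0" "z (Suc i) = z i / 2" for i using l y by (auto simp: z_def)
    have "(\<Sum>i\<le>I. (l / 2 ^ i) powr \<beta> * exp (- (l / 2 ^ i * y))) = (\<Sum>i\<le>I. y powr - \<beta> * (z i powr \<beta> * exp (- z i)))"
    proof (rule sum.cong[OF refl])
      fix i
      have "z i powr \<beta> = (l / 2 ^ i) powr \<beta> * y powr \<beta>"
        using l y by (simp add: z_def flip: powr_mult)
      then have "(l / 2 ^ i) powr \<beta> = y powr - \<beta> * z i powr \<beta>"
        using y by (simp add: powr_minus field_simps)
      moreover have "l / 2 ^ i * y = z i" by (simp add: z_def)
      ultimately show "(l / 2 ^ i) powr \<beta> * exp (- (l / 2 ^ i * y)) = y powr - \<beta> * (z i powr \<beta> * exp (- z i))"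
        by simp
    qed
    also have "\<dots> \<le> (\<Sum>i\<le>I. y powr - \<beta> * (K * (F (z i) - F (z (Suc i)))))"
      unfolding z(2) by (intro sum_mono mult_left_mono key z) auto
    also have "\<dots> = y powr - \<beta> * (K * (F (z 0) - F (z (Suc I))))"
    proof -
      have "(\<Sum>i\<le>I. F (z i) - F (z (Suc i))) = F (z 0) - F (z (Suc I))"
        by (induction I) auto
      then show ?thesis by (simp flip: sum_distrib_left)
    qed
    also have "\<dots> \<le> y powr - \<beta> * (K * 1)"
      using F(1)[of "z (Suc I)"] F(2)[of "z 0"] K0 by (intro mult_left_mono) auto
    finally show ?thesis by (simp add: mult.commute)
  qed
  then show ?thesis using K0 by blast
qed

lemma continuous_on_wave_packet [continuous_intros]:
  "continuous_on S (wave_packet n l I \<beta> t)"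
  unfolding wave_packet_def[abs_def] by (intro continuous_intros)

lemma wave_packet_pos:
  "n \<ge> 1 \<Longrightarrow> l > 0 \<Longrightarrow> wave_packet n l I \<beta> t (x::'a::euclidean_space) > 0"
  unfolding wave_packet_def by (intro sum_pos mult_pos_pos avg_exp_pos) auto

text \<open>The lowest frequency is l / 2^I, so one more power of the frequency costs at most 2^I /
  l. This is why the packet is truncated at the scale R = 2^I: the factor R / l is compensated by
  the extra 1/R in the second derivative of the cut-off.\<close>

lemma wave_packet_le_Suc:
  assumes "n \<ge> 1" "l > 0"
  shows "wave_packet n l I \<beta> t (x::'a::euclidean_space) \<le> (2 ^ I / l) * wave_packet n l I (\<beta> + 1) t x"
  unfolding wave_packet_def sum_distrib_left
proof (rule sum_mono)
  fix i assume "i \<in> {..I}"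
  then have "(2::real) ^ i \<le> 2 ^ I" by simp
  then have 1: "1 \<le> 2 ^ I / l * (l / 2 ^ i)" using assms(2) by simp
  have "(l / 2 ^ i) powr \<beta> * 1 \<le> (l / 2 ^ i) powr \<beta> * (2 ^ I / l * (l / 2 ^ i))"
    by (intro mult_left_mono 1) auto
  also have "\<dots> = (2 ^ I / l) * (l / 2 ^ i) powr (\<beta> + 1)"
    using assms(2) by (simp add: powr_add)
  finally have "(l / 2 ^ i) powr \<beta> \<le> (2 ^ I / l) * (l / 2 ^ i) powr (\<beta> + 1)" by simp
  then have "(l / 2 ^ i) powr \<beta> * (exp (- (l / 2 ^ i * t)) * avg_exp n (l / 2 ^ i) x)
     \<le> ((2 ^ I / l) * (l / 2 ^ i) powr (\<beta> + 1)) * (exp (- (l / 2 ^ i * t)) * avg_exp n (l / 2 ^ i) x)"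
    using less_imp_le[OF avg_exp_pos[OF assms(1), of "l / 2 ^ i" x]] by (intro mult_right_mono) auto
  then show "(l / 2 ^ i) powr \<beta> * (exp (- (l / 2 ^ i * t)) * avg_exp n (l / 2 ^ i) x)
     \<le> (2 ^ I / l) * ((l / 2 ^ i) powr (\<beta> + 1) * (exp (- (l / 2 ^ i * t)) * avg_exp n (l / 2 ^ i) x))"
    by (simp add: mult.assoc)
qed

text \<open>The lowest frequency m = l / 2^I alone suffices: for times and radii of order 2^I its
  exponents stay bounded, by m (2 t + \<open>r\<^sub>0\<close>) \<le> 3 l.\<close>

lemma wave_packet_ge:
  assumes n: "n \<ge> 1" and l: "l > 0" and t: "0 \<le> t" "t \<le> 2 ^ I"
    and r: "r\<^sub>0 \<le> 2 ^ I" and x: "norm (x::'a::euclidean_space) \<le> r\<^sub>0 + t"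
  shows "l powr \<beta> * exp (- (3 * l)) * (2 ^ I) powr - \<beta> \<le> wave_packet n l I \<beta> t x"
proof -
  define m where "m = l / 2 ^ I"
  have m: "m > 0" using l by (simp add: m_def)
  have "exp (- (3 * l)) \<le> exp (- (m * t)) * exp (- (m * (r\<^sub>0 + t)))"
  proof -
    have "m * (t + (r\<^sub>0 + t)) \<le> m * (3 * 2 ^ I)"
      using m t r by (intro mult_left_mono) auto
    also have "\<dots> = 3 * l" by (simp add: m_def)
    finally show ?thesis by (simp add: algebra_simps flip: exp_add)
  qed
  also have "\<dots> \<le> exp (- (m * t)) * avg_exp n m x"
    using avg_exp_bounds(1)[OF n, of m x "r\<^sub>0 + t"] m x by (intro mult_left_mono) auto
  finally have "m powr \<beta> * exp (- (3 * l)) \<le> m powr \<beta> * (exp (- (m * t)) * avg_exp n m x)"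
    by (intro mult_left_mono) auto
  also have "\<dots> \<le> wave_packet n l I \<beta> t x"
    unfolding wave_packet_def m_def
    using less_imp_le[OF avg_exp_pos[OF n, of _ x]] by (intro member_le_sum) auto
  also have "m powr \<beta> = l powr \<beta> * (2 ^ I) powr - \<beta>"
    using l by (simp add: m_def powr_divide powr_minus_divide)
  finally show ?thesis by (simp add: mult_ac)
qed

text \<open>Summing over frequencies before averaging turns each direction into a multiple of (s - x
  \<bullet> w)^(-\<beta>), whose average is known to decay. The shift of time by
  \<open>r\<^sub>0 + 1\<close> costs a fixed factor \<open>E\<close>, since no frequency exceeds
  l.\<close>

lemma wave_packet_le:
  fixes r\<^sub>0 l \<beta> :: real
  defines "a \<equiv> (real DIM('a::euclidean_space) - 1) / 2"
  assumes l: "l > 0" and r0: "r\<^sub>0 \<ge> 0" and \<beta>: "\<beta> > a"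
  shows "\<exists>C>0. \<forall>n t I. \<forall>x::'a. 0 \<le> t \<longrightarrow> norm x \<le> r\<^sub>0 + t \<longrightarrow> r\<^sub>0 + 1 + t \<le> real n \<longrightarrow>
    wave_packet n l I \<beta> t x \<le> C * ((r\<^sub>0 + 1 + t) powr - a * (r\<^sub>0 + 1 + t - norm x) powr (a - \<beta>))"
proof -
  have a0: "a \<ge> 0" unfolding a_def by (simp add: Suc_le_eq)
  obtain C where C: "C > 0" "\<And>n s x. norm x \<le> s - 1 \<Longrightarrow> s \<le> real n \<Longrightarrow>
      dir_avg n (\<lambda>w. (s - x \<bullet> w) powr - \<beta>) \<le> C * (s powr - a * (s - norm (x::'a)) powr (a - \<beta>))"
    using dir_avg_powr_le[where 'a='a, of \<beta>] \<beta> unfolding a_def by auto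
  obtain K where K: "K > 0" "\<And>I y. y > 0 \<Longrightarrow>
      (\<Sum>i\<le>I. (l / 2 ^ i) powr \<beta> * exp (- (l / 2 ^ i * y))) \<le> K * y powr - \<beta>"
    using dyadic_exp_sum_le[of \<beta> l] \<beta> a0 l by force
  define E where "E = exp (l * (r\<^sub>0 + 1))"
  have E0: "E > 0" by (simp add: E_def)
  have "wave_packet n l I \<beta> t x \<le> E * K * C * ((r\<^sub>0 + 1 + t) powr - a * (r\<^sub>0 + 1 + t - norm x) powr (a - \<beta>))"
    if t: "0 \<le> t" "norm x \<le> r\<^sub>0 + t" "r\<^sub>0 + 1 + t \<le> real n" for n t I and x :: 'a
  proof -
    define s where "s = r\<^sub>0 + 1 + t"
    have "wave_packet n l I \<beta> t x
        = dir_avg n (\<lambda>w. \<Sum>i\<le>I. (l / 2 ^ i) powr \<beta> * (exp (- (l / 2 ^ i * t)) * exp (l / 2 ^ i * (x \<bullet> w))))"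
      unfolding wave_packet_def avg_exp_def dir_avg_sum dir_avg_cmult ..
    also have "\<dots> \<le> dir_avg n (\<lambda>w. (E * K) * (s - x \<bullet> w) powr - \<beta>)"
    proof (rule dir_avg_mono)
      fix w :: 'a assume w: "norm w = 1"
      have "x \<bullet> w \<le> norm x" using norm_cauchy_schwarz[of x w] w by simp
      then have y: "s - x \<bullet> w > 0" using t by (simp add: s_def)
      have "(\<Sum>i\<le>I. (l / 2 ^ i) powr \<beta> * (exp (- (l / 2 ^ i * t)) * exp (l / 2 ^ i * (x \<bullet> w))))
          \<le> (\<Sum>i\<le>I. E * ((l / 2 ^ i) powr \<beta> * exp (- (l / 2 ^ i * (s - x \<bullet> w)))))"
      proof (rule sum_mono)
        fix i
        have "l / 2 ^ i \<le> l" using l by (simp add: field_simps)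
        then have "l / 2 ^ i * (r\<^sub>0 + 1) \<le> l * (r\<^sub>0 + 1)" using r0 by (intro mult_right_mono) auto
        then have "exp (- (l / 2 ^ i * t)) * exp (l / 2 ^ i * (x \<bullet> w)) \<le> E * exp (- (l / 2 ^ i * (s - x \<bullet> w)))"
          unfolding E_def exp_add[symmetric] exp_le_cancel_iff s_def
          by (simp only: algebra_simps)
        then have "(l / 2 ^ i) powr \<beta> * (exp (- (l / 2 ^ i * t)) * exp (l / 2 ^ i * (x \<bullet> w)))
            \<le> (l / 2 ^ i) powr \<beta> * (E * exp (- (l / 2 ^ i * (s - x \<bullet> w))))"
          by (intro mult_left_mono) auto
        then show "(l / 2 ^ i) powr \<beta> * (exp (- (l / 2 ^ i * t)) * exp (l / 2 ^ i * (x \<bullet> w)))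
            \<le> E * ((l / 2 ^ i) powr \<beta> * exp (- (l / 2 ^ i * (s - x \<bullet> w))))"
          by (simp add: mult_ac)
      qed
      also have "\<dots> \<le> E * (K * (s - x \<bullet> w) powr - \<beta>)"
        unfolding sum_distrib_left[symmetric] using E0 by (intro mult_left_mono K y) auto
      finally show "(\<Sum>i\<le>I. (l / 2 ^ i) powr \<beta> * (exp (- (l / 2 ^ i * t)) * exp (l / 2 ^ i * (x \<bullet> w))))
          \<le> (E * K) * (s - x \<bullet> w) powr - \<beta>" by (simp add: mult.assoc)
    qed
    also have "\<dots> = (E * K) * dir_avg n (\<lambda>w. (s - x \<bullet> w) powr - \<beta>)" by (rule dir_avg_cmult)
    also have "\<dots> \<le> (E * K) * (C * (s powr - a * (s - norm x) powr (a - \<beta>)))"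
      using K E0 t by (intro mult_left_mono C) (auto simp: s_def)
    finally show ?thesis by (simp add: s_def mult.assoc)
  qed
  then show ?thesis using K E0 C(1) by (intro exI[of _ "E * K * C"]) auto
qed

lemma powr_comparable:
  fixes s R c :: real
  assumes "R > 0" "R / 2 \<le> s" "s \<le> 2 * R"
  shows "s powr c \<le> 2 powr \<bar>c\<bar> * R powr c"
proof (cases "c \<ge> 0")
  case True
  then have "s powr c \<le> (2 * R) powr c" using assms by (intro powr_mono2) auto
  then show ?thesis using True assms by (simp add: powr_mult)
next
  case False
  then have "s powr c \<le> (R / 2) powr c" using assms by (intro powr_mono2') auto
  also have "\<dots> = 2 powr \<bar>c\<bar> * R powr c"
  proof -
    have "\<bar>c\<bar> = - c" using False by simp
    then show ?thesis using assms by (simp only: powr_divide powr_minus_divide) simp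
  qed
  finally show ?thesis .
qed

text \<open>With \<open>\<beta> = a - 1/q\<close> the power of the distance to the light cone is exactly \<open>-1\<close>; this
  is the source of the logarithm in the critical case.\<close>

lemma wave_packet_cone_integral:
  fixes r\<^sub>0 l q :: real
  defines "a \<equiv> (real DIM('a::euclidean_space) - 1) / 2"
  defines "\<beta> \<equiv> a - 1 / q" and "q' \<equiv> q / (q - 1)"
  assumes l: "l > 0" and r0: "r\<^sub>0 \<ge> 0" and q: "q > 1"
  shows "\<exists>C>0. \<forall>n t I. r\<^sub>0 + 1 \<le> 2 ^ I \<longrightarrow> 2 ^ I / 2 \<le> t \<longrightarrow> t \<le> 2 ^ I \<longrightarrow> r\<^sub>0 + 1 + t \<le> real n \<longrightarrow>
    (LINT x:cball (0::'a) (r\<^sub>0 + t)|lebesgue.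
       wave_packet n l I (\<beta> + 1) t x powr q' * wave_packet n l I \<beta> t x powr (1 - q'))
      \<le> C * (1 + real I) * (2 ^ I) powr (2 * a - a * q' + \<beta> * (q' - 1))"
proof -
  have q': "q' > 1" using q by (simp add: q'_def field_simps)
  \<comment> \<open>The difference a - (\<beta> + 1) equals 1/q - 1 = -1/q', which is what the
    choice of \<beta> is made for.\<close>
  have a\<beta>: "(a - (\<beta> + 1)) * q' = - 1" using q by (simp add: \<beta>_def q'_def field_simps)
  have \<beta>1: "\<beta> + 1 > a" using q by (simp add: \<beta>_def)
  obtain C where C: "C > 0" "\<And>n t I x. 0 \<le> t \<Longrightarrow> norm (x::'a) \<le> r\<^sub>0 + t \<Longrightarrow> r\<^sub>0 + 1 + t \<le> real n \<Longrightarrow>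
    wave_packet n l I (\<beta> + 1) t x \<le> C * ((r\<^sub>0 + 1 + t) powr - a * (r\<^sub>0 + 1 + t - norm x) powr (a - (\<beta> + 1)))"
    using wave_packet_le[OF l r0, where 'a='a, of "\<beta> + 1"] \<beta>1 unfolding a_def by blast
  define M where "M = real DIM('a) * measure lebesgue (ball (0::'a) 1)"
  have M0: "M \<ge> 0" by (simp add: M_def)
  have a2: "2 * a = real (DIM('a) - 1)" unfolding a_def by (simp add: of_nat_diff Suc_le_eq)
  define c where "c = l powr \<beta> * exp (- (3 * l))"
  have c0: "c > 0" using l by (simp add: c_def)
  define e where "e = 2 * a - a * q'"
  define A where "A = C powr q' * c powr (1 - q')"
  have A0: "A > 0" using C(1) c0 by (simp add: A_def)
  define K where "K = A * (2 powr \<bar>e\<bar> * (M * 2)) + 1"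
  have K0: "K > 0" unfolding K_def using M0 A0 by (intro add_nonneg_pos) auto
  have "(LINT x:cball (0::'a) (r\<^sub>0 + t)|lebesgue.
       wave_packet n l I (\<beta> + 1) t x powr q' * wave_packet n l I \<beta> t x powr (1 - q'))
      \<le> K * (1 + real I) * (2 ^ I) powr (2 * a - a * q' + \<beta> * (q' - 1))"
    if I: "r\<^sub>0 + 1 \<le> 2 ^ I" and t: "2 ^ I / 2 \<le> t" "t \<le> 2 ^ I" and n: "r\<^sub>0 + 1 + t \<le> real n" for n t I
  proof -
    define R :: real where "R = 2 ^ I"
    have R1: "R \<ge> 1" by (simp add: R_def)
    define s where "s = r\<^sub>0 + 1 + t"
    have t0: "t \<ge> 0" using t R1 unfolding R_def[symmetric] by simp
    have s1: "s \<ge> 1" using t0 r0 by (simp add: s_def)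
    have sR: "R / 2 \<le> s" "s \<le> 2 * R" using t I r0 by (auto simp: s_def R_def)
    have n1: "n \<ge> 1" using s1 n by (simp add: s_def)
    have B: "r\<^sub>0 + t = s - 1" by (simp add: s_def)
    have pos: "wave_packet n l I b t x > 0" for b and x :: 'a by (rule wave_packet_pos[OF n1 l])
    then have pos': "wave_packet n l I b t x \<noteq> 0" for b and x :: 'a by (metis less_irrefl)
    define D where "D = A * (s powr (- (a * q')) * R powr (\<beta> * (q' - 1)))"
    have "(LINT x:cball (0::'a) (s - 1)|lebesgue.
       wave_packet n l I (\<beta> + 1) t x powr q' * wave_packet n l I \<beta> t x powr (1 - q'))
       \<le> (LINT x:cball (0::'a) (s - 1)|lebesgue. D * (s - norm x) powr - 1)"
    proof (rule set_integral_mono)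
      show "set_integrable lebesgue (cball (0::'a) (s - 1))
          (\<lambda>x. wave_packet n l I (\<beta> + 1) t x powr q' * wave_packet n l I \<beta> t x powr (1 - q'))"
        using pos' by (intro integrable_on_cball continuous_intros) auto
      show "set_integrable lebesgue (cball (0::'a) (s - 1)) (\<lambda>x. D * (s - norm x) powr - 1)"
        by (intro integrable_on_cball continuous_intros) auto
      fix x :: 'a assume x: "x \<in> cball 0 (s - 1)"
      have d1: "s - norm x \<ge> 1" using x by simp
      have "wave_packet n l I (\<beta> + 1) t x powr q' \<le> (C * (s powr - a * (s - norm x) powr (a - (\<beta> + 1)))) powr q'"
        using C(2)[of t x n I] t0 n x q' less_imp_le[OF pos[of "\<beta> + 1" x]]
        by (intro powr_mono2) (simp_all add: s_def)
      also have "\<dots> = C powr q' * (s powr (- (a * q')) * (s - norm x) powr - 1)"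
        using C(1) s1 d1 a\<beta> by (simp add: powr_mult powr_powr)
      finally have 1: "wave_packet n l I (\<beta> + 1) t x powr q' \<le> C powr q' * (s powr (- (a * q')) * (s - norm x) powr - 1)" .
      \<comment> \<open>The exponent 1 - q' is negative, so here the packet must be bounded from
        below; t being of order 2^I, its lower bound is uniform on the whole ball.\<close>
      have "c * R powr - \<beta> \<le> wave_packet n l I \<beta> t x"
        using wave_packet_ge[OF n1 l t0 t(2), of r\<^sub>0 x \<beta>] I x unfolding c_def R_def s_def by simp
      then have "wave_packet n l I \<beta> t x powr (1 - q') \<le> (c * R powr - \<beta>) powr (1 - q')"
        using c0 R1 q' by (intro powr_mono2') auto
      also have "\<dots> = c powr (1 - q') * R powr (\<beta> * (q' - 1))"
        using c0 R1 by (simp add: powr_mult powr_powr algebra_simps)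
      finally have 2: "wave_packet n l I \<beta> t x powr (1 - q') \<le> c powr (1 - q') * R powr (\<beta> * (q' - 1))" .
      have "wave_packet n l I (\<beta> + 1) t x powr q' * wave_packet n l I \<beta> t x powr (1 - q')
         \<le> (C powr q' * (s powr (- (a * q')) * (s - norm x) powr - 1)) * (c powr (1 - q') * R powr (\<beta> * (q' - 1)))"
        by (rule mult_mono[OF 1 2]) auto
      also have "\<dots> = D * (s - norm x) powr - 1"
        unfolding D_def A_def by (simp only: mult_ac)
      finally show "wave_packet n l I (\<beta> + 1) t x powr q' * wave_packet n l I \<beta> t x powr (1 - q')
         \<le> D * (s - norm x) powr - 1" .
    qed
    also have "\<dots> = D * (LINT x:cball (0::'a) (s - 1)|lebesgue. (s - norm x) powr - 1)"
      by (rule set_integral_mult_right)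
    also have "\<dots> \<le> D * (M * s powr (2 * a) * (2 * (1 + real I)))"
    proof (rule mult_left_mono)
      have "(LINT x:cball (0::'a) (s - 1)|lebesgue. (s - norm x) powr - 1)
          \<le> M * s ^ (DIM('a) - 1) * (\<Sum>k=1..nat \<lfloor>s\<rfloor>. real k powr - 1)"
        unfolding M_def by (rule cone_integral_le[OF s1]) simp
      also have "\<dots> \<le> M * s ^ (DIM('a) - 1) * (2 * (1 + real I))"
      proof (rule mult_left_mono)
        have f1: "nat \<lfloor>s\<rfloor> \<ge> 1" using s1 by (simp add: le_nat_iff)
        have "(\<Sum>k=1..nat \<lfloor>s\<rfloor>. real k powr - 1) \<le> 1 + ln (real (nat \<lfloor>s\<rfloor>))"
          by (rule sum_inverse_le[OF f1])
        also have "ln (real (nat \<lfloor>s\<rfloor>)) \<le> ln (2 * R)"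
          using f1 sR s1 by (subst ln_le_cancel_iff) (auto, linarith)
        also have "ln (2 * R) = (real I + 1) * ln 2"
          by (simp add: R_def ln_mult ln_realpow algebra_simps)
        also have "\<dots> \<le> (real I + 1) * 1"
          using ln_2_less_1 by (intro mult_left_mono) auto
        finally show "(\<Sum>k=1..nat \<lfloor>s\<rfloor>. real k powr - 1) \<le> 2 * (1 + real I)" by simp
      qed (use M0 s1 in auto)
      also have "s ^ (DIM('a) - 1) = s powr (2 * a)" using s1 unfolding a2 by (subst powr_realpow) auto
      finally show "(LINT x:cball (0::'a) (s - 1)|lebesgue. (s - norm x) powr - 1)
          \<le> M * s powr (2 * a) * (2 * (1 + real I))" .
    qed (use A0 in \<open>simp add: D_def\<close>)
    also have "\<dots> = A * (M * 2) * (1 + real I) * R powr (\<beta> * (q' - 1)) * s powr e"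
    proof -
      have "s powr e = s powr (2 * a) * s powr (- (a * q'))"
        unfolding e_def by (simp flip: powr_add)
      then show ?thesis unfolding D_def by (simp only: mult_ac)
    qed
    also have "\<dots> \<le> A * (M * 2) * (1 + real I) * R powr (\<beta> * (q' - 1)) * (2 powr \<bar>e\<bar> * R powr e)"
      using powr_comparable[of R s e] R1 sR A0 M0 by (intro mult_left_mono mult_nonneg_nonneg) auto
    also have "\<dots> = (A * (2 powr \<bar>e\<bar> * (M * 2))) * ((1 + real I) * R powr (e + \<beta> * (q' - 1)))"
      by (simp add: powr_add)
    also have "\<dots> \<le> K * ((1 + real I) * R powr (e + \<beta> * (q' - 1)))"
      unfolding K_def by (intro mult_right_mono) auto
    finally show ?thesis unfolding B e_def R_def by (simp only: mult.assoc)
  qed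
  then show ?thesis using K0 by blast
qed

section \<open>Square integrable functions\<close>

lemma borel_measurable_lebesgue_continuous:
  "continuous_on UNIV (h :: 'a::euclidean_space \<Rightarrow> 'b::euclidean_space) \<Longrightarrow> h \<in> borel_measurable lebesgue"
  by (rule measurable_completion) (simp add: borel_measurable_continuous_onI)

lemma in_L2_measurable: "in_L2 f \<Longrightarrow> f \<in> borel_measurable lebesgue"
  by (simp add: in_L2_def)

lemma in_L2_square_integrable: "in_L2 (f :: _ \<Rightarrow> real) \<Longrightarrow> integrable lebesgue (\<lambda>x. (f x)\<^sup>2)"
  by (simp add: in_L2_def)

lemma in_L2_add:
  assumes f: "in_L2 (f :: 'a::euclidean_space \<Rightarrow> real)" and g: "in_L2 g"
  shows "in_L2 (\<lambda>x. f x + g x)"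
proof -
  have [measurable]: "f \<in> borel_measurable lebesgue" "g \<in> borel_measurable lebesgue"
    using f g by (auto dest: in_L2_measurable)
  have "integrable lebesgue (\<lambda>x. (norm (f x + g x))\<^sup>2)"
  proof (rule Bochner_Integration.integrable_bound)
    show "integrable lebesgue (\<lambda>x. 2 * (f x)\<^sup>2 + 2 * (g x)\<^sup>2)"
      by (intro Bochner_Integration.integrable_add integrable_mult_right in_L2_square_integrable f g)
    have "(a + b)\<^sup>2 \<le> 2 * a\<^sup>2 + 2 * b\<^sup>2" for a b :: real
      using sum_squares_bound[of a b] by (simp add: power2_sum)
    then show "AE x in lebesgue. norm ((norm (f x + g x))\<^sup>2) \<le> norm (2 * (f x)\<^sup>2 + 2 * (g x)\<^sup>2)"
      by (auto intro!: always_eventually)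
  qed measurable
  then show ?thesis by (simp add: in_L2_def)
qed

lemma in_L2_cmult: "in_L2 (f :: 'a::euclidean_space \<Rightarrow> real) \<Longrightarrow> in_L2 (\<lambda>x. c * f x)"
  by (auto simp: in_L2_def power_mult_distrib)

lemma in_L2_diff: "in_L2 (f :: 'a::euclidean_space \<Rightarrow> real) \<Longrightarrow> in_L2 g \<Longrightarrow> in_L2 (\<lambda>x. f x - g x)"
  using in_L2_add[of f "\<lambda>x. (-1) * g x"] in_L2_cmult[of g "-1"] by simp

lemma L2_norm_nonneg: "L2_norm f \<ge> 0"
  by (simp add: L2_norm_def)

lemma L2_norm_square: "(L2_norm (f :: _ \<Rightarrow> real))\<^sup>2 = (LINT x|lebesgue. (f x)\<^sup>2)"
  by (simp add: L2_norm_def)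

lemma in_L2_mult_integrable:
  assumes f: "in_L2 (f :: 'a::euclidean_space \<Rightarrow> real)" and g: "in_L2 (g :: 'a \<Rightarrow> 'b::euclidean_space)"
  shows "integrable lebesgue (\<lambda>x. f x *\<^sub>R g x)"
proof (rule Bochner_Integration.integrable_bound)
  have [measurable]: "f \<in> borel_measurable lebesgue" "g \<in> borel_measurable lebesgue"
    using f g by (auto dest: in_L2_measurable)
  show "(\<lambda>x. f x *\<^sub>R g x) \<in> borel_measurable lebesgue" by measurable
  show "integrable lebesgue (\<lambda>x. (f x)\<^sup>2 + (norm (g x))\<^sup>2)"
    using f g by (auto simp: in_L2_def)
  have "\<bar>a\<bar> * norm b \<le> a\<^sup>2 + (norm b)\<^sup>2" for a and b :: 'b
  proof -
    have "0 \<le> \<bar>a\<bar> * norm b" by simp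
    then show ?thesis using sum_squares_bound[of "\<bar>a\<bar>" "norm b"] by (simp only: power2_abs mult.assoc)
  qed
  then show "AE x in lebesgue. norm (f x *\<^sub>R g x) \<le> norm ((f x)\<^sup>2 + (norm (g x))\<^sup>2)"
    by (auto intro!: always_eventually)
qed

lemma L2_Cauchy_Schwarz:
  assumes f: "in_L2 (f :: 'a::euclidean_space \<Rightarrow> real)" and g: "in_L2 g"
  shows "\<bar>LINT x|lebesgue. f x * g x\<bar> \<le> L2_norm f * L2_norm g"
proof -
  define A B c where "A = (LINT x|lebesgue. (f x)\<^sup>2)" and "B = (LINT x|lebesgue. (g x)\<^sup>2)"
    and "c = (LINT x|lebesgue. f x * g x)"
  have fg: "integrable lebesgue (\<lambda>x. f x * g x)" using in_L2_mult_integrable[OF f g] by simp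
  have q: "0 \<le> A * \<tau>\<^sup>2 - 2 * c * \<tau> + B" for \<tau>
  proof -
    have "0 \<le> (LINT x|lebesgue. (\<tau> * f x - g x)\<^sup>2)" by simp
    also have "(\<lambda>x. (\<tau> * f x - g x)\<^sup>2) = (\<lambda>x. (\<tau>\<^sup>2 * (f x)\<^sup>2 - (2 * \<tau>) * (f x * g x)) + (g x)\<^sup>2)"
      by (auto simp: power2_diff power_mult_distrib algebra_simps)
    also have "(LINT x|lebesgue. (\<tau>\<^sup>2 * (f x)\<^sup>2 - (2 * \<tau>) * (f x * g x)) + (g x)\<^sup>2)
        = ((LINT x|lebesgue. \<tau>\<^sup>2 * (f x)\<^sup>2) - (LINT x|lebesgue. (2 * \<tau>) * (f x * g x))) + (LINT x|lebesgue. (g x)\<^sup>2)"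
      using f g fg by (simp only: Bochner_Integration.integral_add Bochner_Integration.integral_diff
          Bochner_Integration.integrable_diff integrable_mult_right in_L2_square_integrable)
    also have "\<dots> = A * \<tau>\<^sup>2 - 2 * c * \<tau> + B"
      unfolding integral_mult_right_zero A_def[symmetric] B_def[symmetric] c_def[symmetric] by simp
    finally show ?thesis .
  qed
  have "c\<^sup>2 \<le> A * B"
  proof (cases "A = 0")
    case True
    have "c = 0"
    proof (rule ccontr)
      assume "c \<noteq> 0"
      then have "2 * c * ((B + 1) / (2 * c)) = B + 1" by simp
      then show False using q[of "(B + 1) / (2 * c)"] True by simp
    qed
    then show ?thesis using True by simp
  next
    case False
    then have "A > 0" by (simp add: A_def less_le)
    then have "A * (c / A)\<^sup>2 = c\<^sup>2 / A" "2 * c * (c / A) = 2 * (c\<^sup>2 / A)"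
      by (simp_all add: power2_eq_square)
    then have "c\<^sup>2 / A \<le> B" using q[of "c / A"] by linarith
    then show ?thesis using \<open>A > 0\<close> by (simp add: pos_divide_le_eq mult.commute)
  qed
  then have "c\<^sup>2 \<le> (L2_norm f * L2_norm g)\<^sup>2"
    by (simp add: A_def B_def power_mult_distrib L2_norm_square)
  then have "\<bar>c\<bar> \<le> \<bar>L2_norm f * L2_norm g\<bar>" by (simp only: abs_le_square_iff)
  then show ?thesis by (simp add: c_def L2_norm_nonneg abs_mult)
qed

lemma in_L2_continuous_compact:
  fixes h :: "'a::euclidean_space \<Rightarrow> 'b::euclidean_space"
  assumes "continuous_on UNIV h" "\<And>x. norm x > r \<Longrightarrow> h x = 0"
  shows "in_L2 h"
proof -
  have "set_integrable lebesgue (cball 0 r) (\<lambda>x. (norm (h x))\<^sup>2)"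
    by (intro integrable_on_cball continuous_intros continuous_on_subset[OF assms(1)]) auto
  moreover have "(\<lambda>x. indicat_real (cball 0 r) x *\<^sub>R (norm (h x))\<^sup>2) = (\<lambda>x. (norm (h x))\<^sup>2)"
    using assms(2) by (auto simp: indicator_def fun_eq_iff not_le)
  ultimately show ?thesis
    using assms(1) by (simp add: in_L2_def set_integrable_def borel_measurable_lebesgue_continuous)
qed

text \<open>The approximants need to match \<open>w\<close> on S in absolute value only. This fits
  differences of which one term vanishes on S, such as u(s) - u(t) outside the cone at the later
  time s.\<close>

lemma L2_limit_vanishes:
  assumes w: "in_L2 (w :: 'a::euclidean_space \<Rightarrow> real)" and S: "S \<in> sets lebesgue"
    and approx: "\<And>e. e > 0 \<Longrightarrow> \<exists>h. in_L2 h \<and> L2_norm h < e \<and> (AE x in lebesgue. x \<in> S \<longrightarrow> \<bar>h x\<bar> = \<bar>w x\<bar>)"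
  shows "AE x in lebesgue. x \<in> S \<longrightarrow> w x = 0"
proof -
  have [measurable]: "w \<in> borel_measurable lebesgue" "S \<in> sets lebesgue"
    using w S by (auto dest: in_L2_measurable)
  have int: "integrable lebesgue (\<lambda>x. indicat_real S x * (w x)\<^sup>2)"
    by (rule Bochner_Integration.integrable_bound[OF in_L2_square_integrable[OF w]])
      (measurable, auto simp: indicator_def)
  have "(LINT x|lebesgue. indicat_real S x * (w x)\<^sup>2) \<le> 0"
  proof (rule field_le_epsilon)
    fix e :: real assume "e > 0"
    then obtain h where h: "in_L2 h" "L2_norm h < sqrt e" and ae: "AE x in lebesgue. x \<in> S \<longrightarrow> \<bar>h x\<bar> = \<bar>w x\<bar>"
      using approx[of "sqrt e"] by auto
    have "(LINT x|lebesgue. indicat_real S x * (w x)\<^sup>2) \<le> (LINT x|lebesgue. (h x)\<^sup>2)"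
    proof (rule integral_mono_AE[OF int in_L2_square_integrable[OF h(1)]])
      show "AE x in lebesgue. indicat_real S x * (w x)\<^sup>2 \<le> (h x)\<^sup>2"
        using ae by eventually_elim (auto simp: indicator_def abs_eq_iff power2_eq_iff)
    qed
    also have "\<dots> = (L2_norm h)\<^sup>2" by (simp add: L2_norm_square)
    also have "\<dots> \<le> (sqrt e)\<^sup>2" using h(2) by (intro power_mono) (auto simp: L2_norm_nonneg)
    finally show "(LINT x|lebesgue. indicat_real S x * (w x)\<^sup>2) \<le> 0 + e" using \<open>e > 0\<close> by simp
  qed
  then have "(LINT x|lebesgue. indicat_real S x * (w x)\<^sup>2) = 0"
    by (intro antisym) (auto intro!: integral_nonneg_AE)
  then have "AE x in lebesgue. indicat_real S x * (w x)\<^sup>2 = 0"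
    using integral_nonneg_eq_0_iff_AE[OF int] by simp
  then show ?thesis by eventually_elim (auto simp: indicator_def)
qed

section \<open>Cut-offs and Green's formula\<close>

definition laplace :: "('a::euclidean_space \<Rightarrow> real) \<Rightarrow> 'a \<Rightarrow> real" where
  "laplace \<phi> x = (\<Sum>i\<in>Basis. pderiv_dir i (pderiv_dir i \<phi>) x)"

lemma frechet_derivative_local:
  assumes "C_infinity f" "open S" "x \<in> S" "\<And>y. y \<in> S \<Longrightarrow> g y = f y"
  shows "frechet_derivative g (at x) = frechet_derivative f (at x)"
proof (rule frechet_derivative_eqI)
  show "(g has_derivative frechet_derivative f (at x)) (at x)"
    by (rule has_derivative_transform_within_open[OF C_infinity_has_derivative[OF assms(1)] assms(2,3)])
      (simp add: assms(4))
qed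

lemma laplace_local:
  assumes "C_infinity f" "open S" "x \<in> S" "\<And>y. y \<in> S \<Longrightarrow> g y = f y"
  shows "laplace g x = laplace f x"
proof -
  have "pderiv_dir i (pderiv_dir i g) x = pderiv_dir i (pderiv_dir i f) x" if "i \<in> Basis" for i
    using frechet_derivative_local[OF C_infinity_pderiv[OF assms(1) that] assms(2,3), of "pderiv_dir i g"]
      frechet_derivative_local[OF assms(1,2) _ assms(4)] by simp
  then show ?thesis by (simp add: laplace_def)
qed

lemma continuous_on_laplace: "C_infinity \<phi> \<Longrightarrow> continuous_on S (laplace \<phi>)"
  unfolding laplace_def[abs_def]
  by (intro continuous_on_sum C_infinity_continuous C_infinity_pderiv) auto

lemma continuous_on_grad: "C_infinity \<phi> \<Longrightarrow> continuous_on S (grad \<phi>)"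
  unfolding grad_def[abs_def]
  by (intro continuous_on_sum continuous_on_scaleR C_infinity_continuous C_infinity_pderiv continuous_on_const) auto

lemma C_c_infinityI:
  fixes \<phi> :: "'a::euclidean_space \<Rightarrow> real"
  assumes "C_infinity \<phi>" "\<And>x. norm x > r \<Longrightarrow> \<phi> x = 0"
  shows "C_c_infinity \<phi>"
proof -
  have "{x. \<phi> x \<noteq> 0} \<subseteq> cball 0 r" using assms(2) by (auto simp: not_less[symmetric])
  then have "supp \<phi> \<subseteq> cball 0 r" unfolding supp_def by (intro closure_minimal) auto
  then have "compact (supp \<phi>)"
    by (metis bounded_subset bounded_cball closed_closure compact_eq_bounded_closed supp_def)
  then show ?thesis using assms(1) by (simp add: C_c_infinity_def)
qed

lemma pderiv_outside:
  fixes \<phi> :: "'a::euclidean_space \<Rightarrow> real"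
  assumes "\<And>x. norm x > r \<Longrightarrow> \<phi> x = 0" "norm x > r"
  shows "frechet_derivative \<phi> (at x) i = 0"
proof -
  have "open {x::'a. norm x > r}" by (intro open_Collect_less continuous_intros)
  then have "frechet_derivative \<phi> (at x) = frechet_derivative (\<lambda>x::'a. 0::real) (at x)"
    using assms by (intro frechet_derivative_local[of _ "{x. norm x > r}"]) auto
  then show ?thesis by simp
qed

text \<open>The definition of the weak gradient admits scalar test functions. It is applied to every
  partial derivative of \<phi>, the matching component is kept, and the sum of these components is
  the Laplacian.\<close>

lemma weak_grad_green:
  fixes \<phi> :: "'a::euclidean_space \<Rightarrow> real"
  assumes u: "in_H1 f" and \<phi>: "C_infinity \<phi>" "\<And>x. norm x > r \<Longrightarrow> \<phi> x = 0"
  shows "integrable lebesgue (\<lambda>x. weak_grad f x \<bullet> grad \<phi> x)"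
    "(LINT x|lebesgue. weak_grad f x \<bullet> grad \<phi> x) = - (LINT x|lebesgue. f x * laplace \<phi> x)"
proof -
  define w where "w = weak_grad f"
  have "has_L2_weak_grad f w"
    unfolding w_def weak_grad_def using u someI_ex[of "has_L2_weak_grad f"] by (auto simp: in_H1_def)
  then have w: "in_L2 w" and ibp: "\<And>\<phi>. C_c_infinity \<phi> \<Longrightarrow>
      (LINT x|lebesgue. f x *\<^sub>R grad \<phi> x) = - (LINT x|lebesgue. \<phi> x *\<^sub>R w x)"
    by (auto simp: has_L2_weak_grad_def)
  have f: "in_L2 f" using u by (simp add: in_H1_def)
  have out: "pderiv_dir i \<phi> x = 0" if "norm x > r" for i x
    by (rule pderiv_outside[OF \<phi>(2) that])
  have d: "C_infinity (pderiv_dir i \<phi>)" if "i \<in> Basis" for i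
    by (rule C_infinity_pderiv[OF \<phi>(1) that])
  have int1: "integrable lebesgue (\<lambda>x. pderiv_dir i \<phi> x *\<^sub>R w x)" if i: "i \<in> Basis" for i
    by (intro in_L2_mult_integrable w in_L2_continuous_compact[of _ r] C_infinity_continuous d i out)
  then have int1': "integrable lebesgue (\<lambda>x. pderiv_dir i \<phi> x * (w x \<bullet> i))" if i: "i \<in> Basis" for i
    using integrable_inner_left[of i lebesgue "\<lambda>x. pderiv_dir i \<phi> x *\<^sub>R w x"] i by simp
  have int2: "integrable lebesgue (\<lambda>x. f x *\<^sub>R grad (pderiv_dir i \<phi>) x)" if i: "i \<in> Basis" for i
  proof (intro in_L2_mult_integrable f in_L2_continuous_compact[of _ r] continuous_on_grad d i)
    fix x :: 'a assume "norm x > r"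
    then show "grad (pderiv_dir i \<phi>) x = 0"
      unfolding grad_def by (simp add: pderiv_outside[of r "pderiv_dir i \<phi>", OF out])
  qed
  have gi: "grad h x \<bullet> i = pderiv_dir i h x" if "i \<in> Basis" for i h and x :: 'a
    using that by (simp add: grad_def inner_sum_left inner_Basis if_distrib cong: if_cong)
  have int3: "integrable lebesgue (\<lambda>x. f x * pderiv_dir i (pderiv_dir i \<phi>) x)" if i: "i \<in> Basis" for i
    using integrable_inner_left[of i lebesgue "\<lambda>x. f x *\<^sub>R grad (pderiv_dir i \<phi>) x"] int2[OF i] gi[OF i] by simp
  have main: "(LINT x|lebesgue. f x * pderiv_dir i (pderiv_dir i \<phi>) x) = - (LINT x|lebesgue. pderiv_dir i \<phi> x * (w x \<bullet> i))"
    if i: "i \<in> Basis" for i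
  proof -
    have "(LINT x|lebesgue. f x * pderiv_dir i (pderiv_dir i \<phi>) x) = (LINT x|lebesgue. (f x *\<^sub>R grad (pderiv_dir i \<phi>) x) \<bullet> i)"
      using gi[OF i] by simp
    also have "\<dots> = (LINT x|lebesgue. f x *\<^sub>R grad (pderiv_dir i \<phi>) x) \<bullet> i"
      by (rule integral_inner_left) (use int2[OF i] in auto)
    also have "\<dots> = - ((LINT x|lebesgue. pderiv_dir i \<phi> x *\<^sub>R w x) \<bullet> i)"
      using ibp[OF C_c_infinityI[OF d[OF i] out]] by simp
    also have "(LINT x|lebesgue. pderiv_dir i \<phi> x *\<^sub>R w x) \<bullet> i = (LINT x|lebesgue. (pderiv_dir i \<phi> x *\<^sub>R w x) \<bullet> i)"
      by (rule integral_inner_left[symmetric]) (use int1[OF i] in auto)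
    finally show ?thesis by simp
  qed
  have e: "weak_grad f x \<bullet> grad \<phi> x = (\<Sum>i\<in>Basis. pderiv_dir i \<phi> x * (w x \<bullet> i))" for x
    by (simp add: w_def grad_def inner_sum_right)
  show "integrable lebesgue (\<lambda>x. weak_grad f x \<bullet> grad \<phi> x)"
    unfolding e by (intro Bochner_Integration.integrable_sum int1')
  have "(LINT x|lebesgue. weak_grad f x \<bullet> grad \<phi> x) = (\<Sum>i\<in>Basis. LINT x|lebesgue. pderiv_dir i \<phi> x * (w x \<bullet> i))"
    unfolding e by (intro Bochner_Integration.integral_sum int1')
  also have "\<dots> = - (\<Sum>i\<in>Basis. LINT x|lebesgue. f x * pderiv_dir i (pderiv_dir i \<phi>) x)"
    by (simp add: main sum_negf)
  also have "(\<Sum>i\<in>Basis. LINT x|lebesgue. f x * pderiv_dir i (pderiv_dir i \<phi>) x)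
      = (LINT x|lebesgue. f x * laplace \<phi> x)"
    unfolding laplace_def sum_distrib_left by (intro Bochner_Integration.integral_sum[symmetric] int3)
  finally show "(LINT x|lebesgue. weak_grad f x \<bullet> grad \<phi> x) = - (LINT x|lebesgue. f x * laplace \<phi> x)" .
qed

text \<open>Composition with x \<bullet> x avoids the singularity of the norm at the origin. The
  transition takes place for |x|^2 between \<rho>^2 and \<rho>^2 + 1, hence inside radius \<rho> + 1
  when \<rho> \<ge> 0.\<close>

definition cutoff :: "real \<Rightarrow> 'a::euclidean_space \<Rightarrow> real" where
  "cutoff \<rho> x = smooth_step (x \<bullet> x - \<rho>\<^sup>2)"

lemma cutoff_C_infinity: "C_infinity (cutoff \<rho> :: 'a::euclidean_space \<Rightarrow> real)"
proof -
  have "C_infinity (\<lambda>x::'a. (\<Sum>i\<in>Basis. (x \<bullet> i) * (x \<bullet> i)) + (- \<rho>\<^sup>2))"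
    by (intro C_infinity_add C_infinity_sum C_infinity_mult C_infinity_linear bounded_linear_inner_left C_infinity_const)
  also have "(\<lambda>x::'a. (\<Sum>i\<in>Basis. (x \<bullet> i) * (x \<bullet> i)) + (- \<rho>\<^sup>2)) = (\<lambda>x. x \<bullet> x - \<rho>\<^sup>2)"
    by (rule ext) (subst euclidean_inner, simp)
  finally show ?thesis
    unfolding cutoff_def[abs_def] by (rule C_infinity_compose[OF smooth_step_C_infinity])
qed

lemma cutoff_eq_1: "norm x \<le> \<rho> \<Longrightarrow> cutoff \<rho> x = 1"
  unfolding cutoff_def
  using power_mono[of "norm x" \<rho> 2] by (intro smooth_step_eq_1) (simp add: dot_square_norm)

lemma cutoff_eq_0: "\<rho> \<ge> 0 \<Longrightarrow> norm x > \<rho> + 1 \<Longrightarrow> cutoff \<rho> x = 0"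
proof -
  assume \<rho>: "\<rho> \<ge> 0" and x: "norm x > \<rho> + 1"
  have "(\<rho> + 1)\<^sup>2 \<le> (norm x)\<^sup>2" using \<rho> x by (intro power_mono) auto
  then show ?thesis
    unfolding cutoff_def using \<rho> by (intro smooth_step_eq_0) (simp add: dot_square_norm power2_sum)
qed

section \<open>Essential support\<close>

text \<open>Open sets on which u vanishes almost everywhere cover the exterior of the cone. By
  Lindelof countably many of them do, so the exceptional sets can be united, first in time and then
  in space at each good time.\<close>

lemma ess_supp_vanish_AE:
  fixes u :: "real \<Rightarrow> 'a::euclidean_space \<Rightarrow> real"
  assumes "ess_supp I u \<subseteq> {(x, t). norm x \<le> r + t}"
  shows "AE s in lebesgue. s \<in> I \<longrightarrow> (AE y in lebesgue. norm y > r + s \<longrightarrow> u s y = 0)"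
proof -
  define P where "P U \<longleftrightarrow> (AE s in lebesgue. s \<in> I \<longrightarrow> (AE y in lebesgue. (y, s) \<in> U \<longrightarrow> u s y = 0))"
    for U :: "('a \<times> real) set"
  define F where "F = {U. open U \<and> P U}"
  have cover: "(x, t) \<in> \<Union>F" if "t \<in> I" "norm x > r + t" for x t
  proof -
    have "(x, t) \<notin> ess_supp I u" using assms that by auto
    then show ?thesis using that unfolding ess_supp_def F_def P_def by auto
  qed
  obtain F' where F': "F' \<subseteq> F" "countable F'" "\<Union>F' = \<Union>F"
    using Lindelof[of F] unfolding F_def by auto
  have "AE s in lebesgue. \<forall>U\<in>F'. s \<in> I \<longrightarrow> (AE y in lebesgue. (y, s) \<in> U \<longrightarrow> u s y = 0)"
    using F'(1) by (intro AE_ball_countable' F'(2)) (auto simp: F_def P_def)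
  then show ?thesis
  proof eventually_elim
    case (elim s)
    show ?case
    proof
      assume s: "s \<in> I"
      have "AE y in lebesgue. \<forall>U\<in>F'. (y, s) \<in> U \<longrightarrow> u s y = 0"
        using elim s by (intro AE_ball_countable' F'(2)) auto
      then show "AE y in lebesgue. norm y > r + s \<longrightarrow> u s y = 0"
      proof eventually_elim
        case (elim y)
        show ?case
        proof
          assume "norm y > r + s"
          then have "(y, s) \<in> \<Union>F'" using cover[OF s] F'(3) by simp
          then show "u s y = 0" using elim by auto
        qed
      qed
    qed
  qed
qed

section \<open>Integrals of a weak solution against exponential waves\<close>

text \<open>Measurability in time is the issue. Pairing with a bounded \<open>h\<close> is Lipschitz
  on L^1, so the pairing of F is an almost everywhere limit of pairings of simple functions, which
  take finitely many values.\<close>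

lemma L1_L1_pairing:
  fixes F :: "real \<Rightarrow> 'a::euclidean_space \<Rightarrow> real" and h :: "'a \<Rightarrow> real"
  assumes F: "L1_L1 J F" and J: "J \<in> sets lebesgue"
    and h: "continuous_on UNIV h" and B: "\<And>x. \<bar>h x\<bar> \<le> B"
  shows "set_integrable lebesgue J (\<lambda>t. LINT x|lebesgue. F t x * h x)"
proof -
  have [measurable]: "h \<in> borel_measurable lebesgue"
    by (rule borel_measurable_lebesgue_continuous[OF h])
  have int: "integrable lebesgue (\<lambda>x. w x * h x)" if "integrable lebesgue w" for w
  proof (rule Bochner_Integration.integrable_bound)
    show "integrable lebesgue (\<lambda>x. B * w x)" using that by simp
    show "(\<lambda>x. w x * h x) \<in> borel_measurable lebesgue"
      using borel_measurable_integrable[OF that] by measurable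
    show "AE x in lebesgue. norm (w x * h x) \<le> norm (B * w x)"
    proof (rule AE_I2)
      fix x
      have "\<bar>h x\<bar> \<le> \<bar>B\<bar>" using B[of x] by simp
      then have "\<bar>w x\<bar> * \<bar>h x\<bar> \<le> \<bar>w x\<bar> * \<bar>B\<bar>" by (rule mult_left_mono) simp
      then show "norm (w x * h x) \<le> norm (B * w x)" by (simp add: abs_mult mult.commute)
    qed
  qed
  have le: "\<bar>LINT x|lebesgue. w x * h x\<bar> \<le> \<bar>B\<bar> * (LINT x|lebesgue. \<bar>w x\<bar>)" if w: "integrable lebesgue w" for w
  proof -
    have "\<bar>LINT x|lebesgue. w x * h x\<bar> \<le> (LINT x|lebesgue. \<bar>w x * h x\<bar>)"
      by (rule integral_abs_bound)
    also have "\<dots> \<le> (LINT x|lebesgue. \<bar>B\<bar> * \<bar>w x\<bar>)"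
    proof (rule integral_mono)
      show "integrable lebesgue (\<lambda>x. \<bar>w x * h x\<bar>)" using int[OF w] by (rule integrable_abs)
      show "integrable lebesgue (\<lambda>x. \<bar>B\<bar> * \<bar>w x\<bar>)" using w by (intro integrable_mult_right integrable_abs)
      fix x
      have "\<bar>h x\<bar> \<le> \<bar>B\<bar>" using B[of x] by simp
      then show "\<bar>w x * h x\<bar> \<le> \<bar>B\<bar> * \<bar>w x\<bar>"
        unfolding abs_mult using mult_right_mono[of "\<bar>h x\<bar>" "\<bar>B\<bar>" "\<bar>w x\<bar>"] by (simp add: mult.commute)
    qed
    also have "\<dots> = \<bar>B\<bar> * (LINT x|lebesgue. \<bar>w x\<bar>)" by simp
    finally show ?thesis .
  qed
  have ae_int: "AE t in lebesgue. t \<in> J \<longrightarrow> integrable lebesgue (F t)"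
    and int_norm: "set_integrable lebesgue J (\<lambda>t. LINT x|lebesgue. \<bar>F t x\<bar>)"
    using F by (auto simp: L1_L1_def)
  obtain s where s: "\<And>n. L1_simple (s n)"
    and lim: "AE t in lebesgue. t \<in> J \<longrightarrow> (\<lambda>n. LINT x|lebesgue. \<bar>s n t x - F t x\<bar>) \<longlonglongrightarrow> 0"
    using F unfolding L1_L1_def L1_strongly_measurable_def by blast
  define H where "H n t = indicat_real J t * (LINT x|lebesgue. s n t x * h x)" for n t
  define Y where "Y t = indicat_real J t * (LINT x|lebesgue. F t x * h x)" for t
  have s_int: "integrable lebesgue (s n t)" for n t
    using s[of n] by (auto simp: L1_simple_def)
  have H_meas: "H n \<in> borel_measurable lebesgue" for n
  proof -
    have "simple_function lebesgue (s n)"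
      unfolding simple_function_def
    proof (intro conjI ballI)
      show "finite (s n ` space lebesgue)" using s[of n] by (simp add: L1_simple_def)
      fix w assume "w \<in> s n ` space lebesgue"
      then have "{t. s n t = w} \<in> sets lebesgue" using s[of n] by (auto simp: L1_simple_def)
      then show "s n -` {w} \<inter> space lebesgue \<in> sets lebesgue" by (simp add: vimage_def)
    qed
    then have "simple_function lebesgue ((\<lambda>w. LINT x|lebesgue. w x * h x) \<circ> s n)"
      by (rule simple_function_compose)
    then have "(\<lambda>t. LINT x|lebesgue. s n t x * h x) \<in> borel_measurable lebesgue"
      by (simp add: borel_measurable_simple_function o_def)
    then show ?thesis unfolding H_def[abs_def] using J by measurable
  qed
  have conv: "AE t in lebesgue. (\<lambda>n. H n t) \<longlonglongrightarrow> Y t"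
    using ae_int lim
  proof eventually_elim
    case (elim t)
    show ?case
    proof (cases "t \<in> J")
      case True
      have l0: "(\<lambda>n. \<bar>B\<bar> * (LINT x|lebesgue. \<bar>s n t x - F t x\<bar>)) \<longlonglongrightarrow> 0"
        using tendsto_mult_right_zero[of "\<lambda>n. LINT x|lebesgue. \<bar>s n t x - F t x\<bar>" sequentially "\<bar>B\<bar>"] elim True by simp
      have "(\<lambda>n. H n t - Y t) \<longlonglongrightarrow> 0"
      proof (rule Lim_null_comparison[OF always_eventually[OF allI] l0])
        fix n
        have iF: "integrable lebesgue (F t)" using elim True by simp
        have "H n t - Y t = (LINT x|lebesgue. s n t x * h x) - (LINT x|lebesgue. F t x * h x)"
          using True by (simp add: H_def Y_def)
        also have "\<dots> = (LINT x|lebesgue. s n t x * h x - F t x * h x)"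
          by (rule Bochner_Integration.integral_diff[symmetric]) (intro int s_int iF)+
        also have "\<dots> = (LINT x|lebesgue. (s n t x - F t x) * h x)"
          by (simp add: left_diff_distrib)
        finally have e: "H n t - Y t = (LINT x|lebesgue. (s n t x - F t x) * h x)" .
        show "norm (H n t - Y t) \<le> \<bar>B\<bar> * (LINT x|lebesgue. \<bar>s n t x - F t x\<bar>)"
          unfolding e real_norm_def
          by (rule le) (intro Bochner_Integration.integrable_diff s_int iF)
      qed
      then show ?thesis by (simp add: LIM_zero_iff)
    qed (simp add: H_def Y_def)
  qed
  have Y_meas: "Y \<in> borel_measurable lebesgue"
  proof (rule borel_measurable_AE)
    show "(\<lambda>t. lim (\<lambda>n. H n t)) \<in> borel_measurable lebesgue"
      using H_meas by measurable
    show "AE t in lebesgue. lim (\<lambda>n. H n t) = Y t"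
      using conv by eventually_elim (rule limI)
  qed
  have "integrable lebesgue Y"
  proof (rule Bochner_Integration.integrable_bound[OF _ Y_meas])
    show "integrable lebesgue (\<lambda>t. \<bar>B\<bar> * (indicat_real J t *\<^sub>R (LINT x|lebesgue. \<bar>F t x\<bar>)))"
      using int_norm unfolding set_integrable_def by (rule integrable_mult_right)
    show "AE t in lebesgue. norm (Y t) \<le> norm (\<bar>B\<bar> * (indicat_real J t *\<^sub>R (LINT x|lebesgue. \<bar>F t x\<bar>)))"
      using ae_int
    proof eventually_elim
      case (elim t)
      have "(LINT x|lebesgue. \<bar>F t x\<bar>) \<ge> 0" by simp
      then show ?case using le[of "F t"] elim by (auto simp: Y_def indicator_def abs_mult)
    qed
  qed
  then show ?thesis by (simp add: Y_def[abs_def] set_integrable_def)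
qed

section \<open>Solutions supported in the light cone\<close>

locale cone_solution =
  fixes G :: "real \<Rightarrow> real \<Rightarrow> real" and \<epsilon> r\<^sub>0 :: real and f g :: "'a::euclidean_space \<Rightarrow> real"
    and T :: ereal and u v :: "real \<Rightarrow> 'a \<Rightarrow> real"
  assumes r0: "r\<^sub>0 \<ge> 0"
    and G_cont: "continuous_on UNIV (\<lambda>z :: real \<times> real. G (fst z) (snd z))"
    and G_0: "G 0 0 = 0"
    and G_nonneg: "G s \<sigma> \<ge> 0"
    and f_cont: "continuous_on UNIV f" and f_out: "norm x > r\<^sub>0 \<Longrightarrow> f x = 0"
    and g_cont: "continuous_on UNIV g" and g_out: "norm x > r\<^sub>0 \<Longrightarrow> g x = 0"
    and T_pos: "0 < T"
    and u_H1: "cont_H1 {t. 0 \<le> t \<and> ereal t < T} u"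
    and uv_C1: "C1_L2 {t. 0 \<le> t \<and> ereal t < T} u v"
    and G_L1: "L1_L1 {t. 0 < t \<and> ereal t < T} (\<lambda>t x. G (u t x) (v t x))"
    and u_0: "AE x in lebesgue. u 0 x = \<epsilon> * f x"
    and v_0: "AE x in lebesgue. v 0 x = \<epsilon> * g x"
    and weak: "test_function T \<Psi> \<Longrightarrow>
          \<epsilon> * (LINT x|lebesgue. g x * \<Psi> (x, 0)) +
          (LINT t:{t. 0 < t \<and> ereal t < T}|lebesgue. LINT x|lebesgue. G (u t x) (v t x) * \<Psi> (x, t)) =
          (LINT t:{t. 0 < t \<and> ereal t < T}|lebesgue. LINT x|lebesgue.
             - v t x * deriv (\<lambda>s. \<Psi> (x, s)) t +
             weak_grad (u t) x \<bullet> grad (\<lambda>y. \<Psi> (y, t)) x)"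
    and cone: "ess_supp {t. 0 \<le> t \<and> ereal t < T} u \<subseteq> {(x, t). norm x \<le> r\<^sub>0 + t}"
begin

abbreviation "I \<equiv> {t. 0 \<le> t \<and> ereal t < T}"
abbreviation "J \<equiv> {t. 0 < t \<and> ereal t < T}"

definition Upair :: "('a \<Rightarrow> real) \<Rightarrow> real \<Rightarrow> real" where
  "Upair \<phi> t = (LINT x|lebesgue. u t x * \<phi> x)"

definition Vpair :: "('a \<Rightarrow> real) \<Rightarrow> real \<Rightarrow> real" where
  "Vpair \<phi> t = (LINT x|lebesgue. v t x * \<phi> x)"

definition Gpair :: "('a \<Rightarrow> real) \<Rightarrow> real \<Rightarrow> real" where
  "Gpair \<phi> t = (LINT x|lebesgue. G (u t x) (v t x) * \<phi> x)"

lemma u_L2: "t \<in> I \<Longrightarrow> in_L2 (u t)" and v_L2: "t \<in> I \<Longrightarrow> in_L2 (v t)"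
  using uv_C1 by (auto simp: C1_L2_def cont_L2_def)

lemma G_measurable: "t \<in> I \<Longrightarrow> (\<lambda>x. G (u t x) (v t x)) \<in> borel_measurable lebesgue"
  using borel_measurable_continuous_Pair[OF in_L2_measurable[OF u_L2] in_L2_measurable[OF v_L2] G_cont] by blast

lemma u_continuous: "t \<in> I \<Longrightarrow> ((\<lambda>s. L2_norm (\<lambda>x. u s x - u t x)) \<longlongrightarrow> 0) (at t within I)"
proof -
  assume t: "t \<in> I"
  have H: "((\<lambda>s. H1_norm (\<lambda>x. u s x - u t x)) \<longlongrightarrow> 0) (at t within I)"
    using u_H1 t unfolding cont_H1_def by blast
  show ?thesis
  proof (rule Lim_null_comparison[OF always_eventually[OF allI] H])
    fix s
    have "L2_norm (\<lambda>x. u s x - u t x) = sqrt ((L2_norm (\<lambda>x. u s x - u t x))\<^sup>2)"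
      by (simp add: L2_norm_nonneg)
    also have "\<dots> \<le> H1_norm (\<lambda>x. u s x - u t x)"
      unfolding H1_norm_def by (rule real_sqrt_le_mono) simp
    finally show "norm (L2_norm (\<lambda>x. u s x - u t x)) \<le> H1_norm (\<lambda>x. u s x - u t x)"
      by (simp add: L2_norm_nonneg)
  qed
qed

text \<open>Every right neighbourhood of t in the time interval has positive measure, so a condition
  valid near t and one valid almost everywhere can be met at a common later time. The support
  condition is of the second kind, continuity of u of the first.\<close>

lemma frequently_later:
  assumes t: "t \<in> I" and P: "\<forall>\<^sub>F s in at t within I. P s" and d: "d > 0"
    and ae: "AE s in lebesgue. Q s"
  shows "\<exists>s. s \<in> I \<and> t < s \<and> s < t + d \<and> P s \<and> Q s"
proof -
  obtain T1 where T1: "ereal t < ereal T1" "ereal T1 < T"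
    using ereal_dense2[of "ereal t" T] t by auto
  obtain e where e: "e > 0" "\<And>s. s \<in> I \<Longrightarrow> s \<noteq> t \<Longrightarrow> dist s t < e \<Longrightarrow> P s"
    using P unfolding eventually_at by blast
  define m where "m = min (min T1 (t + d)) (t + e)"
  have m: "t < m" using T1 d e by (auto simp: m_def)
  have "\<exists>s. s \<in> {t<..<m} \<and> Q s"
  proof (rule ccontr)
    assume "\<not> ?thesis"
    then have "AE s in lebesgue. s \<notin> {t<..<m}" using ae by (rule_tac AE_mp[OF ae]) (auto intro!: AE_I2)
    then have "{t<..<m} \<in> null_sets lebesgue"
      using AE_iff_null_sets[of "{t<..<m}" lebesgue] by simp
    then have "emeasure lebesgue {t<..<m} = 0" by auto
    then show False using m by simp
  qed
  then obtain s where s: "t < s" "s < m" "Q s" by auto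
  have "s < T1" using s by (simp add: m_def)
  then have sT: "ereal s < T" using T1(2) by (meson ereal_less_eq(3) le_less_trans less_imp_le)
  have "s \<in> I" using s t sT by auto
  moreover have "dist s t < e" using s by (auto simp: dist_real_def m_def)
  ultimately show ?thesis using s e(2)[of s] by (auto simp: m_def)
qed

lemma far_set: "{x::'a. norm x > c} \<in> sets lebesgue"
proof -
  have "open {x::'a. norm x > c}" by (intro open_Collect_less continuous_intros)
  then show ?thesis by auto
qed

lemma AE_far_limit:
  fixes w :: "'a \<Rightarrow> real"
  assumes "\<And>d. d > 0 \<Longrightarrow> AE x in lebesgue. norm x > c + d \<longrightarrow> w x = 0"
  shows "AE x in lebesgue. norm x > c \<longrightarrow> w x = 0"
proof -
  have "AE x in lebesgue. \<forall>m::nat. norm x > c + inverse (real (Suc m)) \<longrightarrow> w x = 0"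
    unfolding AE_all_countable using assms by auto
  then show ?thesis
  proof eventually_elim
    case (elim x)
    show ?case
    proof
      assume "norm x > c"
      then obtain m where "inverse (real (Suc m)) < norm x - c"
        using reals_Archimedean[of "norm x - c"] by auto
      then show "w x = 0" using elim[rule_format, of m] by simp
    qed
  qed
qed

text \<open>The support condition gives vanishing at almost every time. Continuity in L^2 extends it
  to every time by approaching t from later times s; the loss s - t < d in the radius disappears as
  d tends to 0.\<close>

lemma u_vanish: "t \<in> I \<Longrightarrow> AE x in lebesgue. norm x > r\<^sub>0 + t \<longrightarrow> u t x = 0"
proof (rule AE_far_limit)
  fix d :: real assume t: "t \<in> I" and d: "d > 0"
  have "AE x in lebesgue. x \<in> {x. norm x > r\<^sub>0 + t + d} \<longrightarrow> u t x = 0"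
  proof (rule L2_limit_vanishes[OF u_L2[OF t] far_set])
    fix e :: real assume "e > 0"
    then have ev: "\<forall>\<^sub>F s in at t within I. L2_norm (\<lambda>x. u s x - u t x) < e"
      using order_tendstoD(2)[OF u_continuous[OF t]] by simp
    obtain s where s: "s \<in> I" "t < s" "s < t + d" "L2_norm (\<lambda>x. u s x - u t x) < e"
      and ae: "AE y in lebesgue. norm y > r\<^sub>0 + s \<longrightarrow> u s y = 0"
      using frequently_later[OF t ev d ess_supp_vanish_AE[OF cone]] by blast
    show "\<exists>h. in_L2 h \<and> L2_norm h < e \<and> (AE x in lebesgue. x \<in> {x. norm x > r\<^sub>0 + t + d} \<longrightarrow> \<bar>h x\<bar> = \<bar>u t x\<bar>)"
    proof (intro exI conjI)
      show "in_L2 (\<lambda>x. u s x - u t x)" by (rule in_L2_diff[OF u_L2[OF s(1)] u_L2[OF t]])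
      show "L2_norm (\<lambda>x. u s x - u t x) < e" by (rule s(4))
      show "AE x in lebesgue. x \<in> {x. norm x > r\<^sub>0 + t + d} \<longrightarrow> \<bar>u s x - u t x\<bar> = \<bar>u t x\<bar>"
        using ae by eventually_elim (use s in auto)
    qed
  qed
  then show "AE x in lebesgue. norm x > r\<^sub>0 + t + d \<longrightarrow> u t x = 0" by simp
qed

text \<open>Both terms of a forward difference quotient vanish outside the larger radius, and v is
  the L^2 limit of these quotients.\<close>

lemma v_vanish: "t \<in> I \<Longrightarrow> AE x in lebesgue. norm x > r\<^sub>0 + t \<longrightarrow> v t x = 0"
proof (rule AE_far_limit)
  fix d :: real assume t: "t \<in> I" and d: "d > 0"
  have "AE x in lebesgue. x \<in> {x. norm x > r\<^sub>0 + t + d} \<longrightarrow> v t x = 0"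
  proof (rule L2_limit_vanishes[OF v_L2[OF t] far_set])
    fix e :: real assume e: "e > 0"
    have "((\<lambda>s. L2_norm (\<lambda>x. (u s x - u t x) / (s - t) - v t x)) \<longlongrightarrow> 0) (at t within I)"
      using uv_C1 t unfolding C1_L2_def by blast
    then have ev: "\<forall>\<^sub>F s in at t within I. L2_norm (\<lambda>x. (u s x - u t x) / (s - t) - v t x) < e"
      using order_tendstoD(2) e by blast
    obtain s where s: "s \<in> I" "t < s" "s < t + d" "L2_norm (\<lambda>x. (u s x - u t x) / (s - t) - v t x) < e"
      using frequently_later[OF t ev d, of "\<lambda>s. True"] by auto
    show "\<exists>h. in_L2 h \<and> L2_norm h < e \<and> (AE x in lebesgue. x \<in> {x. norm x > r\<^sub>0 + t + d} \<longrightarrow> \<bar>h x\<bar> = \<bar>v t x\<bar>)"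
    proof (intro exI conjI)
      show "in_L2 (\<lambda>x. (u s x - u t x) / (s - t) - v t x)"
        using in_L2_diff[OF in_L2_cmult[OF in_L2_diff[OF u_L2[OF s(1)] u_L2[OF t]], of "inverse (s - t)"] v_L2[OF t]]
        by (simp add: divide_inverse mult.commute)
      show "L2_norm (\<lambda>x. (u s x - u t x) / (s - t) - v t x) < e" by (rule s(4))
      show "AE x in lebesgue. x \<in> {x. norm x > r\<^sub>0 + t + d} \<longrightarrow> \<bar>(u s x - u t x) / (s - t) - v t x\<bar> = \<bar>v t x\<bar>"
        using u_vanish[OF s(1)] u_vanish[OF t] by eventually_elim (use s in auto)
    qed
  qed
  then show "AE x in lebesgue. norm x > r\<^sub>0 + t + d \<longrightarrow> v t x = 0" by simp
qed

lemma G_vanish: "t \<in> I \<Longrightarrow> AE x in lebesgue. norm x > r\<^sub>0 + t \<longrightarrow> G (u t x) (v t x) = 0"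
  using u_vanish[of t] v_vanish[of t] by (auto simp: G_0 elim: AE_mp)

end

text \<open>For such \<phi> the functions exp (l t) \<phi> and exp (-l t) \<phi> solve the wave
  equation. The case l = 0 covers constants, so that total mass and exponential weights obey the
  same identities.\<close>

definition wave_mode :: "real \<Rightarrow> ('a::euclidean_space \<Rightarrow> real) \<Rightarrow> bool" where
  "wave_mode l \<phi> \<longleftrightarrow> C_infinity \<phi> \<and> (\<forall>x. laplace \<phi> x = l\<^sup>2 * \<phi> x)"

lemma wave_mode_continuous: "wave_mode l \<phi> \<Longrightarrow> continuous_on S \<phi>"
  by (simp add: wave_mode_def C_infinity_continuous)

lemma wave_mode_const: "wave_mode 0 (\<lambda>x. c)"
  by (auto simp: wave_mode_def laplace_def)

lemma wave_mode_avg_exp: "wave_mode l (avg_exp n l :: 'a::euclidean_space \<Rightarrow> real)"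
proof -
  define h where "h c x = (\<Sum>k\<in>grid n. c k * exp (l * (x \<bullet> direction k)))"
    for c :: "('a \<Rightarrow> int) \<Rightarrow> real" and x :: 'a
  have pd: "pderiv_dir i (h c) = h (\<lambda>k. c k * (l * (i \<bullet> direction k)))" for c i
  proof
    fix x
    have "(h c has_derivative (\<lambda>v. \<Sum>k\<in>grid n. c k * (exp (l * (x \<bullet> direction k)) * (l * (v \<bullet> direction k))))) (at x)"
      unfolding h_def[abs_def] by (auto intro!: derivative_eq_intros simp: fun_eq_iff mult_ac)
    from frechet_derivative_eqI[OF this]
    show "frechet_derivative (h c) (at x) i = h (\<lambda>k. c k * (l * (i \<bullet> direction k))) x"
      by (simp add: h_def mult_ac)
  qed
  have e: "avg_exp n l = h (\<lambda>k. 1 / real (card (grid n :: ('a \<Rightarrow> int) set)))"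
    by (simp add: fun_eq_iff avg_exp_def dir_avg_def h_def sum_divide_distrib)
  have "laplace (h c) x = l\<^sup>2 * h c x" for c x
  proof -
    have "laplace (h c) x = (\<Sum>i\<in>Basis. \<Sum>k\<in>grid n. (l\<^sup>2 * (c k * exp (l * (x \<bullet> direction k)))) * ((i \<bullet> direction k) * (i \<bullet> direction k)))"
      unfolding laplace_def pd pd[THEN fun_cong] by (simp add: h_def power2_eq_square mult_ac)
    also have "\<dots> = (\<Sum>k\<in>grid n. (l\<^sup>2 * (c k * exp (l * (x \<bullet> direction k)))) * (\<Sum>i\<in>Basis. (i \<bullet> direction k) * (i \<bullet> direction k)))"
      by (subst sum.swap) (simp add: sum_distrib_left)
    also have "\<dots> = (\<Sum>k\<in>grid n. l\<^sup>2 * (c k * exp (l * (x \<bullet> direction k))))"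
    proof (rule sum.cong[OF refl])
      fix k :: "'a \<Rightarrow> int" assume "k \<in> grid n"
      then have "direction k \<bullet> direction k = 1"
        by (simp add: dot_square_norm norm_direction)
      then have "(\<Sum>i\<in>Basis. (i \<bullet> direction k) * (i \<bullet> direction k)) = 1"
        using euclidean_inner[of "direction k" "direction k"] by (simp add: inner_commute)
      then show "(l\<^sup>2 * (c k * exp (l * (x \<bullet> direction k)))) * (\<Sum>i\<in>Basis. (i \<bullet> direction k) * (i \<bullet> direction k))
          = l\<^sup>2 * (c k * exp (l * (x \<bullet> direction k)))" by simp
    qed
    finally show ?thesis by (simp add: h_def sum_distrib_left)
  qed
  moreover have "C_infinity (h c)" for c
    unfolding h_def[abs_def]
    by (intro C_infinity_sum C_infinity_mult C_infinity_const C_infinity_compose[OF C_infinity_exp]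
        C_infinity_linear bounded_linear_inner_left)
  ultimately show ?thesis unfolding e wave_mode_def by blast
qed

section \<open>Weighted pairings and their weak identity\<close>

context cone_solution
begin

lemma subinterval: "ereal T1 < T \<Longrightarrow> 0 \<le> t \<Longrightarrow> t \<le> T1 \<Longrightarrow> t \<in> I"
  using le_less_trans[of "ereal t" "ereal T1" T] by simp

text \<open>Exponential weights are neither bounded nor square integrable. Up to time T1 every
  function living on the cone pairs with them as with a truncation, which is bounded with compact
  support.\<close>

lemma cut_AE:
  fixes w \<phi> :: "'a \<Rightarrow> real"
  assumes "AE x in lebesgue. norm x > r\<^sub>0 + t \<longrightarrow> w x = 0" "t \<le> T1"
  shows "AE x in lebesgue. w x * \<phi> x = w x * (\<phi> x * cutoff (r\<^sub>0 + T1 + 1) x)"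
  using assms(1)
proof eventually_elim
  case (elim x)
  show ?case
  proof (cases "norm x > r\<^sub>0 + t")
    case False
    then have "cutoff (r\<^sub>0 + T1 + 1) x = 1" using assms(2) by (intro cutoff_eq_1) simp
    then show ?thesis by simp
  qed (use elim in simp)
qed

lemma cut_bounded:
  fixes \<phi> :: "'a \<Rightarrow> real"
  assumes "continuous_on UNIV \<phi>" "\<rho> \<ge> 0"
  shows "continuous_on UNIV (\<lambda>x. \<phi> x * cutoff \<rho> x)" "norm x > \<rho> + 1 \<Longrightarrow> \<phi> x * cutoff \<rho> x = 0"
    "\<exists>B. \<forall>x. \<bar>\<phi> x * cutoff \<rho> x\<bar> \<le> B"
proof -
  show c: "continuous_on UNIV (\<lambda>x. \<phi> x * cutoff \<rho> x)"
    by (intro continuous_on_mult assms C_infinity_continuous cutoff_C_infinity)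
  show z: "\<phi> x * cutoff \<rho> x = 0" if "norm x > \<rho> + 1" for x
    using cutoff_eq_0[OF assms(2) that] by simp
  have "bounded ((\<lambda>x. \<phi> x * cutoff \<rho> x) ` cball 0 (\<rho> + 1))"
    by (intro compact_imp_bounded compact_continuous_image continuous_on_subset[OF c]) auto
  then obtain B where "\<forall>y\<in>(\<lambda>x. \<phi> x * cutoff \<rho> x) ` cball 0 (\<rho> + 1). norm y \<le> B"
    unfolding bounded_iff by blast
  then have B: "\<bar>\<phi> x * cutoff \<rho> x\<bar> \<le> B" if "norm x \<le> \<rho> + 1" for x
    using that by simp
  have "\<bar>\<phi> x * cutoff \<rho> x\<bar> \<le> max B 0" for x
    using B[of x] z[of x] by (cases "norm x > \<rho> + 1") auto
  then show "\<exists>B. \<forall>x. \<bar>\<phi> x * cutoff \<rho> x\<bar> \<le> B" by blast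
qed

lemma cut_L2:
  assumes "continuous_on UNIV (\<phi> :: 'a \<Rightarrow> real)" "\<rho> \<ge> 0"
  shows "in_L2 (\<lambda>x. \<phi> x * cutoff \<rho> x)"
  by (rule in_L2_continuous_compact[OF cut_bounded(1)[OF assms] cut_bounded(2)[OF assms]])

lemma pair_cut:
  fixes w \<phi> :: "'a \<Rightarrow> real"
  assumes w: "in_L2 w" "AE x in lebesgue. norm x > r\<^sub>0 + t \<longrightarrow> w x = 0" "t \<le> T1" "T1 \<ge> 0"
    and \<phi>: "continuous_on UNIV \<phi>"
  shows "integrable lebesgue (\<lambda>x. w x * \<phi> x)"
    "(LINT x|lebesgue. w x * \<phi> x) = (LINT x|lebesgue. w x * (\<phi> x * cutoff (r\<^sub>0 + T1 + 1) x))"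
proof -
  have \<rho>: "r\<^sub>0 + T1 + 1 \<ge> 0" using r0 assms(4) by simp
  have [measurable]: "w \<in> borel_measurable lebesgue" "\<phi> \<in> borel_measurable lebesgue"
    using in_L2_measurable[OF w(1)] borel_measurable_lebesgue_continuous[OF \<phi>] by auto
  have [measurable]: "(cutoff (r\<^sub>0 + T1 + 1) :: 'a \<Rightarrow> real) \<in> borel_measurable lebesgue"
    by (intro borel_measurable_lebesgue_continuous C_infinity_continuous cutoff_C_infinity)
  have i: "integrable lebesgue (\<lambda>x. w x * (\<phi> x * cutoff (r\<^sub>0 + T1 + 1) x))"
    using in_L2_mult_integrable[OF w(1) cut_L2[OF \<phi> \<rho>]] by simp
  show "integrable lebesgue (\<lambda>x. w x * \<phi> x)"
    by (rule integrable_cong_AE[THEN iffD2, OF _ _ cut_AE[OF w(2,3)] i]) measurable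
  show "(LINT x|lebesgue. w x * \<phi> x) = (LINT x|lebesgue. w x * (\<phi> x * cutoff (r\<^sub>0 + T1 + 1) x))"
    by (rule integral_cong_AE[OF _ _ cut_AE[OF w(2,3)]]) measurable
qed

lemma G_pair_cut:
  assumes t: "t \<in> I" "t \<le> T1" "T1 \<ge> 0" and \<phi>: "continuous_on UNIV \<phi>"
  shows "Gpair \<phi> t = (LINT x|lebesgue. G (u t x) (v t x) * (\<phi> x * cutoff (r\<^sub>0 + T1 + 1) x))"
proof -
  have [measurable]: "(\<lambda>x. G (u t x) (v t x)) \<in> borel_measurable lebesgue" "\<phi> \<in> borel_measurable lebesgue"
    using G_measurable[OF t(1)] borel_measurable_lebesgue_continuous[OF \<phi>] by auto
  have [measurable]: "(cutoff (r\<^sub>0 + T1 + 1) :: 'a \<Rightarrow> real) \<in> borel_measurable lebesgue"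
    by (intro borel_measurable_lebesgue_continuous C_infinity_continuous cutoff_C_infinity)
  show ?thesis
    unfolding Gpair_def by (rule integral_cong_AE[OF _ _ cut_AE[OF G_vanish[OF t(1)] t(2)]]) measurable
qed

lemma G_integrable_AE: "AE t in lebesgue. t \<in> J \<longrightarrow> integrable lebesgue (\<lambda>x. G (u t x) (v t x))"
  using G_L1 by (simp add: L1_L1_def)

lemma G_mult_integrable:
  assumes t: "t \<in> I" and int: "integrable lebesgue (\<lambda>x. G (u t x) (v t x))"
    and \<phi>: "continuous_on UNIV (\<phi> :: 'a \<Rightarrow> real)"
  shows "integrable lebesgue (\<lambda>x. G (u t x) (v t x) * \<phi> x)"
proof -
  have \<rho>: "r\<^sub>0 + t + 1 \<ge> 0" using r0 t by simp
  have [measurable]: "(\<lambda>x. G (u t x) (v t x)) \<in> borel_measurable lebesgue" "\<phi> \<in> borel_measurable lebesgue"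
    using G_measurable[OF t] borel_measurable_lebesgue_continuous[OF \<phi>] by auto
  obtain B where B: "\<And>x. \<bar>\<phi> x * cutoff (r\<^sub>0 + t + 1) x\<bar> \<le> B"
    using cut_bounded(3)[OF \<phi> \<rho>] by blast
  show ?thesis
  proof (rule Bochner_Integration.integrable_bound[OF integrable_mult_right[OF int, of B]])
    show "(\<lambda>x. G (u t x) (v t x) * \<phi> x) \<in> borel_measurable lebesgue" by measurable
    show "AE x in lebesgue. norm (G (u t x) (v t x) * \<phi> x) \<le> norm (B * G (u t x) (v t x))"
      using cut_AE[OF G_vanish[OF t] order_refl, of \<phi>]
    proof eventually_elim
      case (elim x)
      have "\<bar>\<phi> x * cutoff (r\<^sub>0 + t + 1) x\<bar> \<le> \<bar>B\<bar>" using B[of x] by simp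
      then have "\<bar>G (u t x) (v t x)\<bar> * \<bar>\<phi> x * cutoff (r\<^sub>0 + t + 1) x\<bar> \<le> \<bar>G (u t x) (v t x)\<bar> * \<bar>B\<bar>"
        by (rule mult_left_mono) simp
      moreover have "\<bar>G (u t x) (v t x) * \<phi> x\<bar> = \<bar>G (u t x) (v t x)\<bar> * \<bar>\<phi> x * cutoff (r\<^sub>0 + t + 1) x\<bar>"
        unfolding abs_mult[symmetric] by (rule arg_cong[OF elim])
      ultimately show ?case
        unfolding real_norm_def abs_mult[of B] by (simp only: mult.commute)
    qed
  qed
qed

lemma J_lebesgue: "J \<in> sets lebesgue"
proof (cases T)
  case (real r)
  then have "J = {0<..<r}" by auto
  then show ?thesis by simp
next
  case PInf
  then have "J = {0<..}" by auto
  then show ?thesis by simp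
next
  case MInf
  then have "J = {}" by auto
  then show ?thesis by simp
qed

lemma Gpair_absolutely_integrable:
  assumes T1: "0 \<le> T1" "ereal T1 < T" and \<phi>: "continuous_on UNIV \<phi>"
  shows "Gpair \<phi> absolutely_integrable_on {0..T1}"
proof -
  define h where "h x = \<phi> x * cutoff (r\<^sub>0 + T1 + 1) x" for x
  have \<rho>: "r\<^sub>0 + T1 + 1 \<ge> 0" using r0 T1 by simp
  obtain B where B: "\<And>x. \<bar>h x\<bar> \<le> B"
    using cut_bounded(3)[OF \<phi> \<rho>] unfolding h_def by blast
  have "set_integrable lebesgue J (\<lambda>t. LINT x|lebesgue. G (u t x) (v t x) * h x)"
    using B cut_bounded(1)[OF \<phi> \<rho>] by (intro L1_L1_pairing[OF G_L1 J_lebesgue, of h B]) (auto simp: h_def[abs_def])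
  then have "set_integrable lebesgue {0<..T1} (\<lambda>t. LINT x|lebesgue. G (u t x) (v t x) * h x)"
    by (rule set_integrable_subset) (use subinterval[OF T1(2)] in auto)
  also have "?this \<longleftrightarrow> Gpair \<phi> absolutely_integrable_on {0<..T1}"
  proof (rule set_integrable_cong[OF refl refl])
    fix t assume "t \<in> {0<..T1}"
    then show "(LINT x|lebesgue. G (u t x) (v t x) * h x) = Gpair \<phi> t"
      using G_pair_cut[OF subinterval[OF T1(2), of t], of T1 \<phi>] T1 \<phi> by (simp add: h_def)
  qed
  also have "\<dots> \<longleftrightarrow> Gpair \<phi> absolutely_integrable_on {0..T1}"
  proof (rule absolutely_integrable_spike_set_eq)
    show "negligible {x \<in> {0<..T1} - {0..T1}. Gpair \<phi> x \<noteq> 0}" by (rule negligible_subset[of "{}"]) auto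
    show "negligible {x \<in> {0..T1} - {0<..T1}. Gpair \<phi> x \<noteq> 0}" by (rule negligible_subset[of "{0}"]) auto
  qed
  finally show ?thesis .
qed

lemma Upair_deriv:
  assumes T1: "0 \<le> T1" "ereal T1 < T" and \<phi>: "continuous_on UNIV \<phi>" and t: "t \<in> {0..T1}"
  shows "(Upair \<phi> has_real_derivative Vpair \<phi> t) (at t within {0..T1})"
proof -
  define h where "h x = \<phi> x * cutoff (r\<^sub>0 + T1 + 1) x" for x
  have \<rho>: "r\<^sub>0 + T1 + 1 \<ge> 0" using r0 T1 by simp
  have h: "in_L2 h" using cut_L2[OF \<phi> \<rho>] by (simp add: h_def[abs_def])
  have sub: "{0..T1} \<subseteq> I" using subinterval[OF T1(2)] by auto
  then have tI: "t \<in> I" using t by blast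
  have "((\<lambda>s. L2_norm (\<lambda>x. (u s x - u t x) / (s - t) - v t x)) \<longlongrightarrow> 0) (at t within I)"
    using uv_C1 tI unfolding C1_L2_def by blast
  then have "((\<lambda>s. L2_norm (\<lambda>x. (u s x - u t x) / (s - t) - v t x)) \<longlongrightarrow> 0) (at t within {0..T1})"
    by (rule tendsto_within_subset[OF _ sub])
  then have lim: "((\<lambda>s. L2_norm (\<lambda>x. (u s x - u t x) / (s - t) - v t x) * L2_norm h) \<longlongrightarrow> 0) (at t within {0..T1})"
    by (rule tendsto_mult_left_zero)
  have "((\<lambda>s. (Upair \<phi> s - Upair \<phi> t) / (s - t) - Vpair \<phi> t) \<longlongrightarrow> 0) (at t within {0..T1})"
  proof (rule Lim_null_comparison[OF _ lim])
    show "\<forall>\<^sub>F s in at t within {0..T1}. norm ((Upair \<phi> s - Upair \<phi> t) / (s - t) - Vpair \<phi> t)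
        \<le> L2_norm (\<lambda>x. (u s x - u t x) / (s - t) - v t x) * L2_norm h"
      unfolding eventually_at_filter
    proof (rule always_eventually, intro allI impI)
      fix s assume "s \<noteq> t" and s: "s \<in> {0..T1}"
      have sI: "s \<in> I" using s sub by blast
      have U: "Upair \<phi> s = (LINT x|lebesgue. u s x * h x)" if "s \<in> I" "s \<le> T1" for s
        unfolding Upair_def h_def by (rule pair_cut(2)[OF u_L2 u_vanish _ T1(1) \<phi>]) (use that in auto)
      have V: "Vpair \<phi> t = (LINT x|lebesgue. v t x * h x)"
        unfolding Vpair_def h_def by (rule pair_cut(2)[OF v_L2[OF tI] v_vanish[OF tI] _ T1(1) \<phi>]) (use t in auto)
      have i: "integrable lebesgue (\<lambda>x. w x * h x)" if "in_L2 w" for w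
        using in_L2_mult_integrable[OF that h] by simp
      have "(Upair \<phi> s - Upair \<phi> t) / (s - t) - Vpair \<phi> t
         = (LINT x|lebesgue. ((u s x * h x - u t x * h x) / (s - t)) - v t x * h x)"
        using s t sI tI by (subst Bochner_Integration.integral_diff)
          (auto simp: U V i u_L2 v_L2 intro!: integrable_divide Bochner_Integration.integrable_diff)
      also have "\<dots> = (LINT x|lebesgue. ((u s x - u t x) / (s - t) - v t x) * h x)"
        by (simp add: algebra_simps diff_divide_distrib)
      finally have e: "(Upair \<phi> s - Upair \<phi> t) / (s - t) - Vpair \<phi> t
         = (LINT x|lebesgue. ((u s x - u t x) / (s - t) - v t x) * h x)" .
      have "in_L2 (\<lambda>x. (u s x - u t x) / (s - t) - v t x)"
        using in_L2_diff[OF in_L2_cmult[OF in_L2_diff[OF u_L2[OF sI] u_L2[OF tI]], of "inverse (s - t)"] v_L2[OF tI]]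
        by (simp add: divide_inverse mult.commute)
      then show "norm ((Upair \<phi> s - Upair \<phi> t) / (s - t) - Vpair \<phi> t)
        \<le> L2_norm (\<lambda>x. (u s x - u t x) / (s - t) - v t x) * L2_norm h"
        unfolding e real_norm_def by (rule L2_Cauchy_Schwarz[OF _ h])
    qed
  qed
  then show ?thesis unfolding has_field_derivative_iff by (simp add: LIM_zero_iff)
qed

lemma Vpair_continuous:
  assumes T1: "0 \<le> T1" "ereal T1 < T" and \<phi>: "continuous_on UNIV \<phi>"
  shows "continuous_on {0..T1} (Vpair \<phi>)"
  unfolding continuous_on_def
proof
  fix t assume t: "t \<in> {0..T1}"
  define h where "h x = \<phi> x * cutoff (r\<^sub>0 + T1 + 1) x" for x
  have \<rho>: "r\<^sub>0 + T1 + 1 \<ge> 0" using r0 T1 by simp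
  have h: "in_L2 h" using cut_L2[OF \<phi> \<rho>] by (simp add: h_def[abs_def])
  have sub: "{0..T1} \<subseteq> I" using subinterval[OF T1(2)] by auto
  then have tI: "t \<in> I" using t by blast
  have "((\<lambda>s. L2_norm (\<lambda>x. v s x - v t x)) \<longlongrightarrow> 0) (at t within I)"
    using uv_C1 tI unfolding C1_L2_def cont_L2_def by blast
  then have "((\<lambda>s. L2_norm (\<lambda>x. v s x - v t x)) \<longlongrightarrow> 0) (at t within {0..T1})"
    by (rule tendsto_within_subset[OF _ sub])
  then have lim: "((\<lambda>s. L2_norm (\<lambda>x. v s x - v t x) * L2_norm h) \<longlongrightarrow> 0) (at t within {0..T1})"
    by (rule tendsto_mult_left_zero)
  have "((\<lambda>s. Vpair \<phi> s - Vpair \<phi> t) \<longlongrightarrow> 0) (at t within {0..T1})"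
  proof (rule Lim_null_comparison[OF _ lim])
    show "\<forall>\<^sub>F s in at t within {0..T1}. norm (Vpair \<phi> s - Vpair \<phi> t) \<le> L2_norm (\<lambda>x. v s x - v t x) * L2_norm h"
      unfolding eventually_at_filter
    proof (rule always_eventually, intro allI impI)
      fix s assume "s \<noteq> t" and s: "s \<in> {0..T1}"
      have sI: "s \<in> I" using s sub by blast
      have V: "Vpair \<phi> s = (LINT x|lebesgue. v s x * h x)" if "s \<in> I" "s \<le> T1" for s
        unfolding Vpair_def h_def by (rule pair_cut(2)[OF v_L2 v_vanish _ T1(1) \<phi>]) (use that in auto)
      have i: "integrable lebesgue (\<lambda>x. w x * h x)" if "in_L2 w" for w
        using in_L2_mult_integrable[OF that h] by simp
      have "Vpair \<phi> s - Vpair \<phi> t = (LINT x|lebesgue. v s x * h x - v t x * h x)"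
        using s t sI tI by (subst Bochner_Integration.integral_diff) (auto simp: V i v_L2)
      also have "\<dots> = (LINT x|lebesgue. (v s x - v t x) * h x)"
        by (simp add: algebra_simps)
      finally have e: "Vpair \<phi> s - Vpair \<phi> t = (LINT x|lebesgue. (v s x - v t x) * h x)" .
      show "norm (Vpair \<phi> s - Vpair \<phi> t) \<le> L2_norm (\<lambda>x. v s x - v t x) * L2_norm h"
        unfolding e real_norm_def by (rule L2_Cauchy_Schwarz[OF in_L2_diff[OF v_L2[OF sI] v_L2[OF tI]] h])
    qed
  qed
  then show "(Vpair \<phi> \<longlongrightarrow> Vpair \<phi> t) (at t within {0..T1})" by (simp add: LIM_zero_iff)
qed

lemma Upair_0: "continuous_on UNIV \<phi> \<Longrightarrow> Upair \<phi> 0 = \<epsilon> * (LINT x|lebesgue. f x * \<phi> x)"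
  and Vpair_0: "continuous_on UNIV \<phi> \<Longrightarrow> Vpair \<phi> 0 = \<epsilon> * (LINT x|lebesgue. g x * \<phi> x)"
proof -
  assume \<phi>: "continuous_on UNIV \<phi>"
  have 0: "0 \<in> I" using T_pos by (simp add: zero_ereal_def)
  have [measurable]: "u 0 \<in> borel_measurable lebesgue" "v 0 \<in> borel_measurable lebesgue"
    "\<phi> \<in> borel_measurable lebesgue" "f \<in> borel_measurable lebesgue" "g \<in> borel_measurable lebesgue"
    using in_L2_measurable[OF u_L2[OF 0]] in_L2_measurable[OF v_L2[OF 0]] \<phi> f_cont g_cont
    by (auto intro: borel_measurable_lebesgue_continuous)
  have "Upair \<phi> 0 = (LINT x|lebesgue. \<epsilon> * (f x * \<phi> x))"
    unfolding Upair_def by (rule integral_cong_AE) (measurable, use u_0 in eventually_elim, simp)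
  then show "Upair \<phi> 0 = \<epsilon> * (LINT x|lebesgue. f x * \<phi> x)" by simp
  have "Vpair \<phi> 0 = (LINT x|lebesgue. \<epsilon> * (g x * \<phi> x))"
    unfolding Vpair_def by (rule integral_cong_AE) (measurable, use v_0 in eventually_elim, simp)
  then show "Vpair \<phi> 0 = \<epsilon> * (LINT x|lebesgue. g x * \<phi> x)" by simp
qed

text \<open>The test function is a product, truncated in space beyond the cone and in time before 0.
  Neither truncation is seen by the solution, and Green's formula turns the gradient term into -l^2
  times the pairing with u.\<close>

lemma weak_identity:
  assumes T1: "0 < T1" "ereal T1 < T" and \<phi>: "wave_mode l \<phi>"
    and \<theta>: "C_infinity \<theta>" "\<And>t. t \<ge> T1 \<Longrightarrow> \<theta> t = 0"
  shows "\<epsilon> * \<theta> 0 * (LINT x|lebesgue. g x * \<phi> x) + integral {0..T1} (\<lambda>t. Gpair \<phi> t * \<theta> t)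
    = integral {0..T1} (\<lambda>t. - (Vpair \<phi> t * deriv \<theta> t) - l\<^sup>2 * Upair \<phi> t * \<theta> t)"
proof -
  have \<phi>_smooth: "C_infinity \<phi>" and \<phi>_lap: "\<And>x. laplace \<phi> x = l\<^sup>2 * \<phi> x"
    using \<phi> by (auto simp: wave_mode_def)
  have \<phi>_cont: "continuous_on UNIV \<phi>" by (rule wave_mode_continuous[OF \<phi>])
  \<comment> \<open>The extra 1 leaves an open ball around the cone on which the cut-off is 1, so
    that h and \<phi> have the same derivatives there.\<close>
  define \<rho> where "\<rho> = r\<^sub>0 + T1 + 1"
  have \<rho>: "\<rho> \<ge> 0" using r0 T1 by (simp add: \<rho>_def)
  define h where "h x = \<phi> x * cutoff \<rho> x" for x
  have h: "C_infinity h" unfolding h_def[abs_def] by (intro C_infinity_mult \<phi>_smooth cutoff_C_infinity)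
  have h_out: "h x = 0" if "norm x > \<rho> + 1" for x
    using cut_bounded(2)[OF \<phi>_cont \<rho> that] by (simp add: h_def)
  have h_L2: "in_L2 h" using cut_L2[OF \<phi>_cont \<rho>] by (simp add: h_def[abs_def])
  \<comment> \<open>Equal to 1 for t \<ge> -1 and to 0 for t \<le> -2: test functions live on all of
    space-time, and \<theta> is arbitrary at negative times.\<close>
  define lc where "lc t = smooth_step (- 1 + - t)" for t :: real
  have lc: "C_infinity lc" unfolding lc_def[abs_def]
    by (intro C_infinity_compose[OF smooth_step_C_infinity] C_infinity_add C_infinity_const
        C_infinity_linear bounded_linear_minus bounded_linear_ident)
  define \<Theta> where "\<Theta> t = \<theta> t * lc t" for t
  have \<Theta>: "C_infinity \<Theta>" unfolding \<Theta>_def[abs_def] by (intro C_infinity_mult \<theta>(1) lc)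
  have \<Theta>_eq: "\<Theta> t = \<theta> t" if "t > - 1" for t
    using that by (simp add: \<Theta>_def lc_def smooth_step_eq_1)
  have \<Theta>_out: "\<Theta> t = 0" if "t \<notin> {-2..T1}" for t
  proof (cases "t < - 2")
    case True
    then show ?thesis by (simp add: \<Theta>_def lc_def smooth_step_eq_0)
  next
    case False
    then show ?thesis using that \<theta>(2)[of t] by (simp add: \<Theta>_def)
  qed
  define \<Psi> where "\<Psi> z = h (fst z) * \<Theta> (snd z)" for z
  have "test_function T \<Psi>"
    unfolding test_function_def C_c_infinity_def
  proof (intro conjI)
    show "C_infinity \<Psi>" unfolding \<Psi>_def[abs_def]
      by (intro C_infinity_mult C_infinity_compose_linear[OF h] C_infinity_compose_linear[OF \<Theta>]
          bounded_linear_fst bounded_linear_snd)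
    have "{z. \<Psi> z \<noteq> 0} \<subseteq> cball 0 (\<rho> + 1) \<times> {-2..T1}"
    proof
      fix z assume "z \<in> {z. \<Psi> z \<noteq> 0}"
      then have "h (fst z) \<noteq> 0" "\<Theta> (snd z) \<noteq> 0" by (auto simp: \<Psi>_def)
      then have "\<not> norm (fst z) > \<rho> + 1" "snd z \<in> {-2..T1}" using h_out \<Theta>_out by blast+
      then show "z \<in> cball 0 (\<rho> + 1) \<times> {-2..T1}" by (cases z) auto
    qed
    then have sub: "supp \<Psi> \<subseteq> cball 0 (\<rho> + 1) \<times> {-2..T1}"
      unfolding supp_def by (intro closure_minimal closed_Times) auto
    then show "compact (supp \<Psi>)"
      by (metis bounded_Times bounded_cball bounded_closed_interval bounded_subset closed_closure
          compact_eq_bounded_closed supp_def)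
    show "supp \<Psi> \<subseteq> {(x, t). ereal t < T}"
    proof
      fix z assume "z \<in> supp \<Psi>"
      then have "snd z \<le> T1" using sub by auto
      then have "ereal (snd z) < T" using T1(2) le_less_trans[of "ereal (snd z)" "ereal T1" T] by simp
      then show "z \<in> {(x, t). ereal t < T}" by (cases z) auto
    qed
  qed
  note W = weak[OF this]
  have \<theta>_deriv0: "deriv \<theta> t = 0" if "t > T1" for t
  proof (rule DERIV_imp_deriv)
    have "((\<lambda>t. 0) has_real_derivative 0) (at t)" by simp
    then show "(\<theta> has_real_derivative 0) (at t)"
      by (rule has_field_derivative_transform_within_open[of _ _ _ "{T1<..}"]) (use that \<theta>(2) in auto)
  qed
  have deriv\<Psi>: "deriv (\<lambda>s. \<Psi> (x, s)) t = h x * deriv \<theta> t" if "t > 0" for x t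
  proof (rule DERIV_imp_deriv)
    have "((\<lambda>s. h x * \<theta> s) has_real_derivative h x * deriv \<theta> t) (at t)"
      by (intro DERIV_cmult C_infinity_real_deriv(1) \<theta>(1))
    then show "((\<lambda>s. \<Psi> (x, s)) has_real_derivative h x * deriv \<theta> t) (at t)"
      by (rule has_field_derivative_transform_within_open[of _ _ _ "{-1<..}"])
        (use that in \<open>auto simp: \<Psi>_def \<Theta>_eq\<close>)
  qed
  have grad\<Psi>: "grad (\<lambda>y. \<Psi> (y, t)) x = \<theta> t *\<^sub>R grad h x" if "t > 0" for x t
  proof -
    have "((\<lambda>y. \<theta> t * h y) has_derivative (\<lambda>v. \<theta> t * frechet_derivative h (at x) v)) (at x)"
      by (intro has_derivative_mult_right C_infinity_has_derivative h)
    moreover have "(\<lambda>y. \<Psi> (y, t)) = (\<lambda>y. \<theta> t * h y)" using that by (simp add: \<Psi>_def \<Theta>_eq mult.commute)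
    ultimately have "frechet_derivative (\<lambda>y. \<Psi> (y, t)) (at x) = (\<lambda>v. \<theta> t * frechet_derivative h (at x) v)"
      by (simp add: frechet_derivative_eqI)
    then show ?thesis by (simp add: grad_def scaleR_sum_right)
  qed
  have Ulap: "(LINT x|lebesgue. u t x * laplace h x) = l\<^sup>2 * Upair \<phi> t" if t: "t \<in> I" "t \<le> T1" for t
  proof -
    have [measurable]: "u t \<in> borel_measurable lebesgue" "\<phi> \<in> borel_measurable lebesgue" "laplace h \<in> borel_measurable lebesgue"
      using in_L2_measurable[OF u_L2[OF t(1)]] \<phi>_cont continuous_on_laplace[OF h]
      by (auto intro: borel_measurable_lebesgue_continuous)
    have "(LINT x|lebesgue. u t x * laplace h x) = (LINT x|lebesgue. l\<^sup>2 * (u t x * \<phi> x))"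
    proof (rule integral_cong_AE)
      show "AE x in lebesgue. u t x * laplace h x = l\<^sup>2 * (u t x * \<phi> x)"
        using u_vanish[OF t(1)]
      proof eventually_elim
        case (elim x)
        show ?case
        proof (cases "norm x > r\<^sub>0 + t")
          case False
          then have "laplace h x = laplace \<phi> x"
            using t by (intro laplace_local[OF \<phi>_smooth, of "ball 0 \<rho>"]) (auto simp: \<rho>_def h_def cutoff_eq_1)
          then show ?thesis by (simp add: \<phi>_lap)
        qed (use elim in simp)
      qed
    qed measurable
    then show ?thesis by (simp add: Upair_def)
  qed
  have R: "(LINT x|lebesgue. - v t x * deriv (\<lambda>s. \<Psi> (x, s)) t + weak_grad (u t) x \<bullet> grad (\<lambda>y. \<Psi> (y, t)) x)
      = (if t \<le> T1 then - (Vpair \<phi> t * deriv \<theta> t) - l\<^sup>2 * Upair \<phi> t * \<theta> t else 0)" if t: "t \<in> J" for t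
  proof (cases "t \<le> T1")
    case False
    then show ?thesis using t \<theta>_deriv0[of t] \<theta>(2)[of t] by (simp add: deriv\<Psi> grad\<Psi>)
  next
    case True
    have tI: "t \<in> I" using t by simp
    have uH: "in_H1 (u t)" using u_H1 tI by (auto simp: cont_H1_def)
    have i1: "integrable lebesgue (\<lambda>x. v t x * h x)" using in_L2_mult_integrable[OF v_L2[OF tI] h_L2] by simp
    have "(LINT x|lebesgue. - v t x * deriv (\<lambda>s. \<Psi> (x, s)) t + weak_grad (u t) x \<bullet> grad (\<lambda>y. \<Psi> (y, t)) x)
       = (LINT x|lebesgue. (- deriv \<theta> t) * (v t x * h x) + \<theta> t * (weak_grad (u t) x \<bullet> grad h x))"
      using t by (simp add: deriv\<Psi> grad\<Psi> mult_ac)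
    also have "\<dots> = (LINT x|lebesgue. (- deriv \<theta> t) * (v t x * h x)) + (LINT x|lebesgue. \<theta> t * (weak_grad (u t) x \<bullet> grad h x))"
      by (intro Bochner_Integration.integral_add integrable_mult_right i1 weak_grad_green(1)[OF uH h h_out])
    also have "\<dots> = (- deriv \<theta> t) * (LINT x|lebesgue. v t x * h x) + \<theta> t * (LINT x|lebesgue. weak_grad (u t) x \<bullet> grad h x)"
      by (simp only: integral_mult_right_zero)
    also have "(LINT x|lebesgue. weak_grad (u t) x \<bullet> grad h x) = - (l\<^sup>2 * Upair \<phi> t)"
      using weak_grad_green(2)[OF uH h h_out] Ulap[OF tI True] by simp
    also have "(LINT x|lebesgue. v t x * h x) = Vpair \<phi> t"
      unfolding Vpair_def h_def \<rho>_def
      by (rule pair_cut(2)[OF v_L2[OF tI] v_vanish[OF tI] True _ \<phi>_cont, symmetric]) (use T1 in simp)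
    finally show ?thesis using True by (simp add: algebra_simps)
  qed
  have L: "(LINT x|lebesgue. G (u t x) (v t x) * \<Psi> (x, t)) = (if t \<le> T1 then Gpair \<phi> t * \<theta> t else 0)"
    if t: "t \<in> J" for t
  proof (cases "t \<le> T1")
    case False
    then show ?thesis using t \<theta>(2)[of t] by (simp add: \<Psi>_def \<Theta>_eq)
  next
    case True
    have "(LINT x|lebesgue. G (u t x) (v t x) * \<Psi> (x, t)) = (LINT x|lebesgue. (G (u t x) (v t x) * h x) * \<theta> t)"
      using t by (simp add: \<Psi>_def \<Theta>_eq mult_ac)
    also have "\<dots> = (LINT x|lebesgue. G (u t x) (v t x) * h x) * \<theta> t" by simp
    also have "(LINT x|lebesgue. G (u t x) (v t x) * h x) = Gpair \<phi> t"
      using G_pair_cut[of t T1 \<phi>] t True T1 \<phi>_cont by (simp add: h_def \<rho>_def)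
    finally show ?thesis using True by simp
  qed
  \<comment> \<open>Both integrands vanish beyond T1, so integrals over the possibly infinite J
    reduce to a compact interval; the endpoint 0 is negligible.\<close>
  have restrict: "(LINT t:J|lebesgue. F t) = integral {0..T1} F'"
    if F: "\<And>t. t \<in> J \<Longrightarrow> F t = (if t \<le> T1 then F' t else 0)" and int: "F' absolutely_integrable_on {0..T1}" for F F' :: "real \<Rightarrow> real"
  proof -
    have "(LINT t:J|lebesgue. F t) = (LINT t:{0<..T1}|lebesgue. F' t)"
      unfolding set_lebesgue_integral_def
    proof (rule Bochner_Integration.integral_cong[OF refl])
      fix t :: real
      show "indicat_real J t *\<^sub>R F t = indicat_real {0<..T1} t *\<^sub>R F' t"
      proof (cases "t \<in> J")
        case True
        then show ?thesis using F[OF True] by (auto simp: indicator_def)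
      next
        case False
        then have "t \<notin> {0<..T1}" using subinterval[OF T1(2), of t] by auto
        then show ?thesis using False by simp
      qed
    qed
    also have "\<dots> = integral {0<..T1} F'"
      by (rule set_lebesgue_integral_eq_integral(2)[OF set_integrable_subset[OF int]]) auto
    also have "\<dots> = integral {0..T1} F'"
      by (rule integral_subset_negligible) (auto intro: negligible_subset[of "{0}"])
    finally show ?thesis .
  qed
  have U_cont: "continuous_on {0..T1} (Upair \<phi>)"
    using Upair_deriv[OF _ T1(2) \<phi>_cont] T1 by (intro DERIV_continuous_on[where D = "Vpair \<phi>"]) auto
  have V_cont: "continuous_on {0..T1} (Vpair \<phi>)"
    using Vpair_continuous[OF _ T1(2) \<phi>_cont] T1 by simp
  have \<theta>_cont: "continuous_on {0..T1} \<theta>" "continuous_on {0..T1} (deriv \<theta>)"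
    using C_infinity_continuous[OF \<theta>(1)] C_infinity_continuous[OF C_infinity_real_deriv(2)[OF \<theta>(1)]] by auto
  have i1: "(\<lambda>t. - (Vpair \<phi> t * deriv \<theta> t) - l\<^sup>2 * Upair \<phi> t * \<theta> t) absolutely_integrable_on {0..T1}"
    by (intro absolutely_integrable_continuous_real continuous_intros U_cont V_cont \<theta>_cont)
  have i2: "(\<lambda>t. Gpair \<phi> t * \<theta> t) absolutely_integrable_on {0..T1}"
  proof -
    have "(\<lambda>t. \<theta> t * Gpair \<phi> t) absolutely_integrable_on {0..T1}"
      using T1 \<phi>_cont compact_imp_bounded[OF compact_continuous_image[OF \<theta>_cont(1)]]
      by (intro absolutely_integrable_bounded_measurable_product_real Gpair_absolutely_integrable
          continuous_imp_measurable_on_sets_lebesgue \<theta>_cont) auto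
    then show ?thesis by (simp add: mult.commute)
  qed
  have "(LINT x|lebesgue. g x * \<Psi> (x, 0)) = \<theta> 0 * (LINT x|lebesgue. g x * \<phi> x)"
  proof -
    have "g x * \<Psi> (x, 0) = \<theta> 0 * (g x * \<phi> x)" for x
      using g_out[of x] T1 by (cases "norm x > r\<^sub>0") (auto simp: \<Psi>_def \<Theta>_eq h_def \<rho>_def cutoff_eq_1)
    then have "(LINT x|lebesgue. g x * \<Psi> (x, 0)) = (LINT x|lebesgue. \<theta> 0 * (g x * \<phi> x))"
      by (simp only:)
    then show ?thesis by (simp only: integral_mult_right_zero)
  qed
  then show ?thesis
    using W restrict[OF L i2] restrict[OF R i1] by (simp add: mult.assoc)
qed

end

section \<open>Tools from real analysis\<close>

lemma nondecreasing_within: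
  fixes F :: "real \<Rightarrow> real"
  assumes "a \<le> b" "\<And>x. x \<in> {a..b} \<Longrightarrow> (F has_real_derivative F' x) (at x within {a..b})"
    "\<And>x. x \<in> {a..b} \<Longrightarrow> F' x \<ge> 0"
  shows "F a \<le> F b"
proof -
  have "\<exists>x\<in>{a..b}. F b - F a = F' x * (b - a)"
    using assms(1,2) by (intro mvt_very_simple) (auto simp: has_field_derivative_def)
  then obtain x where "x \<in> {a..b}" "F b - F a = F' x * (b - a)" by blast
  moreover from this have "F' x * (b - a) \<ge> 0"
    using assms(1,3) by (intro mult_nonneg_nonneg) auto
  ultimately show ?thesis by linarith
qed

text \<open>Estimates of the source are available only at times at which it is integrable in space,
  hence the exceptional set.\<close>

lemma integral_le_off_negligible:
  fixes F H :: "real \<Rightarrow> real"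
  assumes N: "negligible N" and F: "F integrable_on S" and H: "H integrable_on S"
    and le: "\<And>t. t \<in> S - N \<Longrightarrow> F t \<le> H t"
  shows "integral S F \<le> integral S H"
proof -
  define F' where "F' t = (if t \<in> N then H t else F t)" for t
  have e: "F' t = F t" if "t \<in> S - N" for t using that by (simp add: F'_def)
  have "integral S F = integral S F'"
    by (rule integral_spike[OF N]) (simp add: F'_def)
  also have "\<dots> \<le> integral S H"
  proof (rule integral_le[OF _ H])
    show "F' integrable_on S" by (rule integrable_spike[OF F N e])
    show "F' t \<le> H t" if "t \<in> S" for t using le[of t] that by (auto simp: F'_def)
  qed
  finally show ?thesis .
qed

lemma lebesgue_AE_negligible:
  assumes "AE t in lebesgue. P t"
  obtains N where "negligible N" "\<And>t. t \<notin> N \<Longrightarrow> P (t::real)"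
  using assms unfolding eventually_ae_filter
  by (auto simp: negligible_iff_null_sets)

text \<open>Testing with smooth approximations of the indicator function of \<open>(-\<infinity>, t]\<close>.\<close>

lemma primitive_from_smooth_steps:
  fixes M m :: "real \<Rightarrow> real"
  assumes t: "0 \<le> t" "t < T1" and M: "continuous_on {0..T1} M" and m: "m absolutely_integrable_on {0..T1}"
    and k0: "k0 > 0"
    and id: "\<And>k. k \<ge> k0 \<Longrightarrow> M 0 + integral {0..T1} (\<lambda>s. m s * smooth_step (k * (s - t)))
      = - integral {0..T1} (\<lambda>s. M s * (k * deriv smooth_step (k * (s - t))))"
  shows "M t = M 0 + integral {0..t} m"
proof -
  define \<sigma> where "\<sigma> k s = smooth_step (k * (s - t))" for k s
  define \<sigma>' where "\<sigma>' k s = k * deriv smooth_step (k * (s - t))" for k s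
  have step_deriv: "(smooth_step has_real_derivative deriv smooth_step y) (at y)" for y
    by (rule C_infinity_real_deriv(1)[OF smooth_step_C_infinity])
  have \<sigma>_deriv: "(\<sigma> k has_real_derivative \<sigma>' k s) (at s within A)" for k s A
  proof -
    have "((\<lambda>s. k * (s - t)) has_real_derivative k) (at s)" by (auto intro!: derivative_eq_intros)
    from DERIV_chain2[OF step_deriv this] show ?thesis
      unfolding \<sigma>_def \<sigma>'_def by (simp add: mult.commute has_field_derivative_at_within)
  qed
  have cont: "continuous_on A (\<sigma> k)" "continuous_on A (\<sigma>' k)" for k A
  proof -
    show "continuous_on A (\<sigma> k)" using \<sigma>_deriv by (rule DERIV_continuous_on)
    have "continuous_on UNIV (deriv smooth_step)"
      by (intro C_infinity_continuous C_infinity_real_deriv(2) smooth_step_C_infinity)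
    then show "continuous_on A (\<sigma>' k)" unfolding \<sigma>'_def[abs_def]
      by (intro continuous_on_mult continuous_on_const) (rule continuous_on_compose2[of UNIV "deriv smooth_step"], auto intro!: continuous_intros)
  qed
  have \<sigma>'_int: "integral {0..T1} (\<sigma>' k) = - 1" if "k > 0" "k * (T1 - t) \<ge> 1" for k
  proof -
    have "(\<sigma>' k has_integral (\<sigma> k T1 - \<sigma> k 0)) {0..T1}"
      using t \<sigma>_deriv by (intro fundamental_theorem_of_calculus)
        (auto simp: has_real_derivative_iff_has_vector_derivative[symmetric])
    moreover have "\<sigma> k T1 = 0" using that by (simp add: \<sigma>_def smooth_step_eq_0)
    moreover have "\<sigma> k 0 = 1" using that t by (simp add: \<sigma>_def smooth_step_eq_1 mult_nonneg_nonpos)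
    ultimately show ?thesis by (simp add: integral_unique)
  qed
  have \<sigma>'_zero: "\<sigma>' k s = 0" if k: "k > 0" and s: "s < t \<or> k * (s - t) > 1" for k s
  proof -
    have "deriv smooth_step y = 0" if y: "y < 0 \<or> y > 1" for y
      using y
    proof
      assume y: "y < 0"
      have "(smooth_step has_real_derivative 0) (at y)"
        by (rule has_field_derivative_transform_within_open[of "\<lambda>x. 1" _ _ "{..<0}"])
          (use y in \<open>auto simp: smooth_step_eq_1\<close>)
      then show ?thesis by (rule DERIV_imp_deriv)
    next
      assume y: "y > 1"
      have "(smooth_step has_real_derivative 0) (at y)"
        by (rule has_field_derivative_transform_within_open[of "\<lambda>x. 0" _ _ "{1<..}"])
          (use y in \<open>auto simp: smooth_step_eq_0\<close>)
      then show ?thesis by (rule DERIV_imp_deriv)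
    qed
    moreover have "k * (s - t) < 0 \<or> k * (s - t) > 1" using k s by (auto simp: mult_pos_neg)
    ultimately show ?thesis by (simp add: \<sigma>'_def)
  qed
  \<comment> \<open>The summand 1 / (T1 - t) makes every step reach 0 before T1, so that the kernel
    has its full mass inside the interval.\<close>
  define kk where "kk n = k0 + 1 / (T1 - t) + real n" for n :: nat
  have kk: "kk n \<ge> k0" "kk n > 0" "kk n * (T1 - t) \<ge> 1" for n
  proof -
    have p: "1 / (T1 - t) > 0" using t by simp
    then show "kk n \<ge> k0" unfolding kk_def by linarith
    then show "kk n > 0" using k0 by linarith
    have "1 / (T1 - t) \<le> kk n" using k0 by (simp add: kk_def)
    then show "kk n * (T1 - t) \<ge> 1" using t by (simp add: pos_divide_le_eq)
  qed
  have kk_inf: "filterlim kk at_top sequentially"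
    unfolding kk_def[abs_def]
    by (intro filterlim_tendsto_add_at_top[OF tendsto_const] filterlim_real_sequentially)
  \<comment> \<open>The kernel \<open>- \<sigma>'\<close> is nonnegative, has integral 1 and is
    concentrated on t \<le> s \<le> t + 1/k, so averages of the continuous M against it tend to M
    t.\<close>
  have lim1: "(\<lambda>n. - integral {0..T1} (\<lambda>s. M s * \<sigma>' (kk n) s)) \<longlonglongrightarrow> M t"
  proof (rule tendstoI)
    fix e :: real assume e: "e > 0"
    obtain d where d: "d > 0" "\<And>s. s \<in> {0..T1} \<Longrightarrow> \<bar>s - t\<bar> < d \<Longrightarrow> \<bar>M s - M t\<bar> < e / 2"
      using M t e unfolding continuous_on_iff dist_real_def by (metis atLeastAtMost_iff half_gt_zero less_imp_le)
    have "\<forall>\<^sub>F n in sequentially. kk n > 1 / d"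
      using kk_inf by (simp add: filterlim_at_top_dense)
    then show "\<forall>\<^sub>F n in sequentially. dist (- integral {0..T1} (\<lambda>s. M s * \<sigma>' (kk n) s)) (M t) < e"
    proof eventually_elim
      case (elim n)
      let ?k = "kk n"
      have kd: "?k * d > 1" using elim d(1) by (simp add: field_simps)
      have int1: "(\<lambda>s. M s * \<sigma>' ?k s) integrable_on {0..T1}" "(\<lambda>s. \<sigma>' ?k s) integrable_on {0..T1}"
        by (intro integrable_continuous_real continuous_intros M cont)+
      have "- integral {0..T1} (\<lambda>s. M s * \<sigma>' ?k s) - M t = - integral {0..T1} (\<lambda>s. M s * \<sigma>' ?k s) + M t * integral {0..T1} (\<sigma>' ?k)"
        using \<sigma>'_int[of ?k] kk by simp
      also have "\<dots> = integral {0..T1} (\<lambda>s. (M t - M s) * \<sigma>' ?k s)"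
        using int1 by (simp add: left_diff_distrib integral_diff integrable_on_mult_right)
      finally have e1: "- integral {0..T1} (\<lambda>s. M s * \<sigma>' ?k s) - M t = integral {0..T1} (\<lambda>s. (M t - M s) * \<sigma>' ?k s)" .
      have "norm (integral {0..T1} (\<lambda>s. (M t - M s) * \<sigma>' ?k s)) \<le> integral {0..T1} (\<lambda>s. (e / 2) * (- \<sigma>' ?k s))"
      proof (rule integral_norm_bound_integral)
        show "(\<lambda>s. (M t - M s) * \<sigma>' ?k s) integrable_on {0..T1}" "(\<lambda>s. (e / 2) * (- \<sigma>' ?k s)) integrable_on {0..T1}"
          by (intro integrable_continuous_real continuous_intros M cont)+
        fix s assume s: "s \<in> {0..T1}"
        have neg: "- \<sigma>' ?k s \<ge> 0"
          unfolding \<sigma>'_def using kk(2)[of n] smooth_step_deriv_nonpos by (simp add: mult_nonneg_nonpos)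
        show "norm ((M t - M s) * \<sigma>' ?k s) \<le> (e / 2) * (- \<sigma>' ?k s)"
        proof (cases "\<sigma>' ?k s = 0")
          case False
          then have "\<not> s < t" "\<not> ?k * (s - t) > 1" using \<sigma>'_zero[OF kk(2)] by blast+
          then have "?k * (s - t) < ?k * d" using kd by simp
          then have "s - t < d" using kk(2)[of n] by simp
          then have "\<bar>M t - M s\<bar> < e / 2" using d(2)[OF s] \<open>\<not> s < t\<close> by (simp add: abs_minus_commute)
          then have "\<bar>M t - M s\<bar> * (- \<sigma>' ?k s) \<le> (e / 2) * (- \<sigma>' ?k s)"
            using neg by (intro mult_right_mono) auto
          then show ?thesis using neg by (simp add: abs_mult)
        qed simp
      qed
      also have "\<dots> = (e / 2) * (- integral {0..T1} (\<sigma>' ?k))"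
        by (simp only: integral_mult_right integral_neg)
      also have "\<dots> = e / 2" using \<sigma>'_int[of ?k] kk by simp
      finally show ?case using e1 e by (simp add: dist_real_def)
    qed
  qed
  have lim2: "(\<lambda>n. integral {0..T1} (\<lambda>s. m s * \<sigma> (kk n) s)) \<longlonglongrightarrow> integral {0..T1} (\<lambda>s. if s \<le> t then m s else 0)"
  proof (rule dominated_convergence(2))
    show "(\<lambda>s. m s * \<sigma> (kk n) s) integrable_on {0..T1}" for n
    proof -
      have "(\<lambda>s. \<sigma> (kk n) s * m s) absolutely_integrable_on {0..T1}"
        using compact_imp_bounded[OF compact_continuous_image[OF cont(1)[of "{0..T1}" "kk n"]]]
        by (intro absolutely_integrable_bounded_measurable_product_real m
            continuous_imp_measurable_on_sets_lebesgue cont) auto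
      then show ?thesis by (simp add: mult.commute set_lebesgue_integral_eq_integral(1))
    qed
    show "(\<lambda>s. \<bar>m s\<bar>) integrable_on {0..T1}"
      using m by (simp add: absolutely_integrable_on_def)
    show "norm (m s * \<sigma> (kk n) s) \<le> \<bar>m s\<bar>" for n s
      using smooth_step_bounds by (simp add: \<sigma>_def abs_mult mult_left_le)
    show "(\<lambda>n. m s * \<sigma> (kk n) s) \<longlonglongrightarrow> (if s \<le> t then m s else 0)" for s
    proof (cases "s \<le> t")
      case True
      then have "\<sigma> (kk n) s = 1" for n
        using kk(2)[of n] by (simp add: \<sigma>_def smooth_step_eq_1 mult_nonneg_nonpos)
      then show ?thesis using True by simp
    next
      case False
      have "\<forall>\<^sub>F n in sequentially. kk n > 1 / (s - t)"
        using kk_inf by (simp add: filterlim_at_top_dense)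
      then have "\<forall>\<^sub>F n in sequentially. 0 = m s * \<sigma> (kk n) s"
      proof eventually_elim
        case (elim n)
        then have "kk n * (s - t) \<ge> 1" using False by (simp add: field_simps)
        then show ?case by (simp add: \<sigma>_def smooth_step_eq_0)
      qed
      then show ?thesis using False by (auto intro: Lim_transform_eventually[OF tendsto_const])
    qed
  qed
  have "integral {0..T1} (\<lambda>s. if s \<le> t then m s else 0) = integral {0..t} m"
  proof -
    have "integral {0..T1} (\<lambda>s. if s \<le> t then m s else 0) = integral ({0..T1} \<inter> {..t}) m"
      using integral_restrict_Int[of "{0..T1}" "{..t}" m] by (simp add: Int_commute)
    also have "{0..T1} \<inter> {..t} = {0..t}" using t by auto
    finally show ?thesis .
  qed
  then have "(\<lambda>n. M 0 + integral {0..T1} (\<lambda>s. m s * \<sigma> (kk n) s)) \<longlonglongrightarrow> M 0 + integral {0..t} m"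
    using tendsto_add[OF tendsto_const lim2] by simp
  moreover have "M 0 + integral {0..T1} (\<lambda>s. m s * \<sigma> (kk n) s) = - integral {0..T1} (\<lambda>s. M s * \<sigma>' (kk n) s)" for n
    using id[OF kk(1)] by (simp add: \<sigma>_def \<sigma>'_def)
  ultimately show ?thesis using LIMSEQ_unique[OF lim1] by simp
qed

text \<open>With \<open>M = exp (- l t) (U' + l U)\<close> nondecreasing, \<open>exp (l t) U\<close> has derivative
  \<open>exp (2 l t) M\<close>, which bounds \<open>U\<close> from above and hence \<open>U'\<close> from below.\<close>

lemma damped_lower_bounds:
  fixes U V :: "real \<Rightarrow> real" and l t T1 :: real
  defines "M \<equiv> \<lambda>t. exp (- (l * t)) * (V t + l * U t)"
  assumes l: "l > 0" and t: "0 \<le> t" "t \<le> T1"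
    and U: "\<And>s. s \<in> {0..T1} \<Longrightarrow> (U has_real_derivative V s) (at s within {0..T1})"
    and mono: "\<And>s s'. 0 \<le> s \<Longrightarrow> s \<le> s' \<Longrightarrow> s' \<le> T1 \<Longrightarrow> M s \<le> M s'"
    and init: "V 0 - l * U 0 \<ge> 0"
  shows "exp (- (l * t)) * V t \<ge> M t / 2"
    "exp (- (l * t)) * U t \<ge> exp (- (l * t)) * U 0 + M 0 / (2 * l) * (1 - exp (- (l * t)))"
proof -
  have K: "exp (- (l * t)) * V t \<ge> M t / 2" if t: "0 \<le> t" "t \<le> T1" for t
  proof -
    \<comment> \<open>With t frozen, W is nondecreasing on \<open>{0..t}\<close>: the derivative of
      exp (l s) U is exp (2 l s) M s, at most exp (2 l s) M t.\<close>
    define W where "W s = M t / (2 * l) * exp (2 * l * s) - exp (l * s) * U s" for s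
    have "W 0 \<le> W t"
    proof (rule nondecreasing_within[OF t(1)])
      fix s assume s: "s \<in> {0..t}"
      have Us: "(U has_real_derivative V s) (at s within {0..t})"
        by (rule DERIV_subset[OF U]) (use s t in auto)
      show "(W has_real_derivative exp (2 * l * s) * (M t - M s)) (at s within {0..t})"
      proof -
        have d: "((\<lambda>s. exp (c * s)) has_real_derivative exp (c * s) * c) (at s within {0..t})" for c
          by (auto intro!: derivative_eq_intros)
        have "(W has_real_derivative M t / (2 * l) * (exp (2 * l * s) * (2 * l)) -
            (exp (l * s) * l * U s + V s * exp (l * s))) (at s within {0..t})"
          unfolding W_def[abs_def] by (intro DERIV_diff DERIV_cmult DERIV_mult d Us)
        also have "M t / (2 * l) * (exp (2 * l * s) * (2 * l)) - (exp (l * s) * l * U s + V s * exp (l * s))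
            = exp (2 * l * s) * (M t - M s)"
        proof -
          have "exp (2 * l * s) * M s = exp (l * s) * (V s + l * U s)"
            by (simp add: M_def flip: mult.assoc exp_add)
          then show ?thesis using l by (simp add: algebra_simps)
        qed
        finally show ?thesis .
      qed
      show "exp (2 * l * s) * (M t - M s) \<ge> 0" using mono[of s t] s t by simp
    qed
    then have "exp (l * t) * U t \<le> U 0 + M t * exp (2 * l * t) / (2 * l) - M t / (2 * l)"
      by (simp add: W_def)
    then have "2 * l * (exp (l * t) * U t) \<le> 2 * l * (U 0 + M t * exp (2 * l * t) / (2 * l) - M t / (2 * l))"
      using l by (intro mult_left_mono) auto
    also have "\<dots> = 2 * l * U 0 - M t + M t * exp (2 * l * t)"
      using l by (simp add: algebra_simps)
    \<comment> \<open>Here the sign condition on V 0 - l U 0 enters: it keeps the growing mode of u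
      from being outweighed by the initial displacement.\<close>
    also have "2 * l * U 0 \<le> M 0" using init by (simp add: M_def)
    also have "M 0 - M t + M t * exp (2 * l * t) \<le> M t * exp (2 * l * t)"
      using mono[of 0 t] t by simp
    finally have "2 * l * (exp (l * t) * U t) \<le> M t * exp (2 * l * t)" by simp
    then have "exp (- (2 * l * t)) * (2 * l * (exp (l * t) * U t)) \<le> exp (- (2 * l * t)) * (M t * exp (2 * l * t))"
      by (intro mult_left_mono) auto
    also have "\<dots> = M t" by (simp add: exp_minus)
    also have "exp (- (2 * l * t)) * (2 * l * (exp (l * t) * U t)) = 2 * l * (exp (- (l * t)) * U t)"
    proof -
      have "exp (- (2 * l * t)) * exp (l * t) = exp (- (l * t))" by (simp flip: exp_add)
      then show ?thesis by (simp add: mult_ac)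
    qed
    finally show ?thesis by (simp add: M_def algebra_simps)
  qed
  show "exp (- (l * t)) * V t \<ge> M t / 2" by (rule K[OF t])
  define W where "W s = U s - M 0 / (2 * l) * exp (l * s)" for s
  have "W 0 \<le> W t"
  proof (rule nondecreasing_within[OF t(1)])
    fix s assume s: "s \<in> {0..t}"
    have Us: "(U has_real_derivative V s) (at s within {0..t})"
      by (rule DERIV_subset[OF U]) (use s t in auto)
    show "(W has_real_derivative V s - M 0 / 2 * exp (l * s)) (at s within {0..t})"
      unfolding W_def[abs_def] using l by (auto intro!: derivative_eq_intros Us)
    have "exp (l * s) * (M 0 / 2) \<le> exp (l * s) * (exp (- (l * s)) * V s)"
      using K[of s] mono[of 0 s] s t by (intro mult_left_mono) auto
    also have "\<dots> = V s" by (simp add: exp_minus)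
    finally show "V s - M 0 / 2 * exp (l * s) \<ge> 0" by (simp add: mult.commute)
  qed
  then have "U 0 + M 0 / (2 * l) * (exp (l * t) - 1) \<le> U t"
    by (simp add: W_def algebra_simps diff_divide_distrib)
  then have "exp (- (l * t)) * (U 0 + M 0 / (2 * l) * (exp (l * t) - 1)) \<le> exp (- (l * t)) * U t"
    by (intro mult_left_mono) auto
  moreover have "exp (- (l * t)) * (U 0 + M 0 / (2 * l) * (exp (l * t) - 1))
      = exp (- (l * t)) * U 0 + M 0 / (2 * l) * (1 - exp (- (l * t)))"
  proof -
    have "exp (- (l * t)) * exp (l * t) = 1" by (simp flip: exp_add)
    then show ?thesis by algebra
  qed
  ultimately show "exp (- (l * t)) * U t \<ge> exp (- (l * t)) * U 0 + M 0 / (2 * l) * (1 - exp (- (l * t)))"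
    by (simp only:)
qed

text \<open>Hoelder's inequality for the splitting A = B^(1/r) (A B^(-1/r)): the first factor joins
  |w| to form the source density, the second leaves a weight integral over the ball. Two different
  weights are allowed because the critical case compares packets of different exponents.\<close>

lemma weighted_Hoelder:
  fixes w F A B :: "'a::euclidean_space \<Rightarrow> real" and r S \<rho> :: real
  assumes r: "r > 1" and w: "w \<in> borel_measurable lebesgue" and F: "integrable lebesgue F"
    and A: "continuous_on UNIV A" "\<And>x. A x > 0" and B: "continuous_on UNIV B" "\<And>x. B x > 0"
    and out: "AE x in lebesgue. norm x > \<rho> \<longrightarrow> w x = 0"
    and wF: "AE x in lebesgue. \<bar>w x\<bar> powr r * B x \<le> F x"
    and S: "S > 0" "(LINT x:cball 0 \<rho>|lebesgue. A x powr (r / (r - 1)) * B x powr (1 - r / (r - 1))) \<le> S"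
  shows "(LINT x|lebesgue. \<bar>w x\<bar> * A x) \<le> (LINT x|lebesgue. F x) powr (1 / r) * S powr (1 - 1 / r)"
proof -
  define r' where "r' = r / (r - 1)"
  have r': "r' > 1" "1 / r + 1 / r' = 1" "1 / r' = 1 - 1 / r" "r' / r = r' - 1"
    using r by (auto simp: r'_def field_simps)
  define X where "X = (LINT x|lebesgue. F x)"
  have F0: "AE x in lebesgue. F x \<ge> 0"
    using wF
  proof eventually_elim
    case (elim x)
    have "0 \<le> \<bar>w x\<bar> powr r * B x" using B(2)[of x] by simp
    then show ?case using elim by simp
  qed
  then have X0: "X \<ge> 0" unfolding X_def by (rule integral_nonneg_AE)
  have [measurable]: "w \<in> borel_measurable lebesgue" "A \<in> borel_measurable lebesgue"
    using w A(1) by (auto intro: borel_measurable_lebesgue_continuous)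
  show ?thesis
  proof (cases "X = 0")
    case True
    then have "AE x in lebesgue. F x = 0"
      using integral_nonneg_eq_0_iff_AE[OF F F0] by (simp add: X_def)
    then have "AE x in lebesgue. \<bar>w x\<bar> * A x = 0"
      using wF
    proof eventually_elim
      case (elim x)
      then have "\<bar>w x\<bar> powr r \<le> 0" using B(2)[of x] by (simp add: mult_le_0_iff)
      then show ?case using r by (simp add: powr_def split: if_splits)
    qed
    then have "(LINT x|lebesgue. \<bar>w x\<bar> * A x) = 0" by (simp add: integral_eq_zero_AE)
    then show ?thesis by simp
  next
    case False
    then have X: "X > 0" using X0 by simp
    \<comment> \<open>After normalisation Young's inequality integrates to 1/r + 1/r' = 1; this is
      impossible for X = 0, which was treated before.\<close>
    define xx yy where "xx = X powr (1 / r)" and "yy = S powr (1 / r')"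
    have "1 / r * r = 1" "1 / r' * r' = 1" using r r'(1) by simp_all
    then have xy: "xx > 0" "yy > 0" "xx powr r = X" "yy powr r' = S"
      using X S(1) by (simp_all only: xx_def yy_def powr_powr) simp_all
    define Y where "Y x = indicat_real (cball 0 \<rho>) x * (A x powr r' * B x powr (1 - r'))" for x
    have Yint: "integrable lebesgue Y"
    proof -
      have "A x \<noteq> 0" "B x \<noteq> 0" for x using A(2)[of x] B(2)[of x] by auto
      then have "set_integrable lebesgue (cball 0 \<rho>) (\<lambda>x. A x powr r' * B x powr (1 - r'))"
        by (intro integrable_on_cball continuous_intros continuous_on_subset[OF A(1)] continuous_on_subset[OF B(1)]) auto
      then show ?thesis by (simp add: set_integrable_def Y_def[abs_def])
    qed
    have Yle: "(LINT x|lebesgue. Y x) \<le> S"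
      using S(2) by (simp add: set_lebesgue_integral_def Y_def r'_def)
    have pt: "AE x in lebesgue. \<bar>w x\<bar> * A x \<le> (xx * yy) * (F x / (r * X) + Y x / (r' * S))"
      using wF out
    proof eventually_elim
      case (elim x)
      show ?case
      proof (cases "norm x > \<rho>")
        case True
        then have "w x = 0" using elim by simp
        moreover have "F x \<ge> 0" using elim \<open>w x = 0\<close> by simp
        moreover have "Y x = 0" using True by (simp add: Y_def)
        ultimately show ?thesis using xy X r by simp
      next
        case False
        define \<alpha> where "\<alpha> = \<bar>w x\<bar> * B x powr (1 / r) / xx"
        define \<beta> where "\<beta> = A x * B x powr (- (1 / r)) / yy"
        have nn: "\<alpha> \<ge> 0" "\<beta> \<ge> 0" using xy A(2)[of x] by (auto simp: \<alpha>_def \<beta>_def)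
        have "\<alpha> * \<beta> = \<bar>w x\<bar> * A x / (xx * yy)"
        proof -
          have "B x powr (1 / r) * B x powr (- (1 / r)) = 1"
            using B(2)[of x] by (simp flip: powr_add)
          then have "\<bar>w x\<bar> * A x * (B x powr (1 / r) * B x powr (- (1 / r))) = \<bar>w x\<bar> * A x" by simp
          then show ?thesis by (simp add: \<alpha>_def \<beta>_def mult_ac)
        qed
        moreover have "\<alpha> * \<beta> \<le> \<alpha> powr r / r + \<beta> powr r' / r'"
          by (rule Youngs_inequality) (use r r' nn in auto)
        moreover have "\<alpha> powr r = \<bar>w x\<bar> powr r * B x / X"
          using r xy B(2)[of x] by (simp add: \<alpha>_def powr_divide powr_mult powr_powr)
        moreover have "\<beta> powr r' = Y x / S"
        proof -
          have "- (1 / r) * r' = 1 - r'" using r'(4) by simp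
          then show ?thesis
            using xy A(2)[of x] B(2)[of x] False
            by (simp add: \<beta>_def Y_def powr_divide powr_mult powr_powr)
        qed
        ultimately have "\<bar>w x\<bar> * A x / (xx * yy) \<le> \<bar>w x\<bar> powr r * B x / X / r + Y x / S / r'" by simp
        also have "\<dots> \<le> F x / X / r + Y x / S / r'"
          using elim X r by (intro add_right_mono divide_right_mono) auto
        also have "\<dots> = F x / (r * X) + Y x / (r' * S)" by (simp add: mult.commute)
        finally show ?thesis using xy by (simp add: pos_divide_le_eq mult.commute)
      qed
    qed
    have Rint: "integrable lebesgue (\<lambda>x. (xx * yy) * (F x / (r * X) + Y x / (r' * S)))"
      using F Yint by (intro integrable_mult_right Bochner_Integration.integrable_add integrable_divide)
    have "(LINT x|lebesgue. \<bar>w x\<bar> * A x) \<le> (LINT x|lebesgue. (xx * yy) * (F x / (r * X) + Y x / (r' * S)))"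
    proof (rule integral_mono_AE[OF _ Rint pt])
      show "integrable lebesgue (\<lambda>x. \<bar>w x\<bar> * A x)"
      proof (rule Bochner_Integration.integrable_bound[OF Rint])
        show "(\<lambda>x. \<bar>w x\<bar> * A x) \<in> borel_measurable lebesgue" by measurable
        show "AE x in lebesgue. norm (\<bar>w x\<bar> * A x) \<le> norm ((xx * yy) * (F x / (r * X) + Y x / (r' * S)))"
          using pt
        proof eventually_elim
          case (elim x)
          have "norm (\<bar>w x\<bar> * A x) = \<bar>w x\<bar> * A x" using A(2)[of x] by (simp add: abs_mult)
          then show ?case using order_trans[OF elim abs_ge_self] by simp
        qed
      qed
    qed
    also have "\<dots> = (xx * yy) * (X / (r * X) + (LINT x|lebesgue. Y x) / (r' * S))"
      using F Yint by (simp add: X_def Bochner_Integration.integral_add integrable_divide)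
    also have "\<dots> \<le> (xx * yy) * (1 / r + 1 / r')"
    proof (intro mult_left_mono add_mono)
      have "(LINT x|lebesgue. Y x) / (r' * S) \<le> S / (r' * S)"
        using Yle r' S(1) by (intro divide_right_mono) auto
      then show "(LINT x|lebesgue. Y x) / (r' * S) \<le> 1 / r'" using S(1) by simp
    qed (use X xy in auto)
    also have "\<dots> = xx * yy" using r' by simp
    finally show ?thesis using r' by (simp add: xx_def yy_def X_def)
  qed
qed

text \<open>The primitive L of \<open>m\<close> satisfies its inequality only off a null set. The
  function K, the primitive of the continuous right-hand side, lies below L, is continuously
  differentiable and satisfies the same inequality everywhere, so K^(-p) K' can be integrated. An
  arbitrary primitive A of the weight covers powers and logarithms at once.\<close>

lemma Bernoulli_blowup:
  fixes m :: "real \<Rightarrow> real"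
  assumes p: "p > 1" and c: "c > 0" and L0: "L0 > 0" and T1: "T1 \<ge> 0" and s0: "s0 > 0"
    and m: "m integrable_on {0..T1}" and N: "negligible N"
    and ineq: "\<And>t. t \<in> {0..T1} - N \<Longrightarrow> m t \<ge> c * (L0 + integral {0..t} m) powr p * (s0 + t) powr - \<alpha>"
    and nonneg: "\<And>t. t \<in> {0..T1} \<Longrightarrow> m t \<ge> 0"
    and A: "\<And>t. t \<in> {0..T1} \<Longrightarrow> (A has_real_derivative (s0 + t) powr - \<alpha>) (at t within {0..T1})"
  shows "(p - 1) * c * (A T1 - A 0) \<le> L0 powr (1 - p)"
proof -
  define L where "L t = L0 + integral {0..t} m" for t
  have L_ge: "L t \<ge> L0" if "t \<in> {0..T1}" for t
    unfolding L_def using nonneg that by (auto intro!: integral_nonneg integrable_subinterval_real[OF m])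
  have L_cont: "continuous_on {0..T1} L"
    unfolding L_def[abs_def] by (intro continuous_intros indefinite_integral_continuous_1 m)
  define h where "h t = c * L t powr p * (s0 + t) powr - \<alpha>" for t
  have h_cont: "continuous_on {0..T1} h"
    unfolding h_def[abs_def] using L_ge L0 s0
    by (intro continuous_intros L_cont) (force+)
  define K where "K t = L0 + integral {0..t} h" for t
  have K_deriv: "(K has_real_derivative h t) (at t within {0..T1})" if "t \<in> {0..T1}" for t
    using integral_has_real_derivative[OF h_cont that] unfolding K_def[abs_def]
    by (auto intro!: derivative_eq_intros)
  have h_nonneg: "h t \<ge> 0" for t using c by (simp add: h_def)
  have h_int: "h integrable_on {0..t}" if "t \<in> {0..T1}" for t
    using that by (intro integrable_continuous_real continuous_on_subset[OF h_cont]) auto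
  have KL: "K t \<le> L t" if "t \<in> {0..T1}" for t
  proof -
    have "integral {0..t} h \<le> integral {0..t} m"
      using that ineq by (intro integral_le_off_negligible[OF N] h_int integrable_subinterval_real[OF m])
        (auto simp: h_def L_def)
    then show ?thesis by (simp add: K_def L_def)
  qed
  have K_ge: "K t \<ge> L0" if "t \<in> {0..T1}" for t
    unfolding K_def using integral_nonneg[OF h_int[OF that]] h_nonneg by simp
  define W where "W t = - (K t powr (1 - p)) - (p - 1) * c * A t" for t
  have "W 0 \<le> W T1"
  proof (rule nondecreasing_within[OF T1])
    fix t assume t: "t \<in> {0..T1}"
    have K0: "K t > 0" using K_ge[OF t] L0 by simp
    show "(W has_real_derivative (p - 1) * (K t powr (- p) * h t) - (p - 1) * c * (s0 + t) powr - \<alpha>) (at t within {0..T1})"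
    proof -
      have "((\<lambda>t. K t powr (1 - p)) has_real_derivative (1 - p) * K t powr (1 - p - 1) * h t) (at t within {0..T1})"
        using K0 DERIV_chain2[OF has_real_derivative_powr[OF K0, of "1 - p"] K_deriv[OF t]] by simp
      then have "(W has_real_derivative - ((1 - p) * K t powr (1 - p - 1) * h t) - (p - 1) * c * (s0 + t) powr - \<alpha>) (at t within {0..T1})"
        unfolding W_def[abs_def] by (intro DERIV_diff DERIV_minus DERIV_cmult A t)
      then show ?thesis by (simp add: algebra_simps)
    qed
    have "K t powr (- p) * h t = c * (s0 + t) powr - \<alpha> * (K t powr - p * L t powr p)"
      by (simp add: h_def)
    also have "\<dots> \<ge> c * (s0 + t) powr - \<alpha> * (K t powr - p * K t powr p)"
      using KL[OF t] K0 p c by (intro mult_left_mono powr_mono2) auto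
    also have "K t powr - p * K t powr p = 1" using K0 by (simp flip: powr_add)
    finally have "K t powr (- p) * h t \<ge> c * (s0 + t) powr - \<alpha>" by simp
    then have "(p - 1) * (K t powr (- p) * h t) \<ge> (p - 1) * (c * (s0 + t) powr - \<alpha>)"
      using p by (intro mult_left_mono) auto
    then show "(p - 1) * (K t powr (- p) * h t) - (p - 1) * c * (s0 + t) powr - \<alpha> \<ge> 0" by (simp add: mult.assoc)
  qed
  then have "(p - 1) * c * (A T1 - A 0) \<le> K 0 powr (1 - p) - K T1 powr (1 - p)"
    by (simp add: W_def algebra_simps)
  also have "\<dots> \<le> K 0 powr (1 - p)" by simp
  finally show ?thesis by (simp add: K_def)
qed

section \<open>Smooth cut-offs in time\<close>

lemma deriv_locally_const:
  fixes h :: "real \<Rightarrow> real"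
  assumes "open S" "y \<in> S" "\<And>x. x \<in> S \<Longrightarrow> h x = c"
  shows "deriv h y = 0"
proof (rule DERIV_imp_deriv)
  have "((\<lambda>x. c) has_real_derivative 0) (at y)" by simp
  then show "(h has_real_derivative 0) (at y)"
    by (rule has_field_derivative_transform_within_open[OF _ assms(1,2)]) (simp add: assms(3))
qed

lemma smooth_step_derivs_bounded:
  "\<exists>D>0. \<forall>y. \<bar>deriv smooth_step y\<bar> \<le> D \<and> \<bar>deriv (deriv smooth_step) y\<bar> \<le> D"
proof -
  have c1: "C_infinity (deriv smooth_step)" by (rule C_infinity_real_deriv(2)[OF smooth_step_C_infinity])
  have c2: "C_infinity (deriv (deriv smooth_step))" by (rule C_infinity_real_deriv(2)[OF c1])
  have z1: "deriv smooth_step y = 0" if y: "y < 0 \<or> y > 1" for y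
    using y deriv_locally_const[of "{..<0}" y smooth_step 1] deriv_locally_const[of "{1<..}" y smooth_step 0]
    by (auto simp: smooth_step_eq_1 smooth_step_eq_0)
  have z2: "deriv (deriv smooth_step) y = 0" if y: "y < 0 \<or> y > 1" for y
    by (rule deriv_locally_const[of "{..<0} \<union> {1<..}" _ _ 0]) (use y z1 in auto)
  have bd: "\<exists>B. \<forall>y\<in>{0..1}. \<bar>h y\<bar> \<le> B" if h: "C_infinity h" for h :: "real \<Rightarrow> real"
  proof -
    have "bounded (h ` {0..1})"
      by (intro compact_imp_bounded compact_continuous_image C_infinity_continuous h compact_Icc)
    then show ?thesis unfolding bounded_iff by simp
  qed
  obtain D1 where D1: "\<And>y. y \<in> {0..1} \<Longrightarrow> \<bar>deriv smooth_step y\<bar> \<le> D1"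
    using bd[OF c1] by blast
  obtain D2 where D2: "\<And>y. y \<in> {0..1} \<Longrightarrow> \<bar>deriv (deriv smooth_step) y\<bar> \<le> D2"
    using bd[OF c2] by blast
  define D where "D = \<bar>D1\<bar> + \<bar>D2\<bar> + 1"
  have "\<bar>deriv smooth_step y\<bar> \<le> D \<and> \<bar>deriv (deriv smooth_step) y\<bar> \<le> D" for y
  proof (cases "y \<in> {0..1}")
    case True
    then show ?thesis using D1[OF True] D2[OF True] unfolding D_def by linarith
  next
    case False
    then have "y < 0 \<or> y > 1" by auto
    then show ?thesis using z1 z2 by (simp add: D_def)
  qed
  moreover have "D > 0" by (simp add: D_def)
  ultimately show ?thesis by blast
qed

text \<open>A high power of the step makes the derivatives small relative to \<open>\<psi> powr (1 / q)\<close>.\<close>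

definition time_cutoff :: "nat \<Rightarrow> real \<Rightarrow> real \<Rightarrow> real" where
  "time_cutoff m R t = smooth_step (2 / R * t - 1) ^ m"

definition cutoff_power :: "real \<Rightarrow> nat" where
  "cutoff_power q = nat \<lceil>2 * (q / (q - 1))\<rceil> + 2"

lemma time_cutoff_props:
  assumes R: "R > 0"
  shows "C_infinity (time_cutoff m R)" "0 \<le> time_cutoff m R t" "time_cutoff m R t \<le> 1"
    "t \<le> R / 2 \<Longrightarrow> time_cutoff m R t = 1"
    "m \<ge> 1 \<Longrightarrow> t \<ge> R \<Longrightarrow> time_cutoff m R t = 0"
proof -
  have "C_infinity (\<lambda>t. smooth_step ((2 / R) * t + (- 1)) ^ m)"
    by (intro C_infinity_power C_infinity_compose[OF smooth_step_C_infinity] C_infinity_add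
        C_infinity_const C_infinity_linear bounded_linear_mult_right)
  then show "C_infinity (time_cutoff m R)" by (simp add: time_cutoff_def[abs_def])
  show "0 \<le> time_cutoff m R t" "time_cutoff m R t \<le> 1"
    using smooth_step_bounds by (auto simp: time_cutoff_def power_le_one)
  show "time_cutoff m R t = 1" if "t \<le> R / 2"
    using that R by (simp add: time_cutoff_def smooth_step_eq_1 field_simps)
  show "time_cutoff m R t = 0" if "m \<ge> 1" "t \<ge> R"
    using that R by (simp add: time_cutoff_def smooth_step_eq_0 field_simps)
qed

lemma time_cutoff_derivs:
  assumes q: "q > 1"
  defines "m \<equiv> cutoff_power q"
  shows "\<exists>C>0. \<forall>R>0. \<forall>t.
     \<bar>deriv (time_cutoff m R) t\<bar> \<le> C / R * time_cutoff m R t powr (1 / q) \<and>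
     \<bar>deriv (deriv (time_cutoff m R)) t\<bar> \<le> C / R\<^sup>2 * time_cutoff m R t powr (1 / q) \<and>
     (t < R / 2 \<longrightarrow> deriv (time_cutoff m R) t = 0 \<and> deriv (deriv (time_cutoff m R)) t = 0)"
proof -
  obtain D where D: "D > 0" "\<And>y. \<bar>deriv smooth_step y\<bar> \<le> D" "\<And>y. \<bar>deriv (deriv smooth_step) y\<bar> \<le> D"
    using smooth_step_derivs_bounded by blast
  obtain m' where m': "m = m' + 2" by (simp add: m_def cutoff_power_def)
  \<comment> \<open>The choice of \<open>cutoff_power\<close> is made for this: m \<ge> 2 q/(q - 1)
    says that m - 2 \<ge> m/q, so even the second derivative of s^m keeps a power of s bounded by
    (s^m)^(1/q).\<close>
  have mq: "real m' \<ge> real m / q"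
  proof -
    have "2 * (q / (q - 1)) \<le> real m" unfolding m_def cutoff_power_def by linarith
    then have "2 * q \<le> real m * (q - 1)" using q by (simp add: field_simps)
    then have "real m \<le> (real m - 2) * q" by (simp add: algebra_simps)
    then show ?thesis using q m' by (simp add: field_simps)
  qed
  have pw: "s ^ k \<le> (s ^ m) powr (1 / q)" if s: "0 \<le> s" "s \<le> 1" and k: "m' \<le> k" for s :: real and k
  proof (cases "s = 0")
    case True
    have "k \<noteq> 0"
    proof
      assume "k = 0"
      then have "real m / q \<le> 0" using mq k by simp
      then show False using m' q by (simp add: divide_le_0_iff)
    qed
    then have "s ^ k = 0" using True by simp
    then show ?thesis by (simp only: powr_ge_zero)
  next
    case False
    then have s0: "s > 0" using s by simp
    have "s ^ k = s powr real k" using s0 by (simp add: powr_realpow)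
    also have "\<dots> \<le> s powr (real m * (1 / q))"
      using s0 s mq k by (intro powr_mono') auto
    also have "\<dots> = (s powr real m) powr (1 / q)" by (simp only: powr_powr)
    also have "\<dots> = (s ^ m) powr (1 / q)" using s0 by (simp only: powr_realpow)
    finally show ?thesis .
  qed
  define C where "C = 4 * (real m * D + real m * real m * D * D + real m * D)"
  have mD: "real m * D > 0" using D m' by simp
  have C0: "C > 0" unfolding C_def by (intro mult_pos_pos add_pos_pos) (use m' mD D in auto)
  have "\<bar>deriv (time_cutoff m R) t\<bar> \<le> C / R * time_cutoff m R t powr (1 / q) \<and>
     \<bar>deriv (deriv (time_cutoff m R)) t\<bar> \<le> C / R\<^sup>2 * time_cutoff m R t powr (1 / q) \<and>
     (t < R / 2 \<longrightarrow> deriv (time_cutoff m R) t = 0 \<and> deriv (deriv (time_cutoff m R)) t = 0)" if R: "R > 0" for R t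
  proof -
    define s where "s t = smooth_step (2 / R * t - 1)" for t
    define s1 where "s1 t = deriv smooth_step (2 / R * t - 1)" for t
    define s2 where "s2 t = deriv (deriv smooth_step) (2 / R * t - 1)" for t
    have lin: "((\<lambda>t. 2 / R * t - 1) has_real_derivative 2 / R) (at t)" for t
      using R by (auto intro!: derivative_eq_intros)
    have ds: "(s has_real_derivative s1 t * (2 / R)) (at t)" for t
      using DERIV_chain2[OF C_infinity_real_deriv(1)[OF smooth_step_C_infinity] lin]
      unfolding s_def[abs_def] s1_def .
    have ds1: "(s1 has_real_derivative s2 t * (2 / R)) (at t)" for t
      using DERIV_chain2[OF C_infinity_real_deriv(1)[OF C_infinity_real_deriv(2)[OF smooth_step_C_infinity]] lin]
      unfolding s1_def[abs_def] s2_def .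
    have tc: "time_cutoff m R = (\<lambda>t. s t ^ m)" by (simp add: fun_eq_iff time_cutoff_def s_def)
    define d1 where "d1 t = real m * (s1 t * (2 / R) * s t ^ (m' + 1))" for t
    have d1: "(time_cutoff m R has_real_derivative d1 t) (at t)" for t
    proof -
      have "m - Suc 0 = m' + 1" using m' by simp
      then show ?thesis
        using DERIV_power[OF ds[of t], of m] unfolding tc d1_def by (simp only:)
    qed
    have d1': "deriv (time_cutoff m R) = d1" using d1 by (auto simp: fun_eq_iff intro: DERIV_imp_deriv)
    define d2 where "d2 t = real m * ((s2 t * (2 / R) * (2 / R)) * s t ^ (m' + 1)
        + real (m' + 1) * (s1 t * (2 / R) * s t ^ m') * (s1 t * (2 / R)))" for t
    have d2: "(d1 has_real_derivative d2 t) (at t)" for t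
    proof -
      have "((\<lambda>t. s t ^ (m' + 1)) has_real_derivative real (m' + 1) * (s1 t * (2 / R) * s t ^ m')) (at t)"
        using DERIV_power[OF ds[of t], of "m' + 1"] by simp
      from DERIV_cmult[OF DERIV_mult[OF DERIV_cmult_right[OF ds1, of "2 / R"] this], of "real m"]
      show ?thesis unfolding d1_def[abs_def] d2_def .
    qed
    have d2': "deriv d1 = d2" using d2 by (auto simp: fun_eq_iff intro: DERIV_imp_deriv)
    have sb: "0 \<le> s t" "s t \<le> 1" using smooth_step_bounds by (auto simp: s_def)
    define P where "P = time_cutoff m R t powr (1 / q)"
    have P: "P \<ge> 0" "s t ^ (m' + 1) \<le> P" "s t ^ m' \<le> P"
      using pw[OF sb, of "m' + 1"] pw[OF sb, of m'] by (auto simp: P_def tc)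
    have b1: "\<bar>s1 t\<bar> \<le> D" "\<bar>s2 t\<bar> \<le> D" using D by (auto simp: s1_def s2_def)
    have "\<bar>d1 t\<bar> = real m * (\<bar>s1 t\<bar> * (2 / R) * s t ^ (m' + 1))"
      unfolding d1_def using R sb by (simp add: abs_mult)
    also have "\<dots> \<le> real m * (D * (2 / R) * P)"
      using b1 R sb P D by (intro mult_left_mono mult_mono) auto
    also have "\<dots> = (2 * (real m * D)) / R * P" by simp
    also have "\<dots> \<le> C / R * P"
      using R P D mD unfolding C_def by (intro mult_right_mono divide_right_mono) auto
    finally have 1: "\<bar>d1 t\<bar> \<le> C / R * P" .
    have "\<bar>d2 t\<bar> \<le> real m * (\<bar>(s2 t * (2 / R) * (2 / R)) * s t ^ (m' + 1)\<bar>
        + \<bar>real (m' + 1) * (s1 t * (2 / R) * s t ^ m') * (s1 t * (2 / R))\<bar>)"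
      unfolding d2_def abs_mult[of "real m"] by (simp only: abs_of_nat) (intro mult_left_mono abs_triangle_ineq, simp)
    also have "\<bar>(s2 t * (2 / R) * (2 / R)) * s t ^ (m' + 1)\<bar> = \<bar>s2 t\<bar> * s t ^ (m' + 1) * (4 / R\<^sup>2)"
      using R sb by (simp add: abs_mult power2_eq_square)
    also have "\<bar>real (m' + 1) * (s1 t * (2 / R) * s t ^ m') * (s1 t * (2 / R))\<bar>
        = real (m' + 1) * (\<bar>s1 t\<bar> * \<bar>s1 t\<bar> * s t ^ m') * (4 / R\<^sup>2)"
      using R sb by (simp add: abs_mult power2_eq_square)
    also have "real m * (\<bar>s2 t\<bar> * s t ^ (m' + 1) * (4 / R\<^sup>2) + real (m' + 1) * (\<bar>s1 t\<bar> * \<bar>s1 t\<bar> * s t ^ m') * (4 / R\<^sup>2))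
       \<le> real m * (D * P * (4 / R\<^sup>2) + real m * (D * D * P) * (4 / R\<^sup>2))"
      using b1 sb P D R m' by (intro mult_left_mono add_mono mult_mono) auto
    also have "\<dots> = (4 * (real m * D + real m * real m * D * D)) / R\<^sup>2 * P"
      by (simp add: algebra_simps add_divide_distrib)
    also have "\<dots> \<le> C / R\<^sup>2 * P"
      using R P D mD unfolding C_def by (intro mult_right_mono divide_right_mono) auto
    finally have 2: "\<bar>d2 t\<bar> \<le> C / R\<^sup>2 * P" .
    have 3: "d1 t = 0 \<and> d2 t = 0" if t: "t < R / 2"
    proof -
      have z: "d1 t = 0" if "t < R / 2" for t
        unfolding d1'[symmetric]
        by (rule deriv_locally_const[of "{..<R / 2}" _ _ 1]) (use that time_cutoff_props(4)[OF R] in auto)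
      moreover have "deriv d1 t = 0"
        by (rule deriv_locally_const[of "{..<R / 2}" _ _ 0]) (use t z in auto)
      ultimately show ?thesis using t by (simp add: d2')
    qed
    show ?thesis unfolding d1' d2' using 1 2 3 by (simp add: P_def)
  qed
  then show ?thesis using C0 by blast
qed

section \<open>Integral identities for the solution\<close>

context cone_solution
begin

lemma Gpair_nonneg: "(\<And>x. \<phi> x \<ge> 0) \<Longrightarrow> Gpair \<phi> t \<ge> 0"
  unfolding Gpair_def using G_nonneg by (intro integral_nonneg_AE) auto

lemma Gpair_times_continuous:
  assumes "0 \<le> T1" "ereal T1 < T" "continuous_on UNIV \<phi>" and h: "continuous_on {0..T1} h"
  shows "(\<lambda>t. h t * Gpair \<phi> t) absolutely_integrable_on {0..T1}"
  using compact_imp_bounded[OF compact_continuous_image[OF h]] assms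
  by (intro absolutely_integrable_bounded_measurable_product_real Gpair_absolutely_integrable
      continuous_imp_measurable_on_sets_lebesgue) auto

lemma Upair_continuous:
  assumes "0 \<le> T1" "ereal T1 < T" "continuous_on UNIV \<phi>"
  shows "continuous_on {0..T1} (Upair \<phi>)"
  using Upair_deriv[OF assms] by (rule DERIV_continuous_on)

text \<open>Since exp (-l s) \<phi> solves the wave equation, testing with it times a smooth step
  leaves only terms with the derivative of the step. As the step sharpens these concentrate at t and
  give the momentum.\<close>

lemma momentum_identity:
  assumes t: "0 \<le> t" "t < T1" "ereal T1 < T" and \<phi>: "wave_mode l \<phi>"
  shows "exp (- (l * t)) * (Vpair \<phi> t + l * Upair \<phi> t)
    = Vpair \<phi> 0 + l * Upair \<phi> 0 + integral {0..t} (\<lambda>s. exp (- (l * s)) * Gpair \<phi> s)"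
proof -
  have T1: "0 < T1" "0 \<le> T1" using t by auto
  have \<phi>_cont: "continuous_on UNIV \<phi>" by (rule wave_mode_continuous[OF \<phi>])
  note Ud = Upair_deriv[OF T1(2) t(3) \<phi>_cont]
  note Vc = Vpair_continuous[OF T1(2) t(3) \<phi>_cont]
  note Uc = Upair_continuous[OF T1(2) t(3) \<phi>_cont]
  define E where "E s = exp (- (l * s))" for s
  have E_deriv: "(E has_real_derivative - l * E s) (at s within A)" for s A
    unfolding E_def[abs_def] by (auto intro!: derivative_eq_intros)
  have Ec: "continuous_on A E" for A unfolding E_def[abs_def] by (intro continuous_intros)
  define M where "M s = E s * (Vpair \<phi> s + l * Upair \<phi> s)" for s
  define m where "m s = E s * Gpair \<phi> s" for s
  have "M t = M 0 + integral {0..t} m"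
  proof (rule primitive_from_smooth_steps[OF t(1,2)])
    show "continuous_on {0..T1} M" unfolding M_def[abs_def] by (intro continuous_intros Ec Uc Vc)
    show "m absolutely_integrable_on {0..T1}"
      unfolding m_def[abs_def] by (rule Gpair_times_continuous[OF T1(2) t(3) \<phi>_cont Ec])
    show "1 / (T1 - t) > 0" using t by simp
    fix k assume k: "k \<ge> 1 / (T1 - t)"
    have k0: "k > 0" using k t by (meson divide_pos_pos less_le_trans zero_less_one diff_gt_0_iff_gt)
    have kT: "k * (T1 - t) \<ge> 1" using k t by (simp add: field_simps)
    define \<sigma> where "\<sigma> s = smooth_step (k * s + (- (k * t)))" for s
    have \<sigma>_C: "C_infinity \<sigma>"
      unfolding \<sigma>_def[abs_def] by (intro C_infinity_compose[OF smooth_step_C_infinity] C_infinity_add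
        C_infinity_const C_infinity_linear bounded_linear_mult_right)
    have \<sigma>_eq: "\<sigma> s = smooth_step (k * (s - t))" for s by (simp add: \<sigma>_def algebra_simps)
    define \<sigma>' where "\<sigma>' s = k * deriv smooth_step (k * (s - t))" for s
    have \<sigma>_deriv: "(\<sigma> has_real_derivative \<sigma>' s) (at s within A)" for s A
    proof -
      have "((\<lambda>s. k * (s - t)) has_real_derivative k) (at s)" by (auto intro!: derivative_eq_intros)
      from DERIV_chain2[OF C_infinity_real_deriv(1)[OF smooth_step_C_infinity] this] show ?thesis
        unfolding \<sigma>_eq[abs_def] \<sigma>'_def by (simp add: mult.commute has_field_derivative_at_within)
    qed
    have \<sigma>'_eq: "\<sigma>' = deriv \<sigma>"
      using \<sigma>_deriv[of _ UNIV] by (auto simp: fun_eq_iff intro!: DERIV_imp_deriv[symmetric])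
    have \<sigma>c: "continuous_on A \<sigma>" "continuous_on A \<sigma>'" for A
      unfolding \<sigma>'_eq by (intro C_infinity_continuous \<sigma>_C C_infinity_real_deriv(2))+
    have \<sigma>T: "\<sigma> s = 0" if "s \<ge> T1" for s
    proof -
      have "k * (T1 - t) \<le> k * (s - t)" using that k0 by (intro mult_left_mono) auto
      then show ?thesis using kT by (simp add: \<sigma>_eq smooth_step_eq_0)
    qed
    have \<sigma>0: "\<sigma> 0 = 1" using k0 t by (simp add: \<sigma>_eq smooth_step_eq_1)
    define \<theta> where "\<theta> s = exp (- l * s) * \<sigma> s" for s
    have \<theta>_C: "C_infinity \<theta>"
      unfolding \<theta>_def[abs_def] by (intro C_infinity_mult C_infinity_exp \<sigma>_C)
    have \<theta>_E: "\<theta> s = E s * \<sigma> s" for s by (simp add: \<theta>_def E_def)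
    have \<theta>_deriv: "deriv \<theta> s = E s * (\<sigma>' s - l * \<sigma> s)" for s
    proof (rule DERIV_imp_deriv)
      show "(\<theta> has_real_derivative E s * (\<sigma>' s - l * \<sigma> s)) (at s)"
        unfolding \<theta>_E[abs_def] using DERIV_mult[OF E_deriv \<sigma>_deriv, of s UNIV] by (simp add: algebra_simps)
    qed
    have id: "\<epsilon> * \<theta> 0 * (LINT x|lebesgue. g x * \<phi> x) + integral {0..T1} (\<lambda>s. Gpair \<phi> s * \<theta> s)
      = integral {0..T1} (\<lambda>s. - (Vpair \<phi> s * deriv \<theta> s) - l\<^sup>2 * Upair \<phi> s * \<theta> s)"
      by (rule weak_identity[OF T1(1) t(3) \<phi> \<theta>_C]) (simp add: \<theta>_E \<sigma>T)
    \<comment> \<open>Because U' = V, everything except the momentum times \<open>\<sigma>'\<close>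
      is the exact derivative of Q; its value at 0 supplies the missing term l U(0).\<close>
    define Q where "Q s = l * (E s * (Upair \<phi> s * \<sigma> s))" for s
    define Q' where "Q' s = l * (E s * (Vpair \<phi> s * \<sigma> s + \<sigma>' s * Upair \<phi> s) + - l * E s * (Upair \<phi> s * \<sigma> s))" for s
    have "(Q has_real_derivative Q' s) (at s within {0..T1})" if "s \<in> {0..T1}" for s
      unfolding Q_def[abs_def] Q'_def by (intro DERIV_cmult DERIV_mult' E_deriv DERIV_mult[OF Ud[OF that] \<sigma>_deriv])
    then have "(Q' has_integral (Q T1 - Q 0)) {0..T1}"
      using T1 by (intro fundamental_theorem_of_calculus)
        (auto simp: has_real_derivative_iff_has_vector_derivative[symmetric])
    then have Qi: "integral {0..T1} Q' = - (l * Upair \<phi> 0)"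
      using \<sigma>T[of T1] \<sigma>0 by (simp add: integral_unique Q_def E_def)
    have "(\<lambda>s. - (Vpair \<phi> s * deriv \<theta> s) - l\<^sup>2 * Upair \<phi> s * \<theta> s) = (\<lambda>s. Q' s - M s * \<sigma>' s)"
      by (simp add: fun_eq_iff \<theta>_deriv \<theta>_E Q'_def M_def algebra_simps power2_eq_square)
    then have "integral {0..T1} (\<lambda>s. - (Vpair \<phi> s * deriv \<theta> s) - l\<^sup>2 * Upair \<phi> s * \<theta> s)
      = integral {0..T1} Q' - integral {0..T1} (\<lambda>s. M s * \<sigma>' s)"
      unfolding Q'_def[abs_def] M_def[abs_def]
      by (simp only:) (intro integral_diff integrable_continuous_real continuous_intros Ec Uc Vc \<sigma>c)
    moreover have "\<epsilon> * (LINT x|lebesgue. g x * \<phi> x) = Vpair \<phi> 0" using Vpair_0[OF \<phi>_cont] by simp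
    moreover have "M 0 = Vpair \<phi> 0 + l * Upair \<phi> 0" by (simp add: M_def E_def)
    moreover have "(\<lambda>s. Gpair \<phi> s * \<theta> s) = (\<lambda>s. m s * smooth_step (k * (s - t)))"
      by (simp add: fun_eq_iff \<theta>_E m_def \<sigma>_eq mult_ac)
    moreover have "\<theta> 0 = 1" by (simp add: \<theta>_E \<sigma>0 E_def)
    ultimately show "M 0 + integral {0..T1} (\<lambda>s. m s * smooth_step (k * (s - t)))
        = - integral {0..T1} (\<lambda>s. M s * (k * deriv smooth_step (k * (s - t))))"
      using id Qi unfolding \<sigma>'_def by simp
  qed
  then show ?thesis by (simp add: M_def m_def[abs_def] E_def)
qed

text \<open>A further integration by parts moves the remaining time derivative from the velocity to
  the cut-off. As exp (-l t) \<phi> is an exact wave, only derivatives of \<psi> survive on the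
  right; the conditions at 0 and R fix the boundary terms.\<close>

lemma cutoff_identity:
  assumes R: "0 < R" "ereal R < T" and \<phi>: "wave_mode l \<phi>"
    and \<psi>: "C_infinity \<psi>" "\<And>t. t \<ge> R \<Longrightarrow> \<psi> t = 0" "\<psi> 0 = 1" "deriv \<psi> 0 = 0" "deriv \<psi> R = 0"
  shows "Vpair \<phi> 0 + l * Upair \<phi> 0 + integral {0..R} (\<lambda>t. Gpair \<phi> t * (\<psi> t * exp (- (l * t))))
    = integral {0..R} (\<lambda>t. Upair \<phi> t * ((deriv (deriv \<psi>) t - 2 * l * deriv \<psi> t) * exp (- (l * t))))"
proof -
  have \<phi>_cont: "continuous_on UNIV \<phi>" by (rule wave_mode_continuous[OF \<phi>])
  have R0: "0 \<le> R" using R by simp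
  note Ud = Upair_deriv[OF R0 R(2) \<phi>_cont]
  note Vc = Vpair_continuous[OF R0 R(2) \<phi>_cont]
  note Uc = Upair_continuous[OF R0 R(2) \<phi>_cont]
  define E where "E s = exp (- (l * s))" for s
  have E_deriv: "(E has_real_derivative - l * E s) (at s within A)" for s A
    unfolding E_def[abs_def] by (auto intro!: derivative_eq_intros)
  have Ec: "continuous_on A E" for A unfolding E_def[abs_def] by (intro continuous_intros)
  have \<psi>1: "C_infinity (deriv \<psi>)" by (rule C_infinity_real_deriv(2)[OF \<psi>(1)])
  have \<psi>2: "C_infinity (deriv (deriv \<psi>))" by (rule C_infinity_real_deriv(2)[OF \<psi>1])
  have d\<psi>: "(\<psi> has_real_derivative deriv \<psi> s) (at s within A)" "(deriv \<psi> has_real_derivative deriv (deriv \<psi>) s) (at s within A)" for s A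
    using C_infinity_real_deriv(1)[OF \<psi>(1)] C_infinity_real_deriv(1)[OF \<psi>1]
    by (auto intro: has_field_derivative_at_within)
  have \<psi>c: "continuous_on A \<psi>" "continuous_on A (deriv \<psi>)" "continuous_on A (deriv (deriv \<psi>))" for A
    by (intro C_infinity_continuous \<psi> \<psi>1 \<psi>2)+
  define \<theta> where "\<theta> s = exp (- l * s) * \<psi> s" for s
  have \<theta>_C: "C_infinity \<theta>"
    unfolding \<theta>_def[abs_def] by (intro C_infinity_mult C_infinity_exp \<psi>(1))
  have \<theta>_E: "\<theta> s = E s * \<psi> s" for s by (simp add: \<theta>_def E_def)
  define \<theta>1 where "\<theta>1 s = E s * (deriv \<psi> s - l * \<psi> s)" for s
  have \<theta>_deriv: "deriv \<theta> s = \<theta>1 s" for s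
  proof (rule DERIV_imp_deriv)
    show "(\<theta> has_real_derivative \<theta>1 s) (at s)"
      unfolding \<theta>_E[abs_def] \<theta>1_def using DERIV_mult[OF E_deriv d\<psi>(1), of s UNIV] by (simp add: algebra_simps)
  qed
  define \<theta>2 where "\<theta>2 s = E s * (deriv (deriv \<psi>) s - l * deriv \<psi> s) + - l * E s * (deriv \<psi> s - l * \<psi> s)" for s
  have \<theta>1_deriv: "(\<theta>1 has_real_derivative \<theta>2 s) (at s within A)" for s A
    unfolding \<theta>1_def[abs_def] \<theta>2_def by (intro DERIV_mult' E_deriv DERIV_diff DERIV_cmult d\<psi>)
  have id: "\<epsilon> * \<theta> 0 * (LINT x|lebesgue. g x * \<phi> x) + integral {0..R} (\<lambda>s. Gpair \<phi> s * \<theta> s)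
      = integral {0..R} (\<lambda>s. - (Vpair \<phi> s * deriv \<theta> s) - l\<^sup>2 * Upair \<phi> s * \<theta> s)"
    by (rule weak_identity[OF R \<phi> \<theta>_C]) (simp add: \<theta>_E \<psi>(2))
  define Q where "Q s = Upair \<phi> s * \<theta>1 s" for s
  define Q' where "Q' s = Vpair \<phi> s * \<theta>1 s + \<theta>2 s * Upair \<phi> s" for s
  have "(Q has_real_derivative Q' s) (at s within {0..R})" if "s \<in> {0..R}" for s
    unfolding Q_def[abs_def] Q'_def by (intro DERIV_mult Ud that \<theta>1_deriv)
  then have "(Q' has_integral (Q R - Q 0)) {0..R}"
    using R0 by (intro fundamental_theorem_of_calculus)
      (auto simp: has_real_derivative_iff_has_vector_derivative[symmetric])
  then have Qi: "integral {0..R} Q' = l * Upair \<phi> 0"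
    using \<psi>(2)[of R] \<psi>(3-5) by (simp add: integral_unique Q_def \<theta>1_def E_def)
  have "(\<lambda>s. - (Vpair \<phi> s * deriv \<theta> s) - l\<^sup>2 * Upair \<phi> s * \<theta> s)
      = (\<lambda>s. Upair \<phi> s * ((deriv (deriv \<psi>) s - 2 * l * deriv \<psi> s) * E s) - Q' s)"
    by (simp add: fun_eq_iff \<theta>_deriv \<theta>_E Q'_def \<theta>1_def \<theta>2_def algebra_simps power2_eq_square)
  then have "integral {0..R} (\<lambda>s. - (Vpair \<phi> s * deriv \<theta> s) - l\<^sup>2 * Upair \<phi> s * \<theta> s)
      = integral {0..R} (\<lambda>s. Upair \<phi> s * ((deriv (deriv \<psi>) s - 2 * l * deriv \<psi> s) * E s)) - integral {0..R} Q'"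
    unfolding Q'_def[abs_def] \<theta>1_def[abs_def] \<theta>2_def[abs_def]
    by (simp only:) (intro integral_diff integrable_continuous_real continuous_intros Ec Uc Vc \<psi>c)
  moreover have "\<epsilon> * (LINT x|lebesgue. g x * \<phi> x) = Vpair \<phi> 0" using Vpair_0[OF \<phi>_cont] by simp
  moreover have "(\<lambda>s. Gpair \<phi> s * \<theta> s) = (\<lambda>s. Gpair \<phi> s * (\<psi> s * E s))"
    by (simp add: fun_eq_iff \<theta>_E mult_ac)
  moreover have "\<theta> 0 = 1" by (simp add: \<theta>_E \<psi>(3) E_def)
  ultimately show ?thesis using id Qi unfolding E_def by simp
qed

text \<open>The two sources \<open>a |u|^q\<close> and \<open>b |v|^p\<close> are treated alike: \<open>w\<close> is \<open>u t\<close> or \<open>v t\<close>.\<close>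

lemma pair_Hoelder:
  assumes t: "t \<in> I" and int: "integrable lebesgue (\<lambda>x. G (u t x) (v t x))"
    and r: "r > 1" and c: "c > 0"
    and w: "in_L2 w" "AE x in lebesgue. norm x > r\<^sub>0 + t \<longrightarrow> w x = 0"
      "\<And>x. c * \<bar>w x\<bar> powr r \<le> G (u t x) (v t x)"
    and A: "continuous_on UNIV A" "\<And>x. A x > 0" and B: "continuous_on UNIV B" "\<And>x. B x > 0"
    and S: "S > 0" "(LINT x:cball 0 (r\<^sub>0 + t)|lebesgue. A x powr (r / (r - 1)) * B x powr (1 - r / (r - 1))) \<le> S"
  shows "(LINT x|lebesgue. \<bar>w x\<bar> * A x) \<le> (Gpair B t / c) powr (1 / r) * S powr (1 - 1 / r)"
proof -
  have "(LINT x|lebesgue. \<bar>w x\<bar> * A x) \<le> (LINT x|lebesgue. (G (u t x) (v t x) * B x) / c) powr (1 / r) * S powr (1 - 1 / r)"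
  proof (rule weighted_Hoelder[OF r in_L2_measurable[OF w(1)] _ A B w(2) _ S])
    show "integrable lebesgue (\<lambda>x. (G (u t x) (v t x) * B x) / c)"
      by (intro integrable_divide G_mult_integrable t int B)
    show "AE x in lebesgue. \<bar>w x\<bar> powr r * B x \<le> (G (u t x) (v t x) * B x) / c"
    proof (rule AE_I2)
      fix x
      have "c * \<bar>w x\<bar> powr r * B x \<le> G (u t x) (v t x) * B x"
        using w(3)[of x] less_imp_le[OF B(2)[of x]] by (rule mult_right_mono)
      then show "\<bar>w x\<bar> powr r * B x \<le> (G (u t x) (v t x) * B x) / c"
        using c by (simp add: pos_le_divide_eq mult_ac)
    qed
  qed
  then show ?thesis by (simp add: Gpair_def)
qed

lemma abs_pair_le:
  fixes w A :: "'a \<Rightarrow> real"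
  assumes "\<And>x. A x > 0"
  shows "\<bar>LINT x|lebesgue. w x * A x\<bar> \<le> (LINT x|lebesgue. \<bar>w x\<bar> * A x)"
proof -
  have "\<bar>LINT x|lebesgue. w x * A x\<bar> \<le> (LINT x|lebesgue. \<bar>w x * A x\<bar>)" by (rule integral_abs_bound)
  also have "(\<lambda>x. \<bar>w x * A x\<bar>) = (\<lambda>x. \<bar>w x\<bar> * A x)"
    using assms by (simp add: abs_mult fun_eq_iff less_imp_le)
  finally show ?thesis .
qed

end

section \<open>Scalar inequalities\<close>

lemma Hoelder_invert:
  fixes K X S c r :: real
  assumes K: "0 \<le> K" "K \<le> (X / c) powr (1 / r) * S powr (1 - 1 / r)"
    and X: "X \<ge> 0" and c: "c > 0" and S: "S > 0" and r: "r > 1"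
  shows "c * K powr r * S powr (1 - r) \<le> X"
proof -
  have "K powr r \<le> ((X / c) powr (1 / r) * S powr (1 - 1 / r)) powr r"
    using K r by (intro powr_mono2) auto
  also have "\<dots> = (X / c) powr (1 / r * r) * S powr ((1 - 1 / r) * r)"
    using X c S by (simp only: powr_mult powr_powr)
  also have "1 / r * r = 1" using r by simp
  also have "(1 - 1 / r) * r = r - 1" using r by (simp add: left_diff_distrib)
  also have "(X / c) powr 1 = X / c" using X c by simp
  finally have "K powr r * S powr (1 - r) \<le> (X / c * S powr (r - 1)) * S powr (1 - r)"
    by (intro mult_right_mono) auto
  also have "\<dots> = X / c * (S powr (r - 1) * S powr (1 - r))" by simp
  also have "S powr (r - 1) * S powr (1 - r) = 1" using S by (simp flip: powr_add)
  finally have "c * (K powr r * S powr (1 - r)) \<le> c * (X / c * 1)"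
    using c by (intro mult_left_mono) auto
  then show ?thesis using c by (simp add: mult.assoc)
qed

text \<open>The coefficient 1/2 of y is what allows absorption into the left side; the number \<tau>
  with \<tau>^q = 1/2 transfers the price to Z, and 1/\<tau> \<le> 2 keeps it explicit.\<close>

lemma Young_half:
  fixes y Z q :: real
  assumes y: "y \<ge> 0" and Z: "Z \<ge> 0" and q: "q > 1"
  shows "y powr (1 / q) * Z \<le> y / 2 + 2 powr (q / (q - 1)) * Z powr (q / (q - 1))"
proof -
  define q' where "q' = q / (q - 1)"
  have q': "q' > 1" "1 / q + 1 / q' = 1" "q' / q = q' - 1" "1 / q * q = 1"
    using q by (auto simp: q'_def field_simps)
  define \<tau> :: real where "\<tau> = (1 / 2) powr (1 / q)"
  have \<tau>: "\<tau> > 0" "\<tau> powr q = 1 / 2"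
    using q'(4) by (simp_all only: \<tau>_def powr_powr) simp_all
  have half: "1 / \<tau> \<le> 2"
  proof -
    have "1 / 2 = (1 / 2 :: real) powr 1" by simp
    also have "\<dots> \<le> \<tau>" unfolding \<tau>_def using q by (intro powr_mono') auto
    finally show ?thesis using \<tau>(1) by (simp add: field_simps)
  qed
  have "y powr (1 / q) * Z = (y powr (1 / q) * \<tau>) * (Z / \<tau>)" using \<tau> by simp
  also have "\<dots> \<le> (y powr (1 / q) * \<tau>) powr q / q + (Z / \<tau>) powr q' / q'"
    by (rule Youngs_inequality) (use q q' Z \<tau> in auto)
  also have "(y powr (1 / q) * \<tau>) powr q = y powr (1 / q * q) * \<tau> powr q"
    using \<tau> by (simp only: powr_mult powr_powr)
  also have "\<dots> = y / 2" using q'(4) \<tau> y by simp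
  also have "y / 2 / q \<le> y / 2" using y q by (simp add: divide_le_eq mult_le_cancel_left1)
  also have "(Z / \<tau>) powr q' / q' \<le> (Z / \<tau>) powr q'"
    using q' by (simp add: divide_le_eq mult_le_cancel_left1)
  also have "(Z / \<tau>) powr q' \<le> (2 * Z) powr q'"
  proof (rule powr_mono2)
    have "Z * (1 / \<tau>) \<le> Z * 2" using half Z by (intro mult_left_mono) auto
    then show "Z / \<tau> \<le> 2 * Z" by simp
  qed (use q' Z \<tau> in auto)
  also have "(2 * Z) powr q' = 2 powr q' * Z powr q'" using Z by (simp add: powr_mult)
  finally show ?thesis by (simp add: q'_def)
qed

text \<open>Lifespan bounds are proved for every finite R below T. This treats T = \<infinity>
  without a separate case: it would admit R above the bound.\<close>

lemma ereal_le_from_reals: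
  assumes "\<And>R. 0 < R \<Longrightarrow> ereal R < T \<Longrightarrow> R \<le> B" "0 \<le> B"
  shows "T \<le> ereal B"
proof (rule ccontr)
  assume "\<not> T \<le> ereal B"
  then obtain R where R: "ereal B < ereal R" "ereal R < T"
    using ereal_dense2[of "ereal B" T] by (auto simp: not_le)
  then show False using assms(1)[of R] assms(2) by simp
qed

lemma integrable_continuous_compact:
  fixes h :: "'a::euclidean_space \<Rightarrow> real"
  assumes "continuous_on UNIV h" "\<And>x. norm x > r \<Longrightarrow> h x = 0"
  shows "integrable lebesgue h"
proof -
  have "set_integrable lebesgue (cball 0 r) h"
    by (intro integrable_on_cball continuous_on_subset[OF assms(1)]) auto
  moreover have "(\<lambda>x. indicat_real (cball 0 r) x *\<^sub>R h x) = h"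
    using assms(2) by (auto simp: indicator_def fun_eq_iff not_le)
  ultimately show ?thesis by (simp add: set_integrable_def)
qed

text \<open>Only the data are fixed here. Solutions are quantified inside the statements, after the
  constants, which is what makes the constants independent of \<epsilon>, T and u.\<close>

locale blowup_data =
  fixes G :: "real \<Rightarrow> real \<Rightarrow> real" and a b p q r\<^sub>0 dec :: real and f g :: "'a::euclidean_space \<Rightarrow> real"
  assumes dec_eq: "dec = (real DIM('a) - 1) / 2"
    and p: "p > 1" and q: "q > 1" and a: "a > 0" and b: "b > 0" and r0: "r\<^sub>0 \<ge> 0"
    and G_lower: "\<And>s \<sigma>. G s \<sigma> \<ge> a * \<bar>s\<bar> powr q + b * \<bar>\<sigma>\<bar> powr p"
    and f_cont: "continuous_on UNIV f" and f_out: "\<And>x. norm x > r\<^sub>0 \<Longrightarrow> f x = 0"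
    and g_cont: "continuous_on UNIV g" and g_out: "\<And>x. norm x > r\<^sub>0 \<Longrightarrow> g x = 0"
    and g_pos: "(LINT x|lebesgue. g x) > 0"
begin

abbreviation solution :: "real \<Rightarrow> ereal \<Rightarrow> (real \<Rightarrow> 'a \<Rightarrow> real) \<Rightarrow> (real \<Rightarrow> 'a \<Rightarrow> real) \<Rightarrow> bool" where
  "solution \<epsilon> T u v \<equiv> cone_solution G \<epsilon> r\<^sub>0 f g T u v"

lemma G_lower_u: "a * \<bar>s\<bar> powr q \<le> G s \<sigma>" and G_lower_v: "b * \<bar>\<sigma>\<bar> powr p \<le> G s \<sigma>"
proof -
  have "a * \<bar>s\<bar> powr q \<ge> 0" "b * \<bar>\<sigma>\<bar> powr p \<ge> 0" using a b by auto
  then show "a * \<bar>s\<bar> powr q \<le> G s \<sigma>" "b * \<bar>\<sigma>\<bar> powr p \<le> G s \<sigma>" using G_lower[of s \<sigma>] by linarith+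
qed

section \<open>Lower bounds for pairings and source in terms of the data\<close>

lemma avg_exp_perturbation:
  assumes h: "continuous_on UNIV h" "\<And>x. norm x > r\<^sub>0 \<Longrightarrow> h x = 0" and n: "n \<ge> 1" and l: "l \<ge> 0"
  shows "\<bar>(LINT x|lebesgue. h x * avg_exp n l (x::'a)) - (LINT x|lebesgue. h x)\<bar>
      \<le> (exp (l * r\<^sub>0) - 1) * (LINT x|lebesgue. \<bar>h x\<bar>)"
    "\<bar>LINT x|lebesgue. h x * avg_exp n l x\<bar> \<le> exp (l * r\<^sub>0) * (LINT x|lebesgue. \<bar>h x\<bar>)"
proof -
  have i1: "integrable lebesgue h" by (rule integrable_continuous_compact[OF h])
  have i2: "integrable lebesgue (\<lambda>x. h x * avg_exp n l x)"
    by (rule integrable_continuous_compact[of _ r\<^sub>0]) (auto intro!: continuous_intros h)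
  have E: "exp (- (l * r\<^sub>0)) \<le> avg_exp n l x" "avg_exp n l x \<le> exp (l * r\<^sub>0)" if "norm x \<le> r\<^sub>0" for x :: 'a
    using avg_exp_bounds[OF n l that] by auto
  have "(LINT x|lebesgue. h x * avg_exp n l x) - (LINT x|lebesgue. h x) = (LINT x|lebesgue. h x * avg_exp n l x - h x)"
    using i1 i2 by simp
  also have "\<bar>\<dots>\<bar> \<le> (LINT x|lebesgue. \<bar>h x * avg_exp n l x - h x\<bar>)" by (rule integral_abs_bound)
  also have "\<dots> \<le> (LINT x|lebesgue. (exp (l * r\<^sub>0) - 1) * \<bar>h x\<bar>)"
  proof (rule integral_mono)
    show "integrable lebesgue (\<lambda>x. \<bar>h x * avg_exp n l x - h x\<bar>)"
      using i1 i2 by (intro integrable_abs Bochner_Integration.integrable_diff)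
    show "integrable lebesgue (\<lambda>x. (exp (l * r\<^sub>0) - 1) * \<bar>h x\<bar>)"
      using i1 by (intro integrable_mult_right integrable_abs)
    fix x :: 'a
    show "\<bar>h x * avg_exp n l x - h x\<bar> \<le> (exp (l * r\<^sub>0) - 1) * \<bar>h x\<bar>"
    proof (cases "norm x > r\<^sub>0")
      case False
      have "1 - exp (- (l * r\<^sub>0)) \<le> exp (l * r\<^sub>0) - 1"
        using exp_ge_add_one_self[of "l * r\<^sub>0"] exp_ge_add_one_self[of "- (l * r\<^sub>0)"] by linarith
      then have "\<bar>avg_exp n l x - 1\<bar> \<le> exp (l * r\<^sub>0) - 1"
        using E[of x] False by (simp add: abs_le_iff)
      then have "\<bar>avg_exp n l x - 1\<bar> * \<bar>h x\<bar> \<le> (exp (l * r\<^sub>0) - 1) * \<bar>h x\<bar>" by (intro mult_right_mono) auto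
      moreover have "h x * avg_exp n l x - h x = (avg_exp n l x - 1) * h x" by (simp add: algebra_simps)
      ultimately show ?thesis by (simp only: abs_mult)
    qed (simp add: h(2))
  qed
  finally show "\<bar>(LINT x|lebesgue. h x * avg_exp n l x) - (LINT x|lebesgue. h x)\<bar>
      \<le> (exp (l * r\<^sub>0) - 1) * (LINT x|lebesgue. \<bar>h x\<bar>)" by simp
  have "\<bar>LINT x|lebesgue. h x * avg_exp n l x\<bar> \<le> (LINT x|lebesgue. \<bar>h x * avg_exp n l x\<bar>)" by (rule integral_abs_bound)
  also have "\<dots> \<le> (LINT x|lebesgue. exp (l * r\<^sub>0) * \<bar>h x\<bar>)"
  proof (rule integral_mono)
    show "integrable lebesgue (\<lambda>x. \<bar>h x * avg_exp n l x\<bar>)" using i2 by (rule integrable_abs)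
    show "integrable lebesgue (\<lambda>x. exp (l * r\<^sub>0) * \<bar>h x\<bar>)"
      using i1 by (intro integrable_mult_right integrable_abs)
    fix x :: 'a
    show "\<bar>h x * avg_exp n l x\<bar> \<le> exp (l * r\<^sub>0) * \<bar>h x\<bar>"
    proof (cases "norm x > r\<^sub>0")
      case False
      have "\<bar>avg_exp n l x\<bar> \<le> exp (l * r\<^sub>0)"
        using E[of x] False avg_exp_pos[OF n, of l x] by simp
      then have "\<bar>h x\<bar> * \<bar>avg_exp n l x\<bar> \<le> \<bar>h x\<bar> * exp (l * r\<^sub>0)" by (rule mult_left_mono) simp
      then show ?thesis by (simp only: abs_mult mult.commute)
    qed (simp add: h(2))
  qed
  finally show "\<bar>LINT x|lebesgue. h x * avg_exp n l x\<bar> \<le> exp (l * r\<^sub>0) * (LINT x|lebesgue. \<bar>h x\<bar>)" by simp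
qed

text \<open>On the support of the data the averaged waves tend to 1 with the frequency, uniformly in
  \<open>n\<close>, so both combinations tend to the positive integral of g. The plus sign starts
  the momentum, the minus sign is the initial condition of the damped bounds, and all frequencies
  below l are included because packets use l / 2^i.\<close>

lemma small_frequency:
  "\<exists>l c C. 0 < l \<and> 0 < c \<and> 0 \<le> C \<and> (\<forall>l' n. 0 < l' \<and> l' \<le> l \<and> n \<ge> 1 \<longrightarrow>
     (LINT x|lebesgue. g x * avg_exp n l' x) + l' * (LINT x|lebesgue. f x * avg_exp n l' x) \<ge> c \<and>
     (LINT x|lebesgue. g x * avg_exp n l' x) - l' * (LINT x|lebesgue. f x * avg_exp n l' x) \<ge> c \<and>
     \<bar>LINT x|lebesgue. f x * avg_exp n l' x\<bar> \<le> C)"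
proof -
  define g0 Gn Fn where "g0 = (LINT x|lebesgue. g x)" and "Gn = (LINT x|lebesgue. \<bar>g x\<bar>)"
    and "Fn = (LINT x|lebesgue. \<bar>f x\<bar>)"
  have g0: "g0 > 0" using g_pos by (simp add: g0_def)
  have Fn: "Fn \<ge> 0" by (simp add: Fn_def)
  define \<eta> where "\<eta> l = (exp (l * r\<^sub>0) - 1) * Gn + l * (exp (l * r\<^sub>0) * Fn)" for l
  have "isCont \<eta> 0" unfolding \<eta>_def[abs_def] by (intro continuous_intros)
  then obtain d where d: "d > 0" "\<And>l. \<bar>l\<bar> < d \<Longrightarrow> \<bar>\<eta> l - \<eta> 0\<bar> < g0 / 2"
    using g0 unfolding continuous_at_eps_delta dist_real_def by (metis diff_0_right half_gt_zero)
  have \<eta>0: "\<eta> 0 = 0" by (simp add: \<eta>_def)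
  define l where "l = d / 2"
  have "(LINT x|lebesgue. g x * avg_exp n l' x) + l' * (LINT x|lebesgue. f x * avg_exp n l' x) \<ge> g0 / 2 \<and>
     (LINT x|lebesgue. g x * avg_exp n l' x) - l' * (LINT x|lebesgue. f x * avg_exp n l' x) \<ge> g0 / 2 \<and>
     \<bar>LINT x|lebesgue. f x * avg_exp n l' x\<bar> \<le> exp (l * r\<^sub>0) * Fn"
    if l': "0 < l'" "l' \<le> l" and n: "n \<ge> 1" for l' and n :: nat
  proof -
    have \<eta>: "\<eta> l' < g0 / 2" using d(2)[of l'] l' d(1) \<eta>0 by (simp add: l_def)
    have 1: "\<bar>(LINT x|lebesgue. g x * avg_exp n l' x) - g0\<bar> \<le> (exp (l' * r\<^sub>0) - 1) * Gn"
      using avg_exp_perturbation(1)[OF g_cont g_out n, of l'] l' by (simp add: g0_def Gn_def)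
    have 2: "\<bar>LINT x|lebesgue. f x * avg_exp n l' x\<bar> \<le> exp (l' * r\<^sub>0) * Fn"
      using avg_exp_perturbation(2)[OF f_cont f_out n, of l'] l' by (simp add: Fn_def)
    have 3: "\<bar>l' * (LINT x|lebesgue. f x * avg_exp n l' x)\<bar> \<le> l' * (exp (l' * r\<^sub>0) * Fn)"
      using 2 l' by (simp add: abs_mult)
    have "exp (l' * r\<^sub>0) * Fn \<le> exp (l * r\<^sub>0) * Fn"
      using l' r0 Fn by (intro mult_right_mono) (auto intro: mult_right_mono)
    with 2 have 4: "\<bar>LINT x|lebesgue. f x * avg_exp n l' x\<bar> \<le> exp (l * r\<^sub>0) * Fn" by linarith
    show ?thesis
      using 1 3 \<eta> unfolding \<eta>_def by (intro conjI 4) (simp only: abs_le_iff; linarith)+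
  qed
  moreover have "l > 0" using d by (simp add: l_def)
  moreover have "g0 / 2 > 0" using g0 by simp
  moreover have "exp (l * r\<^sub>0) * Fn \<ge> 0" using Fn by simp
  ultimately show ?thesis by blast
qed

end

text \<open>The source is nonnegative, so the momentum never falls below its initial value, which is
  at least \<epsilon> c. The first bound retains the accumulated source, from which the Bernoulli
  inequality is built; the second isolates a transient coming from f.\<close>

lemma (in cone_solution) exponential_pairing_bounds:
  assumes t: "0 \<le> t" "t < T1" "ereal T1 < T" and l: "l > 0" and n: "n \<ge> 1" and \<epsilon>: "\<epsilon> > 0"
    and c: "c > 0"
      "(LINT x|lebesgue. g x * avg_exp n l x) + l * (LINT x|lebesgue. f x * avg_exp n l x) \<ge> c"
      "(LINT x|lebesgue. g x * avg_exp n l x) - l * (LINT x|lebesgue. f x * avg_exp n l x) \<ge> c"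
      "\<bar>LINT x|lebesgue. f x * avg_exp n l x\<bar> \<le> C"
  shows "exp (- (l * t)) * Vpair (avg_exp n l) t
      \<ge> (\<epsilon> * c + integral {0..t} (\<lambda>s. exp (- (l * s)) * Gpair (avg_exp n l) s)) / 2"
    "exp (- (l * t)) * Upair (avg_exp n l) t \<ge> \<epsilon> * (c / (2 * l) - (C + c / (2 * l)) * exp (- (l * t)))"
proof -
  define \<phi> :: "'a \<Rightarrow> real" where "\<phi> = avg_exp n l"
  have wm: "wave_mode l \<phi>" unfolding \<phi>_def by (rule wave_mode_avg_exp)
  have \<phi>_cont: "continuous_on UNIV \<phi>" by (rule wave_mode_continuous[OF wm])
  have \<phi>_pos: "\<phi> x \<ge> 0" for x unfolding \<phi>_def using avg_exp_pos[OF n, of l x] by simp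
  define m where "m s = exp (- (l * s)) * Gpair \<phi> s" for s
  have m_nn: "m s \<ge> 0" for s unfolding m_def using Gpair_nonneg[OF \<phi>_pos] by simp
  have T1: "0 \<le> T1" using t by simp
  have m_int: "m integrable_on {0..T1}"
    unfolding m_def[abs_def]
    by (intro set_lebesgue_integral_eq_integral(1) Gpair_times_continuous[OF T1 t(3) \<phi>_cont] continuous_intros)
  define M where "M s = exp (- (l * s)) * (Vpair \<phi> s + l * Upair \<phi> s)" for s
  have M_eq: "M s = Vpair \<phi> 0 + l * Upair \<phi> 0 + integral {0..s} m" if "0 \<le> s" "s < T1" for s
    unfolding M_def m_def[abs_def] by (rule momentum_identity[OF that t(3) wm])
  have M0: "M 0 = \<epsilon> * ((LINT x|lebesgue. g x * \<phi> x) + l * (LINT x|lebesgue. f x * \<phi> x))"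
    by (simp add: M_def Upair_0[OF \<phi>_cont] Vpair_0[OF \<phi>_cont] algebra_simps)
  have M0c: "M 0 \<ge> \<epsilon> * c" unfolding M0 using c \<epsilon> by (intro mult_left_mono) (auto simp: \<phi>_def)
  have tT: "ereal t < T" using t le_less_trans[of "ereal t" "ereal T1" T] by simp
  have mono: "M s \<le> M s'" if "0 \<le> s" "s \<le> s'" "s' \<le> t" for s s'
  proof -
    have "integral {0..s} m \<le> integral {0..s'} m"
      using that t m_nn by (intro integral_subset_le integrable_subinterval_real[OF m_int]) auto
    then show ?thesis using M_eq[of s] M_eq[of s'] that t by simp
  qed
  have init: "Vpair \<phi> 0 - l * Upair \<phi> 0 \<ge> 0"
  proof -
    have "Vpair \<phi> 0 - l * Upair \<phi> 0 = \<epsilon> * ((LINT x|lebesgue. g x * \<phi> x) - l * (LINT x|lebesgue. f x * \<phi> x))"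
      by (simp add: Upair_0[OF \<phi>_cont] Vpair_0[OF \<phi>_cont] algebra_simps)
    also have "\<dots> \<ge> 0" using c \<epsilon> by (intro mult_nonneg_nonneg) (auto simp: \<phi>_def)
    finally show ?thesis .
  qed
  note B = damped_lower_bounds[OF l t(1) order_refl Upair_deriv[OF t(1) tT \<phi>_cont] mono[unfolded M_def] init]
  have "exp (- (l * t)) * Vpair \<phi> t \<ge> M t / 2" using B(1) by (simp add: M_def)
  moreover have "M t \<ge> \<epsilon> * c + integral {0..t} m"
    using M_eq[OF t(1,2)] M_eq[of 0] M0c t by simp
  ultimately show "exp (- (l * t)) * Vpair (avg_exp n l) t
      \<ge> (\<epsilon> * c + integral {0..t} (\<lambda>s. exp (- (l * s)) * Gpair (avg_exp n l) s)) / 2"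
    unfolding m_def[abs_def] \<phi>_def by simp
  have "exp (- (l * t)) * Upair \<phi> t \<ge> exp (- (l * t)) * Upair \<phi> 0 + M 0 / (2 * l) * (1 - exp (- (l * t)))"
    using B(2) by (simp add: M_def)
  moreover have "exp (- (l * t)) * Upair \<phi> 0 \<ge> exp (- (l * t)) * (- (\<epsilon> * C))"
  proof (rule mult_left_mono)
    have "- C \<le> (LINT x|lebesgue. f x * \<phi> x)" using c(4) by (simp add: \<phi>_def abs_le_iff)
    then have "\<epsilon> * (- C) \<le> \<epsilon> * (LINT x|lebesgue. f x * \<phi> x)" using \<epsilon> by (intro mult_left_mono) auto
    then show "- (\<epsilon> * C) \<le> Upair \<phi> 0" by (simp add: Upair_0[OF \<phi>_cont])
  qed simp
  moreover have "M 0 / (2 * l) * (1 - exp (- (l * t))) \<ge> \<epsilon> * c / (2 * l) * (1 - exp (- (l * t)))"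
    using M0c l t by (intro mult_right_mono divide_right_mono) auto
  ultimately have "exp (- (l * t)) * Upair \<phi> t \<ge> exp (- (l * t)) * (- (\<epsilon> * C)) + \<epsilon> * c / (2 * l) * (1 - exp (- (l * t)))"
    by linarith
  also have "exp (- (l * t)) * (- (\<epsilon> * C)) + \<epsilon> * c / (2 * l) * (1 - exp (- (l * t)))
      = \<epsilon> * (c / (2 * l) - (C + c / (2 * l)) * exp (- (l * t)))"
    by (simp add: algebra_simps diff_divide_distrib)
  finally show "exp (- (l * t)) * Upair (avg_exp n l) t \<ge> \<epsilon> * (c / (2 * l) - (C + c / (2 * l)) * exp (- (l * t)))"
    by (simp add: \<phi>_def)
qed

context blowup_data
begin

lemma solution_G_lower:
  assumes sol: "solution \<epsilon> T u v" and t: "0 \<le> t" "ereal t < T"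
    and int: "integrable lebesgue (\<lambda>x. G (u t x) (v t x))"
    and w: "(w, r, c) \<in> {(u t, q, a), (v t, p, b)}"
  shows "in_L2 w" "AE x in lebesgue. norm x > r\<^sub>0 + t \<longrightarrow> w x = 0"
    "\<And>x. c * \<bar>w x\<bar> powr r \<le> G (u t x) (v t x)" "r > 1" "c > 0"
proof -
  interpret cone_solution G \<epsilon> r\<^sub>0 f g T u v by (rule sol)
  have tI: "t \<in> I" using t by simp
  show "in_L2 w" "AE x in lebesgue. norm x > r\<^sub>0 + t \<longrightarrow> w x = 0"
    "\<And>x. c * \<bar>w x\<bar> powr r \<le> G (u t x) (v t x)" "r > 1" "c > 0"
    using w u_L2[OF tI] v_L2[OF tI] u_vanish[OF tI] v_vanish[OF tI] G_lower_u G_lower_v p q a b by auto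
qed

text \<open>Hoelder's inequality against the constant weight 1: a pairing of size \<epsilon> with a
  wave concentrated near the cone forces a definite mass of |w|^r. The exponent is (2 dec - dec
  r')(1 - r) = dec (2 - r).\<close>

lemma source_lower_bound:
  assumes l: "l > 0" and \<kappa>: "\<kappa> > 0" and r: "r > 1" and c: "c > 0"
  shows "\<exists>k>0. \<forall>\<epsilon> T u v t n w. solution \<epsilon> T u v \<and> \<epsilon> > 0 \<and> 0 \<le> t \<and> ereal t < T \<and>
     integrable lebesgue (\<lambda>x. G (u t x) (v t x)) \<and> (w, r, c) \<in> {(u t, q, a), (v t, p, b)} \<and>
     r\<^sub>0 + 1 + t \<le> real n \<and> exp (- (l * t)) * (LINT x|lebesgue. w x * avg_exp n l x) \<ge> \<kappa> * \<epsilon> \<longrightarrow>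
     (LINT x|lebesgue. G (u t x) (v t x)) \<ge> k * \<epsilon> powr r * (r\<^sub>0 + 1 + t) powr (dec * (2 - r))"
proof -
  define r' where "r' = r / (r - 1)"
  have r': "r' \<ge> 1" "r' * (r - 1) = r" using r by (auto simp: r'_def field_simps)
  obtain C where C: "C > 0" "\<And>n t. 0 \<le> t \<Longrightarrow> r\<^sub>0 + 1 + t \<le> real n \<Longrightarrow>
    (LINT x:cball (0::'a) (r\<^sub>0 + t)|lebesgue. (exp (- (l * t)) * avg_exp n l x) powr r')
      \<le> C * (r\<^sub>0 + 1 + t) powr (2 * dec - dec * r')"
    using avg_exp_cone_integral[OF l r0 r'(1), where 'a='a] unfolding dec_eq[symmetric] by blast
  define k where "k = c * \<kappa> powr r * C powr (1 - r)"
  have k0: "k > 0" using c \<kappa> C(1) by (simp add: k_def)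
  have "(LINT x|lebesgue. G (u t x) (v t x)) \<ge> k * \<epsilon> powr r * (r\<^sub>0 + 1 + t) powr (dec * (2 - r))"
    if sol: "solution \<epsilon> T u v" and \<epsilon>: "\<epsilon> > 0" and t: "0 \<le> t" "ereal t < T"
      and int: "integrable lebesgue (\<lambda>x. G (u t x) (v t x))" and w: "(w, r, c) \<in> {(u t, q, a), (v t, p, b)}"
      and n: "r\<^sub>0 + 1 + t \<le> real n" and low: "exp (- (l * t)) * (LINT x|lebesgue. w x * avg_exp n l x) \<ge> \<kappa> * \<epsilon>"
    for \<epsilon> T u v t n w
  proof -
    interpret cone_solution G \<epsilon> r\<^sub>0 f g T u v by (rule sol)
    note w = solution_G_lower[OF sol t int w]
    have n1: "n \<ge> 1" using n r0 t by simp
    define s where "s = r\<^sub>0 + 1 + t"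
    have s0: "s > 0" using r0 t by (simp add: s_def)
    define A where "A x = exp (- (l * t)) * avg_exp n l x" for x :: 'a
    have A: "continuous_on UNIV A" "\<And>x. A x > 0"
      unfolding A_def[abs_def] by (auto intro!: continuous_intros mult_pos_pos avg_exp_pos n1)
    have tI: "t \<in> I" using t by simp
    have "\<kappa> * \<epsilon> \<le> (LINT x|lebesgue. w x * A x)"
    proof -
      have "w x * A x = exp (- (l * t)) * (w x * avg_exp n l x)" for x by (simp add: A_def)
      then show ?thesis using low by (simp only: integral_mult_right_zero)
    qed
    also have "\<dots> \<le> (LINT x|lebesgue. \<bar>w x\<bar> * A x)" using abs_pair_le[of A w, OF A(2)] by linarith
    also have "\<dots> \<le> (Gpair (\<lambda>x. 1) t / c) powr (1 / r) * (C * s powr (2 * dec - dec * r')) powr (1 - 1 / r)"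
    proof (rule pair_Hoelder[OF tI int r c w(1-3) A])
      show "C * s powr (2 * dec - dec * r') > 0" using C(1) s0 by simp
      show "(LINT x:cball 0 (r\<^sub>0 + t)|lebesgue. A x powr (r / (r - 1)) * 1 powr (1 - r / (r - 1)))
          \<le> C * s powr (2 * dec - dec * r')"
        using C(2)[OF t(1) n] by (simp add: A_def s_def r'_def)
    qed auto
    finally have "c * (\<kappa> * \<epsilon>) powr r * (C * s powr (2 * dec - dec * r')) powr (1 - r) \<le> Gpair (\<lambda>x. 1) t"
      using \<kappa> \<epsilon> C(1) s0 by (intro Hoelder_invert[OF _ _ Gpair_nonneg c _ r]) auto
    moreover have "(C * s powr (2 * dec - dec * r')) powr (1 - r) = C powr (1 - r) * s powr (dec * (2 - r))"
    proof -
      have "(2 * dec - dec * r') * (1 - r) = 2 * dec * (1 - r) + dec * (r' * (r - 1))" by (simp only: algebra_simps)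
      also have "\<dots> = dec * (2 - r)" unfolding r'(2) by (simp only: algebra_simps)
      finally show ?thesis using C(1) s0 by (simp only: powr_mult powr_powr less_imp_le powr_ge_zero)
    qed
    moreover have "(\<kappa> * \<epsilon>) powr r = \<kappa> powr r * \<epsilon> powr r" using \<kappa> \<epsilon> by (simp add: powr_mult)
    ultimately show ?thesis by (simp add: Gpair_def k_def s_def mult_ac)
  qed
  then show ?thesis using k0 by blast
qed

end

section \<open>Bernoulli inequality for the pairing with the time derivative\<close>

context blowup_data
begin

lemma solution_good_times:
  assumes "solution \<epsilon> T u v"
  obtains N where "negligible N" "0 \<in> N"
    "\<And>t. t \<notin> N \<Longrightarrow> 0 \<le> t \<Longrightarrow> ereal t < T \<Longrightarrow> integrable lebesgue (\<lambda>x. G (u t x) (v t x))"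
proof -
  interpret cone_solution G \<epsilon> r\<^sub>0 f g T u v by (rule assms)
  obtain N where N: "negligible N"
    "\<And>t. t \<notin> N \<Longrightarrow> t \<in> J \<longrightarrow> integrable lebesgue (\<lambda>x. G (u t x) (v t x))"
    using lebesgue_AE_negligible[OF G_integrable_AE] by blast
  show ?thesis
  \<comment> \<open>Spatial integrability of the source is known for almost every positive time, so
    0 joins the exceptional set.\<close>
  proof (rule that[of "insert 0 N"])
    show "negligible (insert 0 N)" using N(1) by simp
    fix t assume "t \<notin> insert 0 N" "0 \<le> t" "ereal t < T"
    then show "integrable lebesgue (\<lambda>x. G (u t x) (v t x))" using N(2)[of t] by simp
  qed simp
qed

text \<open>The same wave is used as weight on both sides of Hoelder's inequality, so that the
  source pairing is bounded below by its own time integral: m \<ge> cc (\<epsilon> c + \<integral>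
  m)^p s^(-dec (p - 1)). The primitive A is left open for the power and the logarithm.\<close>

lemma Glassey_estimate:
  "\<exists>k>0. \<forall>\<epsilon> T u v T1 A. solution \<epsilon> T u v \<and> \<epsilon> > 0 \<and> 0 \<le> T1 \<and> ereal T1 < T \<and>
     (\<forall>t\<in>{0..T1}. (A has_real_derivative (r\<^sub>0 + 1 + t) powr - (dec * (p - 1))) (at t within {0..T1})) \<longrightarrow>
     k * (A T1 - A 0) \<le> \<epsilon> powr (1 - p)"
proof -
  obtain l c C where l: "0 < l" and c: "0 < c" and data: "\<And>l' n. 0 < l' \<Longrightarrow> l' \<le> l \<Longrightarrow> n \<ge> 1 \<Longrightarrow>
     (LINT x|lebesgue. g x * avg_exp n l' x) + l' * (LINT x|lebesgue. f x * avg_exp n l' x) \<ge> c \<and>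
     (LINT x|lebesgue. g x * avg_exp n l' x) - l' * (LINT x|lebesgue. f x * avg_exp n l' x) \<ge> c \<and>
     \<bar>LINT x|lebesgue. f x * avg_exp n l' x\<bar> \<le> C"
    using small_frequency by blast
  obtain C1 where C1: "C1 > 0" "\<And>n t. 0 \<le> t \<Longrightarrow> r\<^sub>0 + 1 + t \<le> real n \<Longrightarrow>
    (LINT x:cball (0::'a) (r\<^sub>0 + t)|lebesgue. (exp (- (l * t)) * avg_exp n l x) powr 1)
      \<le> C1 * (r\<^sub>0 + 1 + t) powr (2 * dec - dec * 1)"
    using avg_exp_cone_integral[OF l r0 order_refl, where 'a='a] unfolding dec_eq[symmetric] by blast
  define cc where "cc = b * (1 / 2) powr p * C1 powr (1 - p)"
  have cc: "cc > 0" using b C1 by (simp add: cc_def)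
  define k where "k = (p - 1) * cc * c powr (p - 1)"
  have k: "k > 0" using p cc c by (simp add: k_def)
  have "k * (A T1 - A 0) \<le> \<epsilon> powr (1 - p)"
    if sol: "solution \<epsilon> T u v" and \<epsilon>: "\<epsilon> > 0" and T1: "0 \<le> T1" "ereal T1 < T"
      and A: "\<And>t. t \<in> {0..T1} \<Longrightarrow> (A has_real_derivative (r\<^sub>0 + 1 + t) powr - (dec * (p - 1))) (at t within {0..T1})"
    for \<epsilon> T u v T1 A
  proof -
    interpret cone_solution G \<epsilon> r\<^sub>0 f g T u v by (rule sol)
    obtain T2 where T2: "T1 < T2" "ereal T2 < T" using ereal_dense2[OF T1(2)] by auto
    obtain N where N: "negligible N" "0 \<in> N"
      "\<And>t. t \<notin> N \<Longrightarrow> 0 \<le> t \<Longrightarrow> ereal t < T \<Longrightarrow> integrable lebesgue (\<lambda>x. G (u t x) (v t x))"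
      using solution_good_times[OF sol] by blast
    define n where "n = nat \<lceil>r\<^sub>0 + 1 + T1\<rceil>"
    have n: "r\<^sub>0 + 1 + T1 \<le> real n" unfolding n_def by linarith
    have n1: "n \<ge> 1" using n r0 T1 by simp
    define m where "m s = exp (- (l * s)) * Gpair (avg_exp n l) s" for s
    have m_nn: "m s \<ge> 0" for s
      unfolding m_def using less_imp_le[OF avg_exp_pos[OF n1]] by (intro mult_nonneg_nonneg Gpair_nonneg) auto
    have m_int: "m integrable_on {0..T1}"
      unfolding m_def[abs_def]
      by (intro set_lebesgue_integral_eq_integral(1) Gpair_times_continuous[OF T1] continuous_intros)
    have "(p - 1) * cc * (A T1 - A 0) \<le> (\<epsilon> * c) powr (1 - p)"
    proof (rule Bernoulli_blowup[OF p cc _ T1(1) _ m_int N(1) _ _ A])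
      show "\<epsilon> * c > 0" using \<epsilon> c by simp
      show "r\<^sub>0 + 1 > 0" using r0 by simp
      show "m t \<ge> 0" for t by (rule m_nn)
      fix t assume t: "t \<in> {0..T1} - N"
      have tT: "0 \<le> t" "ereal t < T" using t le_less_trans[of "ereal t" "ereal T1" T] T1 by auto
      have tI: "t \<in> I" using tT by simp
      have int: "integrable lebesgue (\<lambda>x. G (u t x) (v t x))" using N(3)[of t] t tT by auto
      define s where "s = r\<^sub>0 + 1 + t"
      have s: "s > 0" "s \<le> real n" using r0 t n by (auto simp: s_def)
      define L where "L = \<epsilon> * c + integral {0..t} m"
      have L: "L \<ge> 0" unfolding L_def using t \<epsilon> c m_nn
        by (intro add_nonneg_nonneg integral_nonneg integrable_subinterval_real[OF m_int]) auto
      define B where "B x = exp (- (l * t)) * avg_exp n l x" for x :: 'a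
      have B: "continuous_on UNIV B" "\<And>x. B x > 0"
        unfolding B_def[abs_def] by (auto intro!: continuous_intros mult_pos_pos avg_exp_pos n1)
      note w = solution_G_lower[OF sol tT int, of "v t" p b, simplified]
      have "L / 2 \<le> exp (- (l * t)) * Vpair (avg_exp n l) t"
        using exponential_pairing_bounds(1)[of t T2 l n c C] data[OF l order_refl n1] T2 t l n1 \<epsilon> c
        by (simp add: L_def m_def[abs_def])
      also have "\<dots> = (LINT x|lebesgue. v t x * B x)"
      proof -
        have "v t x * B x = exp (- (l * t)) * (v t x * avg_exp n l x)" for x by (simp add: B_def)
        then show ?thesis by (simp only: Vpair_def integral_mult_right_zero)
      qed
      also have "\<dots> \<le> (LINT x|lebesgue. \<bar>v t x\<bar> * B x)" using abs_pair_le[of B "v t", OF B(2)] by linarith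
      also have "\<dots> \<le> (Gpair B t / b) powr (1 / p) * (C1 * s powr dec) powr (1 - 1 / p)"
      proof (rule pair_Hoelder[OF tI int p b w(1-3) B B])
        show "C1 * s powr dec > 0" using C1 s by simp
        \<comment> \<open>With equal weights the exponents p' and 1 - p' add up to 1, and the cone
          integral of the wave itself, of order s^dec, is enough.\<close>
        have "B x powr (p / (p - 1)) * B x powr (1 - p / (p - 1)) = B x powr 1" for x
          by (simp flip: powr_add)
        then show "(LINT x:cball 0 (r\<^sub>0 + t)|lebesgue. B x powr (p / (p - 1)) * B x powr (1 - p / (p - 1))) \<le> C1 * s powr dec"
          using C1(2)[of t n] tT s by (simp add: B_def s_def)
      qed
      finally have "b * (L / 2) powr p * (C1 * s powr dec) powr (1 - p) \<le> Gpair B t"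
        using L C1 s less_imp_le[OF B(2)] by (intro Hoelder_invert[OF _ _ Gpair_nonneg b _ p]) auto
      moreover have "Gpair B t = m t"
      proof -
        have "G (u t x) (v t x) * B x = exp (- (l * t)) * (G (u t x) (v t x) * avg_exp n l x)" for x
          by (simp add: B_def)
        then show ?thesis by (simp only: Gpair_def m_def integral_mult_right_zero)
      qed
      moreover have "(C1 * s powr dec) powr (1 - p) = C1 powr (1 - p) * s powr - (dec * (p - 1))"
        using C1 s by (simp add: powr_mult powr_powr algebra_simps)
      moreover have "(L / 2) powr p = (1 / 2) powr p * L powr p"
        using L by (simp flip: powr_mult)
      ultimately show "m t \<ge> cc * (\<epsilon> * c + integral {0..t} m) powr p * (r\<^sub>0 + 1 + t) powr - (dec * (p - 1))"
        by (simp add: cc_def L_def s_def mult_ac)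
    qed
    then have "c powr (p - 1) * ((p - 1) * cc * (A T1 - A 0)) \<le> c powr (p - 1) * (\<epsilon> * c) powr (1 - p)"
      by (intro mult_left_mono) auto
    also have "\<dots> = (c powr (p - 1) * c powr (1 - p)) * \<epsilon> powr (1 - p)"
      using \<epsilon> c by (simp add: powr_mult)
    also have "c powr (p - 1) * c powr (1 - p) = 1" using c by (simp flip: powr_add)
    finally show ?thesis by (simp add: k_def mult_ac)
  qed
  then show ?thesis using k by blast
qed

section \<open>Source lower bound against the upper bound from a time cut-off\<close>

lemma pairing_lower_bound:
  "\<exists>l \<kappa> t0. 0 < l \<and> 0 < \<kappa> \<and> 0 \<le> t0 \<and> (\<forall>\<epsilon> T u v t n. solution \<epsilon> T u v \<and> \<epsilon> > 0 \<and> t0 \<le> t \<and> ereal t < T \<and> n \<ge> 1 \<longrightarrow>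
     exp (- (l * t)) * (LINT x|lebesgue. u t x * avg_exp n l x) \<ge> \<kappa> * \<epsilon> \<and>
     exp (- (l * t)) * (LINT x|lebesgue. v t x * avg_exp n l x) \<ge> \<kappa> * \<epsilon>)"
proof -
  obtain l c C where l: "0 < l" and c: "0 < c" and C: "C \<ge> 0" and data: "\<And>l' n. 0 < l' \<Longrightarrow> l' \<le> l \<Longrightarrow> n \<ge> 1 \<Longrightarrow>
     (LINT x|lebesgue. g x * avg_exp n l' x) + l' * (LINT x|lebesgue. f x * avg_exp n l' x) \<ge> c \<and>
     (LINT x|lebesgue. g x * avg_exp n l' x) - l' * (LINT x|lebesgue. f x * avg_exp n l' x) \<ge> c \<and>
     \<bar>LINT x|lebesgue. f x * avg_exp n l' x\<bar> \<le> C"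
    using small_frequency by blast
  define D where "D = C + c / (2 * l)"
  have D: "D > 0" unfolding D_def using C c l by (intro add_nonneg_pos) auto
  define \<eta> where "\<eta> = c / (4 * l)"
  have \<eta>: "\<eta> > 0" using c l by (simp add: \<eta>_def)
  \<comment> \<open>After \<open>t0\<close> the transient D exp (-l t) is at most \<eta>, half of
    the limiting value c / (2 l) = 2 \<eta>.\<close>
  define t0 where "t0 = max 0 (ln (D / \<eta>) / l)"
  define \<kappa> where "\<kappa> = min (c / 2) \<eta>"
  have \<kappa>: "\<kappa> > 0" using c \<eta> by (simp add: \<kappa>_def)
  have "exp (- (l * t)) * (LINT x|lebesgue. u t x * avg_exp n l x) \<ge> \<kappa> * \<epsilon> \<and>
     exp (- (l * t)) * (LINT x|lebesgue. v t x * avg_exp n l x) \<ge> \<kappa> * \<epsilon>"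
    if sol: "solution \<epsilon> T u v" and \<epsilon>: "\<epsilon> > 0" and t: "t0 \<le> t" "ereal t < T" and n: "n \<ge> 1" for \<epsilon> T u v t n
  proof -
    interpret cone_solution G \<epsilon> r\<^sub>0 f g T u v by (rule sol)
    have t0: "0 \<le> t" using t by (simp add: t0_def)
    obtain T2 where T2: "t < T2" "ereal T2 < T" using ereal_dense2[OF t(2)] by auto
    note B = exponential_pairing_bounds[OF t0 T2 l n \<epsilon> c, of C]
    have i: "integral {0..t} (\<lambda>s. exp (- (l * s)) * Gpair (avg_exp n l) s) \<ge> 0"
    proof (rule integral_nonneg)
      show "(\<lambda>s. exp (- (l * s)) * Gpair (avg_exp n l) s) integrable_on {0..t}"
        by (intro set_lebesgue_integral_eq_integral(1) Gpair_times_continuous[OF t0 t(2)] continuous_intros)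
      show "0 \<le> exp (- (l * s)) * Gpair (avg_exp n l) s" for s
        using less_imp_le[OF avg_exp_pos[OF n]] by (intro mult_nonneg_nonneg Gpair_nonneg) auto
    qed
    have V: "exp (- (l * t)) * Vpair (avg_exp n l) t \<ge> \<epsilon> * (c / 2)"
      using B(1) data[OF l order_refl n] i by simp
    have "ln (D / \<eta>) \<le> l * t" using t l by (simp add: t0_def field_simps)
    then have "D / \<eta> \<le> exp (l * t)" using D \<eta> by (metis divide_pos_pos exp_le_cancel_iff exp_ln)
    then have "D * exp (- (l * t)) \<le> \<eta>" using D \<eta> by (simp add: exp_minus field_simps)
    moreover have "c / (2 * l) = 2 * \<eta>" by (simp add: \<eta>_def)
    ultimately have "\<epsilon> * \<eta> \<le> \<epsilon> * (c / (2 * l) - D * exp (- (l * t)))"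
      using \<epsilon> by (intro mult_left_mono) auto
    also have "\<dots> \<le> exp (- (l * t)) * Upair (avg_exp n l) t"
      using B(2) data[OF l order_refl n] by (simp add: D_def)
    finally have U: "exp (- (l * t)) * Upair (avg_exp n l) t \<ge> \<epsilon> * \<eta>" .
    have "\<kappa> * \<epsilon> \<le> \<epsilon> * (c / 2)" "\<kappa> * \<epsilon> \<le> \<epsilon> * \<eta>"
      using \<epsilon> by (auto simp: \<kappa>_def mult.commute intro!: mult_left_mono)
    then show ?thesis using U V unfolding Upair_def Vpair_def by linarith
  qed
  then show ?thesis using l \<kappa> by (intro exI[of _ l] exI[of _ \<kappa>] exI[of _ t0]) (auto simp: t0_def)
qed

lemma source_lower_bound_late:
  assumes rc: "(r, c) \<in> {(q, a), (p, b)}"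
  shows "\<exists>k t0. 0 < k \<and> 0 \<le> t0 \<and> (\<forall>\<epsilon> T u v t. solution \<epsilon> T u v \<and> \<epsilon> > 0 \<and> t0 \<le> t \<and> ereal t < T \<and>
     integrable lebesgue (\<lambda>x. G (u t x) (v t x)) \<longrightarrow>
     (LINT x|lebesgue. G (u t x) (v t x)) \<ge> k * \<epsilon> powr r * (r\<^sub>0 + 1 + t) powr (dec * (2 - r)))"
proof -
  have r: "r > 1" and c: "c > 0" using rc p q a b by auto
  obtain l \<kappa> t0 where l: "0 < l" and \<kappa>: "0 < \<kappa>" and t0: "0 \<le> t0" and low:
    "\<And>\<epsilon> T u v t n. solution \<epsilon> T u v \<Longrightarrow> \<epsilon> > 0 \<Longrightarrow> t0 \<le> t \<Longrightarrow> ereal t < T \<Longrightarrow> n \<ge> 1 \<Longrightarrow>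
     exp (- (l * t)) * (LINT x|lebesgue. u t x * avg_exp n l x) \<ge> \<kappa> * \<epsilon> \<and>
     exp (- (l * t)) * (LINT x|lebesgue. v t x * avg_exp n l x) \<ge> \<kappa> * \<epsilon>"
    using pairing_lower_bound by blast
  obtain k where k: "k > 0" and src: "\<And>\<epsilon> T u v t n w. solution \<epsilon> T u v \<Longrightarrow> \<epsilon> > 0 \<Longrightarrow> 0 \<le> t \<Longrightarrow> ereal t < T \<Longrightarrow>
     integrable lebesgue (\<lambda>x. G (u t x) (v t x)) \<Longrightarrow> (w, r, c) \<in> {(u t, q, a), (v t, p, b)} \<Longrightarrow>
     r\<^sub>0 + 1 + t \<le> real n \<Longrightarrow> exp (- (l * t)) * (LINT x|lebesgue. w x * avg_exp n l x) \<ge> \<kappa> * \<epsilon> \<Longrightarrow>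
     (LINT x|lebesgue. G (u t x) (v t x)) \<ge> k * \<epsilon> powr r * (r\<^sub>0 + 1 + t) powr (dec * (2 - r))"
    using source_lower_bound[OF l \<kappa> r c] by blast
  have "(LINT x|lebesgue. G (u t x) (v t x)) \<ge> k * \<epsilon> powr r * (r\<^sub>0 + 1 + t) powr (dec * (2 - r))"
    if sol: "solution \<epsilon> T u v" and \<epsilon>: "\<epsilon> > 0" and t: "t0 \<le> t" "ereal t < T"
      and int: "integrable lebesgue (\<lambda>x. G (u t x) (v t x))" for \<epsilon> T u v t
  proof -
    define n where "n = nat \<lceil>r\<^sub>0 + 1 + t\<rceil>"
    have n: "r\<^sub>0 + 1 + t \<le> real n" unfolding n_def by linarith
    have tt: "0 \<le> t" using t t0 by simp
    have n1: "n \<ge> 1" using n r0 tt by simp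
    note low' = low[OF sol \<epsilon> t n1]
    from rc have "(u t, r, c) \<in> {(u t, q, a), (v t, p, b)} \<or> (v t, r, c) \<in> {(u t, q, a), (v t, p, b)}" by auto
    then show ?thesis
      using src[OF sol \<epsilon> tt t(2) int _ n, of "u t"] src[OF sol \<epsilon> tt t(2) int _ n, of "v t"] low' by blast
  qed
  then show ?thesis using k t0 by blast
qed

text \<open>Testing with the constant mode gives \<integral> X \<psi> \<le> \<integral> U \<psi>''.
  By Hoelder's inequality on a ball of radius at most 2 R, U is bounded by X^(1/q) R^(d/q'), and
  \<psi>'' by R^(-2) \<psi>^(1/q); Young's inequality then absorbs half of the left side. What
  remains is R (R^(d/q') R^(-2))^q' = R^(d + 1 - 2 q') with d = 2 dec + 1.\<close>

lemma subcritical_upper_bound: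
  defines "q' \<equiv> q / (q - 1)" and "m \<equiv> cutoff_power q"
  shows "\<exists>K>0. \<forall>\<epsilon> T u v R. solution \<epsilon> T u v \<and> \<epsilon> > 0 \<and> r\<^sub>0 + 1 \<le> R \<and> ereal R < T \<longrightarrow>
    integral {0..R} (\<lambda>t. (LINT x|lebesgue. G (u t x) (v t x)) * time_cutoff m R t) \<le> K * R powr (2 * dec + 2 - 2 * q')"
proof -
  have q': "q' > 1" using q by (simp add: q'_def field_simps)
  obtain C where C: "C > 0" and der: "\<And>R t. R > 0 \<Longrightarrow>
     \<bar>deriv (time_cutoff m R) t\<bar> \<le> C / R * time_cutoff m R t powr (1 / q) \<and>
     \<bar>deriv (deriv (time_cutoff m R)) t\<bar> \<le> C / R\<^sup>2 * time_cutoff m R t powr (1 / q) \<and>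
     (t < R / 2 \<longrightarrow> deriv (time_cutoff m R) t = 0 \<and> deriv (deriv (time_cutoff m R)) t = 0)"
    using time_cutoff_derivs[OF q] unfolding m_def by blast
  have m1: "m \<ge> 1" by (simp add: m_def cutoff_power_def)
  define d where "d = DIM('a)"
  have d: "real d = 2 * dec + 1" by (simp add: d_def dec_eq field_simps)
  define V where "V = measure lebesgue (ball (0::'a) 1) + 1"
  have V: "V > 0" unfolding V_def by (intro add_nonneg_pos) auto
  define Z0 where "Z0 = C * (a powr - (1 / q) * (V * 2 ^ d) powr (1 - 1 / q))"
  have Z0: "Z0 > 0" using C a V by (simp add: Z0_def)
  define K where "K = 2 * (2 powr q' * Z0 powr q')"
  have K: "K > 0" using Z0 by (simp add: K_def)
  have "integral {0..R} (\<lambda>t. (LINT x|lebesgue. G (u t x) (v t x)) * time_cutoff m R t) \<le> K * R powr (2 * dec + 2 - 2 * q')"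
    if sol: "solution \<epsilon> T u v" and \<epsilon>: "\<epsilon> > 0" and R: "r\<^sub>0 + 1 \<le> R" "ereal R < T" for \<epsilon> T u v R
  proof -
    interpret cone_solution G \<epsilon> r\<^sub>0 f g T u v by (rule sol)
    have R0: "R > 0" using R r0 by simp
    obtain N where N: "negligible N" "0 \<in> N"
      "\<And>t. t \<notin> N \<Longrightarrow> 0 \<le> t \<Longrightarrow> ereal t < T \<Longrightarrow> integrable lebesgue (\<lambda>x. G (u t x) (v t x))"
      using solution_good_times[OF sol] by blast
    define \<psi> where "\<psi> = time_cutoff m R"
    note tc = time_cutoff_props[OF R0, where m=m, folded \<psi>_def]
    note der = der[OF R0, folded \<psi>_def]
    have \<psi>R: "\<psi> R = 0" using tc(5)[OF m1] by simp
    have \<psi>2: "C_infinity (deriv (deriv \<psi>))" by (intro C_infinity_real_deriv(2) tc(1))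
    define X where "X = Gpair (\<lambda>x::'a. 1)"
    define U where "U = Upair (\<lambda>x::'a. 1)"
    have X_nn: "X t \<ge> 0" for t unfolding X_def by (rule Gpair_nonneg) simp
    have Xi: "(\<lambda>t. X t * \<psi> t) integrable_on {0..R}"
      using Gpair_times_continuous[of R "\<lambda>x. 1" \<psi>] R R0 C_infinity_continuous[OF tc(1)]
      by (simp add: X_def mult.commute set_lebesgue_integral_eq_integral(1))
    have Xi2: "(\<lambda>t. X t * \<psi> t / 2) integrable_on {0..R}"
      using integrable_on_mult_right[OF Xi, of "1 / 2"] by simp
    have Uc: "continuous_on {0..R} U" unfolding U_def by (rule Upair_continuous) (use R R0 in auto)
    have id: "Vpair (\<lambda>x. 1) 0 + integral {0..R} (\<lambda>t. X t * \<psi> t) = integral {0..R} (\<lambda>t. U t * deriv (deriv \<psi>) t)"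
    proof -
      have 0: "deriv \<psi> 0 = 0" using der[of 0] R0 by simp
      have 1: "deriv \<psi> R = 0" using der[of R] \<psi>R by simp
      show ?thesis
        using cutoff_identity[OF R0 R(2) wave_mode_const[of 1] tc(1) tc(5)[OF m1] tc(4) 0 1] R0
        by (simp add: X_def U_def)
    qed
    have V0: "Vpair (\<lambda>x. 1) 0 \<ge> 0"
      using Vpair_0[of "\<lambda>x. 1"] \<epsilon> g_pos by simp
    define Z where "Z = Z0 * (R powr (real d * (1 - 1 / q)) / R\<^sup>2)"
    have Z: "Z \<ge> 0" using Z0 by (simp add: Z_def)
    have Uest: "U t * deriv (deriv \<psi>) t \<le> X t * \<psi> t / 2 + 2 powr q' * Z powr q'" if t: "t \<in> {0..R} - N" for t
    proof -
      have tT: "0 \<le> t" "ereal t < T" using t le_less_trans[of "ereal t" "ereal R" T] R by auto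
      have tI: "t \<in> I" using tT by simp
      have int: "integrable lebesgue (\<lambda>x. G (u t x) (v t x))" using N(3)[of t] t tT by auto
      note w = solution_G_lower[OF sol tT int, of "u t" q a, simplified]
      have "\<bar>U t\<bar> \<le> (LINT x|lebesgue. \<bar>u t x\<bar> * 1)"
        unfolding U_def Upair_def by (rule abs_pair_le) simp
      also have "\<dots> \<le> (X t / a) powr (1 / q) * (V * (2 * R) ^ d) powr (1 - 1 / q)"
        unfolding X_def
      proof (rule pair_Hoelder[OF tI int q a w(1-3)])
        show "V * (2 * R) ^ d > 0" using V R0 by simp
        have "(LINT x:cball (0::'a) (r\<^sub>0 + t)|lebesgue. 1 powr (q / (q - 1)) * 1 powr (1 - q / (q - 1)))
            = measure lebesgue (cball (0::'a) (r\<^sub>0 + t))"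
          by (simp add: set_lebesgue_integral_def)
        also have "\<dots> = (r\<^sub>0 + t) ^ d * measure lebesgue (ball (0::'a) 1)"
          using measure_cball_0[of "r\<^sub>0 + t", where 'a='a] r0 tT by (simp add: d_def)
        also have "\<dots> \<le> (2 * R) ^ d * V"
          using r0 t R unfolding V_def by (intro mult_mono power_mono) auto
        finally show "(LINT x:cball (0::'a) (r\<^sub>0 + t)|lebesgue. 1 powr (q / (q - 1)) * 1 powr (1 - q / (q - 1)))
            \<le> V * (2 * R) ^ d" by (simp add: mult.commute)
      qed auto
      finally have Ub: "\<bar>U t\<bar> \<le> (X t / a) powr (1 / q) * (V * (2 * R) ^ d) powr (1 - 1 / q)" .
      have e1: "(X t / a) powr (1 / q) = a powr - (1 / q) * X t powr (1 / q)"
        using X_nn[of t] a by (simp add: powr_divide powr_minus_divide)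
      have e2: "(V * (2 * R) ^ d) powr (1 - 1 / q) = (V * 2 ^ d) powr (1 - 1 / q) * R powr (real d * (1 - 1 / q))"
      proof -
        have "V * (2 * R) ^ d = (V * 2 ^ d) * R powr real d"
          using R0 by (simp add: power_mult_distrib powr_realpow)
        then show ?thesis using V R0 by (simp only: powr_mult powr_powr)
      qed
      have "U t * deriv (deriv \<psi>) t \<le> \<bar>U t\<bar> * \<bar>deriv (deriv \<psi>) t\<bar>"
        using abs_ge_self[of "U t * deriv (deriv \<psi>) t"] by (simp add: abs_mult)
      also have "\<dots> \<le> ((X t / a) powr (1 / q) * (V * (2 * R) ^ d) powr (1 - 1 / q)) * (C / R\<^sup>2 * \<psi> t powr (1 / q))"
        using Ub der[of t] by (intro mult_mono) auto
      also have "\<dots> = (X t powr (1 / q) * \<psi> t powr (1 / q)) * Z"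
        unfolding e1 e2 Z_def Z0_def by simp
      also have "X t powr (1 / q) * \<psi> t powr (1 / q) = (X t * \<psi> t) powr (1 / q)"
        using X_nn tc(2) by (simp add: powr_mult)
      also have "(X t * \<psi> t) powr (1 / q) * Z \<le> X t * \<psi> t / 2 + 2 powr (q / (q - 1)) * Z powr (q / (q - 1))"
        using X_nn tc(2) Z q by (intro Young_half) auto
      finally show ?thesis by (simp add: q'_def)
    qed
    have "integral {0..R} (\<lambda>t. X t * \<psi> t) \<le> integral {0..R} (\<lambda>t. U t * deriv (deriv \<psi>) t)"
      using id V0 by simp
    also have "\<dots> \<le> integral {0..R} (\<lambda>t. X t * \<psi> t / 2 + 2 powr q' * Z powr q')"
    proof (rule integral_le_off_negligible[OF N(1) _ _ Uest])
      show "(\<lambda>t. U t * deriv (deriv \<psi>) t) integrable_on {0..R}"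
        by (intro integrable_continuous_real continuous_on_mult Uc C_infinity_continuous[OF \<psi>2])
      show "(\<lambda>t. X t * \<psi> t / 2 + 2 powr q' * Z powr q') integrable_on {0..R}"
        by (rule integrable_add[OF Xi2 integrable_const_ivl])
    qed
    also have "\<dots> = integral {0..R} (\<lambda>t. X t * \<psi> t) / 2 + R * (2 powr q' * Z powr q')"
      using R0 by (simp add: integral_add[OF Xi2 integrable_const_ivl])
    finally have "integral {0..R} (\<lambda>t. X t * \<psi> t) \<le> 2 * (R * (2 powr q' * Z powr q'))" by simp
    also have "\<dots> = K * R powr (2 * dec + 2 - 2 * q')"
    proof -
      have e: "(real d * (1 - 1 / q)) * q' = real d" using q by (simp add: q'_def field_simps)
      have "(R\<^sup>2) powr q' = R powr (2 * q')"
        using R0 powr_powr[of R 2 q'] by simp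
      then have Zq: "Z powr q' = Z0 powr q' * (R powr real d / R powr (2 * q'))"
        using Z0 R0 by (simp only: Z_def powr_mult powr_divide powr_powr e)
      have "2 * (R * (2 powr q' * Z powr q')) = K * (R * (R powr real d / R powr (2 * q')))"
        unfolding Zq K_def by simp
      also have "R * (R powr real d / R powr (2 * q')) = R powr (2 * dec + 2 - 2 * q')"
        unfolding d using R0 by (simp add: powr_add powr_diff power2_eq_square)
      finally show ?thesis .
    qed
    finally show ?thesis by (simp add: X_def \<psi>_def Gpair_def)
  qed
  then show ?thesis using K by blast
qed

lemma powr_comparable_lower:
  fixes s R c :: real
  assumes "R > 0" "R / 2 \<le> s" "s \<le> 2 * R"
  shows "2 powr - \<bar>c\<bar> * R powr c \<le> s powr c"
proof -
  have s: "s > 0" using assms by linarith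
  have "s powr - c \<le> 2 powr \<bar>c\<bar> * R powr - c"
    using powr_comparable[OF assms, of "- c"] by simp
  then have "s powr - c * (s powr c * R powr c) \<le> 2 powr \<bar>c\<bar> * R powr - c * (s powr c * R powr c)"
    by (intro mult_right_mono) auto
  moreover have "s powr - c * s powr c = 1" "R powr - c * R powr c = 1"
    using s assms by (simp_all flip: powr_add)
  ultimately have "R powr c \<le> 2 powr \<bar>c\<bar> * s powr c"
    by (metis (no_types, opaque_lifting) mult.assoc mult.commute mult.right_neutral)
  then have "2 powr - \<bar>c\<bar> * R powr c \<le> 2 powr - \<bar>c\<bar> * (2 powr \<bar>c\<bar> * s powr c)"
    by (intro mult_left_mono) auto
  then show ?thesis by (simp add: powr_minus field_simps)
qed

text \<open>On \<open>{R/4..R/2}\<close> the cut-off equals 1, so the lower bound of the source,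
  integrated over this interval of length R/4, must stay below the upper bound.\<close>

lemma subcritical_estimate:
  assumes rc: "(r, c) \<in> {(q, a), (p, b)}"
  shows "\<exists>K R1. 0 < K \<and> 1 \<le> R1 \<and> (\<forall>\<epsilon> T u v R. solution \<epsilon> T u v \<and> \<epsilon> > 0 \<and> R1 \<le> R \<and> ereal R < T \<longrightarrow>
    \<epsilon> powr r * R powr ((q + 1) / (q - 1) - dec * r) \<le> K)"
proof -
  define m where "m = cutoff_power q"
  define q' where "q' = q / (q - 1)"
  obtain k t0 where k: "0 < k" and t0: "0 \<le> t0" and low: "\<And>\<epsilon> T u v t. solution \<epsilon> T u v \<Longrightarrow> \<epsilon> > 0 \<Longrightarrow> t0 \<le> t \<Longrightarrow> ereal t < T \<Longrightarrow>
     integrable lebesgue (\<lambda>x. G (u t x) (v t x)) \<Longrightarrow>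
     (LINT x|lebesgue. G (u t x) (v t x)) \<ge> k * \<epsilon> powr r * (r\<^sub>0 + 1 + t) powr (dec * (2 - r))"
    using source_lower_bound_late[OF rc] by blast
  obtain K where K: "K > 0" and up: "\<And>\<epsilon> T u v R. solution \<epsilon> T u v \<Longrightarrow> \<epsilon> > 0 \<Longrightarrow> r\<^sub>0 + 1 \<le> R \<Longrightarrow> ereal R < T \<Longrightarrow>
    integral {0..R} (\<lambda>t. (LINT x|lebesgue. G (u t x) (v t x)) * time_cutoff m R t) \<le> K * R powr (2 * dec + 2 - 2 * q')"
    using subcritical_upper_bound unfolding m_def q'_def by blast
  define e where "e = dec * (2 - r)"
  define k' where "k' = k * (2 powr - \<bar>e\<bar> * (1 / 2) powr e) / 4"
  have k': "k' > 0" using k by (simp add: k'_def)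
  \<comment> \<open>For t in \<open>{R/4..R/2}\<close> this places t beyond \<open>t0\<close> and
    keeps \<open>r\<^sub>0 + 1 + t\<close> within a factor 2 of R/2.\<close>
  define R1 where "R1 = 4 * t0 + 2 * (r\<^sub>0 + 1)"
  have R1: "R1 \<ge> 1" using t0 r0 by (simp add: R1_def)
  have "\<epsilon> powr r * R powr ((q + 1) / (q - 1) - dec * r) \<le> K / k'"
    if sol: "solution \<epsilon> T u v" and \<epsilon>: "\<epsilon> > 0" and R: "R1 \<le> R" "ereal R < T" for \<epsilon> T u v R
  proof -
    interpret cone_solution G \<epsilon> r\<^sub>0 f g T u v by (rule sol)
    have R0: "R > 0" and Rr: "r\<^sub>0 + 1 \<le> R / 2" "t0 \<le> R / 4" using R t0 r0 by (auto simp: R1_def)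
    obtain N where N: "negligible N" "0 \<in> N"
      "\<And>t. t \<notin> N \<Longrightarrow> 0 \<le> t \<Longrightarrow> ereal t < T \<Longrightarrow> integrable lebesgue (\<lambda>x. G (u t x) (v t x))"
      using solution_good_times[OF sol] by blast
    define \<psi> where "\<psi> = time_cutoff m R"
    note tc = time_cutoff_props[OF R0, where m=m, folded \<psi>_def]
    define X where "X t = (LINT x|lebesgue. G (u t x) (v t x))" for t
    have XG: "X = Gpair (\<lambda>x. 1)" by (simp add: X_def Gpair_def fun_eq_iff)
    have X_nn: "X t \<ge> 0" for t unfolding XG by (rule Gpair_nonneg) simp
    have Xi: "(\<lambda>t. X t * \<psi> t) integrable_on {0..R}"
      using Gpair_times_continuous[of R "\<lambda>x. 1" \<psi>] R R0 C_infinity_continuous[OF tc(1)]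
      by (simp add: XG mult.commute set_lebesgue_integral_eq_integral(1))
    define L where "L = k * \<epsilon> powr r * (2 powr - \<bar>e\<bar> * (R / 2) powr e)"
    have "L * (R / 4) = integral {R / 4..R / 2} (\<lambda>t. L)" using R0 by simp
    also have "\<dots> \<le> integral {R / 4..R / 2} (\<lambda>t. X t * \<psi> t)"
    proof (rule integral_le_off_negligible[OF N(1)])
      show "(\<lambda>t. X t * \<psi> t) integrable_on {R / 4..R / 2}"
        by (rule integrable_subinterval_real[OF Xi]) (use R0 in auto)
      fix t assume t: "t \<in> {R / 4..R / 2} - N"
      have tT: "0 \<le> t" "ereal t < T" using t R0 le_less_trans[of "ereal t" "ereal R" T] R by auto
      have int: "integrable lebesgue (\<lambda>x. G (u t x) (v t x))" using N(3)[of t] t tT by auto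
      have "2 powr - \<bar>e\<bar> * (R / 2) powr e \<le> (r\<^sub>0 + 1 + t) powr e"
        by (rule powr_comparable_lower) (use R0 Rr t r0 in auto)
      then have "L \<le> k * \<epsilon> powr r * (r\<^sub>0 + 1 + t) powr e"
        unfolding L_def using k by (intro mult_left_mono) auto
      also have "\<dots> \<le> X t"
        unfolding X_def e_def using low[OF sol \<epsilon> _ tT(2) int] t Rr by auto
      finally show "L \<le> X t * \<psi> t" using tc(4)[of t] t by simp
    qed (rule integrable_const_ivl)
    also have "\<dots> \<le> integral {0..R} (\<lambda>t. X t * \<psi> t)"
      using R0 X_nn tc(2) by (intro integral_subset_le Xi integrable_subinterval_real[OF Xi]) auto
    also have "\<dots> \<le> K * R powr (2 * dec + 2 - 2 * q')"
      using up[OF sol \<epsilon> _ R(2)] Rr R0 by (simp add: X_def \<psi>_def)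
    finally have "L * (R / 4) \<le> K * R powr (2 * dec + 2 - 2 * q')" .
    moreover have "L * (R / 4) = k' * \<epsilon> powr r * R powr (e + 1)"
    proof -
      have "(R / 2) powr e = (1 / 2) powr e * R powr e" using R0 by (simp flip: powr_mult)
      then show ?thesis using R0 by (simp add: L_def k'_def powr_add)
    qed
    ultimately have "k' * \<epsilon> powr r * R powr (e + 1) * R powr - (2 * dec + 2 - 2 * q')
        \<le> K * R powr (2 * dec + 2 - 2 * q') * R powr - (2 * dec + 2 - 2 * q')"
      by (intro mult_right_mono) auto
    also have "\<dots> = K * (R powr (2 * dec + 2 - 2 * q') * R powr - (2 * dec + 2 - 2 * q'))" by simp
    also have "R powr (2 * dec + 2 - 2 * q') * R powr - (2 * dec + 2 - 2 * q') = 1"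
      using R0 by (simp flip: powr_add)
    also have "k' * \<epsilon> powr r * R powr (e + 1) * R powr - (2 * dec + 2 - 2 * q')
        = k' * (\<epsilon> powr r * R powr ((e + 1) + - (2 * dec + 2 - 2 * q')))"
      unfolding powr_add by simp
    also have "(e + 1) + - (2 * dec + 2 - 2 * q') = (q + 1) / (q - 1) - dec * r"
    proof -
      have "2 * q' - 1 = (q + 1) / (q - 1)" using q by (simp add: q'_def field_simps)
      then show ?thesis by (simp add: e_def algebra_simps)
    qed
    finally show ?thesis using k' by (simp add: field_simps)
  qed
  moreover have "K / k' > 0" using K k' by simp
  ultimately show ?thesis using R1 by blast
qed

end

section \<open>The critical Strauss exponent\<close>

lemma one_le_powr_minus: "0 < x \<Longrightarrow> x \<le> 1 \<Longrightarrow> 0 \<le> s \<Longrightarrow> 1 \<le> x powr (- s)" for x s :: real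
  using powr_mono2'[of "- s" x 1] by simp

text \<open>The derivative of z^(1-q) has modulus (q - 1) z^(-q), which on the interval is smallest
  at y. This is the discrete form of dividing S' \<ge> S^q by S^q; evaluation at the upper end
  matches an increment bounded by a power of the new value.\<close>

lemma powr_convex_step:
  fixes x y q :: real
  assumes q: "q > 1" and xy: "0 < x" "x \<le> y"
  shows "(q - 1) * (y powr - q * (y - x)) \<le> x powr (1 - q) - y powr (1 - q)"
proof -
  define h where "h z = - (z powr (1 - q)) - (q - 1) * (y powr - q * z)" for z
  have "h x \<le> h y"
  proof (rule nondecreasing_within[OF xy(2)])
    fix z assume z: "z \<in> {x..y}"
    then have z0: "z > 0" using xy by simp
    have "((\<lambda>z. z powr (1 - q)) has_real_derivative (1 - q) * z powr (1 - q - 1)) (at z within {x..y})"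
      using has_real_derivative_powr[OF z0, of "1 - q"] by (rule has_field_derivative_at_within)
    then have "(h has_real_derivative - ((1 - q) * z powr (1 - q - 1)) - (q - 1) * (y powr - q * 1)) (at z within {x..y})"
      unfolding h_def[abs_def] by (intro DERIV_diff DERIV_minus DERIV_cmult DERIV_ident)
    then show "(h has_real_derivative (q - 1) * (z powr - q - y powr - q)) (at z within {x..y})"
      by (simp add: algebra_simps)
    have "y powr - q \<le> z powr - q" using z z0 q by (intro powr_mono2') auto
    then show "(q - 1) * (z powr - q - y powr - q) \<ge> 0" using q by simp
  qed
  then show ?thesis by (simp add: h_def algebra_simps)
qed

text \<open>Linear growth makes S of size at least \<epsilon>^q k when j = k = J div 2, up to
  constants. In each of the next k steps S^(1-q) drops by at least a multiple of k^(1-q), and it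
  stays nonnegative, so k k^(1-q) is at most a multiple of (\<epsilon>^q k)^(1-q). The powers
  k^(1-q) cancel and leave the bound on k.\<close>

lemma discrete_blowup:
  fixes q c1 c2 :: real and j0 :: nat
  assumes q: "q > 1" and c: "c1 > 0" "c2 > 0"
  shows "\<exists>C>0. \<forall>\<epsilon> S Z J. 0 < \<epsilon> \<and> \<epsilon> \<le> 1 \<and> S j0 \<ge> 0 \<and>
    (\<forall>j. j0 < j \<and> j \<le> J \<longrightarrow> S j \<ge> S (j - 1) + c1 * \<epsilon> powr q \<and> S (j - 1) \<le> Z j \<and> Z j \<le> S j \<and>
       Z j - S (j - 1) \<ge> c2 * (1 + real j) powr (1 - q) * Z j powr q) \<longrightarrow>
    real J \<le> C * \<epsilon> powr (- (q * (q - 1)))"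
proof -
  define c3 where "c3 = (q - 1) * c2 * 3 powr (1 - q)"
  have c3: "c3 > 0" using q c by (simp add: c3_def)
  define C0 where "C0 = (c1 / 2) powr (1 - q) / c3"
  have C0: "C0 > 0" using c c3 by (simp add: C0_def)
  \<comment> \<open>For J < 4 j0 + 4 the constant alone suffices; otherwise k = J div 2 satisfies k
    - j0 \<ge> k/2 and J \<le> 3 k.\<close>
  define C where "C = 4 * real j0 + 4 + 3 * C0"
  have C: "C > 0" using C0 by (simp add: C_def)
  have "real J \<le> C * \<epsilon> powr (- (q * (q - 1)))"
    if \<epsilon>: "0 < \<epsilon>" "\<epsilon> \<le> 1" and S0: "S j0 \<ge> 0"
      and hyp: "\<And>j. j0 < j \<Longrightarrow> j \<le> J \<Longrightarrow> S j \<ge> S (j - 1) + c1 * \<epsilon> powr q \<and> S (j - 1) \<le> Z j \<and> Z j \<le> S j \<and>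
       Z j - S (j - 1) \<ge> c2 * (1 + real j) powr (1 - q) * Z j powr q" for \<epsilon> S Z J
  proof -
    have \<epsilon>1: "\<epsilon> powr (- (q * (q - 1))) \<ge> 1"
      using \<epsilon> q by (intro one_le_powr_minus) auto
    show ?thesis
    proof (cases "J < 4 * j0 + 4")
      case True
      then have "real J \<le> C * 1" using C0 by (simp add: C_def)
      also have "\<dots> \<le> C * \<epsilon> powr (- (q * (q - 1)))" using \<epsilon>1 C by (intro mult_left_mono) auto
      finally show ?thesis .
    next
      case False
      define k where "k = J div 2"
      have k: "k \<ge> 2 * j0 + 2" "2 * k \<le> J" "J \<le> 2 * k + 1" using False by (auto simp: k_def)
      have k0: "real k > 0" using k by simp
      have S_lin: "S j \<ge> c1 * \<epsilon> powr q * real (j - j0)" if "j0 \<le> j" "j \<le> J" for j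
        using that
      proof (induction j rule: dec_induct)
        case (step j)
        have "S (Suc j) \<ge> S j + c1 * \<epsilon> powr q" using hyp[of "Suc j"] step by simp
        moreover have "S j \<ge> c1 * \<epsilon> powr q * real (j - j0)" using step by simp
        moreover have "real (Suc j - j0) = real (j - j0) + 1" using step by (simp add: Suc_diff_le)
        ultimately show ?case by (simp add: algebra_simps)
      qed (use S0 in simp)
      define s where "s = c1 * \<epsilon> powr q * (real k / 2)"
      have s0: "s > 0" using c \<epsilon> k0 by (simp add: s_def)
      have Sk: "S k \<ge> s"
      proof -
        have "real k / 2 \<le> real (k - j0)" using k by (simp add: of_nat_diff)
        then have "s \<le> c1 * \<epsilon> powr q * real (k - j0)"
          unfolding s_def using c by (intro mult_left_mono) auto
        then show ?thesis using S_lin[of k] k by simp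
      qed
      have S_mono: "S j \<ge> s" if "k \<le> j" "j \<le> J" for j
        using that
      proof (induction j rule: dec_induct)
        case (step j)
        have "S (Suc j) \<ge> S j + c1 * \<epsilon> powr q" using hyp[of "Suc j"] step k by simp
        moreover have "c1 * \<epsilon> powr q \<ge> 0" using c by simp
        ultimately show ?case using step by simp
      qed (rule Sk)
      define \<delta> where "\<delta> = c3 * real k powr (1 - q)"
      have dec: "S (k + i) powr (1 - q) \<le> S k powr (1 - q) - real i * \<delta>" if "i \<le> k" for i
        using that
      proof (induction i)
        case (Suc i)
        define j where "j = k + Suc i"
        have j: "j0 < j" "j \<le> J" "j \<le> 2 * k" "j - 1 = k + i" using Suc k by (auto simp: j_def)
        note st = hyp[OF j(1,2)]
        have x: "S (j - 1) \<ge> s" using S_mono[of "j - 1"] j Suc k by simp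
        then have x0: "S (j - 1) > 0" using s0 by simp
        have Z0: "Z j > 0" using st x0 by linarith
        have "\<delta> \<le> (q - 1) * (c2 * (1 + real j) powr (1 - q))"
        proof -
          have "1 + real j \<le> 3 * real k" using j k by simp
          then have "(3 * real k) powr (1 - q) \<le> (1 + real j) powr (1 - q)"
            using q by (intro powr_mono2') auto
          moreover have "(3 * real k) powr (1 - q) = 3 powr (1 - q) * real k powr (1 - q)"
            by (simp add: powr_mult)
          ultimately have "((q - 1) * c2) * (3 powr (1 - q) * real k powr (1 - q)) \<le> ((q - 1) * c2) * (1 + real j) powr (1 - q)"
            using q c by (intro mult_left_mono) auto
          then show ?thesis by (simp add: \<delta>_def c3_def mult.assoc)
        qed
        also have "\<dots> = (q - 1) * (Z j powr - q * (c2 * (1 + real j) powr (1 - q) * Z j powr q))"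
        proof -
          have "Z j powr - q * Z j powr q = 1" using Z0 by (simp flip: powr_add)
          then have "Z j powr - q * (c2 * (1 + real j) powr (1 - q) * Z j powr q) = c2 * (1 + real j) powr (1 - q)"
            by (simp add: mult.left_commute[of "Z j powr - q"])
          then show ?thesis by simp
        qed
        also have "\<dots> \<le> (q - 1) * (Z j powr - q * (Z j - S (j - 1)))"
          using st q by (intro mult_left_mono) auto
        also have "\<dots> \<le> S (j - 1) powr (1 - q) - Z j powr (1 - q)"
          by (rule powr_convex_step[OF q x0]) (use st in simp)
        also have "\<dots> \<le> S (j - 1) powr (1 - q) - S j powr (1 - q)"
          using st Z0 q by (intro diff_left_mono powr_mono2') auto
        finally have "S j powr (1 - q) \<le> S (k + i) powr (1 - q) - \<delta>" using j by simp
        then show ?case using Suc by (simp add: j_def algebra_simps)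
      qed simp
      have "0 \<le> S (k + k) powr (1 - q)" by simp
      also have "\<dots> \<le> S k powr (1 - q) - real k * \<delta>" using dec[of k] by simp
      also have "\<dots> \<le> s powr (1 - q) - real k * \<delta>"
        using Sk s0 q by (intro diff_right_mono powr_mono2') auto
      finally have "real k * (c3 * real k powr (1 - q)) \<le> s powr (1 - q)" by (simp add: \<delta>_def)
      also have "s powr (1 - q) = ((c1 / 2) powr (1 - q) * \<epsilon> powr (- (q * (q - 1)))) * real k powr (1 - q)"
      proof -
        have seq: "s = (c1 / 2) * \<epsilon> powr q * real k" by (simp add: s_def)
        have "q * (1 - q) = - (q * (q - 1))" by (simp add: algebra_simps)
        then show ?thesis unfolding seq using c \<epsilon> by (simp only: powr_mult powr_powr)
      qed
      finally have "(real k * c3) * real k powr (1 - q) \<le> ((c1 / 2) powr (1 - q) * \<epsilon> powr (- (q * (q - 1)))) * real k powr (1 - q)"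
        by (simp add: mult.assoc)
      then have "real k * c3 \<le> (c1 / 2) powr (1 - q) * \<epsilon> powr (- (q * (q - 1)))"
        using k0 by (simp add: mult_le_cancel_right)
      then have "real k \<le> C0 * \<epsilon> powr (- (q * (q - 1)))"
        using c3 by (simp add: C0_def field_simps)
      then have "real J \<le> 3 * (C0 * \<epsilon> powr (- (q * (q - 1))))" using k by simp
      also have "\<dots> \<le> C * \<epsilon> powr (- (q * (q - 1)))"
        using \<epsilon>1 by (simp add: C_def mult.assoc[symmetric] mult_right_mono)
      finally show ?thesis .
    qed
  qed
  then show ?thesis using C by blast
qed

context cone_solution
begin

lemma Gpair_wave_packet:
  assumes "t \<in> I" "integrable lebesgue (\<lambda>x. G (u t x) (v t x))"
  shows "Gpair (wave_packet n l j \<beta> t) t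
    = (\<Sum>i\<le>j. (l / 2 ^ i) powr \<beta> * (exp (- (l / 2 ^ i * t)) * Gpair (avg_exp n (l / 2 ^ i)) t))"
proof -
  have "G (u t x) (v t x) * wave_packet n l j \<beta> t x = (\<Sum>i\<le>j. ((l / 2 ^ i) powr \<beta> * exp (- (l / 2 ^ i * t)))
      * (G (u t x) (v t x) * avg_exp n (l / 2 ^ i) x))" for x
    unfolding wave_packet_def sum_distrib_left by (intro sum.cong refl) (simp only: mult_ac)
  then have "Gpair (wave_packet n l j \<beta> t) t = (\<Sum>i\<le>j. LINT x|lebesgue. ((l / 2 ^ i) powr \<beta> * exp (- (l / 2 ^ i * t)))
      * (G (u t x) (v t x) * avg_exp n (l / 2 ^ i) x))"
    unfolding Gpair_def
    by (simp only:) (intro Bochner_Integration.integral_sum integrable_mult_right G_mult_integrable[OF assms] continuous_intros)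
  then show ?thesis by (simp only: integral_mult_right_zero Gpair_def mult.assoc)
qed

lemma Upair_wave_packet:
  assumes "t \<in> I"
  shows "Upair (wave_packet n l j \<beta> t) t
    = (\<Sum>i\<le>j. (l / 2 ^ i) powr \<beta> * (exp (- (l / 2 ^ i * t)) * Upair (avg_exp n (l / 2 ^ i)) t))"
proof -
  have "u t x * wave_packet n l j \<beta> t x = (\<Sum>i\<le>j. ((l / 2 ^ i) powr \<beta> * exp (- (l / 2 ^ i * t)))
      * (u t x * avg_exp n (l / 2 ^ i) x))" for x
    unfolding wave_packet_def sum_distrib_left by (intro sum.cong refl) (simp only: mult_ac)
  moreover have "integrable lebesgue (\<lambda>x. u t x * avg_exp n (l / 2 ^ i) x)" for i
    by (rule pair_cut(1)[OF u_L2[OF assms] u_vanish[OF assms] order_refl]) (use assms in \<open>auto intro: continuous_intros\<close>)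
  ultimately have "Upair (wave_packet n l j \<beta> t) t = (\<Sum>i\<le>j. LINT x|lebesgue. ((l / 2 ^ i) powr \<beta> * exp (- (l / 2 ^ i * t)))
      * (u t x * avg_exp n (l / 2 ^ i) x))"
    unfolding Upair_def by (simp only:) (intro Bochner_Integration.integral_sum integrable_mult_right)
  then show ?thesis by (simp only: integral_mult_right_zero Upair_def mult.assoc)
qed

end

context blowup_data
begin

text \<open>\<open>X j\<close> is the pairing of the source with the packet of length \<open>j\<close>; the packet is
  adapted to times of order \<open>2 ^ j\<close>, and its length may grow with the time scale because
  all terms are positive.\<close>

lemma critical_estimate:
  assumes crit: "dec * q\<^sup>2 = (dec + 1) * q + 1"
  shows "\<exists>C>0. \<forall>\<epsilon> T u v J. solution \<epsilon> T u v \<and> 0 < \<epsilon> \<and> \<epsilon> \<le> 1 \<and> ereal (2 ^ J) < T \<longrightarrow>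
    real J \<le> C * \<epsilon> powr (- (q * (q - 1)))"
proof -
  define q' where "q' = q / (q - 1)"
  have q': "q' > 1" using q by (simp add: q'_def field_simps)
  define \<beta> where "\<beta> = dec - 1 / q"
  define m where "m = cutoff_power q"
  have m1: "m \<ge> 1" by (simp add: m_def cutoff_power_def)
  define e where "e = 2 * dec - dec * q' + \<beta> * (q' - 1)"
  \<comment> \<open>First use of criticality: in the upper estimate all powers of R cancel, leaving
    only the logarithmic factor 1 + j.\<close>
  have e: "e + 1 - q' = 0"
  proof -
    have "(e + 1 - q') * (q - 1) * q = (2 * dec + 1) * (q - 1) * q - (dec + 1) * (q' * (q - 1)) * q + (\<beta> * q) * ((q' - 1) * (q - 1))"
      by (simp add: e_def algebra_simps)
    also have "q' * (q - 1) = q" using q by (simp add: q'_def)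
    also have "(q' - 1) * (q - 1) = 1" using q by (simp add: q'_def field_simps)
    also have "\<beta> * q = dec * q - 1" using q by (simp add: \<beta>_def left_diff_distrib)
    also have "(2 * dec + 1) * (q - 1) * q - (dec + 1) * q * q + (dec * q - 1) * 1 = dec * q\<^sup>2 - (dec + 1) * q - 1"
      by (simp add: algebra_simps power2_eq_square)
    also have "\<dots> = 0" using crit by simp
    finally show ?thesis using q by simp
  qed
  \<comment> \<open>Second use of criticality: the lower bound of the packet, the source and the
    length of a dyadic interval multiply to R^0, so each scale gains the same multiple of
    \<epsilon>^q.\<close>
  have e': "1 - \<beta> + dec * (2 - q) = 0"
  proof -
    have "(1 - \<beta> + dec * (2 - q)) * q = q - \<beta> * q + dec * (2 - q) * q" by (simp add: algebra_simps)
    also have "\<beta> * q = dec * q - 1" using q by (simp add: \<beta>_def left_diff_distrib)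
    also have "q - (dec * q - 1) + dec * (2 - q) * q = - (dec * q\<^sup>2 - (dec + 1) * q - 1)"
      by (simp add: algebra_simps power2_eq_square)
    also have "\<dots> = 0" using crit by simp
    finally show ?thesis using q by simp
  qed
  obtain l c CC where l: "0 < l" and c: "0 < c" and data: "\<And>l' n. 0 < l' \<Longrightarrow> l' \<le> l \<Longrightarrow> n \<ge> 1 \<Longrightarrow>
     (LINT x|lebesgue. g x * avg_exp n l' x) + l' * (LINT x|lebesgue. f x * avg_exp n l' x) \<ge> c"
    using small_frequency by blast
  obtain k t0 where k: "0 < k" and t0: "0 \<le> t0" and low: "\<And>\<epsilon> T u v t. solution \<epsilon> T u v \<Longrightarrow> \<epsilon> > 0 \<Longrightarrow> t0 \<le> t \<Longrightarrow> ereal t < T \<Longrightarrow>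
     integrable lebesgue (\<lambda>x. G (u t x) (v t x)) \<Longrightarrow>
     (LINT x|lebesgue. G (u t x) (v t x)) \<ge> k * \<epsilon> powr q * (r\<^sub>0 + 1 + t) powr (dec * (2 - q))"
    using source_lower_bound_late[of q a] by blast
  obtain C1 where C1: "C1 > 0" and packet: "\<And>n t I. r\<^sub>0 + 1 \<le> 2 ^ I \<Longrightarrow> 2 ^ I / 2 \<le> t \<Longrightarrow> t \<le> 2 ^ I \<Longrightarrow> r\<^sub>0 + 1 + t \<le> real n \<Longrightarrow>
    (LINT x:cball (0::'a) (r\<^sub>0 + t)|lebesgue.
       wave_packet n l I (\<beta> + 1) t x powr q' * wave_packet n l I \<beta> t x powr (1 - q'))
      \<le> C1 * (1 + real I) * (2 ^ I) powr e"
    using wave_packet_cone_integral[OF l r0 q, where 'a='a] unfolding dec_eq[symmetric] \<beta>_def q'_def e_def by blast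
  obtain C2 where C2: "C2 > 0" and der: "\<And>R t. R > 0 \<Longrightarrow>
     \<bar>deriv (time_cutoff m R) t\<bar> \<le> C2 / R * time_cutoff m R t powr (1 / q) \<and>
     \<bar>deriv (deriv (time_cutoff m R)) t\<bar> \<le> C2 / R\<^sup>2 * time_cutoff m R t powr (1 / q) \<and>
     (t < R / 2 \<longrightarrow> deriv (time_cutoff m R) t = 0 \<and> deriv (deriv (time_cutoff m R)) t = 0)"
    using time_cutoff_derivs[OF q] unfolding m_def by blast
  obtain j0 :: nat where j0: "2 * t0 + (r\<^sub>0 + 1) < 2 ^ j0"
    using real_arch_pow[of 2 "2 * t0 + (r\<^sub>0 + 1)"] by auto
  have big: "t0 \<le> 2 ^ j / 2" "r\<^sub>0 + 1 \<le> 2 ^ j" if "j0 \<le> j" for j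
  proof -
    have "(2::real) ^ j0 \<le> 2 ^ j" using that by simp
    then have "2 * t0 + (r\<^sub>0 + 1) \<le> 2 ^ j" using j0 by linarith
    then show "t0 \<le> 2 ^ j / 2" "r\<^sub>0 + 1 \<le> 2 ^ j" using t0 r0 by auto
  qed
  define kp where "kp = l powr \<beta> * exp (- (3 * l))"
  have kp: "kp > 0" using l by (simp add: kp_def)
  define e2 where "e2 = dec * (2 - q)"
  define c1 where "c1 = kp * k * 2 powr - \<bar>e2\<bar> / 2"
  have c1: "c1 > 0" using kp k by (simp add: c1_def)
  define D0 where "D0 = C2 * (1 / l + 2) * a powr - (1 / q)"
  have D0: "D0 > 0" using C2 l a by (simp add: D0_def add_pos_pos)
  define K3 where "K3 = 2 powr q' * (D0 powr q' * C1)"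
  have K3: "K3 > 0" using D0 C1 by (simp add: K3_def)
  define c2 where "c2 = (2 * K3) powr (1 - q)"
  have c2: "c2 > 0" using K3 by (simp add: c2_def)
  obtain C where C: "C > 0" and blow: "\<And>\<epsilon> S Z J. 0 < \<epsilon> \<Longrightarrow> \<epsilon> \<le> 1 \<Longrightarrow> S j0 \<ge> 0 \<Longrightarrow>
    (\<And>j. j0 < j \<Longrightarrow> j \<le> J \<Longrightarrow> S j \<ge> S (j - 1) + c1 * \<epsilon> powr q \<and> S (j - 1) \<le> Z j \<and> Z j \<le> S j \<and>
       Z j - S (j - 1) \<ge> c2 * (1 + real j) powr (1 - q) * Z j powr q) \<Longrightarrow>
    real J \<le> C * \<epsilon> powr (- (q * (q - 1)))"
    using discrete_blowup[OF q c1 c2, of j0] by blast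
  have small: "real J \<le> (C + real j0) * \<epsilon> powr (- (q * (q - 1)))"
    if sol: "solution \<epsilon> T u v" and \<epsilon>: "0 < \<epsilon>" "\<epsilon> \<le> 1" and J: "ereal (2 ^ J) < T" for \<epsilon> T u v J
  proof (cases "j0 \<le> J")
    case False
    have "\<epsilon> powr (- (q * (q - 1))) \<ge> 1"
      using \<epsilon> q by (intro one_le_powr_minus) auto
    then have "real j0 * 1 \<le> (C + real j0) * \<epsilon> powr (- (q * (q - 1)))"
      using C by (intro mult_mono) auto
    then show ?thesis using False by simp
  next
    case j0J: True
    interpret cone_solution G \<epsilon> r\<^sub>0 f g T u v by (rule sol)
    obtain N where N: "negligible N" "0 \<in> N"
      "\<And>t. t \<notin> N \<Longrightarrow> 0 \<le> t \<Longrightarrow> ereal t < T \<Longrightarrow> integrable lebesgue (\<lambda>x. G (u t x) (v t x))"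
      using solution_good_times[OF sol] by blast
    \<comment> \<open>One set of directions, dense enough for the last scale, serves all scales, so
      packets of different lengths consist of the same waves.\<close>
    define n where "n = nat \<lceil>r\<^sub>0 + 1 + 2 ^ J\<rceil>"
    have n: "r\<^sub>0 + 1 + 2 ^ J \<le> real n" unfolding n_def by linarith
    have n1: "n \<ge> 1"
    proof -
      have "(0::real) < 2 ^ J" by simp
      then have "real n > 1" using n r0 by linarith
      then show ?thesis by simp
    qed
    have RJ: "(2::real) ^ j \<le> 2 ^ J" if "j \<le> J" for j using that by simp
    define li where "li i = l / 2 ^ i" for i :: nat
    have li: "0 < li i" "li i \<le> l" for i using l by (auto simp: li_def field_simps)
    define E :: "nat \<Rightarrow> 'a \<Rightarrow> real" where "E i = avg_exp n (li i)" for i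
    have E_cont: "continuous_on UNIV (E i)" for i unfolding E_def by (intro continuous_intros)
    have E_nn: "E i x \<ge> 0" for i x unfolding E_def using avg_exp_pos[OF n1] by (rule less_imp_le)
    \<comment> \<open>Defined through the separate frequencies, each known to be integrable in time;
      the formula as one pairing with the packet holds at good times.\<close>
    define X where "X j t = (\<Sum>i\<le>j. li i powr \<beta> * (exp (- (li i * t)) * Gpair (E i) t))" for j t
    have X_nn: "X j t \<ge> 0" for j t
      unfolding X_def by (intro sum_nonneg mult_nonneg_nonneg Gpair_nonneg E_nn) auto
    have X_mono: "X i t \<le> X j t" if "i \<le> j" for i j t
      unfolding X_def using that by (intro sum_mono2 mult_nonneg_nonneg Gpair_nonneg E_nn) auto
    have X_ai: "(\<lambda>t. h t * X j t) integrable_on {0..2 ^ J}" if h: "continuous_on UNIV h" for h j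
    proof -
      have e1: "h t * X j t = (\<Sum>i\<le>j. (h t * (li i powr \<beta> * exp (- (li i * t)))) * Gpair (E i) t)" for t
        unfolding X_def sum_distrib_left by (simp only: mult.assoc)
      show ?thesis
        unfolding e1
        by (intro integrable_sum set_lebesgue_integral_eq_integral(1) Gpair_times_continuous J E_cont
            continuous_intros continuous_on_subset[OF h]) auto
    qed
    have X_int: "X j integrable_on {0..2 ^ J}" for j using X_ai[of "\<lambda>t. 1" j] by simp
    have Xsub: "X j integrable_on {x..y}" if "0 \<le> x" "y \<le> 2 ^ J" for j x y
      by (rule integrable_subinterval_real[OF X_int]) (use that in auto)
    define \<psi> where "\<psi> j = time_cutoff m (2 ^ j)" for j :: nat
    have pj: "(2::real) ^ j > 0" for j :: nat by simp
    note tc = time_cutoff_props[OF pj, where m=m, folded \<psi>_def]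
    have der: "\<bar>deriv (\<psi> j) t\<bar> \<le> C2 / 2 ^ j * \<psi> j t powr (1 / q) \<and>
       \<bar>deriv (deriv (\<psi> j)) t\<bar> \<le> C2 / (2 ^ j)\<^sup>2 * \<psi> j t powr (1 / q) \<and>
       (t < 2 ^ j / 2 \<longrightarrow> deriv (\<psi> j) t = 0 \<and> deriv (deriv (\<psi> j)) t = 0)" for j t
      unfolding \<psi>_def by (rule der[OF pj])
    have X\<psi>sub: "(\<lambda>t. X j t * \<psi> j t) integrable_on {x..y}" if "0 \<le> x" "y \<le> 2 ^ J" for j x y
    proof (rule integrable_subinterval_real)
      show "(\<lambda>t. X j t * \<psi> j t) integrable_on {0..2 ^ J}"
        using X_ai[OF C_infinity_continuous[OF tc(1)], of j j] by (simp add: mult.commute)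
    qed (use that in auto)
    define S where "S j = integral {0..2 ^ j} (X j)" for j
    define Z where "Z j = integral {0..2 ^ j} (\<lambda>t. X j t * \<psi> j t)" for j
    define W where "W j = integral {2 ^ j / 2..2 ^ j} (\<lambda>t. X j t * \<psi> j t)" for j
    have good: "t \<in> I" "integrable lebesgue (\<lambda>x. G (u t x) (v t x))" "ereal t < T" "0 \<le> t"
      if "t \<in> {0..2 ^ J} - N" for t
    proof -
      show t: "ereal t < T" "0 \<le> t" using that le_less_trans[of "ereal t" "ereal (2 ^ J)" T] J by auto
      then show "t \<in> I" by simp
      show "integrable lebesgue (\<lambda>x. G (u t x) (v t x))" using N(3)[of t] that t by auto
    qed
    have X_packet: "X j t = Gpair (wave_packet n l j \<beta> t) t" if "t \<in> {0..2 ^ J} - N" for j t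
      unfolding X_def E_def li_def by (rule Gpair_wave_packet[OF good(1,2)[OF that], symmetric])
    have "S j \<ge> S (j - 1) + c1 * \<epsilon> powr q \<and> S (j - 1) \<le> Z j \<and> Z j \<le> S j \<and>
       Z j - S (j - 1) \<ge> c2 * (1 + real j) powr (1 - q) * Z j powr q" if j: "j0 < j" "j \<le> J" for j
    proof -
      define R :: real where "R = 2 ^ j"
      have R: "R > 0" "R / 2 = 2 ^ (j - 1)" "R \<le> 2 ^ J" using j RJ[of j] by (auto simp: R_def power_diff)
      have Rb: "t0 \<le> R / 2" "r\<^sub>0 + 1 \<le> R" using big[of j] j by (auto simp: R_def)
      \<comment> \<open>Lengthening the packet adds nonnegative terms, so quantities of consecutive
        scales can be compared although the weight has changed.\<close>
      have S_prev: "S (j - 1) \<le> integral {0..R / 2} (X j)"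
        unfolding S_def R(2)[symmetric] using R(1,3) by (intro integral_le Xsub X_mono) auto
      have S_split: "S j = integral {0..R / 2} (X j) + integral {R / 2..R} (X j)"
        unfolding S_def R_def[symmetric]
        using R by (intro Henstock_Kurzweil_Integration.integral_combine[symmetric] Xsub) auto
      have \<psi>1: "integral {0..R / 2} (\<lambda>t. X j t * \<psi> j t) = integral {0..R / 2} (X j)"
        by (rule integral_cong) (simp add: tc(4) R_def)
      have Z_split: "Z j = integral {0..R / 2} (X j) + W j"
        unfolding Z_def W_def R_def[symmetric] \<psi>1[symmetric]
        using R by (intro Henstock_Kurzweil_Integration.integral_combine[symmetric] X\<psi>sub) auto
      have W0: "W j \<ge> 0" unfolding W_def R_def[symmetric] using R X_nn tc(2)
        by (intro integral_nonneg X\<psi>sub mult_nonneg_nonneg) auto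
      have ZS: "Z j \<le> S j" unfolding Z_def S_def
      proof (rule integral_le)
        fix t
        show "X j t * \<psi> j t \<le> X j t" using X_nn[of j t] tc(3)[of j t] by (simp add: mult_left_le)
      qed (use R in \<open>auto intro!: Xsub X\<psi>sub simp: R_def\<close>)
      \<comment> \<open>Only the lowest frequency of the packet and the lower bound of the
        unweighted source are used here.\<close>
      have gain: "integral {R / 2..R} (X j) \<ge> c1 * \<epsilon> powr q"
      proof -
        define L where "L = (kp * R powr - \<beta>) * (k * \<epsilon> powr q * (2 powr - \<bar>e2\<bar> * R powr e2))"
        have "L * (R / 2) = integral {R / 2..R} (\<lambda>t. L)" using R by simp
        also have "\<dots> \<le> integral {R / 2..R} (X j)"
        proof (rule integral_le_off_negligible[OF N(1)])
          fix t assume t: "t \<in> {R / 2..R} - N"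
          then have tJ: "t \<in> {0..2 ^ J} - N" using R by auto
          note gt = good[OF tJ]
          have x1: "k * \<epsilon> powr q * (2 powr - \<bar>e2\<bar> * R powr e2) \<le> (LINT x|lebesgue. G (u t x) (v t x))"
          proof -
            have "2 powr - \<bar>e2\<bar> * R powr e2 \<le> (r\<^sub>0 + 1 + t) powr e2"
              by (rule powr_comparable_lower) (use R Rb t r0 in auto)
            then have "k * \<epsilon> powr q * (2 powr - \<bar>e2\<bar> * R powr e2) \<le> k * \<epsilon> powr q * (r\<^sub>0 + 1 + t) powr e2"
              using k by (intro mult_left_mono) auto
            also have "\<dots> \<le> (LINT x|lebesgue. G (u t x) (v t x))"
              unfolding e2_def using t Rb by (intro low[OF sol \<epsilon>(1) _ gt(3,2)]) auto
            finally show ?thesis .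
          qed
          have "L \<le> (kp * R powr - \<beta>) * (LINT x|lebesgue. G (u t x) (v t x))"
            unfolding L_def using kp by (intro mult_left_mono x1) auto
          also have "\<dots> = (LINT x|lebesgue. (kp * R powr - \<beta>) * G (u t x) (v t x))" by simp
          also have "\<dots> \<le> Gpair (wave_packet n l j \<beta> t) t"
            unfolding Gpair_def
          proof (rule integral_mono_AE)
            show "integrable lebesgue (\<lambda>x. (kp * R powr - \<beta>) * G (u t x) (v t x))"
              by (intro integrable_mult_right gt(2))
            show "integrable lebesgue (\<lambda>x. G (u t x) (v t x) * wave_packet n l j \<beta> t x)"
              by (intro G_mult_integrable[OF gt(1,2)] continuous_intros)
            show "AE x in lebesgue. (kp * R powr - \<beta>) * G (u t x) (v t x) \<le> G (u t x) (v t x) * wave_packet n l j \<beta> t x"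
              using G_vanish[OF gt(1)]
            proof eventually_elim
              case (elim x)
              show ?case
              proof (cases "norm x > r\<^sub>0 + t")
                case False
                then have "kp * R powr - \<beta> \<le> wave_packet n l j \<beta> t x"
                  unfolding kp_def R_def using t Rb
                  by (intro wave_packet_ge[OF n1 l gt(4), of j r\<^sub>0]) (auto simp: R_def)
                then show ?thesis using G_nonneg by (subst mult.commute) (intro mult_left_mono)
              qed (use elim in simp)
            qed
          qed
          also have "\<dots> = X j t" by (rule X_packet[OF tJ, symmetric])
          finally show "L \<le> X j t" .
        qed (use R in \<open>auto intro!: Xsub\<close>)
        finally have "L * (R / 2) \<le> integral {R / 2..R} (X j)" .
        moreover have "L * (R / 2) = c1 * \<epsilon> powr q"
        proof -
          have "R powr - \<beta> * R powr e2 * R = R powr (1 - \<beta> + e2)"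
            using R by (simp add: powr_add powr_diff powr_minus field_simps)
          also have "1 - \<beta> + e2 = 0" using e' by (simp add: e2_def)
          finally have "R powr - \<beta> * R powr e2 * R = 1" using R by simp
          moreover have "L * (R / 2) = c1 * \<epsilon> powr q * (R powr - \<beta> * R powr e2 * R)"
            by (simp add: L_def c1_def)
          ultimately show ?thesis by simp
        qed
        ultimately show ?thesis by simp
      qed
      define M where "M = K3 * (1 + real j)"
      have M: "M > 0" using K3 by (simp add: M_def)
      \<comment> \<open>In the bracket 1/l stems from the second derivative of the cut-off, where
        passing from \<beta> to \<beta> + 1 costs R/l, and 2 from the first derivative. The
        remaining factor is Hoelder's.\<close>
      define D where "D = (C2 * (1 / l + 2) / R) * (a powr - (1 / q) * (C1 * (1 + real j) * R powr e) powr (1 - 1 / q))"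
      have D: "D \<ge> 0" using C2 l R by (simp add: D_def)
      have DM: "2 powr q' * D powr q' * R = M"
      proof -
        have "1 / q' = 1 - 1 / q" using q by (simp add: q'_def field_simps)
        then have "(1 - 1 / q) * q' = 1" using q' by (metis less_irrefl nonzero_divide_eq_eq not_one_less_zero)
        then have "((C1 * (1 + real j) * R powr e) powr (1 - 1 / q)) powr q' = C1 * (1 + real j) * R powr e"
          using C1 R by (simp add: powr_powr)
        moreover have "D = D0 / R * (C1 * (1 + real j) * R powr e) powr (1 - 1 / q)"
          by (simp add: D_def D0_def)
        ultimately have "D powr q' = D0 powr q' / R powr q' * (C1 * (1 + real j) * R powr e)"
          using D0 R C1 by (simp add: powr_mult powr_divide)
        then have "2 powr q' * D powr q' * R = M * (R powr e * R / R powr q')"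
          by (simp add: M_def K3_def)
        also have "R powr e * R / R powr q' = R powr (e + 1 - q')"
          using R by (simp add: powr_add powr_diff)
        finally show ?thesis using e R by simp
      qed
      define H where "H t = (\<Sum>i\<le>j. li i powr \<beta> *
          (Upair (E i) t * ((deriv (deriv (\<psi> j)) t - 2 * li i * deriv (\<psi> j) t) * exp (- (li i * t)))))" for t
      have \<psi>C1: "C_infinity (deriv (\<psi> j))" by (rule C_infinity_real_deriv(2)[OF tc(1)])
      have \<psi>C2: "C_infinity (deriv (deriv (\<psi> j)))" by (rule C_infinity_real_deriv(2)[OF \<psi>C1])
      have RT: "ereal R < T" using R J le_less_trans[of "ereal R" "ereal (2 ^ J)" T] by simp
      have U_cont: "continuous_on {0..R} (Upair (E i))" for i
        by (rule Upair_continuous) (use R RT E_cont in auto)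
      have H_cont: "continuous_on {0..R} H"
        unfolding H_def[abs_def]
        by (intro continuous_intros U_cont C_infinity_continuous \<psi>C1 \<psi>C2)
      \<comment> \<open>Each frequency obeys the cut-off identity with a nonnegative contribution of
        the data, which is dropped; the weighted sum over frequencies gives the claim.\<close>
      have Z_H: "Z j \<le> integral {0..R} H"
      proof -
        have summand: "integral {0..R} (\<lambda>t. Gpair (E i) t * (\<psi> j t * exp (- (li i * t))))
            \<le> integral {0..R} (\<lambda>t. Upair (E i) t * ((deriv (deriv (\<psi> j)) t - 2 * li i * deriv (\<psi> j) t) * exp (- (li i * t))))" for i
        proof -
          have wm: "wave_mode (li i) (E i)" unfolding E_def by (rule wave_mode_avg_exp)
          have R2: "R = 2 ^ j" by (simp add: R_def)
          have \<psi>R: "\<psi> j R = 0" unfolding R2 using tc(5)[OF m1] by simp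
          have d0: "deriv (\<psi> j) 0 = 0" using der[of j 0] by simp
          have dR: "deriv (\<psi> j) R = 0" using der[of j R] \<psi>R by simp
          have "Vpair (E i) 0 + li i * Upair (E i) 0 = \<epsilon> * ((LINT x|lebesgue. g x * E i x) + li i * (LINT x|lebesgue. f x * E i x))"
            by (simp add: Upair_0[OF E_cont] Vpair_0[OF E_cont] algebra_simps)
          also have "\<dots> \<ge> 0"
            using data[OF li n1] c \<epsilon> unfolding E_def by (intro mult_nonneg_nonneg) (auto intro: order_trans[OF less_imp_le])
          finally show ?thesis
            using cutoff_identity[OF R(1) RT wm tc(1) _ _ d0 dR] tc(5)[OF m1] tc(4) by (simp add: R2)
        qed
        have int1: "(\<lambda>t. Gpair (E i) t * (\<psi> j t * exp (- (li i * t)))) integrable_on {0..R}" for i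
        proof -
          have "(\<lambda>t. (\<psi> j t * exp (- (li i * t))) * Gpair (E i) t) absolutely_integrable_on {0..R}"
            by (intro Gpair_times_continuous RT E_cont continuous_intros C_infinity_continuous tc) (use R in auto)
          then show ?thesis by (simp add: mult.commute set_lebesgue_integral_eq_integral(1))
        qed
        have int2: "(\<lambda>t. Upair (E i) t * ((deriv (deriv (\<psi> j)) t - 2 * li i * deriv (\<psi> j) t) * exp (- (li i * t)))) integrable_on {0..R}" for i
          by (intro integrable_continuous_real continuous_intros U_cont C_infinity_continuous \<psi>C1 \<psi>C2)
        have "X j t * \<psi> j t = (\<Sum>i\<le>j. li i powr \<beta> * (Gpair (E i) t * (\<psi> j t * exp (- (li i * t)))))" for t
          unfolding X_def sum_distrib_right by (intro sum.cong refl) (simp only: mult_ac)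
        then have "Z j = (\<Sum>i\<le>j. li i powr \<beta> * integral {0..R} (\<lambda>t. Gpair (E i) t * (\<psi> j t * exp (- (li i * t)))))"
          unfolding Z_def R_def[symmetric]
          by (simp only: integral_sum[OF finite_atMost integrable_on_mult_right[OF int1]] integral_mult_right)
        also have "\<dots> \<le> (\<Sum>i\<le>j. li i powr \<beta> * integral {0..R} (\<lambda>t. Upair (E i) t * ((deriv (deriv (\<psi> j)) t - 2 * li i * deriv (\<psi> j) t) * exp (- (li i * t)))))"
          by (intro sum_mono mult_left_mono summand) auto
        also have "\<dots> = integral {0..R} H"
          unfolding H_def[abs_def]
          by (simp only: integral_sum[OF finite_atMost integrable_on_mult_right[OF int2]] integral_mult_right)
        finally show ?thesis .
      qed
      \<comment> \<open>The derivatives of the cut-off vanish before R/2, so Z is controlled by the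
        late part W alone. This yields a bound for the increment Z - S(j - 1) instead of Z
        itself.\<close>
      have H_early: "H t = 0" if "t < R / 2" for t
      proof -
        have "deriv (\<psi> j) t = 0" "deriv (deriv (\<psi> j)) t = 0" using der[of j t] that by (auto simp: R_def)
        then show ?thesis by (simp add: H_def)
      qed
      have H_late: "H t \<le> D * (X j t * \<psi> j t) powr (1 / q)" if t: "t \<in> {R / 2..R} - N" for t
      proof -
        have tJ: "t \<in> {0..2 ^ J} - N" using R t by auto
        note gt = good[OF tJ]
        define P where "P \<gamma> = Upair (wave_packet n l j \<gamma> t) t" for \<gamma>
        define Q where "Q \<gamma> = (LINT x|lebesgue. \<bar>u t x\<bar> * wave_packet n l j \<gamma> t x)" for \<gamma>
        have PQ: "\<bar>P \<gamma>\<bar> \<le> Q \<gamma>" for \<gamma>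
          unfolding P_def Q_def Upair_def by (rule abs_pair_le) (rule wave_packet_pos[OF n1 l])
        have P_sum: "P \<gamma> = (\<Sum>i\<le>j. li i powr \<gamma> * (exp (- (li i * t)) * Upair (E i) t))" for \<gamma>
          unfolding P_def E_def li_def by (rule Upair_wave_packet[OF gt(1)])
        \<comment> \<open>The factor \<open>li i\<close> in front of the first derivative of the
          cut-off raises the exponent of the packet from \<beta> to \<beta> + 1.\<close>
        have HP: "H t = deriv (deriv (\<psi> j)) t * P \<beta> - 2 * deriv (\<psi> j) t * P (\<beta> + 1)"
        proof -
          have "li i powr (\<beta> + 1) = li i powr \<beta> * li i" for i using li(1)[of i] by (simp add: powr_add)
          then show ?thesis
            unfolding P_sum H_def sum_distrib_left sum_subtractf[symmetric]
            by (intro sum.cong refl) (simp add: algebra_simps)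
        qed
        have Q_int: "integrable lebesgue (\<lambda>x. \<bar>u t x\<bar> * wave_packet n l j \<gamma> t x)" for \<gamma>
        proof -
          have "integrable lebesgue (\<lambda>x. u t x * wave_packet n l j \<gamma> t x)"
            by (rule pair_cut(1)[OF u_L2[OF gt(1)] u_vanish[OF gt(1)] order_refl])
              (use gt in \<open>auto intro: continuous_intros\<close>)
          then have "integrable lebesgue (\<lambda>x. \<bar>u t x * wave_packet n l j \<gamma> t x\<bar>)" by (rule integrable_abs)
          then show ?thesis by (simp add: abs_mult abs_of_pos[OF wave_packet_pos[OF n1 l]])
        qed
        have QQ: "Q \<beta> \<le> (R / l) * Q (\<beta> + 1)"
        proof -
          have "Q \<beta> \<le> (LINT x|lebesgue. (R / l) * (\<bar>u t x\<bar> * wave_packet n l j (\<beta> + 1) t x))"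
            unfolding Q_def
          proof (rule integral_mono[OF Q_int integrable_mult_right[OF Q_int]])
            fix x
            have "\<bar>u t x\<bar> * wave_packet n l j \<beta> t x \<le> \<bar>u t x\<bar> * ((R / l) * wave_packet n l j (\<beta> + 1) t x)"
              unfolding R_def by (intro mult_left_mono wave_packet_le_Suc n1 l) auto
            then show "\<bar>u t x\<bar> * wave_packet n l j \<beta> t x \<le> (R / l) * (\<bar>u t x\<bar> * wave_packet n l j (\<beta> + 1) t x)"
              by (simp add: mult.left_commute)
          qed
          then show ?thesis by (simp add: Q_def)
        qed
        have Q_nn: "Q (\<beta> + 1) \<ge> 0" using PQ[of "\<beta> + 1"] abs_ge_zero[of "P (\<beta> + 1)"] by linarith
        define Y where "Y = \<psi> j t powr (1 / q)"
        have Y: "Y \<ge> 0" by (simp add: Y_def)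
        have d12: "\<bar>deriv (\<psi> j) t\<bar> \<le> C2 / R * Y" "\<bar>deriv (deriv (\<psi> j)) t\<bar> \<le> C2 / R\<^sup>2 * Y"
          using der[of j t] by (auto simp: Y_def R_def)
        have "H t \<le> \<bar>deriv (deriv (\<psi> j)) t * P \<beta>\<bar> + \<bar>2 * deriv (\<psi> j) t * P (\<beta> + 1)\<bar>"
          unfolding HP by linarith
        also have "\<dots> = \<bar>deriv (deriv (\<psi> j)) t\<bar> * \<bar>P \<beta>\<bar> + 2 * \<bar>deriv (\<psi> j) t\<bar> * \<bar>P (\<beta> + 1)\<bar>"
          by (simp add: abs_mult)
        also have "\<dots> \<le> (C2 / R\<^sup>2 * Y) * ((R / l) * Q (\<beta> + 1)) + 2 * (C2 / R * Y) * Q (\<beta> + 1)"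
          using d12 PQ[of \<beta>] PQ[of "\<beta> + 1"] QQ C2 R Y
          by (intro add_mono mult_mono) auto
        also have "\<dots> = (C2 * (1 / l + 2) / R) * Y * Q (\<beta> + 1)"
          using R l by (simp add: power2_eq_square field_simps)
        also have "\<dots> \<le> (C2 * (1 / l + 2) / R) * Y * ((X j t / a) powr (1 / q) * (C1 * (1 + real j) * R powr e) powr (1 - 1 / q))"
        proof (rule mult_left_mono)
          note w = solution_G_lower[OF sol gt(4,3,2), of "u t" q a, simplified]
          have "Q (\<beta> + 1) \<le> (Gpair (wave_packet n l j \<beta> t) t / a) powr (1 / q) * (C1 * (1 + real j) * R powr e) powr (1 - 1 / q)"
            unfolding Q_def
          proof (rule pair_Hoelder[OF gt(1,2) q a w(1-3)])
            show "C1 * (1 + real j) * R powr e > 0" using C1 R by simp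
            show "(LINT x:cball (0::'a) (r\<^sub>0 + t)|lebesgue. wave_packet n l j (\<beta> + 1) t x powr (q / (q - 1))
                * wave_packet n l j \<beta> t x powr (1 - q / (q - 1))) \<le> C1 * (1 + real j) * R powr e"
              unfolding R_def q'_def[symmetric] using t Rb R n by (intro packet) (auto simp: R_def)
          qed (auto intro: continuous_intros wave_packet_pos n1 l)
          then show "Q (\<beta> + 1) \<le> (X j t / a) powr (1 / q) * (C1 * (1 + real j) * R powr e) powr (1 - 1 / q)"
            by (simp add: X_packet[OF tJ])
        qed (use C2 l R Y in auto)
        also have "\<dots> = D * (X j t * \<psi> j t) powr (1 / q)"
        proof -
          have "(X j t / a) powr (1 / q) = a powr - (1 / q) * X j t powr (1 / q)"
            using X_nn[of j t] a by (simp add: powr_divide powr_minus_divide)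
          moreover have "(X j t * \<psi> j t) powr (1 / q) = X j t powr (1 / q) * Y"
            using X_nn tc(2) by (simp add: powr_mult Y_def)
          ultimately show ?thesis by (simp add: D_def)
        qed
        finally show ?thesis .
      qed
      \<comment> \<open>Young's inequality with a free parameter, chosen below, plays the part of
        Hoelder's inequality in time.\<close>
      have key: "Z j \<le> \<tau> * W j / 2 + M / 2 * \<tau> powr (1 - q')" if \<tau>: "\<tau> > 0" for \<tau>
      proof -
        define B where "B = 2 powr q' * D powr q' * \<tau> powr (1 - q')"
        have pt: "H t \<le> \<tau> / 2 * (X j t * \<psi> j t) + B" if t: "t \<in> {R / 2..R} - N" for t
        proof -
          define y where "y = X j t * \<psi> j t"
          have y: "y \<ge> 0" using X_nn tc(2) by (simp add: y_def)
          have "\<tau> powr (1 / q) * \<tau> powr - (1 / q) = 1" using \<tau> by (simp flip: powr_add)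
          then have "D * y powr (1 / q) = (\<tau> powr (1 / q) * y powr (1 / q)) * (D * \<tau> powr - (1 / q))" by simp
          also have "\<tau> powr (1 / q) * y powr (1 / q) = (\<tau> * y) powr (1 / q)" using \<tau> y by (simp add: powr_mult)
          also have "(\<tau> * y) powr (1 / q) * (D * \<tau> powr - (1 / q)) \<le> (\<tau> * y) / 2 + 2 powr (q / (q - 1)) * (D * \<tau> powr - (1 / q)) powr (q / (q - 1))"
            by (rule Young_half) (use \<tau> y D q in auto)
          also have "(D * \<tau> powr - (1 / q)) powr (q / (q - 1)) = D powr q' * \<tau> powr (1 - q')"
          proof -
            have "- (1 / q) * q' = 1 - q'" using q by (simp add: q'_def field_simps)
            then show ?thesis using D \<tau> by (simp add: powr_mult powr_powr q'_def[symmetric])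
          qed
          finally show ?thesis using H_late[OF t] by (simp add: y_def B_def q'_def)
        qed
        have "integral {0..R} H = integral {0..R / 2} H + integral {R / 2..R} H"
          using R by (intro Henstock_Kurzweil_Integration.integral_combine[symmetric] integrable_continuous_real H_cont) auto
        also have "integral {0..R / 2} H = 0"
        proof -
          have "integral {0..R / 2} H = integral {0..R / 2} (\<lambda>t. 0)"
            by (rule integral_spike[of "{R / 2}"]) (use H_early in auto)
          then show ?thesis by simp
        qed
        also have "0 + integral {R / 2..R} H \<le> 0 + integral {R / 2..R} (\<lambda>t. \<tau> / 2 * (X j t * \<psi> j t) + B)"
        proof (intro add_left_mono integral_le_off_negligible[OF N(1)] pt)
          show "H integrable_on {R / 2..R}"
            by (intro integrable_continuous_real continuous_on_subset[OF H_cont]) (use R in auto)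
          show "(\<lambda>t. \<tau> / 2 * (X j t * \<psi> j t) + B) integrable_on {R / 2..R}"
            by (intro integrable_add integrable_on_mult_right X\<psi>sub integrable_const_ivl) (use R in auto)
        qed
        also have "0 + integral {R / 2..R} (\<lambda>t. \<tau> / 2 * (X j t * \<psi> j t) + B)
            = \<tau> / 2 * W j + R / 2 * B"
        proof -
          have "(\<lambda>t. \<tau> / 2 * (X j t * \<psi> j t)) integrable_on {R / 2..R}"
            by (intro integrable_on_mult_right X\<psi>sub) (use R in auto)
          then have "integral {R / 2..R} (\<lambda>t. \<tau> / 2 * (X j t * \<psi> j t) + B)
              = integral {R / 2..R} (\<lambda>t. \<tau> / 2 * (X j t * \<psi> j t)) + integral {R / 2..R} (\<lambda>t. B)"
            by (rule integral_add) (rule integrable_const_ivl)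
          then show ?thesis unfolding integral_mult_right using R by (simp add: W_def R_def)
        qed
        also have "R / 2 * B = M / 2 * \<tau> powr (1 - q')"
          unfolding DM[symmetric] B_def by simp
        finally show ?thesis using Z_H by simp
      qed
      have final: "W j \<ge> c2 * (1 + real j) powr (1 - q) * Z j powr q"
      proof (cases "Z j > 0")
        case True
        \<comment> \<open>With this choice the constant term is Z j / 2 and can be absorbed, leaving
          W j \<ge> M^(1-q) (Z j)^q.\<close>
        define \<tau> where "\<tau> = (M / Z j) powr (q - 1)"
        have \<tau>: "\<tau> > 0" using M True by (simp add: \<tau>_def)
        have "(q - 1) * (1 - q') = - 1" using q by (simp add: q'_def field_simps)
        then have "\<tau> powr (1 - q') = Z j / M"
          using M True by (simp add: \<tau>_def powr_powr powr_minus)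
        then have "Z j \<le> \<tau> * W j / 2 + Z j / 2" using key[OF \<tau>] M by simp
        then have "Z j / \<tau> \<le> W j" using \<tau> by (simp add: field_simps)
        moreover have "Z j / \<tau> = M powr (1 - q) * Z j powr q"
        proof -
          have "Z j / \<tau> = Z j powr 1 * (Z j powr (q - 1) / M powr (q - 1))"
            using M True by (simp add: \<tau>_def powr_divide)
          also have "\<dots> = (Z j powr 1 * Z j powr (q - 1)) * M powr - (q - 1)"
            by (simp only: powr_minus divide_inverse mult.assoc)
          also have "Z j powr 1 * Z j powr (q - 1) = Z j powr q"
            by (simp only: powr_add[symmetric]) simp
          finally show ?thesis by (simp add: mult.commute)
        qed
        moreover have "c2 * (1 + real j) powr (1 - q) \<le> M powr (1 - q)"
        proof -
          have "M powr (1 - q) = K3 powr (1 - q) * (1 + real j) powr (1 - q)"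
            using K3 by (simp add: M_def powr_mult)
          moreover have "c2 \<le> K3 powr (1 - q)"
            unfolding c2_def using K3 q by (intro powr_mono2') auto
          ultimately show ?thesis by (simp add: mult_right_mono)
        qed
        then have "c2 * (1 + real j) powr (1 - q) * Z j powr q \<le> M powr (1 - q) * Z j powr q"
          by (rule mult_right_mono) simp
        ultimately show ?thesis by linarith
      next
        case False
        have "Z j \<ge> 0" unfolding Z_split
          using W0 R(1,3) by (intro add_nonneg_nonneg integral_nonneg Xsub X_nn) auto
        then have "Z j = 0" using False by simp
        then show ?thesis using W0 by simp
      qed
      show ?thesis
      proof (intro conjI)
        show "S (j - 1) + c1 * \<epsilon> powr q \<le> S j" using S_prev S_split gain by linarith
        show "S (j - 1) \<le> Z j" using S_prev Z_split W0 by linarith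
        show "Z j \<le> S j" by (rule ZS)
        show "c2 * (1 + real j) powr (1 - q) * Z j powr q \<le> Z j - S (j - 1)"
          using final Z_split S_prev by linarith
      qed
    qed
    moreover have "S j0 \<ge> 0" unfolding S_def using RJ[OF j0J] by (intro integral_nonneg Xsub X_nn) auto
    ultimately have "real J \<le> C * \<epsilon> powr (- (q * (q - 1)))" using \<epsilon> by (intro blow[of \<epsilon> S J Z]) auto
    also have "\<dots> \<le> (C + real j0) * \<epsilon> powr (- (q * (q - 1)))" by (intro mult_right_mono) auto
    finally show ?thesis .
  qed
  show ?thesis
  proof (intro exI[of _ "C + real j0"] conjI allI impI)
    show "C + real j0 > 0" using C by simp
    fix \<epsilon> T u v J
    assume "solution \<epsilon> T u v \<and> 0 < \<epsilon> \<and> \<epsilon> \<le> 1 \<and> ereal (2 ^ J) < T"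
    then show "real J \<le> (C + real j0) * \<epsilon> powr (- (q * (q - 1)))"
      by (elim conjE) (rule small)
  qed
qed

end

section \<open>Lifespan bounds\<close>

context blowup_data
begin

text \<open>For \<gamma> = 1 - dec (p - 1) > 0 the weight has the unbounded primitive (s0 +
  t)^\<gamma> / \<gamma>, and the Glassey estimate is inverted. The initial value s0^\<gamma> is
  absorbed because \<epsilon>^(1-p) \<ge> 1 for \<epsilon> \<le> 1.\<close>

lemma lifespan_Glassey_subcritical:
  assumes \<alpha>: "dec * (p - 1) < 1"
  shows "\<exists>C>0. \<forall>\<epsilon> T u v. solution \<epsilon> T u v \<and> 0 < \<epsilon> \<and> \<epsilon> \<le> 1 \<longrightarrow>
    T \<le> ereal (C * \<epsilon> powr (- ((p - 1) / (1 - dec * (p - 1)))))"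
proof -
  define \<gamma> where "\<gamma> = 1 - dec * (p - 1)"
  have \<gamma>: "\<gamma> > 0" using \<alpha> by (simp add: \<gamma>_def)
  obtain k where k: "k > 0" and est: "\<And>\<epsilon> T u v T1 A. solution \<epsilon> T u v \<Longrightarrow> \<epsilon> > 0 \<Longrightarrow> 0 \<le> T1 \<Longrightarrow> ereal T1 < T \<Longrightarrow>
     (\<And>t. t \<in> {0..T1} \<Longrightarrow> (A has_real_derivative (r\<^sub>0 + 1 + t) powr - (dec * (p - 1))) (at t within {0..T1})) \<Longrightarrow>
     k * (A T1 - A 0) \<le> \<epsilon> powr (1 - p)"
    using Glassey_estimate by blast
  define s0 where "s0 = r\<^sub>0 + 1"
  have s0: "s0 > 0" using r0 by (simp add: s0_def)
  define K where "K = \<gamma> / k + s0 powr \<gamma>"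
  have K: "K > 0" unfolding K_def using \<gamma> k by (intro add_pos_nonneg) auto
  have "T \<le> ereal (K powr (1 / \<gamma>) * \<epsilon> powr (- ((p - 1) / \<gamma>)))"
    if sol: "solution \<epsilon> T u v" and \<epsilon>: "0 < \<epsilon>" "\<epsilon> \<le> 1" for \<epsilon> T u v
  proof (rule ereal_le_from_reals)
    fix R :: real assume R: "0 < R" "ereal R < T"
    have E1: "\<epsilon> powr (1 - p) \<ge> 1"
      using one_le_powr_minus[of \<epsilon> "p - 1"] \<epsilon> p by simp
    have "k * ((s0 + R) powr \<gamma> / \<gamma> - (s0 + 0) powr \<gamma> / \<gamma>) \<le> \<epsilon> powr (1 - p)"
    proof (rule est[OF sol \<epsilon>(1) _ R(2), of "\<lambda>t. (s0 + t) powr \<gamma> / \<gamma>"])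
      fix t assume "t \<in> {0..R}"
      then have pos: "s0 + t > 0" using s0 by simp
      have "((\<lambda>t. s0 + t) has_real_derivative 1) (at t within {0..R})" by (auto intro!: derivative_eq_intros)
      from DERIV_chain2[OF has_real_derivative_powr[OF pos, of \<gamma>] this]
      have "((\<lambda>t. (s0 + t) powr \<gamma>) has_real_derivative \<gamma> * (s0 + t) powr (\<gamma> - 1)) (at t within {0..R})" by simp
      from DERIV_cdivide[OF this, of \<gamma>]
      have "((\<lambda>t. (s0 + t) powr \<gamma> / \<gamma>) has_real_derivative (s0 + t) powr (\<gamma> - 1)) (at t within {0..R})"
        using \<gamma> by simp
      then show "((\<lambda>t. (s0 + t) powr \<gamma> / \<gamma>) has_real_derivative (r\<^sub>0 + 1 + t) powr - (dec * (p - 1))) (at t within {0..R})"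
        by (simp add: \<gamma>_def s0_def)
    qed (use R in auto)
    then have "(s0 + R) powr \<gamma> \<le> \<gamma> / k * \<epsilon> powr (1 - p) + s0 powr \<gamma> * 1"
      using \<gamma> k by (simp add: field_simps)
    also have "\<dots> \<le> \<gamma> / k * \<epsilon> powr (1 - p) + s0 powr \<gamma> * \<epsilon> powr (1 - p)"
      using E1 by (intro add_left_mono mult_left_mono) auto
    also have "\<dots> = K * \<epsilon> powr (1 - p)" by (simp add: K_def algebra_simps)
    finally have "((s0 + R) powr \<gamma>) powr (1 / \<gamma>) \<le> (K * \<epsilon> powr (1 - p)) powr (1 / \<gamma>)"
      using \<gamma> by (intro powr_mono2) auto
    moreover have "((s0 + R) powr \<gamma>) powr (1 / \<gamma>) = s0 + R" using \<gamma> s0 R by (simp add: powr_powr)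
    moreover have "(K * \<epsilon> powr (1 - p)) powr (1 / \<gamma>) = K powr (1 / \<gamma>) * \<epsilon> powr (- ((p - 1) / \<gamma>))"
    proof -
      have "(1 - p) * (1 / \<gamma>) = - ((p - 1) / \<gamma>)" by (simp add: minus_divide_left)
      then show ?thesis using K by (simp only: powr_mult powr_powr less_imp_le powr_ge_zero)
    qed
    ultimately show "R \<le> K powr (1 / \<gamma>) * \<epsilon> powr (- ((p - 1) / \<gamma>))" using s0 by linarith
  qed simp
  moreover have "K powr (1 / \<gamma>) > 0" using K by simp
  ultimately show ?thesis unfolding \<gamma>_def by blast
qed

text \<open>The weight is now 1 / (s0 + t), whose primitive is only logarithmic; this produces the
  exponential.\<close>

lemma lifespan_Glassey_critical:
  assumes \<alpha>: "dec * (p - 1) = 1"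
  shows "\<exists>C>0. \<forall>\<epsilon> T u v. solution \<epsilon> T u v \<and> 0 < \<epsilon> \<and> \<epsilon> \<le> 1 \<longrightarrow>
    T \<le> ereal (exp (C * \<epsilon> powr (- (p - 1))))"
proof -
  obtain k where k: "k > 0" and est: "\<And>\<epsilon> T u v T1 A. solution \<epsilon> T u v \<Longrightarrow> \<epsilon> > 0 \<Longrightarrow> 0 \<le> T1 \<Longrightarrow> ereal T1 < T \<Longrightarrow>
     (\<And>t. t \<in> {0..T1} \<Longrightarrow> (A has_real_derivative (r\<^sub>0 + 1 + t) powr - (dec * (p - 1))) (at t within {0..T1})) \<Longrightarrow>
     k * (A T1 - A 0) \<le> \<epsilon> powr (1 - p)"
    using Glassey_estimate by blast
  define s0 where "s0 = r\<^sub>0 + 1"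
  have s0: "s0 \<ge> 1" using r0 by (simp add: s0_def)
  have ls0: "ln s0 \<ge> 0" using s0 by simp
  define C where "C = 1 / k + ln s0"
  have C: "C > 0" unfolding C_def using k ls0 by (intro add_pos_nonneg) auto
  have "T \<le> ereal (exp (C * \<epsilon> powr (- (p - 1))))"
    if sol: "solution \<epsilon> T u v" and \<epsilon>: "0 < \<epsilon>" "\<epsilon> \<le> 1" for \<epsilon> T u v
  proof (rule ereal_le_from_reals)
    fix R :: real assume R: "0 < R" "ereal R < T"
    define E where "E = \<epsilon> powr (- (p - 1))"
    have E1: "E \<ge> 1"
      using one_le_powr_minus[of \<epsilon> "p - 1"] \<epsilon> p by (simp add: E_def)
    have "k * (ln (s0 + R) - ln (s0 + 0)) \<le> \<epsilon> powr (1 - p)"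
    proof (rule est[OF sol \<epsilon>(1) _ R(2), of "\<lambda>t. ln (s0 + t)"])
      fix t assume "t \<in> {0..R}"
      then have pos: "s0 + t > 0" using s0 by simp
      then have "((\<lambda>t. ln (s0 + t)) has_real_derivative 1 / (s0 + t)) (at t within {0..R})"
        by (auto intro!: derivative_eq_intros)
      then show "((\<lambda>t. ln (s0 + t)) has_real_derivative (r\<^sub>0 + 1 + t) powr - (dec * (p - 1))) (at t within {0..R})"
        using pos by (simp add: \<alpha> s0_def powr_minus divide_inverse)
    qed (use R in auto)
    then have "k * (ln (s0 + R) - ln s0) \<le> E" by (simp add: E_def)
    then have "ln (s0 + R) \<le> 1 / k * E + ln s0 * 1"
      using k by (simp add: field_simps)
    also have "\<dots> \<le> 1 / k * E + ln s0 * E"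
      using E1 ls0 by (intro add_left_mono mult_left_mono) auto
    also have "\<dots> = C * E" by (simp add: C_def algebra_simps)
    finally have "exp (ln (s0 + R)) \<le> exp (C * E)" by simp
    then show "R \<le> exp (C * \<epsilon> powr (- (p - 1)))" using s0 R by (simp add: E_def)
  qed simp
  then show ?thesis using C by blast
qed

text \<open>Times below the threshold \<open>R1\<close> are covered by adding \<open>R1\<close> to
  the constant, since the negative power of \<epsilon> is at least 1.\<close>

lemma lifespan_subcritical:
  assumes rc: "(r, c) \<in> {(q, a), (p, b)}" and \<gamma>: "(q + 1) / (q - 1) - dec * r > 0"
  shows "\<exists>C>0. \<forall>\<epsilon> T u v. solution \<epsilon> T u v \<and> 0 < \<epsilon> \<and> \<epsilon> \<le> 1 \<longrightarrow>
    T \<le> ereal (C * \<epsilon> powr (- (r / ((q + 1) / (q - 1) - dec * r))))"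
proof -
  define \<gamma> where "\<gamma> = (q + 1) / (q - 1) - dec * r"
  have \<gamma>: "\<gamma> > 0" using assms by (simp add: \<gamma>_def)
  have r: "r > 1" using rc p q by auto
  obtain K R1 where K: "K > 0" and R1: "R1 \<ge> 1" and est: "\<And>\<epsilon> T u v R. solution \<epsilon> T u v \<Longrightarrow> \<epsilon> > 0 \<Longrightarrow> R1 \<le> R \<Longrightarrow> ereal R < T \<Longrightarrow>
    \<epsilon> powr r * R powr \<gamma> \<le> K"
    using subcritical_estimate[OF rc] unfolding \<gamma>_def by blast
  define C where "C = K powr (1 / \<gamma>) + R1"
  have C: "C > 0" unfolding C_def using R1 by (intro add_nonneg_pos) auto
  have "T \<le> ereal (C * \<epsilon> powr (- (r / \<gamma>)))"
    if sol: "solution \<epsilon> T u v" and \<epsilon>: "0 < \<epsilon>" "\<epsilon> \<le> 1" for \<epsilon> T u v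
  proof (rule ereal_le_from_reals)
    fix R :: real assume R: "0 < R" "ereal R < T"
    define E where "E = \<epsilon> powr (- (r / \<gamma>))"
    have E1: "E \<ge> 1" unfolding E_def using \<epsilon> r \<gamma> by (intro one_le_powr_minus) auto
    show "R \<le> C * E"
    proof (cases "R1 \<le> R")
      case True
      have "\<epsilon> powr - r * (\<epsilon> powr r * R powr \<gamma>) \<le> \<epsilon> powr - r * K"
        using est[OF sol \<epsilon>(1) True R(2)] by (intro mult_left_mono) auto
      moreover have "\<epsilon> powr - r * (\<epsilon> powr r * R powr \<gamma>) = R powr \<gamma>"
        unfolding mult.assoc[symmetric] using \<epsilon> by (simp flip: powr_add)
      ultimately have "R powr \<gamma> \<le> K * \<epsilon> powr - r" by (simp only: mult.commute)
      then have "(R powr \<gamma>) powr (1 / \<gamma>) \<le> (K * \<epsilon> powr - r) powr (1 / \<gamma>)"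
        using \<gamma> by (intro powr_mono2) auto
      moreover have "(R powr \<gamma>) powr (1 / \<gamma>) = R" using \<gamma> R by (simp add: powr_powr)
      moreover have "(K * \<epsilon> powr - r) powr (1 / \<gamma>) = K powr (1 / \<gamma>) * E"
      proof -
        have "- r * (1 / \<gamma>) = - (r / \<gamma>)" by simp
        then show ?thesis unfolding E_def using K by (simp only: powr_mult powr_powr less_imp_le powr_ge_zero)
      qed
      ultimately have "R \<le> K powr (1 / \<gamma>) * E" by simp
      also have "\<dots> \<le> C * E" unfolding C_def using R1 E1 by (intro mult_right_mono) auto
      finally show ?thesis .
    next
      case False
      have "R1 * 1 \<le> C * E" unfolding C_def using R1 E1 by (intro mult_mono) auto
      then show ?thesis using False by simp
    qed
  qed (use C in simp)
  then show ?thesis unfolding \<gamma>_def using C by blast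
qed

text \<open>A bound on the number of dyadic scales below T becomes a bound on T through 2^n \<le>
  exp n; the constant C + 1 accounts for the last, incomplete scale.\<close>

lemma lifespan_Strauss_critical:
  assumes crit: "dec * q\<^sup>2 = (dec + 1) * q + 1"
  shows "\<exists>C>0. \<forall>\<epsilon> T u v. solution \<epsilon> T u v \<and> 0 < \<epsilon> \<and> \<epsilon> \<le> 1 \<longrightarrow>
    T \<le> ereal (exp (C * \<epsilon> powr (- (q * (q - 1)))))"
proof -
  obtain C where C: "C > 0" and est: "\<And>\<epsilon> T u v J. solution \<epsilon> T u v \<Longrightarrow> 0 < \<epsilon> \<Longrightarrow> \<epsilon> \<le> 1 \<Longrightarrow> ereal (2 ^ J) < T \<Longrightarrow>
    real J \<le> C * \<epsilon> powr (- (q * (q - 1)))"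
    using critical_estimate[OF crit] by blast
  have "T \<le> ereal (exp ((C + 1) * \<epsilon> powr (- (q * (q - 1)))))"
    if sol: "solution \<epsilon> T u v" and \<epsilon>: "0 < \<epsilon>" "\<epsilon> \<le> 1" for \<epsilon> T u v
  proof (rule ereal_le_from_reals)
    fix R :: real assume R: "0 < R" "ereal R < T"
    define E where "E = \<epsilon> powr (- (q * (q - 1)))"
    have E1: "E \<ge> 1" unfolding E_def using \<epsilon> q by (intro one_le_powr_minus) auto
    show "R \<le> exp ((C + 1) * E)"
    proof (cases "R < 1")
      case True
      have "(C + 1) * E \<ge> 0" using C E1 by simp
      then have "exp ((C + 1) * E) \<ge> 1" by simp
      then show ?thesis using True by linarith
    next
      case False
      obtain n0 where "R < 2 ^ n0" using real_arch_pow[of 2 R] by auto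
      define n where "n = (LEAST n. R < 2 ^ n)"
      have n: "R < 2 ^ n" unfolding n_def by (rule LeastI) fact
      have "n \<noteq> 0"
      proof
        assume "n = 0"
        then show False using n False by simp
      qed
      then obtain J where J: "n = Suc J" by (cases n) auto
      have "\<not> R < 2 ^ J" using not_less_Least[of J "\<lambda>n. R < 2 ^ n"] J unfolding n_def by simp
      then have "ereal (2 ^ J) < T" using R(2) le_less_trans[of "ereal (2 ^ J)" "ereal R" T] by simp
      then have "real J \<le> C * E" unfolding E_def by (rule est[OF sol \<epsilon>])
      then have le: "real n \<le> (C + 1) * E" using J E1 by (simp add: algebra_simps)
      have "R \<le> 2 ^ n" using n by simp
      also have "(2::real) ^ n \<le> exp 1 ^ n"
        using exp_ge_add_one_self[of 1] by (intro power_mono) auto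
      also have "\<dots> = exp (real n)" using exp_of_nat_mult[of n "1::real"] by simp
      also have "\<dots> \<le> exp ((C + 1) * E)" using le by simp
      finally show ?thesis .
    qed
  qed simp
  moreover have "C + 1 > 0" using C by simp
  ultimately show ?thesis by blast
qed

end

section \<open>The polynomial defining the Strauss exponent\<close>

lemma below_p_S:
  fixes q :: real
  assumes q: "q > 1" and less: "ereal q < p_S N"
  shows "2 + (real N + 1) * q - (real N - 1) * q\<^sup>2 > 0"
proof -
  obtain r where r: "r > 1" "2 + (real N + 1) * r - (real N - 1) * r\<^sup>2 > 0" "q < r"
    using less unfolding p_S_def less_SUP_iff by auto
  show ?thesis
  proof (cases "real N \<le> 1")
    case True
    then have "(real N - 1) * q\<^sup>2 \<le> 0" by (simp add: mult_nonpos_nonneg)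
    moreover have "(real N + 1) * q \<ge> 0" using q by simp
    ultimately show ?thesis by linarith
  next
    case False
    \<comment> \<open>Writing P for the polynomial, the product equals q P(r) + 2 (r - q). This
      reflects that P(x)/x decreases and carries positivity from r down to q.\<close>
    have "0 < r * (2 + (real N + 1) * q - (real N - 1) * q * r)"
    proof -
      have "q * (2 + (real N + 1) * r - (real N - 1) * r\<^sup>2) > 0" using q r by simp
      then have "0 < q * (2 + (real N + 1) * r - (real N - 1) * r\<^sup>2) + 2 * (r - q)" using r by simp
      then show ?thesis by (simp add: algebra_simps power2_eq_square)
    qed
    then have "2 + (real N + 1) * q - (real N - 1) * q * r > 0"
      using r by (simp add: zero_less_mult_iff)
    moreover have "(real N - 1) * q * q \<le> (real N - 1) * q * r"
      using False q r by (intro mult_left_mono) auto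
    ultimately show ?thesis by (simp add: power2_eq_square mult.assoc)
  qed
qed

text \<open>By continuity a nonzero value would keep its sign near q: a positive one puts a point
  above q into the set, a negative one contradicts positivity below the supremum.\<close>

lemma at_p_S:
  fixes q :: real
  assumes q: "q > 1" and eq: "ereal q = p_S N"
  shows "2 + (real N + 1) * q - (real N - 1) * q\<^sup>2 = 0"
proof (rule ccontr)
  define P where "P x = 2 + (real N + 1) * x - (real N - 1) * x\<^sup>2" for x :: real
  assume "2 + (real N + 1) * q - (real N - 1) * q\<^sup>2 \<noteq> 0"
  then have nz: "P q \<noteq> 0" by (simp add: P_def)
  have "isCont P q" unfolding P_def[abs_def] by (intro continuous_intros)
  then obtain d where d: "d > 0" "\<And>x. \<bar>x - q\<bar> < d \<Longrightarrow> \<bar>P x - P q\<bar> < \<bar>P q\<bar>"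
    using nz unfolding continuous_at_eps_delta dist_real_def by (metis zero_less_abs_iff)
  show False
  proof (cases "P q > 0")
    case True
    have "\<bar>P (q + d / 2) - P q\<bar> < P q" using d(1) d(2)[of "q + d / 2"] True by simp
    then have "P (q + d / 2) > 0" by linarith
    then have "ereal (q + d / 2) \<le> p_S N"
      unfolding p_S_def using q d by (intro SUP_upper) (auto simp: P_def)
    then show False using eq d by (metis add_le_same_cancel1 ereal_less_eq(3) half_gt_zero not_le)
  next
    case False
    define q1 where "q1 = max ((1 + q) / 2) (q - d / 2)"
    have q1: "1 < q1" "q1 < q" "q - d < q1" using q d by (auto simp: q1_def less_max_iff_disj)
    have "ereal q1 < p_S N" using q1 by (simp flip: eq)
    then have "P q1 > 0" using below_p_S[of q1 N] q1 by (simp add: P_def)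
    moreover have "\<bar>P q1 - P q\<bar> < \<bar>P q\<bar>" using q1 d(2)[of q1] by simp
    ultimately show False using False by linarith
  qed
qed

lemma supp_mem: "h x \<noteq> 0 \<Longrightarrow> x \<in> supp h"
  unfolding supp_def by (rule closure_subset[THEN subsetD]) simp

theorem proposition6p1:
  fixes N :: nat and p q a b r\<^sub>0 :: real
    and G :: "real \<Rightarrow> real \<Rightarrow> real"
    and f g :: "real ^ 'n \<Rightarrow> real"
  assumes N: "N = CARD('n)"
    and p: "p > 1" and q: "q > 1" and a: "a > 0" and b: "b > 0"
    and G_C1: "C_k 1 (\<lambda>z :: real \<times> real. G (fst z) (snd z))"
    and G_0: "G 0 0 = 0"
    and G_lower: "\<And>s \<sigma>. G s \<sigma> \<ge> a * \<bar>s\<bar> powr q + b * \<bar>\<sigma>\<bar> powr p"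
    and f: "C_c_infinity f" and g: "C_c_infinity g"
    and g_pos: "(LINT x|lebesgue. g x) > 0"
    and r0: "r\<^sub>0 = Sup {norm x | x. x \<in> supp (\<lambda>x. (f x, g x))}"
    and \<Gamma>: "max (\<Gamma>_S N q) (\<Gamma>_G N p) \<ge> 0 \<or> \<Gamma>_comb N p q > 0"
  shows "\<exists>\<epsilon>\<^sub>0>0. \<exists>C>0. \<forall>\<epsilon>\<in>{0<..\<epsilon>\<^sub>0}. \<forall>T u.
    weak_solution G \<epsilon> f g T u \<and>
    ess_supp {t. 0 \<le> t \<and> ereal t < T} u \<subseteq> {(x, t). norm x \<le> r\<^sub>0 + t} \<longrightarrow>
      (ereal p = p_G N \<and> q > 1 + 4 / (real N - 1) \<longrightarrow>
         T \<le> ereal (exp (C * \<epsilon> powr (- (p - 1))))) \<and>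
      (ereal p < p_G N \<and> q > 2 * p - 1 \<longrightarrow>
         T \<le> ereal (C * \<epsilon> powr (- inverse (\<Gamma>_G N p)))) \<and>
      (p \<le> q \<and> q \<le> 2 * p - 1 \<and> \<Gamma>_comb N p q > 0 \<longrightarrow>
         T \<le> ereal (C * \<epsilon> powr (- inverse (\<Gamma>_comb N p q)))) \<and>
      (p > q \<and> ereal q < p_S N \<longrightarrow>
         T \<le> ereal (C * \<epsilon> powr (- inverse (\<Gamma>_S N q)))) \<and>
      (p \<ge> q \<and> ereal q = p_S N \<longrightarrow>
         T \<le> ereal (exp (C * \<epsilon> powr (- (q * (q - 1))))))"
proof -
  let ?S = "{norm x | x. x \<in> supp (\<lambda>x. (f x, g x))}"
  define dec where "dec = (real N - 1) / 2"
  have f_cont: "continuous_on UNIV f" and g_cont: "continuous_on UNIV g"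
    using f g by (auto simp: C_c_infinity_def intro: C_infinity_continuous)
  have "bdd_above ?S"
  proof -
    have "compact (supp f)" "compact (supp g)" using f g by (auto simp: C_c_infinity_def)
    then have c: "compact (supp f \<union> supp g)" by (rule compact_Un)
    have "supp (\<lambda>x. (f x, g x)) \<subseteq> supp f \<union> supp g"
      unfolding supp_def[of "\<lambda>x. (f x, g x)"]
    proof (rule closure_minimal)
      show "{x. (f x, g x) \<noteq> 0} \<subseteq> supp f \<union> supp g"
        using supp_mem[of f] supp_mem[of g] by (auto simp: zero_prod_def)
      show "closed (supp f \<union> supp g)" by (rule compact_imp_closed[OF c])
    qed
    moreover obtain B where "\<And>x. x \<in> supp f \<union> supp g \<Longrightarrow> norm x \<le> B"
      using compact_imp_bounded[OF c] unfolding bounded_iff by blast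
    ultimately show ?thesis by (intro bdd_aboveI[of _ B]) auto
  qed
  then have r0_ge: "norm x \<le> r\<^sub>0" if "(f x, g x) \<noteq> 0" for x
    unfolding r0 using supp_mem[of "\<lambda>x. (f x, g x)" x] that by (intro cSup_upper) auto
  \<comment> \<open>The positive integral of g shows that the set of norms is nonempty, hence that
    its supremum is nonnegative.\<close>
  have "\<exists>x. g x \<noteq> 0"
  proof (rule ccontr)
    assume "\<not> ?thesis"
    then have "g = (\<lambda>x. 0)" by auto
    then show False using g_pos by simp
  qed
  then have r0_nonneg: "r\<^sub>0 \<ge> 0" using r0_ge by (metis norm_ge_zero order_trans prod.inject zero_prod_def)
  have f_out: "f x = 0" and g_out: "g x = 0" if "norm x > r\<^sub>0" for x
    using r0_ge[of x] that by (auto simp: zero_prod_def)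
  interpret blowup_data G a b p q r\<^sub>0 dec f g
    by unfold_locales (use p q a b G_lower f_cont g_cont f_out g_out g_pos r0_nonneg in \<open>auto simp: dec_def N\<close>)
  have G_cont: "continuous_on UNIV (\<lambda>z :: real \<times> real. G (fst z) (snd z))"
  proof -
    have "C_k 0 (\<lambda>z :: real \<times> real. G (fst z) (snd z))"
      by (rule C_k_SucD) (use G_C1 in \<open>simp only: One_nat_def\<close>)
    then show ?thesis by (simp only: C_k.simps)
  qed
  have G_nn: "G s \<sigma> \<ge> 0" for s \<sigma>
    using G_lower_u[of s \<sigma>] a by (meson mult_nonneg_nonneg less_imp_le order_trans powr_ge_zero)
  have sol: "\<exists>v. solution \<epsilon> T u v"
    if "weak_solution G \<epsilon> f g T u" "ess_supp {t. 0 \<le> t \<and> ereal t < T} u \<subseteq> {(x, t). norm x \<le> r\<^sub>0 + t}" for \<epsilon> T u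
    using that r0_nonneg G_cont G_0 G_nn f_cont g_cont f_out g_out
    unfolding weak_solution_def cone_solution_def Let_def by blast
  define B where "B \<Phi> \<longleftrightarrow> (\<exists>C>0. \<forall>\<epsilon> T u v. solution \<epsilon> T u v \<and> 0 < \<epsilon> \<and> \<epsilon> \<le> 1 \<longrightarrow> T \<le> ereal (\<Phi> C \<epsilon>))"
    for \<Phi> :: "real \<Rightarrow> real \<Rightarrow> real"
  \<comment> \<open>Each regime yields its constant only if its condition holds. Choosing
    conditionally, with an arbitrary positive value otherwise, avoids splitting into cases.\<close>
  have choose: "\<exists>C>0. P \<longrightarrow> (\<forall>\<epsilon> T u v. solution \<epsilon> T u v \<and> 0 < \<epsilon> \<and> \<epsilon> \<le> 1 \<longrightarrow> T \<le> ereal (\<Phi> C \<epsilon>))"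
    if "P \<Longrightarrow> B \<Phi>" for P \<Phi>
    using that zero_less_one unfolding B_def by metis
  have A1: "B (\<lambda>C \<epsilon>. exp (C * \<epsilon> powr (- (p - 1))))" if "ereal p = p_G N \<and> q > 1 + 4 / (real N - 1)"
    unfolding B_def
  proof (rule lifespan_Glassey_critical)
    have "N \<noteq> 1" and pN: "p = (real N + 1) / (real N - 1)" using that by (auto simp: p_G_def split: if_splits)
    then have "N > 1" using N by (metis One_nat_def Suc_lessI zero_less_card_finite)
    then show "dec * (p - 1) = 1" unfolding dec_def pN by (simp add: field_simps)
  qed
  have A2: "B (\<lambda>C \<epsilon>. C * \<epsilon> powr (- inverse (\<Gamma>_G N p)))" if "ereal p < p_G N \<and> q > 2 * p - 1"
  proof -
    have \<alpha>: "dec * (p - 1) < 1"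
    proof (cases "N = 1")
      case False
      then have "N > 1" using N by (metis One_nat_def Suc_lessI zero_less_card_finite)
      moreover have "p < (real N + 1) / (real N - 1)" using that False by (simp add: p_G_def)
      ultimately show ?thesis unfolding dec_def by (simp add: field_simps)
    qed (simp add: dec_def)
    have "\<Gamma>_G N p = (1 - dec * (p - 1)) / (p - 1)"
      using p by (simp add: \<Gamma>_G_def dec_def diff_divide_distrib)
    then have "inverse (\<Gamma>_G N p) = (p - 1) / (1 - dec * (p - 1))" by simp
    then show ?thesis unfolding B_def using lifespan_Glassey_subcritical[OF \<alpha>] by simp
  qed
  have A3: "B (\<lambda>C \<epsilon>. C * \<epsilon> powr (- inverse (\<Gamma>_comb N p q)))" if "p \<le> q \<and> q \<le> 2 * p - 1 \<and> \<Gamma>_comb N p q > 0"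
  proof -
    have e: "(q + 1) / (q - 1) - dec * p = p * \<Gamma>_comb N p q"
    proof -
      have "p * ((q + 1) / (p * (q - 1))) = (q + 1) / (q - 1)" using p by simp
      then show ?thesis
        unfolding \<Gamma>_comb_def dec_def[symmetric] right_diff_distrib by (simp add: mult.commute)
    qed
    then have "(q + 1) / (q - 1) - dec * p > 0" using that p by simp
    moreover have "p / ((q + 1) / (q - 1) - dec * p) = inverse (\<Gamma>_comb N p q)"
      unfolding e using p by (simp add: divide_inverse)
    ultimately show ?thesis unfolding B_def using lifespan_subcritical[of p b] by simp
  qed
  have eS: "(q + 1) / (q - 1) - dec * q = q * \<Gamma>_S N q"
  proof -
    have "q * ((1 + 1 / q) * inverse (q - 1)) = (q * (1 + 1 / q)) * inverse (q - 1)" by simp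
    also have "q * (1 + 1 / q) = q + 1" using q by (simp add: distrib_left)
    finally have h: "q * ((1 + 1 / q) * inverse (q - 1)) = (q + 1) * inverse (q - 1)" .
    show ?thesis
      unfolding \<Gamma>_S_def dec_def[symmetric] right_diff_distrib h
      by (simp only: divide_inverse mult.commute[of dec q])
  qed
  have A4: "B (\<lambda>C \<epsilon>. C * \<epsilon> powr (- inverse (\<Gamma>_S N q)))" if "p > q \<and> ereal q < p_S N"
  proof -
    have "2 + (real N + 1) * q - (real N - 1) * q\<^sup>2 > 0" using that q by (intro below_p_S) auto
    \<comment> \<open>By \<open>eS\<close> the right side is 2 (q - 1) q \<Gamma>_S, so \<Gamma>_S
      is positive below the Strauss exponent.\<close>
    also have "2 + (real N + 1) * q - (real N - 1) * q\<^sup>2 = 2 * (q - 1) * ((q + 1) / (q - 1) - dec * q)"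
    proof -
      define X where "X = (q + 1) / (q - 1)"
      have X: "(q - 1) * X = q + 1" using q by (simp add: X_def)
      have d: "real N = 1 + 2 * dec" unfolding dec_def by (simp only: mult_2 field_sum_of_halves)
      have "2 + (1 + 2 * dec + 1) * q - (1 + 2 * dec - 1) * q\<^sup>2 = 2 * (q - 1) * (X - dec * q)"
        using X by algebra
      then show ?thesis unfolding X_def d by simp
    qed
    finally have "(q + 1) / (q - 1) - dec * q > 0" using q by (simp add: zero_less_mult_iff)
    moreover have "q / ((q + 1) / (q - 1) - dec * q) = inverse (\<Gamma>_S N q)"
      unfolding eS using q by (simp add: divide_inverse)
    ultimately show ?thesis unfolding B_def using lifespan_subcritical[of q a] by simp
  qed
  have A5: "B (\<lambda>C \<epsilon>. exp (C * \<epsilon> powr (- (q * (q - 1)))))" if "p \<ge> q \<and> ereal q = p_S N"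
    unfolding B_def
  proof (rule lifespan_Strauss_critical)
    have "2 + (real N + 1) * q - (real N - 1) * q\<^sup>2 = 0" using that q by (intro at_p_S) auto
    then show "dec * q\<^sup>2 = (dec + 1) * q + 1" unfolding dec_def by (simp add: field_simps)
  qed
  obtain C1 where C1: "C1 > 0" and B1: "ereal p = p_G N \<and> q > 1 + 4 / (real N - 1) \<longrightarrow>
      (\<forall>\<epsilon> T u v. solution \<epsilon> T u v \<and> 0 < \<epsilon> \<and> \<epsilon> \<le> 1 \<longrightarrow> T \<le> ereal (exp (C1 * \<epsilon> powr (- (p - 1)))))"
    using choose[OF A1] by blast
  obtain C2 where C2: "C2 > 0" and B2: "ereal p < p_G N \<and> q > 2 * p - 1 \<longrightarrow>
      (\<forall>\<epsilon> T u v. solution \<epsilon> T u v \<and> 0 < \<epsilon> \<and> \<epsilon> \<le> 1 \<longrightarrow> T \<le> ereal (C2 * \<epsilon> powr (- inverse (\<Gamma>_G N p))))"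
    using choose[OF A2] by blast
  obtain C3 where C3: "C3 > 0" and B3: "p \<le> q \<and> q \<le> 2 * p - 1 \<and> \<Gamma>_comb N p q > 0 \<longrightarrow>
      (\<forall>\<epsilon> T u v. solution \<epsilon> T u v \<and> 0 < \<epsilon> \<and> \<epsilon> \<le> 1 \<longrightarrow> T \<le> ereal (C3 * \<epsilon> powr (- inverse (\<Gamma>_comb N p q))))"
    using choose[OF A3] by blast
  obtain C4 where C4: "C4 > 0" and B4: "p > q \<and> ereal q < p_S N \<longrightarrow>
      (\<forall>\<epsilon> T u v. solution \<epsilon> T u v \<and> 0 < \<epsilon> \<and> \<epsilon> \<le> 1 \<longrightarrow> T \<le> ereal (C4 * \<epsilon> powr (- inverse (\<Gamma>_S N q))))"
    using choose[OF A4] by blast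
  obtain C5 where C5: "C5 > 0" and B5: "p \<ge> q \<and> ereal q = p_S N \<longrightarrow>
      (\<forall>\<epsilon> T u v. solution \<epsilon> T u v \<and> 0 < \<epsilon> \<and> \<epsilon> \<le> 1 \<longrightarrow> T \<le> ereal (exp (C5 * \<epsilon> powr (- (q * (q - 1))))))"
    using choose[OF A5] by blast
  \<comment> \<open>All five bounds increase with their constant, so the sum serves every regime;
    \<epsilon> \<le> 1 is the only smallness used.\<close>
  define C where "C = C1 + C2 + C3 + C4 + C5"
  have C: "C > 0" "C1 \<le> C" "C2 \<le> C" "C3 \<le> C" "C4 \<le> C" "C5 \<le> C"
    using C1 C2 C3 C4 C5 by (auto simp: C_def)
  have up: "T \<le> ereal (C' * \<epsilon> powr x) \<Longrightarrow> C' \<le> C \<Longrightarrow> T \<le> ereal (C * \<epsilon> powr x)"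
    and up_exp: "T \<le> ereal (exp (C' * \<epsilon> powr x)) \<Longrightarrow> C' \<le> C \<Longrightarrow> T \<le> ereal (exp (C * \<epsilon> powr x))" for T C' \<epsilon> x
  proof -
    assume "C' \<le> C"
    then have le: "C' * \<epsilon> powr x \<le> C * \<epsilon> powr x" by (intro mult_right_mono) auto
    show "T \<le> ereal (C * \<epsilon> powr x)" if "T \<le> ereal (C' * \<epsilon> powr x)"
      by (rule order_trans[OF that]) (simp add: le)
    show "T \<le> ereal (exp (C * \<epsilon> powr x))" if "T \<le> ereal (exp (C' * \<epsilon> powr x))"
      by (rule order_trans[OF that]) (simp add: le)
  qed
  show ?thesis
  proof (rule exI[of _ 1], intro conjI exI[of _ C] ballI allI impI)
    fix \<epsilon> T u
    assume "\<epsilon> \<in> {0<..1::real}" and ws: "weak_solution G \<epsilon> f g T u \<and>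
      ess_supp {t. 0 \<le> t \<and> ereal t < T} u \<subseteq> {(x, t). norm x \<le> r\<^sub>0 + t}"
    then have \<epsilon>: "0 < \<epsilon>" "\<epsilon> \<le> 1" by auto
    obtain v where s: "solution \<epsilon> T u v" using sol ws by blast
    note s = conjI[OF s conjI[OF \<epsilon>]]
    show "T \<le> ereal (exp (C * \<epsilon> powr (- (p - 1))))" if "ereal p = p_G N \<and> q > 1 + 4 / (real N - 1)"
      using B1[rule_format, OF that s] C(2) by (rule up_exp)
    show "T \<le> ereal (C * \<epsilon> powr (- inverse (\<Gamma>_G N p)))" if "ereal p < p_G N \<and> q > 2 * p - 1"
      using B2[rule_format, OF that s] C(3) by (rule up)
    show "T \<le> ereal (C * \<epsilon> powr (- inverse (\<Gamma>_comb N p q)))" if "p \<le> q \<and> q \<le> 2 * p - 1 \<and> \<Gamma>_comb N p q > 0"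
      using B3[rule_format, OF that s] C(4) by (rule up)
    show "T \<le> ereal (C * \<epsilon> powr (- inverse (\<Gamma>_S N q)))" if "p > q \<and> ereal q < p_S N"
      using B4[rule_format, OF that s] C(5) by (rule up)
    show "T \<le> ereal (exp (C * \<epsilon> powr (- (q * (q - 1)))))" if "p \<ge> q \<and> ereal q = p_S N"
      using B5[rule_format, OF that s] C(6) by (rule up_exp)
  qed (use C in auto)
qed

end
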